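(* Let $d\ge 2$ and let $M$ be either the unit sphere $\mathbb{S}^d\subset\mathbb{R}^{d+1}$ or the real projective space $P_d(\mathbb{R})$. Let $0<\sigma<1$ and let $p,q$ be exponents such that $$\frac{2d}{d+1}<p\le q<\frac{2d}{d-1}\quad\text{and}\quad \frac1q\ge\frac1p-\frac{\sigma}{d}.$$ Then there exists a constant $C$ such that for every $f\in L^p(L^2(M))$, $$\|(-\Delta_M)^{-\sigma/2}f\|_{L^q(L^2(M))}\le C\,\|f\|_{L^p(L^2(M))}.$$
   Context: Sphere. Let $\tilde\Delta_{\mathbb{S}^d}$ be the Laplace--Beltrami operator on $\mathbb{S}^d$ and $-\Delta_{\mathbb{S}^d}:=-\tilde\Delta_{\mathbb{S}^d}+\left(\frac{d-1}{2}\right)^2$. One has $L^2(\mathbb{S}^d)=\bigoplus_{n\ge0}\mathcal{H}_n(\mathbb{S}^d)$, where $\mathcal{H}_n(\mathbb{S}^d)$ is the space of spherical harmonics of degree $n$ in $d+1$ variables, and $-\Delta_{\mathbb{S}^d}$ acts on $\mathcal{H}_n(\mathbb{S}^d)$ as multiplication by $(n+\frac{d-1}{2})^2$. For $0<\sigma<1$ the fractional integral is $$(-\Delta_{\mathbb{S}^d})^{-\sigma/2}f=\sum_{n=0}^\infty\frac{1}{(n+\frac{d-1}{2})^{\sigma}}\operatorname{Proj}_{\mathcal{H}_n(\mathbb{S}^d)}(f),\qquad f\in L^2(\mathbb{S}^d),$$ where $\operatorname{Proj}$ denotes orthogonal projection. For functions that are not in $L^2$, the operator is understood as its unique continuous extension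 from $L^2(\mathbb{S}^d)$ to $L^1(\mathbb{S}^d)$ (note that $L^p(L^2(\mathbb{S}^d))\subset L^1(\mathbb{S}^d)$). Mixed norm. Points of $\mathbb{S}^d$ are written in geodesic polar coordinates as $\Phi(\theta,x')=(\cos\theta,x_1'\sin\theta,\ldots,x_d'\sin\theta)$, $\theta\in[0,\pi]$, $x'\in\mathbb{S}^{d-1}$. For $1\le p<\infty$, $L^p(L^2(\mathbb{S}^d))$ is the space of (measurable) functions $f$ on $\mathbb{S}^d$ with $$\|f\|_{L^p(L^2(\mathbb{S}^d))}:=\left(\int_0^\pi\left(\int_{\mathbb{S}^{d-1}}|f(\Phi(\theta,x'))|^2\,dx'\right)^{p/2}(\sin\theta)^{d-1}\,d\theta\right)^{1/p}<\infty,$$ where $dx'$ is the surface measure on $\mathbb{S}^{d-1}$. Real projective space. Functions on $P_d(\mathbb{R})$ are identified with even functions on $\mathbb{S}^d$ via the projection $s\mapsto\pm s$. The space of even functions in $L^2(\mathbb{S}^d)$ is $\bigoplus_{n\ge0}\mathcal{H}_{2n}(\mathbb{S}^d)$, and $$(-\Delta_{P_d(\mathbb{R})})^{-\sigma/2}f=\sum_{n=0}^\infty\frac{1}{(2n+\frac{d-1}{2})^{\sigma}}\operatorname{Proj}_{\mathcal{H}_{2n}(\mathbb{S}^d)}(f)$$ (extended to $L^1$ in the same way). $L^p(L^2(P_d(\mathbb{R})))$ is the space of functions on $P_d(\mathbb{R})$ whose even lift to $\mathbb{S}^d$ belongs to $L^p(L^2(\mathbb{S}^d))$, with the norm of the lift.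 *)

theory Defs
  imports "HOL-Analysis.Analysis"
begin

text \<open>Spaces and operators are built from complex-valued functions, modulo null sets.
  \<open>\<real>\<^sup>d\<close> is \<open>real ^ 'n\<close> with \<open>d = CARD('n)\<close>, and \<open>\<real>\<^sup>d\<^sup>+\<^sup>1\<close> is \<open>real \<times> (real ^ 'n)\<close>, whose first
  component is the axis of the geodesic polar coordinates.\<close>

type_synonym 'n ambient = "real \<times> (real ^ 'n)"


subsection \<open>Surface measure on a unit sphere\<close>

text \<open>The cone construction: for a Borel subset \<open>A\<close> of the unit sphere of \<open>\<real>\<^sup>m\<close>, the surface measure
  is \<open>m\<close> times the volume of the cone \<open>{r x | 0 < r < 1, x \<in> A}\<close>.
  On nonzero vectors \<open>sgn x = x / \<bar>x\<bar>\<close>.\<close>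

definition surface_measure :: "'a::euclidean_space measure" where
  "surface_measure =
     scale_measure (of_nat DIM('a))
       (distr (restrict_space lborel (ball 0 1 - {0})) (restrict_space borel (sphere 0 1)) sgn)"


subsection \<open>Spherical harmonics\<close>

definition laplacian :: "('a::euclidean_space \<Rightarrow> complex) \<Rightarrow> 'a \<Rightarrow> complex" where
  "laplacian u x =
     (\<Sum>b\<in>Basis. vector_derivative
        (\<lambda>t. vector_derivative (\<lambda>s. u (x + s *\<^sub>R b)) (at t)) (at 0))"

definition homogeneous_harmonic_polynomial :: "nat \<Rightarrow> ('a::euclidean_space \<Rightarrow> complex) \<Rightarrow> bool" where
  "homogeneous_harmonic_polynomial n u \<longleftrightarrow>
     polynomial_function u \<and>
     (\<forall>c x. u (c *\<^sub>R x) = c ^ n *\<^sub>R u x) \<and>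
     (\<forall>x. laplacian u x = 0)"

definition spherical_harmonics :: "nat \<Rightarrow> ('a::euclidean_space \<Rightarrow> complex) set" where
  "spherical_harmonics n =
     (\<lambda>u. restrict u (sphere 0 1)) ` {u. homogeneous_harmonic_polynomial n u}"


subsection \<open>Real projective space\<close>

definition antipodal_class :: "'a::euclidean_space \<Rightarrow> 'a set" where
  "antipodal_class x = {x, - x}"

definition projective_space :: "'a::euclidean_space set set" where
  "projective_space = antipodal_class ` sphere 0 1"

text \<open>The image of the surface measure, on the largest \<open>\<sigma>\<close>-algebra that makes the projection
  \<open>s \<mapsto> \<plusminus>s\<close> measurable: \<open>F\<close> is measurable iff its even lift \<open>F \<circ> antipodal_class\<close> is, and the
  integral of \<open>F\<close> is the integral of its lift.\<close>

definition projective_measure :: "'a::euclidean_space set measure" where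
  "projective_measure =
     distr surface_measure
       (sigma projective_space
          {B. B \<subseteq> projective_space \<and> antipodal_class -` B \<inter> sphere 0 1 \<in> sets surface_measure})
       antipodal_class"

text \<open>The functions whose lift is a spherical harmonic of degree \<open>n\<close>; used for even \<open>n\<close>.\<close>

definition projective_harmonics :: "nat \<Rightarrow> ('a::euclidean_space set \<Rightarrow> complex) set" where
  "projective_harmonics n =
     {Y \<in> extensional projective_space.
        restrict (Y \<circ> antipodal_class) (sphere 0 1) \<in> spherical_harmonics n}"


subsection \<open>Fractional integrals\<close>

definition L2_functions :: "'b measure \<Rightarrow> ('b \<Rightarrow> complex) set" where
  "L2_functions M = {f \<in> borel_measurable M. integrable M (\<lambda>x. (cmod (f x))\<^sup>2)}"

text \<open>Here \<open>H\<close> is a finite-dimensional space of continuous functions, so that the projection is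
  a function and not only a class modulo null sets.\<close>

definition Proj :: "'b measure \<Rightarrow> ('b \<Rightarrow> complex) set \<Rightarrow> ('b \<Rightarrow> complex) \<Rightarrow> 'b \<Rightarrow> complex" where
  "Proj M H f = (THE h. h \<in> H \<and> (\<forall>g\<in>H. (LINT x|M. (f x - h x) * cnj (g x)) = 0))"

text \<open>For \<open>f \<in> L\<^sup>2\<close>, a representative of the sum, convergent in \<open>L\<^sup>2\<close>, of the series
  \<open>\<Sum>n. \<mu>\<^sub>n\<^bsup>-\<sigma>\<^esup> Proj\<^bsub>H\<^sub>n\<^esub> f\<close>.\<close>

definition fractional_integral_L2 ::
    "'b measure \<Rightarrow> (nat \<Rightarrow> ('b \<Rightarrow> complex) set) \<Rightarrow> (nat \<Rightarrow> real) \<Rightarrow> real \<Rightarrow>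
     ('b \<Rightarrow> complex) \<Rightarrow> 'b \<Rightarrow> complex" where
  "fractional_integral_L2 M H \<mu> \<sigma> f =
     (SOME g. g \<in> L2_functions M \<and>
        (\<lambda>N. LINT x|M. (cmod (g x - (\<Sum>n<N. Proj M (H n) f x /\<^sub>R (\<mu> n powr \<sigma>))))\<^sup>2)
          \<longlonglongrightarrow> 0)"

definition continuous_L1_extension ::
    "'b measure \<Rightarrow> (('b \<Rightarrow> complex) \<Rightarrow> 'b \<Rightarrow> complex) \<Rightarrow> (('b \<Rightarrow> complex) \<Rightarrow> 'b \<Rightarrow> complex) \<Rightarrow> bool" where
  "continuous_L1_extension M T S \<longleftrightarrow>
     (\<forall>f. integrable M f \<longrightarrow> integrable M (S f)) \<and>
     (\<forall>f\<in>L2_functions M. AE x in M. S f x = T f x) \<and>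
     (\<forall>F f. (\<forall>k. integrable M (F k)) \<and> integrable M f \<and>
        (\<lambda>k. LINT x|M. cmod (F k x - f x)) \<longlonglongrightarrow> 0 \<longrightarrow>
        (\<lambda>k::nat. LINT x|M. cmod (S (F k) x - S f x)) \<longlonglongrightarrow> 0)"

text \<open>The extension is unique up to null sets, since \<open>L\<^sup>2\<close> is dense in \<open>L\<^sup>1\<close>; \<open>SOME\<close> picks
  representatives.\<close>

definition fractional_integral ::
    "'b measure \<Rightarrow> (nat \<Rightarrow> ('b \<Rightarrow> complex) set) \<Rightarrow> (nat \<Rightarrow> real) \<Rightarrow> real \<Rightarrow>
     ('b \<Rightarrow> complex) \<Rightarrow> 'b \<Rightarrow> complex" where
  "fractional_integral M H \<mu> \<sigma> =
     (SOME S. continuous_L1_extension M (fractional_integral_L2 M H \<mu> \<sigma>) S)"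

definition sphere_fractional_integral ::
    "real \<Rightarrow> ('n::finite ambient \<Rightarrow> complex) \<Rightarrow> 'n ambient \<Rightarrow> complex" where
  "sphere_fractional_integral =
     fractional_integral surface_measure spherical_harmonics
       (\<lambda>n. real n + (real CARD('n) - 1) / 2)"

definition projective_fractional_integral ::
    "real \<Rightarrow> ('n::finite ambient set \<Rightarrow> complex) \<Rightarrow> 'n ambient set \<Rightarrow> complex" where
  "projective_fractional_integral =
     fractional_integral projective_measure (\<lambda>n. projective_harmonics (2 * n))
       (\<lambda>n. 2 * real n + (real CARD('n) - 1) / 2)"


subsection \<open>Mixed norms\<close>

definition polar :: "real \<Rightarrow> real ^ 'n::finite \<Rightarrow> 'n ambient" where
  "polar \<theta> x' = (cos \<theta>, sin \<theta> *\<^sub>R x')"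

text \<open>Real powers on \<open>[0, \<infinity>]\<close>, meant for exponents \<open>a > 0\<close>.\<close>

definition epowr :: "ennreal \<Rightarrow> real \<Rightarrow> ennreal" where
  "epowr t a = (if t = \<infinity> then \<infinity> else ennreal (enn2real t powr a))"

definition sphere_mixed_norm :: "real \<Rightarrow> ('n::finite ambient \<Rightarrow> complex) \<Rightarrow> ennreal" where
  "sphere_mixed_norm p f =
     epowr (\<integral>\<^sup>+\<theta>\<in>{0..pi}.
              epowr (\<integral>\<^sup>+x'. ennreal ((cmod (f (polar \<theta> x')))\<^sup>2) \<partial>surface_measure) (p / 2)
              * ennreal (sin \<theta> ^ (CARD('n) - 1)) \<partial>lborel)
       (1 / p)"

definition sphere_mixed_space :: "real \<Rightarrow> ('n::finite ambient \<Rightarrow> complex) set" where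
  "sphere_mixed_space p = {f \<in> borel_measurable surface_measure. sphere_mixed_norm p f < \<infinity>}"

definition projective_mixed_norm :: "real \<Rightarrow> ('n::finite ambient set \<Rightarrow> complex) \<Rightarrow> ennreal" where
  "projective_mixed_norm p F = sphere_mixed_norm p (F \<circ> antipodal_class)"

definition projective_mixed_space :: "real \<Rightarrow> ('n::finite ambient set \<Rightarrow> complex) set" where
  "projective_mixed_space p = {F. F \<circ> antipodal_class \<in> sphere_mixed_space p}"

end

theory Submission
  imports Defs "HOL-Computational_Algebra.Polynomial"
begin

text \<open>The Poisson kernel \<open>\<Sum>n. e\<^bsup>-ns\<^esup> Z\<^sub>n\<close> of the sphere, integrated against
  \<open>s\<^bsup>\<sigma>-1\<^esup> e\<^bsup>-\<lambda>s\<^esup> ds / \<Gamma>(\<sigma>)\<close> with \<open>\<lambda> = (d - 1)/2\<close>, is the kernel of the fractional integral,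
  because \<open>(n + \<lambda>)\<^bsup>-\<sigma>\<^esup> \<Gamma>(\<sigma>) = \<integral> e\<^bsup>-(n+\<lambda>)s\<^esup> s\<^bsup>\<sigma>-1\<^esup> ds\<close>. It is nonnegative and at most a constant times
  \<open>(1 - t)\<^bsup>-\<alpha>\<^esup>\<close>, \<open>\<alpha> = (d - \<sigma>)/2\<close>. In the cylindrical coordinates \<open>cos \<theta> = - tanh u\<close>, \<open>sin \<theta> = sech u\<close> one has
  \<open>1 - X \<bullet> Y = sech u sech v (cosh (u - v) - x \<bullet> y)\<close>. Minkowski's inequality and Schur's test on the slices
  \<open>S\<^bsup>d-1\<^esup>\<close> then leave a one-dimensional kernel: the integral of \<open>(cosh (u - v) - x \<bullet> y)\<^bsup>-\<alpha>\<^esup>\<close> over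
  \<open>y\<close> times powers of \<open>sech u\<close> and \<open>sech v\<close>. The hypothesis \<open>1/q \<ge> 1/p - \<sigma>/d\<close> makes the sum of the exponents of
  \<open>sech u\<close> and \<open>sech v\<close> nonnegative, so that they cost at most
  \<open>e\<^bsup>m|u-v|\<^esup>\<close> for some \<open>m < \<alpha>\<close>, and it also makes the singularity at \<open>u = v\<close> lie in
  \<open>L\<^sup>r\<close>, \<open>1/r = 1 + 1/q - 1/p\<close>. Young's inequality on the line finishes the proof.\<close>

subsection \<open>Surface measure and cylindrical coordinates\<close>

text \<open>The fractional integral is specified through \<open>THE\<close> and \<open>SOME\<close>,
  so it has to be identified before it can be estimated. The explicit operator
  \<open>frac_op\<close> is shown to be Lipschitz in L1 and, on L2, to be the limit of the spectral
  series; two continuous extensions agree almost everywhere. The L2 limit comes from Bessel's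
  inequality for the Poisson series beyond \<open>N\<close>, whose squared norm is at most e^(-2Ns)
  times that of \<open>f\<close>; averaging in \<open>s\<close> leaves (\<lambda> + 2N)^(-\<sigma>).
  The kernels of the projections are built from Gegenbauer polynomials, and their reproducing
  property rests on one integration by parts on the sphere. Projective space reduces to the sphere
  because an even function has no components of odd degree. In the final estimate \<alpha> is split
  as a1 + a2: the part a1 becomes the singularity at u = v and must be small enough for L^r, the
  part a2 must be integrable over the slice. The two demands read 2 a1 < 1/r and 2 a1 > 1 -
  \<sigma>; they are compatible since 1/r \<ge> 1 - \<sigma>/d and d \<ge> 2.\<close>

lemma space_surface_measure [simp]: "space surface_measure = sphere 0 1"
  by (simp add: surface_measure_def space_scale_measure space_restrict_space)

lemma sets_surface_measure [measurable_cong]: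
  "sets surface_measure = sets (restrict_space borel (sphere 0 1))"
  by (simp add: surface_measure_def sets_scale_measure)

lemma measurable_sgn_sphere:
  "(sgn :: 'a::euclidean_space \<Rightarrow> 'a) \<in> restrict_space lborel (ball 0 1 - {0}) \<rightarrow>\<^sub>M restrict_space borel (sphere 0 1)"
  by (rule measurable_restrict_space3) (auto simp: norm_sgn)

lemma nn_integral_surface_measure:
  fixes g :: "'a::euclidean_space \<Rightarrow> ennreal"
  assumes g: "g \<in> borel_measurable surface_measure"
  shows "(\<integral>\<^sup>+x. g x \<partial>surface_measure) =
    of_nat DIM('a) * (\<integral>\<^sup>+x. g (sgn x) * indicator (ball 0 1 - {0}) x \<partial>lborel)"
proof -
  have g': "g \<in> borel_measurable (restrict_space borel (sphere 0 1))"
    using g by (simp cong: measurable_cong_sets add: sets_surface_measure)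
  show ?thesis
    unfolding surface_measure_def
    by (subst nn_integral_scale_measure)
       (auto simp: nn_integral_distr[OF measurable_sgn_sphere] g' nn_integral_restrict_space)
qed

lemma nn_integral_lborel_scaleR:
  fixes g :: "'a::euclidean_space \<Rightarrow> ennreal"
  assumes [measurable]: "g \<in> borel_measurable borel" and c: "c \<noteq> 0"
  shows "(\<integral>\<^sup>+x. g x \<partial>lborel) = ennreal (\<bar>c\<bar> ^ DIM('a)) * (\<integral>\<^sup>+x. g (c *\<^sub>R x) \<partial>lborel)"
  by (subst lborel_affine[OF c, of 0])
     (simp add: nn_integral_density nn_integral_distr nn_integral_cmult)

lemma finite_measure_surface_measure: "finite_measure (surface_measure :: 'a::euclidean_space measure)"
proof
  have "emeasure (surface_measure :: 'a measure) (sphere 0 1) = (\<integral>\<^sup>+x. 1 \<partial>(surface_measure :: 'a measure))"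
    by (metis emeasure_eq_measure2 nn_integral_indicator nn_integral_const space_surface_measure mult_1 sets.top)
  also have "\<dots> = of_nat DIM('a) * emeasure lborel (ball (0::'a) 1 - {0})"
    by (subst nn_integral_surface_measure) auto
  also have "\<dots> \<le> of_nat DIM('a) * emeasure lborel (ball (0::'a) 1)"
    by (intro mult_left_mono emeasure_mono) auto
  also have "\<dots> < \<infinity>"
    using emeasure_lborel_ball_finite[of "0::'a" 1] by (simp add: ennreal_mult_less_top of_nat_less_top)
  finally show "emeasure (surface_measure :: 'a measure) (space surface_measure) \<noteq> \<infinity>" by simp
qed

interpretation surface: finite_measure "surface_measure :: 'a::euclidean_space measure"
  by (rule finite_measure_surface_measure)

lemma measurable_ident_surface_measure: "(\<lambda>x. x) \<in> surface_measure \<rightarrow>\<^sub>M borel"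
  by (simp add: measurable_cong_sets[OF sets_surface_measure] measurable_restrict_space1)

lemma measurable_surface_measure_borel:
  "g \<in> borel \<rightarrow>\<^sub>M N \<Longrightarrow> g \<in> surface_measure \<rightarrow>\<^sub>M N"
  using measurable_compose[OF measurable_ident_surface_measure] by blast

section \<open>Polar coordinates for Lebesgue measure\<close>

lemma nn_integral_powr_atLeast:
  assumes "0 < c" "0 < (n::nat)"
  shows "(\<integral>\<^sup>+s. ennreal (inverse (s ^ Suc n)) * indicator {c..} s \<partial>lborel) = ennreal (inverse (c ^ n) / n)"
proof -
  have "(\<integral>\<^sup>+s. ennreal (inverse (s ^ Suc n)) * indicator {c..} s \<partial>lborel)
      = ennreal (0 - - inverse (c ^ n) / n)"
  proof (rule nn_integral_FTC_atLeast)
    show "((\<lambda>s. - inverse (s ^ n) / n) has_real_derivative inverse (x ^ Suc n)) (at x)" if "c \<le> x" for x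
    proof -
      have x: "0 < x" using that assms by simp
      have "x ^ (n - 1) * x ^ Suc n = x ^ n * x ^ n"
        using assms by (cases n) auto
      then have "real n * (x ^ (n - 1) * inverse (x ^ n * x ^ n)) / n = inverse (x ^ Suc n)"
        using x assms by (simp add: field_simps)
      then show ?thesis
        using x assms by (auto intro!: derivative_eq_intros simp: power2_eq_square mult_ac)
    qed
    have "((\<lambda>s::real. inverse (s ^ n)) \<longlongrightarrow> 0) at_top"
      by (rule tendsto_inverse_0_at_top) (use assms in \<open>intro filterlim_pow_at_top filterlim_ident\<close>)
    from tendsto_divide[OF tendsto_minus[OF this] tendsto_const[of "real n"]]
    show "((\<lambda>s. - inverse (s ^ n) / real n) \<longlongrightarrow> 0) at_top" using assms by simp
  qed (use assms in auto)
  thus ?thesis by simp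
qed

text \<open>In the cone formula the radius is rescaled to \<open>r = norm x * s\<close>, which turns
  \<open>r *\<^sub>R sgn x\<close> into \<open>s *\<^sub>R x\<close>. For fixed \<open>s\<close> the
  vector \<open>s *\<^sub>R x\<close> is then renamed \<open>x\<close>, and the unit-ball condition
  becomes \<open>norm x < s\<close>. What remains in \<open>s\<close> is the integral of s^(-D-1)
  from \<open>norm x\<close> to infinity, D being the dimension; it cancels the factor (norm x)^D up
  to 1/D, and 1/D cancels the factor D in the definition of the surface measure.\<close>

lemma nn_integral_polar:
  fixes g :: "'a::euclidean_space \<Rightarrow> ennreal"
  assumes g [measurable]: "g \<in> borel_measurable borel"
  shows "(\<integral>\<^sup>+x. g x \<partial>lborel) =
    (\<integral>\<^sup>+r. (\<integral>\<^sup>+y. g (r *\<^sub>R y) \<partial>surface_measure) * ennreal (r ^ (DIM('a) - 1)) * indicator {0<..} r \<partial>lborel)"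
    (is "_ = ?R")
proof -
  let ?D = "DIM('a)"
  define B where "B = ball (0::'a) 1 - {0}"
  have B [measurable]: "B \<in> sets borel" by (simp add: B_def)
  have D: "0 < ?D" by simp
  have pow: "\<bar>r\<bar> ^ ?D = r * r ^ (?D - 1)" if "0 < r" for r :: real
    using that D by (metis abs_of_pos power_eq_if neq0_conv)
  have sg [measurable]: "(\<lambda>y. g (r *\<^sub>R y)) \<in> borel_measurable surface_measure" for r :: real
    by (rule measurable_surface_measure_borel) measurable
  have "?R = (\<integral>\<^sup>+r. of_nat ?D * (\<integral>\<^sup>+x. g (r *\<^sub>R sgn x) * indicator B x * ennreal (r ^ (?D - 1)) * indicator {0<..} r \<partial>lborel) \<partial>lborel)"
  proof (rule nn_integral_cong)
    fix r :: real
    have m [measurable]: "(\<lambda>x. g (r *\<^sub>R sgn x) * indicator B x) \<in> borel_measurable lborel"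
      by measurable
    have "(\<integral>\<^sup>+x. g (r *\<^sub>R sgn x) * indicator B x * ennreal (r ^ (?D - 1)) * indicator {0<..} r \<partial>lborel)
      = (\<integral>\<^sup>+x. g (r *\<^sub>R sgn x) * indicator B x \<partial>lborel) * ennreal (r ^ (?D - 1)) * indicator {0<..} r"
      by (subst nn_integral_multc, measurable, subst nn_integral_multc[OF m], rule refl)
    then show "(\<integral>\<^sup>+y. g (r *\<^sub>R y) \<partial>surface_measure) * ennreal (r ^ (?D - 1)) * indicator {0<..} r
      = of_nat ?D * (\<integral>\<^sup>+x. g (r *\<^sub>R sgn x) * indicator B x * ennreal (r ^ (?D - 1)) * indicator {0<..} r \<partial>lborel)"
      by (simp only: nn_integral_surface_measure[OF sg] B_def mult.assoc)
  qed
  also have "\<dots> = of_nat ?D * (\<integral>\<^sup>+r. (\<integral>\<^sup>+x. g (r *\<^sub>R sgn x) * indicator B x * ennreal (r ^ (?D - 1)) * indicator {0<..} r \<partial>lborel) \<partial>lborel)"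
    by (rule nn_integral_cmult) measurable
  also have "(\<integral>\<^sup>+r. (\<integral>\<^sup>+x. g (r *\<^sub>R sgn x) * indicator B x * ennreal (r ^ (?D - 1)) * indicator {0<..} r \<partial>lborel) \<partial>lborel)
     = (\<integral>\<^sup>+x. (\<integral>\<^sup>+r. g (r *\<^sub>R sgn x) * indicator B x * ennreal (r ^ (?D - 1)) * indicator {0<..} r \<partial>lborel) \<partial>lborel)"
    by (rule lborel_pair.Fubini') measurable
  also have "\<dots> = (\<integral>\<^sup>+x. (\<integral>\<^sup>+s. g (s *\<^sub>R x) * indicator B x * ennreal (s ^ (?D - 1) * norm x ^ ?D) * indicator {0<..} s \<partial>lborel) \<partial>lborel)"
  proof (rule nn_integral_cong)
    fix x :: 'a
    show "(\<integral>\<^sup>+r. g (r *\<^sub>R sgn x) * indicator B x * ennreal (r ^ (?D - 1)) * indicator {0<..} r \<partial>lborel)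
      = (\<integral>\<^sup>+s. g (s *\<^sub>R x) * indicator B x * ennreal (s ^ (?D - 1) * norm x ^ ?D) * indicator {0<..} s \<partial>lborel)"
    proof (cases "x = 0")
      case False
      have "(\<integral>\<^sup>+r. g (r *\<^sub>R sgn x) * indicator B x * ennreal (r ^ (?D - 1)) * indicator {0<..} r \<partial>lborel)
         = \<bar>norm x\<bar> * (\<integral>\<^sup>+s. g ((0 + norm x * s) *\<^sub>R sgn x) * indicator B x * ennreal ((0 + norm x * s) ^ (?D - 1)) * indicator {0<..} (0 + norm x * s) \<partial>lborel)"
        by (rule nn_integral_real_affine) (use False in auto)
      also have "\<dots> = (\<integral>\<^sup>+s. norm x * (g ((0 + norm x * s) *\<^sub>R sgn x) * indicator B x * ennreal ((0 + norm x * s) ^ (?D - 1)) * indicator {0<..} (0 + norm x * s)) \<partial>lborel)"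
        by (subst nn_integral_cmult) (auto simp: )
      also have "\<dots> = (\<integral>\<^sup>+s. g (s *\<^sub>R x) * indicator B x * ennreal (s ^ (?D - 1) * norm x ^ ?D) * indicator {0<..} s \<partial>lborel)"
      proof (rule nn_integral_cong)
        fix s :: real
        have 1: "(0 + norm x * s) *\<^sub>R sgn x = s *\<^sub>R x" using False by (simp add: sgn_div_norm)
        have 2: "(indicator {0<..} (0 + norm x * s) :: ennreal) = indicator {0<..} s"
          using False by (auto simp: indicator_def zero_less_mult_iff)
        have 3: "ennreal (norm x) * ennreal ((0 + norm x * s) ^ (?D - 1)) = ennreal (s ^ (?D - 1) * norm x ^ ?D)" if "0 < s"
          using that False pow[of "norm x"] by (simp add: ennreal_mult[symmetric] power_mult_distrib algebra_simps)
        show "ennreal (norm x) * (g ((0 + norm x * s) *\<^sub>R sgn x) * indicator B x * ennreal ((0 + norm x * s) ^ (?D - 1)) * indicator {0<..} (0 + norm x * s))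
          = g (s *\<^sub>R x) * indicator B x * ennreal (s ^ (?D - 1) * norm x ^ ?D) * indicator {0<..} s"
        proof (cases "0 < s")
          case True
          have "ennreal (norm x) * (g (s *\<^sub>R x) * indicator B x * ennreal ((0 + norm x * s) ^ (?D - 1)) * indicator {0<..} s)
            = g (s *\<^sub>R x) * indicator B x * (ennreal (norm x) * ennreal ((0 + norm x * s) ^ (?D - 1))) * indicator {0<..} s"
            by (simp only: mult_ac)
          then show ?thesis unfolding 1 2 3[OF True] .
        next
          case False
          then have "indicator {0<..} s = (0::ennreal)" by (simp add: indicator_def)
          then show ?thesis unfolding 1 2 by simp
        qed
      qed
      finally show ?thesis .
    qed (simp add: B_def)
  qed
  also have "\<dots> = (\<integral>\<^sup>+s. (\<integral>\<^sup>+x. g (s *\<^sub>R x) * indicator B x * ennreal (s ^ (?D - 1) * norm x ^ ?D) * indicator {0<..} s \<partial>lborel) \<partial>lborel)"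
    by (rule lborel_pair.Fubini') measurable
  also have "\<dots> = (\<integral>\<^sup>+s. (\<integral>\<^sup>+x. g x * ennreal (norm x ^ ?D) * indicator (-{0}) x * (ennreal (inverse (s ^ Suc ?D)) * (if norm x < s then 1 else 0)) \<partial>lborel) \<partial>lborel)"
  proof (rule nn_integral_cong)
    fix s :: real
    show "(\<integral>\<^sup>+x. g (s *\<^sub>R x) * indicator B x * ennreal (s ^ (?D - 1) * norm x ^ ?D) * indicator {0<..} s \<partial>lborel)
      = (\<integral>\<^sup>+x. g x * ennreal (norm x ^ ?D) * indicator (-{0}) x * (ennreal (inverse (s ^ Suc ?D)) * (if norm x < s then 1 else 0)) \<partial>lborel)"
    proof (cases "0 < s")
      case True
      have "(\<integral>\<^sup>+x. g x * ennreal (norm x ^ ?D) * indicator (-{0}) x * (ennreal (inverse (s ^ Suc ?D)) * (if norm x < s then 1 else 0)) \<partial>lborel)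
        = ennreal (\<bar>s\<bar> ^ ?D) * (\<integral>\<^sup>+x. g (s *\<^sub>R x) * ennreal (norm (s *\<^sub>R x) ^ ?D) * indicator (-{0}) (s *\<^sub>R x) * (ennreal (inverse (s ^ Suc ?D)) * (if norm (s *\<^sub>R x) < s then 1 else 0)) \<partial>lborel)"
        by (rule nn_integral_lborel_scaleR[of "\<lambda>x. g x * ennreal (norm x ^ ?D) * indicator (-{0}) x * (ennreal (inverse (s ^ Suc ?D)) * (if norm x < s then 1 else 0))"]) (use True in auto)
      also have "\<dots> = (\<integral>\<^sup>+x. ennreal (\<bar>s\<bar> ^ ?D) * (g (s *\<^sub>R x) * ennreal (norm (s *\<^sub>R x) ^ ?D) * indicator (-{0}) (s *\<^sub>R x) * (ennreal (inverse (s ^ Suc ?D)) * (if norm (s *\<^sub>R x) < s then 1 else 0))) \<partial>lborel)"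
        by (rule nn_integral_cmult[symmetric]) measurable
      also have "\<dots> = (\<integral>\<^sup>+x. g (s *\<^sub>R x) * indicator B x * ennreal (s ^ (?D - 1) * norm x ^ ?D) * indicator {0<..} s \<partial>lborel)"
      proof (rule nn_integral_cong)
        fix x :: 'a
        have 1: "(indicator (- {0}) (s *\<^sub>R x) * (if norm (s *\<^sub>R x) < s then 1 else 0) :: ennreal) = indicator B x"
          using True by (auto simp: indicator_def B_def)
        have 2: "ennreal (\<bar>s\<bar> ^ ?D) * (ennreal (norm (s *\<^sub>R x) ^ ?D) * ennreal (inverse (s ^ Suc ?D))) = ennreal (s ^ (?D - 1) * norm x ^ ?D)"
          using True pow[of s] by (simp add: ennreal_mult[symmetric] power_mult_distrib field_simps)
        have "ennreal (\<bar>s\<bar> ^ ?D) * (g (s *\<^sub>R x) * ennreal (norm (s *\<^sub>R x) ^ ?D) * indicator (-{0}) (s *\<^sub>R x) * (ennreal (inverse (s ^ Suc ?D)) * (if norm (s *\<^sub>R x) < s then 1 else 0)))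
          = g (s *\<^sub>R x) * (indicator (- {0}) (s *\<^sub>R x) * (if norm (s *\<^sub>R x) < s then 1 else 0)) * (ennreal (\<bar>s\<bar> ^ ?D) * (ennreal (norm (s *\<^sub>R x) ^ ?D) * ennreal (inverse (s ^ Suc ?D))))"
          by (simp only: mult_ac)
        thus "ennreal (\<bar>s\<bar> ^ ?D) * (g (s *\<^sub>R x) * ennreal (norm (s *\<^sub>R x) ^ ?D) * indicator (-{0}) (s *\<^sub>R x) * (ennreal (inverse (s ^ Suc ?D)) * (if norm (s *\<^sub>R x) < s then 1 else 0)))
          = g (s *\<^sub>R x) * indicator B x * ennreal (s ^ (?D - 1) * norm x ^ ?D) * indicator {0<..} s"
          unfolding 1 2 using True by simp
      qed
      finally show ?thesis ..
    next
      case False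
      then have "\<not> norm x < s" for x :: 'a
        using norm_ge_zero[of x] by (auto simp del: norm_ge_zero)
      with False show ?thesis by (simp add: indicator_def)
    qed
  qed
  also have "\<dots> = (\<integral>\<^sup>+x. (\<integral>\<^sup>+s. g x * ennreal (norm x ^ ?D) * indicator (-{0}) x * (ennreal (inverse (s ^ Suc ?D)) * (if norm x < s then 1 else 0)) \<partial>lborel) \<partial>lborel)"
    by (rule lborel_pair.Fubini') measurable
  also have "\<dots> = (\<integral>\<^sup>+x. g x * indicator (-{0}) x * inverse (of_nat ?D) \<partial>lborel)"
  proof (rule nn_integral_cong)
    fix x :: 'a
    show "(\<integral>\<^sup>+s. g x * ennreal (norm x ^ ?D) * indicator (-{0}) x * (ennreal (inverse (s ^ Suc ?D)) * (if norm x < s then 1 else 0)) \<partial>lborel)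
      = g x * indicator (-{0}) x * inverse (of_nat ?D)"
    proof (cases "x = 0")
      case False
      have "(\<integral>\<^sup>+s. (ennreal (inverse (s ^ Suc ?D)) * (if norm x < s then 1 else 0)) \<partial>lborel) = (\<integral>\<^sup>+s. (ennreal (inverse (s ^ Suc ?D)) * (if norm x \<le> s then 1 else 0)) \<partial>lborel)"
      proof (rule nn_integral_cong_AE)
        have "AE s in lborel. s \<noteq> norm x" by (rule AE_lborel_singleton)
        then show "AE s in lborel. ennreal (inverse (s ^ Suc ?D)) * (if norm x < s then 1 else 0) = ennreal (inverse (s ^ Suc ?D)) * (if norm x \<le> s then 1 else 0)"
          by eventually_elim (auto simp: indicator_def)
      qed
      also have "\<dots> = ennreal (inverse (norm x ^ ?D) / ?D)"
        using nn_integral_powr_atLeast[of "norm x" ?D] False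
        by (simp add: indicator_def of_bool_def cong: if_cong)
      finally have 0: "(\<integral>\<^sup>+s. (ennreal (inverse (s ^ Suc ?D)) * (if norm x < s then 1 else 0)) \<partial>lborel) = ennreal (inverse (norm x ^ ?D) / ?D)" .
      have "ennreal (norm x ^ ?D) * ennreal (inverse (norm x ^ ?D) / ?D) = ennreal (inverse (real ?D))"
        using False by (simp add: ennreal_mult[symmetric] field_simps)
      also have "\<dots> = inverse (of_nat ?D)"
        by (simp add: inverse_ennreal[symmetric] ennreal_of_nat_eq_real_of_nat)
      finally show ?thesis using False
        by (subst nn_integral_cmult) (auto simp: 0 mult.assoc simp del: power_Suc)
    qed simp
  qed
  also have "\<dots> = (\<integral>\<^sup>+x. g x \<partial>lborel) * inverse (of_nat ?D)"
  proof -
    have "(\<integral>\<^sup>+x. g x * indicator (-{0}) x \<partial>lborel) = (\<integral>\<^sup>+x. g x \<partial>lborel)"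
    proof (rule nn_integral_cong_AE)
      have "AE x in lborel. x \<noteq> (0::'a)" by (rule AE_lborel_singleton)
      then show "AE x in lborel. g x * indicator (-{0}) x = g x"
        by eventually_elim (auto simp: indicator_def)
    qed
    thus ?thesis by (simp add: nn_integral_multc)
  qed
  finally have "?R = of_nat ?D * ((\<integral>\<^sup>+x. g x \<partial>lborel) * inverse (of_nat ?D))" .
  also have "\<dots> = (of_nat ?D * inverse (of_nat ?D)) * (\<integral>\<^sup>+x. g x \<partial>lborel)"
    by (simp add: mult_ac)
  also have "(of_nat ?D * inverse (of_nat ?D) :: ennreal) = 1"
    using DIM_positive[where 'a='a]
    by (simp add: ennreal_of_nat_eq_real_of_nat inverse_ennreal ennreal_mult[symmetric])
  finally show ?thesis by simp
qed

text \<open>The surface measure transported to the Borel sets of the whole space, on which it is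
  concentrated on the sphere. Polynomials and kernels defined everywhere are then plainly
  measurable, and the constraint \<open>norm x = 1\<close> returns through
  \<open>AE_sph_norm\<close> when it is wanted.\<close>

definition sph :: "'a::euclidean_space measure" where
  "sph = distr surface_measure borel (\<lambda>x. x)"

lemma sets_sph [simp, measurable_cong]: "sets sph = sets borel"
  and space_sph [simp]: "space sph = UNIV"
  by (simp_all add: sph_def)

lemma nn_integral_sph:
  "f \<in> borel_measurable borel \<Longrightarrow> (\<integral>\<^sup>+x. f x \<partial>sph) = (\<integral>\<^sup>+x. f x \<partial>surface_measure)"
  unfolding sph_def by (simp add: nn_integral_distr measurable_ident_surface_measure)

lemma finite_measure_sph: "finite_measure (sph :: 'a::euclidean_space measure)"
  unfolding sph_def by (rule surface.finite_measure_distr[OF measurable_ident_surface_measure])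

interpretation sph: finite_measure "sph :: 'a::euclidean_space measure"
  by (rule finite_measure_sph)

lemma AE_sph_norm: "AE x in sph. norm x = 1"
  unfolding sph_def
  by (subst AE_distr_iff) (auto simp: measurable_ident_surface_measure)

lemma nn_integral_sph_ball:
  fixes g :: "'a::euclidean_space \<Rightarrow> ennreal"
  assumes g: "g \<in> borel_measurable borel"
  shows "(\<integral>\<^sup>+x. g x \<partial>sph) = of_nat DIM('a) * (\<integral>\<^sup>+x. g (sgn x) * indicator (ball 0 1 - {0}) x \<partial>lborel)"
  by (simp add: nn_integral_sph[OF g] nn_integral_surface_measure[OF measurable_surface_measure_borel[OF g]])

lemma nn_integral_polar_sph:
  fixes g :: "'a::euclidean_space \<Rightarrow> ennreal"
  assumes g [measurable]: "g \<in> borel_measurable borel"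
  shows "(\<integral>\<^sup>+x. g x \<partial>lborel) =
    (\<integral>\<^sup>+r. (\<integral>\<^sup>+y. g (r *\<^sub>R y) \<partial>sph) * ennreal (r ^ (DIM('a) - 1)) * indicator {0<..} r \<partial>lborel)"
  by (subst nn_integral_polar) (simp_all add: nn_integral_sph)

text \<open>Compact intervals exhaust the line, the substitution rule holds on each of them, and
  continuity from below of the two density measures passes to the limit. The range of
  \<open>g\<close> is written as the union of the images of these intervals, so that limits of
  \<open>g\<close> at infinity do not enter the statement.\<close>

lemma nn_integral_substitution_UNIV:
  fixes f :: "real \<Rightarrow> ennreal"
  assumes [measurable]: "f \<in> borel_measurable borel"
    and g: "\<And>x. (g has_real_derivative g' x) (at x)"
    and cont: "continuous_on UNIV g'" and nonneg: "\<And>x. 0 \<le> g' x"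
  shows "(\<integral>\<^sup>+x. f x * indicator (\<Union>n. {g (- real (Suc n))..g (real (Suc n))}) x \<partial>lborel)
    = (\<integral>\<^sup>+u. f (g u) * ennreal (g' u) \<partial>lborel)"
proof -
  have "continuous_on UNIV g"
    using g by (auto intro!: continuous_at_imp_continuous_on DERIV_isCont)
  then have [measurable]: "g \<in> borel_measurable borel" "g' \<in> borel_measurable borel"
    using cont by (auto intro: borel_measurable_continuous_onI)
  have mono: "g x \<le> g y" if "x \<le> y" for x y
    by (rule DERIV_nonneg_imp_nondecreasing[OF that]) (use g nonneg in blast)
  define A where "A n = {g (- real (Suc n))..g (real (Suc n))}" for n
  define B where "B n = {- real (Suc n)..real (Suc n)}" for n
  have AB [measurable]: "A n \<in> sets borel" "B n \<in> sets borel" for n by (auto simp: A_def B_def)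
  have inc: "incseq A" "incseq B"
    by (auto simp: A_def B_def incseq_def intro: order_trans[OF _ mono] order_trans[OF mono])
  have "(\<Union>n. B n) = UNIV"
  proof (intro equalityI subsetI UNIV_I)
    fix x :: real
    obtain n where "\<bar>x\<bar> \<le> real n" using real_arch_simple by blast
    then show "x \<in> (\<Union>n. B n)" by (auto simp: B_def intro!: exI[of _ n])
  qed
  then have "(\<integral>\<^sup>+u. f (g u) * ennreal (g' u) \<partial>lborel) = emeasure (density lborel (\<lambda>u. f (g u) * ennreal (g' u))) (\<Union>n. B n)"
    by (simp add: emeasure_density)
  also have "\<dots> = (SUP n. emeasure (density lborel (\<lambda>u. f (g u) * ennreal (g' u))) (B n))"
    using inc by (intro SUP_emeasure_incseq[symmetric]) auto
  also have "\<dots> = (SUP n. emeasure (density lborel f) (A n))"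
  proof (intro SUP_cong refl)
    fix n
    have "(\<integral>\<^sup>+x. f x * indicator {g (- real (Suc n))..g (real (Suc n))} x \<partial>lborel)
      = (\<integral>\<^sup>+x. f (g x) * g' x * indicator {- real (Suc n)..real (Suc n)} x \<partial>lborel)"
      by (rule nn_integral_substitution_aux) (use g nonneg continuous_on_subset[OF cont] in auto)
    then show "emeasure (density lborel (\<lambda>u. f (g u) * ennreal (g' u))) (B n) = emeasure (density lborel f) (A n)"
      by (simp add: emeasure_density A_def B_def)
  qed
  also have "\<dots> = emeasure (density lborel f) (\<Union>n. A n)"
    using inc by (intro SUP_emeasure_incseq) auto
  also have "\<dots> = (\<integral>\<^sup>+x. f x * indicator (\<Union>n. A n) x \<partial>lborel)"
    by (intro emeasure_density) auto
  finally show ?thesis by (simp add: A_def)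
qed

text \<open>The images exhaust the line because \<open>t \<le> sinh t\<close> for
  \<open>t \<ge> 0\<close>.\<close>

lemma nn_integral_sinh:
  fixes f :: "real \<Rightarrow> ennreal"
  assumes [measurable]: "f \<in> borel_measurable borel"
  shows "(\<integral>\<^sup>+x. f x \<partial>lborel) = (\<integral>\<^sup>+u. f (sinh u) * ennreal (cosh u) \<partial>lborel)"
proof -
  have "(\<Union>n. {sinh (- real (Suc n))..sinh (real (Suc n))}) = UNIV"
  proof (intro equalityI subsetI UNIV_I)
    fix x :: real
    obtain n where n: "\<bar>x\<bar> \<le> real n" using real_arch_simple by blast
    have le: "t \<le> sinh t" if "0 \<le> t" for t :: real
    proof -
      have "\<exists>y. ((\<lambda>t. sinh t - t) has_real_derivative y) (at x) \<and> 0 \<le> y" for x :: real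
        by (rule exI[of _ "cosh x - 1"]) (auto intro!: derivative_eq_intros cosh_real_ge_1)
      then have "sinh 0 - 0 \<le> sinh t - t"
        by (intro DERIV_nonneg_imp_nondecreasing[OF that])
      then show ?thesis by simp
    qed
    from le[of "real (Suc n)"] n show "x \<in> (\<Union>n. {sinh (- real (Suc n))..sinh (real (Suc n))})"
      by (auto intro!: exI[of _ n] simp del: of_nat_Suc)
  qed
  moreover have "(sinh has_real_derivative cosh x) (at x)" "continuous_on UNIV (cosh :: real \<Rightarrow> real)" for x :: real
    by (auto intro!: derivative_eq_intros continuous_intros)
  ultimately show ?thesis
    using nn_integral_substitution_UNIV[OF assms, of sinh cosh] by (simp add: less_imp_le)
qed

definition sech :: "real \<Rightarrow> real" where "sech u = inverse (cosh u)"

lemma sech_pos [simp]: "0 < sech u" and sech_le_1: "sech u \<le> 1"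
  by (auto simp: sech_def cosh_real_pos inverse_le_1_iff cosh_real_ge_1)

lemma borel_measurable_hyperbolic [measurable]:
  "(sinh :: real \<Rightarrow> real) \<in> borel_measurable borel" "(cosh :: real \<Rightarrow> real) \<in> borel_measurable borel"
  "(tanh :: real \<Rightarrow> real) \<in> borel_measurable borel" "sech \<in> borel_measurable borel"
  unfolding sech_def tanh_def by (auto intro!: borel_measurable_continuous_onI continuous_intros)

lemma sech2_plus_tanh2: "(tanh u)\<^sup>2 + (sech u)\<^sup>2 = 1"
proof -
  have "(sinh u)\<^sup>2 + 1 = (cosh u)\<^sup>2" by (simp add: cosh_square_eq)
  moreover have "cosh u \<noteq> 0" using cosh_real_pos[of u] by simp
  ultimately show ?thesis by (simp add: tanh_def sech_def field_simps)
qed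

text \<open>The height \<open>u\<close> is the Mercator coordinate: it corresponds to the polar
  angle \<open>2 * arctan (exp u)\<close> (\<open>polar_arctan_exp\<close>), and the minus sign
  makes \<open>u\<close> increase with that angle.\<close>

definition cyl :: "real \<Rightarrow> 'b \<Rightarrow> real \<times> 'b::euclidean_space" where
  "cyl u y = (- tanh u, sech u *\<^sub>R y)"

lemma measurable_cyl [measurable]: "(\<lambda>(u, y). cyl u y) \<in> borel \<Otimes>\<^sub>M borel \<rightarrow>\<^sub>M borel"
  unfolding cyl_def borel_prod[symmetric] by measurable

lemma norm_cyl: "norm y = 1 \<Longrightarrow> norm (cyl u y) = 1"
  using sech2_plus_tanh2[of u] by (simp add: cyl_def norm_Pair)

text \<open>The volume integral over the cone is computed in coordinates \<open>(t, z)\<close>, with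
  \<open>z\<close> in polar form \<open>r *\<^sub>R y\<close> and then
  \<open>t = - r * sinh u\<close>. The point \<open>(- r * sinh u, r *\<^sub>R y)\<close> has norm
  \<open>r * cosh u\<close> and direction \<open>cyl u y\<close>, so it lies in the unit ball
  exactly when \<open>r < sech u\<close>. The remaining integral of r^d, d being the dimension of
  the second factor, gives sech(u)^(d+1) / (d+1); the Jacobian \<open>cosh u\<close> removes one
  power of \<open>sech u\<close>, and d+1 cancels the normalisation of the surface measure.\<close>

lemma nn_integral_sph_cyl:
  fixes g :: "real \<times> 'b::euclidean_space \<Rightarrow> ennreal"
  assumes g [measurable]: "g \<in> borel_measurable borel"
  shows "(\<integral>\<^sup>+x. g x \<partial>sph) = (\<integral>\<^sup>+u. (\<integral>\<^sup>+y. g (cyl u y) \<partial>sph) * ennreal (sech u ^ DIM('b)) \<partial>lborel)"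
proof -
  let ?d = "DIM('b)"
  have d: "0 < ?d" by simp
  define h where "h x = g (sgn x) * indicator (ball 0 1 - {0}) x" for x
  have [measurable]: "(ball 0 1 - {0}) \<in> sets (borel :: (real \<times> 'b) measure)" by auto
  have h [measurable]: "h \<in> borel_measurable borel"
    unfolding h_def by measurable
  have h' [measurable]: "(\<lambda>x. h (fst x, snd x)) \<in> borel_measurable (borel \<Otimes>\<^sub>M borel)"
    using h by (simp add: borel_prod)
  have g' [measurable]: "(\<lambda>x. g (cyl (fst x) (snd x))) \<in> borel_measurable (borel \<Otimes>\<^sub>M borel)"
    using measurable_compose[OF measurable_cyl g] by (simp add: split_def)
  have "(\<integral>\<^sup>+x. h x \<partial>lborel) = (\<integral>\<^sup>+t. (\<integral>\<^sup>+z. h (t, z) \<partial>lborel) \<partial>lborel)"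
  proof -
    have "h \<in> borel_measurable (lborel \<Otimes>\<^sub>M lborel)" using h by (simp add: lborel_prod)
    from lborel.nn_integral_fst[OF this] show ?thesis by (simp add: lborel_prod)
  qed
  also have "\<dots> = (\<integral>\<^sup>+t. (\<integral>\<^sup>+r. (\<integral>\<^sup>+y. h (t, r *\<^sub>R y) \<partial>sph) * ennreal (r ^ (?d - 1)) * indicator {0<..} r \<partial>lborel) \<partial>lborel)"
    by (intro nn_integral_cong nn_integral_polar_sph) measurable
  also have "\<dots> = (\<integral>\<^sup>+r. (\<integral>\<^sup>+t. (\<integral>\<^sup>+y. h (t, r *\<^sub>R y) \<partial>sph) * ennreal (r ^ (?d - 1)) * indicator {0<..} r \<partial>lborel) \<partial>lborel)"
    by (rule lborel_pair.Fubini') measurable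
  also have "\<dots> = (\<integral>\<^sup>+r. (\<integral>\<^sup>+u. (\<integral>\<^sup>+y. g (cyl u y) \<partial>sph) * ennreal (cosh u) * (ennreal (r ^ ?d) * (if 0 < r \<and> r < sech u then 1 else 0)) \<partial>lborel) \<partial>lborel)"
  proof (rule nn_integral_cong)
    fix r :: real
    show "(\<integral>\<^sup>+t. (\<integral>\<^sup>+y. h (t, r *\<^sub>R y) \<partial>sph) * ennreal (r ^ (?d - 1)) * indicator {0<..} r \<partial>lborel) =
      (\<integral>\<^sup>+u. (\<integral>\<^sup>+y. g (cyl u y) \<partial>sph) * ennreal (cosh u) * (ennreal (r ^ ?d) * (if 0 < r \<and> r < sech u then 1 else 0)) \<partial>lborel)"
    proof (cases "0 < r")
      case True
      have "(\<integral>\<^sup>+t. (\<integral>\<^sup>+y. h (t, r *\<^sub>R y) \<partial>sph) * ennreal (r ^ (?d - 1)) * indicator {0<..} r \<partial>lborel)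
        = (\<integral>\<^sup>+t. (\<integral>\<^sup>+y. h (t, r *\<^sub>R y) \<partial>sph) * ennreal (r ^ (?d - 1)) \<partial>lborel)"
        using True by simp
      also have "\<dots> = \<bar>- r\<bar> * (\<integral>\<^sup>+s. (\<integral>\<^sup>+y. h (0 + (- r) * s, r *\<^sub>R y) \<partial>sph) * ennreal (r ^ (?d - 1)) \<partial>lborel)"
        by (rule nn_integral_real_affine) (use True in auto)
      also have "\<dots> = (\<integral>\<^sup>+s. \<bar>- r\<bar> * ((\<integral>\<^sup>+y. h (0 + (- r) * s, r *\<^sub>R y) \<partial>sph) * ennreal (r ^ (?d - 1))) \<partial>lborel)"
        by (rule nn_integral_cmult[symmetric]) measurable
      also have "\<dots> = (\<integral>\<^sup>+s. (\<integral>\<^sup>+y. h (- r * s, r *\<^sub>R y) \<partial>sph) * ennreal (r ^ ?d) \<partial>lborel)"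
      proof (rule nn_integral_cong)
        fix s
        have "ennreal \<bar>- r\<bar> * ennreal (r ^ (?d - 1)) = ennreal (r ^ ?d)"
          using True power_minus_mult[OF d, of r] by (simp add: ennreal_mult[symmetric] mult.commute)
        note eq = this
        show "ennreal \<bar>- r\<bar> * ((\<integral>\<^sup>+y. h (0 + (- r) * s, r *\<^sub>R y) \<partial>sph) * ennreal (r ^ (?d - 1)))
          = (\<integral>\<^sup>+y. h (- r * s, r *\<^sub>R y) \<partial>sph) * ennreal (r ^ ?d)"
          unfolding add_0 mult.left_commute[of "ennreal \<bar>- r\<bar>"] eq ..
      qed
      also have "\<dots> = (\<integral>\<^sup>+u. (\<integral>\<^sup>+y. h (- r * sinh u, r *\<^sub>R y) \<partial>sph) * ennreal (r ^ ?d) * ennreal (cosh u) \<partial>lborel)"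
        by (rule nn_integral_sinh) measurable
      also have "\<dots> = (\<integral>\<^sup>+u. (\<integral>\<^sup>+y. g (cyl u y) \<partial>sph) * ennreal (cosh u) * (ennreal (r ^ ?d) * (if 0 < r \<and> r < sech u then 1 else 0)) \<partial>lborel)"
      proof (rule nn_integral_cong)
        fix u :: real
        have c: "0 < cosh u" by simp
        have "(\<integral>\<^sup>+y. h (- r * sinh u, r *\<^sub>R y) \<partial>sph) = (\<integral>\<^sup>+(y::'b). g (cyl u y) * (if r < sech u then 1 else 0) \<partial>sph)"
        proof (rule nn_integral_cong_AE)
          show "AE y in sph. h (- r * sinh u, r *\<^sub>R (y::'b)) = g (cyl u y) * (if r < sech u then 1 else 0)"
            using AE_sph_norm
          proof eventually_elim
            case (elim y)
            have "(r * sinh u)\<^sup>2 + r\<^sup>2 = (r * cosh u)\<^sup>2" by (simp add: cosh_square_eq power_mult_distrib algebra_simps)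
            then have n: "norm (- r * sinh u, r *\<^sub>R y) = r * cosh u"
              using True c elim by (simp add: norm_Pair real_sqrt_mult)
            have "sgn (- r * sinh u, r *\<^sub>R y) = cyl u y"
              unfolding sgn_div_norm n using True c by (simp add: cyl_def tanh_def sech_def field_simps)
            moreover have "(- r * sinh u, r *\<^sub>R y) \<in> ball 0 1 - {0} \<longleftrightarrow> r < sech u"
              using n True c elim by (auto simp: sech_def field_simps)
            ultimately show ?case by (simp add: h_def indicator_def)
          qed
        qed
        also have "\<dots> = (\<integral>\<^sup>+(y::'b). g (cyl u y) \<partial>sph) * (if r < sech u then 1 else 0)"
          by simp
        finally show "(\<integral>\<^sup>+y. h (- r * sinh u, r *\<^sub>R y) \<partial>sph) * ennreal (r ^ ?d) * ennreal (cosh u)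
          = (\<integral>\<^sup>+y. g (cyl u y) \<partial>sph) * ennreal (cosh u) * (ennreal (r ^ ?d) * (if 0 < r \<and> r < sech u then 1 else 0))"
          using True by (simp add: mult_ac)
      qed
      finally show ?thesis .
    qed simp
  qed
  also have "\<dots> = (\<integral>\<^sup>+u. (\<integral>\<^sup>+r. (\<integral>\<^sup>+y. g (cyl u y) \<partial>sph) * ennreal (cosh u) * (ennreal (r ^ ?d) * (if 0 < r \<and> r < sech u then 1 else 0)) \<partial>lborel) \<partial>lborel)"
    by (rule lborel_pair.Fubini') measurable
  also have "\<dots> = (\<integral>\<^sup>+u. (\<integral>\<^sup>+y. g (cyl u y) \<partial>sph) * ennreal (sech u ^ ?d) * inverse (of_nat (Suc ?d)) \<partial>lborel)"
  proof (rule nn_integral_cong)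
    fix u :: real
    have c: "0 < cosh u" by simp
    have "(\<integral>\<^sup>+r. (ennreal (r ^ ?d) * (if 0 < r \<and> r < sech u then 1 else 0)) \<partial>lborel)
      = (\<integral>\<^sup>+r. ennreal (r ^ ?d) * indicator {0..sech u} r \<partial>lborel)"
    proof (rule nn_integral_cong_AE)
      have "AE r in lborel. r \<noteq> 0" "AE r in lborel. r \<noteq> sech u" by (rule AE_lborel_singleton)+
      then show "AE r in lborel. ennreal (r ^ ?d) * (if 0 < r \<and> r < sech u then 1 else 0) = ennreal (r ^ ?d) * indicator {0..sech u} r"
        by eventually_elim (auto simp: indicator_def)
    qed
    also have "\<dots> = ennreal (sech u ^ Suc ?d / Suc ?d - 0 ^ Suc ?d / Suc ?d)"
      by (rule nn_integral_FTC_Icc)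
         (auto intro!: derivative_eq_intros simp: less_imp_le simp del: power_Suc of_nat_Suc)
    also have "\<dots> = ennreal (sech u ^ Suc ?d) * inverse (of_nat (Suc ?d))"
      by (simp add: divide_inverse ennreal_mult less_imp_le ennreal_of_nat_eq_real_of_nat inverse_ennreal del: of_nat_Suc power_Suc)
    finally have "ennreal (cosh u) * (\<integral>\<^sup>+r. (ennreal (r ^ ?d) * (if 0 < r \<and> r < sech u then 1 else 0)) \<partial>lborel)
       = (ennreal (cosh u) * ennreal (sech u ^ Suc ?d)) * inverse (of_nat (Suc ?d))"
      by (simp only: mult.assoc)
    also have "ennreal (cosh u) * ennreal (sech u ^ Suc ?d) = ennreal (sech u ^ ?d)"
      using c by (simp add: ennreal_mult[symmetric] sech_def mult.assoc[symmetric] less_imp_le)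
    finally have eq: "ennreal (cosh u) * (\<integral>\<^sup>+r. (ennreal (r ^ ?d) * (if 0 < r \<and> r < sech u then 1 else 0)) \<partial>lborel)
       = ennreal (sech u ^ ?d) * inverse (of_nat (Suc ?d))" .
    have "(\<integral>\<^sup>+r. (\<integral>\<^sup>+y. g (cyl u y) \<partial>sph) * ennreal (cosh u) * (ennreal (r ^ ?d) * (if 0 < r \<and> r < sech u then 1 else 0)) \<partial>lborel)
      = (\<integral>\<^sup>+y. g (cyl u y) \<partial>sph) * ennreal (cosh u) * (\<integral>\<^sup>+r. (ennreal (r ^ ?d) * (if 0 < r \<and> r < sech u then 1 else 0)) \<partial>lborel)"
      by (rule nn_integral_cmult) measurable
    then show "(\<integral>\<^sup>+r. (\<integral>\<^sup>+y. g (cyl u y) \<partial>sph) * ennreal (cosh u) * (ennreal (r ^ ?d) * (if 0 < r \<and> r < sech u then 1 else 0)) \<partial>lborel)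
      = (\<integral>\<^sup>+y. g (cyl u y) \<partial>sph) * ennreal (sech u ^ ?d) * inverse (of_nat (Suc ?d))"
      by (simp only: mult.assoc eq)
  qed
  also have "\<dots> = (\<integral>\<^sup>+u. (\<integral>\<^sup>+y. g (cyl u y) \<partial>sph) * ennreal (sech u ^ ?d) \<partial>lborel) * inverse (of_nat (Suc ?d))"
    by (rule nn_integral_multc) measurable
  finally have 1: "(\<integral>\<^sup>+x. h x \<partial>lborel) = \<dots>" .
  have "(\<integral>\<^sup>+x. g x \<partial>sph) = of_nat (Suc ?d) * (\<integral>\<^sup>+x. h x \<partial>lborel)"
    by (simp add: nn_integral_sph_ball[OF g] h_def)
  also have "\<dots> = (of_nat (Suc ?d) * inverse (of_nat (Suc ?d))) * (\<integral>\<^sup>+u. (\<integral>\<^sup>+y. g (cyl u y) \<partial>sph) * ennreal (sech u ^ ?d) \<partial>lborel)"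
    unfolding 1 by (simp only: mult_ac)
  also have "(of_nat (Suc ?d) * inverse (of_nat (Suc ?d)) :: ennreal) = 1"
    by (simp add: ennreal_of_nat_eq_real_of_nat inverse_ennreal ennreal_mult[symmetric] del: of_nat_Suc)
  finally show ?thesis by simp
qed

subsection \<open>Harmonic polynomials and integration by parts on the sphere\<close>

definition dir_deriv :: "'a::euclidean_space \<Rightarrow> ('a \<Rightarrow> real) \<Rightarrow> 'a \<Rightarrow> real" where
  "dir_deriv v u x = deriv (\<lambda>s. u (x + s *\<^sub>R v)) 0"

abbreviation "rpf \<equiv> real_polynomial_function"

lemma has_real_derivative_line:
  assumes "(u has_derivative D) (at (x + t *\<^sub>R v))"
  shows "((\<lambda>s. u (x + s *\<^sub>R v)) has_real_derivative D v) (at t)"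
proof -
  have "((\<lambda>s. x + s *\<^sub>R v) has_derivative (\<lambda>s. s *\<^sub>R v)) (at t)"
    by (auto intro!: derivative_eq_intros)
  from has_derivative_compose[OF this assms]
  show ?thesis
    by (simp add: has_field_derivative_def linear_cmul[OF has_derivative_linear[OF assms]] mult_commute_abs)
qed

lemma dir_deriv_eqI: "(u has_derivative D) (at x) \<Longrightarrow> dir_deriv v u x = D v"
  unfolding dir_deriv_def by (rule DERIV_imp_deriv, rule has_real_derivative_line) simp

text \<open>Differentiability and polynomiality of the derivative are carried together through the
  induction over the construction of polynomials. The induction only asserts that some derivative
  exists; \<open>dir_deriv_eqI\<close> identifies it with \<open>dir_deriv\<close>
  afterwards.\<close>

lemma rpf_has_derivative: "rpf u \<Longrightarrow> (u has_derivative (\<lambda>v. dir_deriv v u x)) (at x)"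
  and rpf_dir_deriv: "rpf u \<Longrightarrow> rpf (dir_deriv v u)"
proof -
  have "(\<forall>x. \<exists>D. (u has_derivative D) (at x)) \<and> (\<forall>v. rpf (dir_deriv v u))" if "rpf u" for u :: "'a \<Rightarrow> real"
    using that
  proof (induction)
    case (linear f)
    then have *: "(f has_derivative f) (at x)" for x by (rule bounded_linear_imp_has_derivative)
    then have "dir_deriv v f = (\<lambda>x. f v)" for v by (auto intro: dir_deriv_eqI)
    with * show ?case by auto
  next
    case (const c)
    have *: "((\<lambda>x. c) has_derivative (\<lambda>v. 0)) (at x)" for x :: 'a by simp
    then have "dir_deriv v (\<lambda>x. c) = (\<lambda>x. 0)" for v :: 'a by (auto intro: dir_deriv_eqI[OF *])
    then show ?case by (auto intro!: exI[of _ "\<lambda>v. 0"])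
  next
    case (add f g)
    have D: "(f has_derivative (\<lambda>v. dir_deriv v f x)) (at x)" "(g has_derivative (\<lambda>v. dir_deriv v g x)) (at x)" for x
      using add(3,4) dir_deriv_eqI by (metis ext)+
    note * = has_derivative_add[OF this]
    have "dir_deriv v (\<lambda>x. f x + g x) = (\<lambda>x. dir_deriv v f x + dir_deriv v g x)" for v by (rule ext, rule dir_deriv_eqI[OF *])
    with * add show ?case by (auto intro!: exI)
  next
    case (mult f g)
    have D: "(f has_derivative (\<lambda>v. dir_deriv v f x)) (at x)" "(g has_derivative (\<lambda>v. dir_deriv v g x)) (at x)" for x
      using mult(3,4) dir_deriv_eqI by (metis ext)+
    note * = has_derivative_mult[OF this]
    have "dir_deriv v (\<lambda>x. f x * g x) = (\<lambda>x. f x * dir_deriv v g x + dir_deriv v f x * g x)" for v by (rule ext, rule dir_deriv_eqI[OF *])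
    with * mult show ?case by (auto intro!: exI real_polynomial_function.intros(3,4))
  qed
  then show "rpf u \<Longrightarrow> (u has_derivative (\<lambda>v. dir_deriv v u x)) (at x)" "rpf u \<Longrightarrow> rpf (dir_deriv v u)"
    using dir_deriv_eqI by (metis ext)+
qed

lemma dir_deriv_const [simp]: "dir_deriv v (\<lambda>x. c) = (\<lambda>x. 0)"
  by (rule ext, rule dir_deriv_eqI) simp

lemma dir_deriv_linear: "bounded_linear f \<Longrightarrow> dir_deriv v f = (\<lambda>x. f v)"
  by (rule ext, rule dir_deriv_eqI, rule bounded_linear_imp_has_derivative)

lemma dir_deriv_add: "rpf f \<Longrightarrow> rpf g \<Longrightarrow> dir_deriv v (\<lambda>x. f x + g x) = (\<lambda>x. dir_deriv v f x + dir_deriv v g x)"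
  by (rule ext, rule dir_deriv_eqI, intro has_derivative_add rpf_has_derivative)

lemma dir_deriv_mult: "rpf f \<Longrightarrow> rpf g \<Longrightarrow> dir_deriv v (\<lambda>x. f x * g x) = (\<lambda>x. f x * dir_deriv v g x + dir_deriv v f x * g x)"
  by (rule ext, rule dir_deriv_eqI, intro has_derivative_mult rpf_has_derivative)

lemma dir_deriv_cmult: "rpf f \<Longrightarrow> dir_deriv v (\<lambda>x. c * f x) = (\<lambda>x. c * dir_deriv v f x)"
  by (subst dir_deriv_mult) auto

lemma dir_deriv_sum:
  assumes "finite I" "\<And>i. i \<in> I \<Longrightarrow> rpf (f i)"
  shows "dir_deriv v (\<lambda>x. \<Sum>i\<in>I. f i x) = (\<lambda>x. \<Sum>i\<in>I. dir_deriv v (f i) x)"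
  using assms by (intro ext dir_deriv_eqI has_derivative_sum rpf_has_derivative) auto

lemma linear_dir_deriv: "rpf u \<Longrightarrow> linear (\<lambda>v. dir_deriv v u x)"
  by (rule has_derivative_linear[OF rpf_has_derivative])

lemma dir_deriv_Basis: "rpf u \<Longrightarrow> dir_deriv v u x = (\<Sum>b\<in>Basis. (v \<bullet> b) * dir_deriv b u x)"
  by (subst euclidean_representation[of v, symmetric])
     (simp add: linear_sum[OF linear_dir_deriv] linear_cmul[OF linear_dir_deriv])

lemma dir_deriv_commute: "rpf u \<Longrightarrow> dir_deriv v (dir_deriv w u) = dir_deriv w (dir_deriv v u)"
proof (induction rule: real_polynomial_function.induct)
  case (mult f g)
  then show ?case
    by (simp add: dir_deriv_mult dir_deriv_add rpf_dir_deriv real_polynomial_function.intros(4) algebra_simps)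
qed (simp_all add: dir_deriv_linear dir_deriv_add rpf_dir_deriv)

lemma rpf_line:
  "rpf u \<Longrightarrow> ((\<lambda>s. u (x + s *\<^sub>R v)) has_real_derivative dir_deriv v u (x + t *\<^sub>R v)) (at t)"
  by (rule has_real_derivative_line[OF rpf_has_derivative])

lemma rpf_continuous:
  fixes u :: "'a::euclidean_space \<Rightarrow> real"
  assumes "rpf u" shows "continuous_on S u"
  by (intro continuous_at_imp_continuous_on ballI) (rule has_derivative_continuous[OF rpf_has_derivative[OF assms]])

lemma rpf_borel [measurable_dest]: "rpf (u :: 'a::euclidean_space \<Rightarrow> real) \<Longrightarrow> u \<in> borel_measurable borel"
  by (intro borel_measurable_continuous_onI rpf_continuous)

lemma rpf_inner [intro]: "rpf (\<lambda>x. x \<bullet> v)" "rpf (\<lambda>x. v \<bullet> x)"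
  by (intro real_polynomial_function.intros(1) bounded_linear_inner_left bounded_linear_inner_right)+

lemma rpf_inner_self [intro]: "rpf (\<lambda>x::'a::euclidean_space. x \<bullet> x)"
  by (subst euclidean_inner) (intro real_polynomial_function_sum real_polynomial_function.intros(4) rpf_inner finite_Basis)

lemma dir_deriv_inner [simp]: "dir_deriv v (\<lambda>x. x \<bullet> w) = (\<lambda>x. v \<bullet> w)" "dir_deriv v (\<lambda>x. w \<bullet> x) = (\<lambda>x. w \<bullet> v)"
  by (intro dir_deriv_linear bounded_linear_inner_left bounded_linear_inner_right)+

lemma dir_deriv_inner_self [simp]: "dir_deriv v (\<lambda>x. x \<bullet> x) = (\<lambda>x. 2 * (x \<bullet> v))"
  by (rule ext, rule dir_deriv_eqI) (auto intro!: derivative_eq_intros simp: inner_commute)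

section \<open>The Laplacian and homogeneous harmonic polynomials\<close>

definition real_laplacian :: "('a::euclidean_space \<Rightarrow> real) \<Rightarrow> 'a \<Rightarrow> real" where
  "real_laplacian u x = (\<Sum>b\<in>Basis. dir_deriv b (dir_deriv b u) x)"

lemma real_laplacian_add: "rpf f \<Longrightarrow> rpf g \<Longrightarrow> real_laplacian (\<lambda>x. f x + g x) x = real_laplacian f x + real_laplacian g x"
  by (simp add: real_laplacian_def dir_deriv_add rpf_dir_deriv sum.distrib)

lemma real_laplacian_cmult: "rpf f \<Longrightarrow> real_laplacian (\<lambda>x. c * f x) x = c * real_laplacian f x"
  by (simp add: real_laplacian_def dir_deriv_cmult rpf_dir_deriv sum_distrib_left)

lemma real_laplacian_mult:
  "rpf f \<Longrightarrow> rpf g \<Longrightarrow>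
    real_laplacian (\<lambda>x. f x * g x) x = f x * real_laplacian g x + real_laplacian f x * g x + 2 * (\<Sum>b\<in>Basis. dir_deriv b f x * dir_deriv b g x)"
  by (simp add: real_laplacian_def dir_deriv_mult dir_deriv_add rpf_dir_deriv real_polynomial_function.intros(4) sum.distrib
      sum_distrib_left sum_distrib_right algebra_simps)

lemma real_laplacian_dir_deriv: "rpf u \<Longrightarrow> real_laplacian (dir_deriv v u) = dir_deriv v (real_laplacian u)"
  unfolding real_laplacian_def[abs_def]
  by (subst dir_deriv_sum) (auto simp: rpf_dir_deriv dir_deriv_commute[of _ _ v])

text \<open>Real counterpart of \<open>homogeneous_harmonic_polynomial\<close>, meant for real and
  imaginary parts. Homogeneity is stated for positive factors, the form in which dilations enter
  radial integration.\<close>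

definition solid_harmonic :: "nat \<Rightarrow> ('a::euclidean_space \<Rightarrow> real) \<Rightarrow> bool" where
  "solid_harmonic n u \<longleftrightarrow> rpf u \<and> (\<forall>c>0. \<forall>x. u (c *\<^sub>R x) = c ^ n * u x) \<and> (\<forall>x. real_laplacian u x = 0)"

lemma dir_deriv_homogeneous:
  assumes u: "rpf u" and hom: "\<And>c x. 0 < c \<Longrightarrow> u (c *\<^sub>R x) = c ^ n * u x" and c: "0 < c"
  shows "c * dir_deriv v u (c *\<^sub>R x) = c ^ n * dir_deriv v u x"
proof -
  have "((\<lambda>s. u (c *\<^sub>R x + s *\<^sub>R (c *\<^sub>R v))) has_real_derivative dir_deriv (c *\<^sub>R v) u (c *\<^sub>R x)) (at 0)"
    using rpf_line[OF u, of "c *\<^sub>R x" "c *\<^sub>R v" 0] by simp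
  moreover have "u (c *\<^sub>R x + s *\<^sub>R (c *\<^sub>R v)) = c ^ n * u (x + s *\<^sub>R v)" for s
    using hom[OF c, of "x + s *\<^sub>R v"] by (simp add: algebra_simps)
  moreover have "((\<lambda>s. c ^ n * u (x + s *\<^sub>R v)) has_real_derivative c ^ n * dir_deriv v u x) (at 0)"
    using DERIV_cmult[OF rpf_line[OF u, of x v 0]] by simp
  ultimately have "dir_deriv (c *\<^sub>R v) u (c *\<^sub>R x) = c ^ n * dir_deriv v u x"
    using DERIV_unique by auto
  then show ?thesis by (simp add: linear_cmul[OF linear_dir_deriv[OF u]])
qed

text \<open>Euler's identity: both sides are the derivative at \<open>s = 0\<close> of u(x + s x) =
  (1 + s)^n u(x), which holds for s > -1 and hence near 0.\<close>

lemma euler_homogeneous: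
  assumes u: "rpf u" and hom: "\<And>c x. 0 < c \<Longrightarrow> u (c *\<^sub>R x) = c ^ n * u x"
  shows "dir_deriv x u x = n * u x"
proof -
  have "((\<lambda>s. u (x + s *\<^sub>R x)) has_real_derivative dir_deriv x u x) (at 0)"
    using rpf_line[OF u, of x x 0] by simp
  moreover have "((\<lambda>s. (1 + s) ^ n * u x) has_real_derivative n * u x) (at 0)"
    by (auto intro!: derivative_eq_intros)
  then have "((\<lambda>s. u (x + s *\<^sub>R x)) has_real_derivative n * u x) (at 0)"
  proof (rule DERIV_cong_ev[THEN iffD1, rotated -1])
    have "eventually (\<lambda>s::real. s > -1) (nhds 0)"
      by (intro eventually_nhds_in_open[of "{-1<..}", simplified]) auto
    then show "\<forall>\<^sub>F s in nhds 0. (1 + s) ^ n * u x = u (x + s *\<^sub>R x)"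
    proof eventually_elim
      case (elim s)
      then show ?case using hom[of "1 + s" x] by (simp add: algebra_simps)
    qed
  qed auto
  ultimately show ?thesis by (rule DERIV_unique)
qed

lemma solid_harmonic_dir_deriv:
  assumes "solid_harmonic (Suc n) u" shows "solid_harmonic n (dir_deriv v u)"
  unfolding solid_harmonic_def
proof (intro conjI allI impI)
  have u: "rpf u" "\<And>c x. 0 < c \<Longrightarrow> u (c *\<^sub>R x) = c ^ Suc n * u x" "real_laplacian u = (\<lambda>x. 0)"
    using assms by (auto simp: solid_harmonic_def)
  show "rpf (dir_deriv v u)" using u by (simp add: rpf_dir_deriv)
  show "dir_deriv v u (c *\<^sub>R x) = c ^ n * dir_deriv v u x" if "0 < c" for c x
    using dir_deriv_homogeneous[OF u(1,2) that, of v x] that by simp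
  show "real_laplacian (dir_deriv v u) x = 0" for x using u by (simp add: real_laplacian_dir_deriv)
qed

text \<open>The derivative of a function homogeneous of degree 0 satisfies
  \<open>c * dir_deriv v u (c *\<^sub>R w) = dir_deriv v u w\<close> for \<open>c > 0\<close>. It is
  continuous at the origin, so letting \<open>c\<close> tend to 0 shows that it vanishes.\<close>

lemma solid_harmonic_0_const:
  assumes "solid_harmonic 0 u" shows "u x = u y"
proof -
  have u: "rpf u" "\<And>c x. 0 < c \<Longrightarrow> u (c *\<^sub>R x) = c ^ 0 * u x"
    using assms by (auto simp: solid_harmonic_def)
  have z: "dir_deriv v u w = 0" for v w
  proof (rule tendsto_unique)
    have "continuous (at 0) (dir_deriv v u)"
      using rpf_continuous[OF rpf_dir_deriv[OF u(1)], of UNIV] by (simp add: continuous_on_eq_continuous_at)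
    moreover have "((\<lambda>c. c *\<^sub>R w) \<longlongrightarrow> 0) (at_right 0)"
      by (rule tendsto_eq_intros | simp)+
    ultimately have "((\<lambda>c. dir_deriv v u (c *\<^sub>R w)) \<longlongrightarrow> dir_deriv v u 0) (at_right 0)"
      by (rule isCont_tendsto_compose)
    then have "((\<lambda>c. c * dir_deriv v u (c *\<^sub>R w)) \<longlongrightarrow> 0 * dir_deriv v u 0) (at_right 0)"
      by (intro tendsto_mult) (auto intro!: tendsto_eq_intros)
    moreover have "eventually (\<lambda>c. c * dir_deriv v u (c *\<^sub>R w) = dir_deriv v u w) (at_right 0)"
      using eventually_at_right_less[of 0]
      by eventually_elim (use dir_deriv_homogeneous[OF u, of _ v w] in auto)
    ultimately show "((\<lambda>c. dir_deriv v u w) \<longlongrightarrow> 0) (at_right (0::real))"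
      by (simp add: tendsto_cong)
  qed auto
  have "(u has_derivative (\<lambda>v. 0)) (at w)" for w
    using rpf_has_derivative[OF u(1), of w] by (simp add: z)
  then show ?thesis
    using has_derivative_zero_unique[of UNIV u] by (metis UNIV_I convex_UNIV)
qed

section \<open>Integration by parts on the sphere\<close>

lemma lborel_integral_translate:
  fixes f :: "'a::euclidean_space \<Rightarrow> real"
  assumes [measurable]: "f \<in> borel_measurable borel"
  shows "(\<integral>x. f (x + c) \<partial>lborel) = (\<integral>x. f x \<partial>lborel)"
    and "integrable lborel (\<lambda>x. f (x + c)) \<longleftrightarrow> integrable lborel f"
proof -
  have m: "(\<lambda>x. x + c) \<in> lborel \<rightarrow>\<^sub>M borel" by simp
  have d: "distr lborel borel (\<lambda>x. x + c) = (lborel :: 'a measure)"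
    using lborel_distr_plus[of c] by (simp add: add.commute[of _ c])
  show "integrable lborel (\<lambda>x. f (x + c)) \<longleftrightarrow> integrable lborel f"
    using integrable_distr_eq[OF m assms] by (simp add: d)
  show "(\<integral>x. f (x + c) \<partial>lborel) = (\<integral>x. f x \<partial>lborel)"
    using integral_distr[OF m assms] by (simp add: d)
qed

text \<open>Integrating \<open>F (x + v) - F x = \<integral>\<^sub>0\<^sup>1 F' (x + s v) ds\<close> over \<open>x\<close> gives \<open>0 = \<integral> F'\<close>
  by translation invariance.\<close>

lemma integral_line_derivative_eq_0:
  fixes F F' :: "'a::euclidean_space \<Rightarrow> real"
  assumes deriv: "\<And>x s. ((\<lambda>s. F (x + s *\<^sub>R v)) has_real_derivative F' (x + s *\<^sub>R v)) (at s)"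
    and cont: "continuous_on UNIV F'"
    and int: "integrable lborel F" "integrable lborel F'"
  shows "(\<integral>x. F' x \<partial>lborel) = 0"
proof -
  have [measurable]: "F' \<in> borel_measurable borel" using cont by (rule borel_measurable_continuous_onI)
  have [measurable]: "F \<in> borel_measurable borel" using int(1) by auto
  let ?f = "\<lambda>(s::real) x. F' (x + s *\<^sub>R v) * indicator {0..1} s"
  have int': "integrable lborel (\<lambda>x. F' (x + s *\<^sub>R v))" for s
    using int by (simp add: lborel_integral_translate)
  have i: "integrable (lborel \<Otimes>\<^sub>M lborel) (\<lambda>(s, x). ?f s x)"
  proof (rule lborel_pair.Fubini_integrable)
    have "(\<integral>x. norm (?f s x) \<partial>lborel) = indicator {0..1} s * (\<integral>x. norm (F' x) \<partial>lborel)" for s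
      using lborel_integral_translate(1)[of "\<lambda>x. norm (F' x)" "s *\<^sub>R v"] by (simp add: abs_mult mult.commute)
    then show "integrable lborel (\<lambda>s. \<integral>x. norm (case (s, x) of (s, x) \<Rightarrow> ?f s x) \<partial>lborel)"
      by simp
    show "AE s in lborel. integrable lborel (\<lambda>x. case (s, x) of (s, x) \<Rightarrow> ?f s x)"
      using int' by simp
  qed measurable
  have "(\<integral>x. F' x \<partial>lborel) = (\<integral>s. indicator {0..1::real} s * (\<integral>x. F' x \<partial>lborel) \<partial>lborel)"
    by (simp add: content_real)
  also have "\<dots> = (\<integral>s. (\<integral>x. ?f s x \<partial>lborel) \<partial>lborel)"
    by (intro Bochner_Integration.integral_cong refl)
       (simp add: lborel_integral_translate(1) mult.commute)
  also have "\<dots> = (\<integral>x. (\<integral>s. ?f s x \<partial>lborel) \<partial>lborel)"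
    using lborel_pair.Fubini_integral[OF i] by simp
  also have "\<dots> = (\<integral>x. F (x + v) - F x \<partial>lborel)"
  proof (intro Bochner_Integration.integral_cong refl)
    fix x
    have "(\<integral>s. ?f s x \<partial>lborel) = F (x + 1 *\<^sub>R v) - F (x + 0 *\<^sub>R v)"
    proof (rule integral_FTC_Icc_real)
      have c: "isCont F' y" for y using cont by (simp add: continuous_on_eq_continuous_at)
      show "isCont (\<lambda>s. F' (x + s *\<^sub>R v)) s" for s
        by (rule isCont_o2[where g=F', OF _ c]) (intro continuous_intros)
    qed (use deriv in auto)
    then show "(\<integral>s. ?f s x \<partial>lborel) = F (x + v) - F x" by simp
  qed
  also have "\<dots> = 0"
    using int by (subst Bochner_Integration.integral_diff) (simp_all add: lborel_integral_translate)
  finally show ?thesis .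
qed

text \<open>Both \<open>H\<close> and \<open>- H\<close> scale by the same factor
  \<open>\<phi>\<close>, so the polar formula separates radius and direction in the integrals of the
  positive and the negative part with one common radial constant. This is the device that converts
  identities over the whole space into identities over the sphere.\<close>

lemma integral_homogeneous_polar:
  fixes H :: "'a::euclidean_space \<Rightarrow> real"
  assumes H [measurable]: "H \<in> borel_measurable borel" and \<psi> [measurable]: "\<psi> \<in> borel_measurable borel"
    and \<phi> [measurable]: "\<phi> \<in> borel_measurable borel"
    and hom: "\<And>r y. 0 < r \<Longrightarrow> H (r *\<^sub>R y) = \<phi> r * H y"
    and nonneg: "\<And>r. 0 < r \<Longrightarrow> 0 \<le> \<phi> r" "\<And>r. 0 \<le> \<psi> r"
    and int: "integrable lborel (\<lambda>x. H x * \<psi> (norm x))" "integrable sph H"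
  shows "(\<integral>x. H x * \<psi> (norm x) \<partial>lborel) =
    enn2real (\<integral>\<^sup>+r. ennreal (\<phi> r * \<psi> r * r ^ (DIM('a) - 1)) * indicator {0<..} r \<partial>lborel) * (\<integral>x. H x \<partial>sph)"
proof -
  define c where "c = (\<integral>\<^sup>+r. ennreal (\<phi> r * \<psi> r * r ^ (DIM('a) - 1)) * indicator {0<..} r \<partial>lborel)"
  have *: "(\<integral>\<^sup>+x. ennreal (G x * \<psi> (norm x)) \<partial>lborel) = c * (\<integral>\<^sup>+x. ennreal (G x) \<partial>sph)"
    if [measurable]: "G \<in> borel_measurable borel" and hom: "\<And>r y. 0 < r \<Longrightarrow> G (r *\<^sub>R y) = \<phi> r * G y"
    for G :: "'a \<Rightarrow> real"
  proof -
    have "(\<integral>\<^sup>+x. ennreal (G x * \<psi> (norm x)) \<partial>lborel)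
      = (\<integral>\<^sup>+r. (\<integral>\<^sup>+y. ennreal (G (r *\<^sub>R y) * \<psi> (norm (r *\<^sub>R y))) \<partial>sph) * ennreal (r ^ (DIM('a) - 1)) * indicator {0<..} r \<partial>lborel)"
      by (rule nn_integral_polar_sph) measurable
    also have "\<dots> = (\<integral>\<^sup>+r. ennreal (\<phi> r * \<psi> r * r ^ (DIM('a) - 1)) * indicator {0<..} r * (\<integral>\<^sup>+x. ennreal (G x) \<partial>sph) \<partial>lborel)"
    proof (rule nn_integral_cong)
      fix r :: real
      show "(\<integral>\<^sup>+y. ennreal (G (r *\<^sub>R y) * \<psi> (norm (r *\<^sub>R y))) \<partial>sph) * ennreal (r ^ (DIM('a) - 1)) * indicator {0<..} r
        = ennreal (\<phi> r * \<psi> r * r ^ (DIM('a) - 1)) * indicator {0<..} r * (\<integral>\<^sup>+x. ennreal (G x) \<partial>sph)"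
      proof (cases "0 < r")
        case True
        have "(\<integral>\<^sup>+y. ennreal (G (r *\<^sub>R y) * \<psi> (norm (r *\<^sub>R y))) \<partial>sph) = (\<integral>\<^sup>+y. ennreal (\<phi> r * \<psi> r) * ennreal (G y) \<partial>sph)"
        proof (rule nn_integral_cong_AE)
          show "AE y in sph. ennreal (G (r *\<^sub>R y) * \<psi> (norm (r *\<^sub>R y))) = ennreal (\<phi> r * \<psi> r) * ennreal (G y)"
            using AE_sph_norm
          proof eventually_elim
            case (elim y)
            have "G (r *\<^sub>R y) * \<psi> (norm (r *\<^sub>R y)) = (\<phi> r * \<psi> r) * G y"
              using True elim hom[OF True, of y] by simp
            then show ?case
              using nonneg(1)[OF True] nonneg(2)[of r] by (simp only: ennreal_mult'[OF mult_nonneg_nonneg])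
          qed
        qed
        also have "\<dots> = ennreal (\<phi> r * \<psi> r) * (\<integral>\<^sup>+x. ennreal (G x) \<partial>sph)"
          by (rule nn_integral_cmult) simp
        finally show ?thesis
          using True nonneg(1)[OF True] nonneg(2)[of r] by (simp add: ennreal_mult mult_ac)
      qed simp
    qed
    also have "\<dots> = c * (\<integral>\<^sup>+x. ennreal (G x) \<partial>sph)"
      unfolding c_def by (rule nn_integral_multc) measurable
    finally show ?thesis .
  qed
  have "(\<integral>\<^sup>+x. ennreal (- (H x * \<psi> (norm x))) \<partial>lborel) = c * (\<integral>\<^sup>+x. ennreal (- H x) \<partial>sph)"
    using *[of "\<lambda>x. - H x"] hom by simp
  moreover have "(\<integral>\<^sup>+x. ennreal (H x * \<psi> (norm x)) \<partial>lborel) = c * (\<integral>\<^sup>+x. ennreal (H x) \<partial>sph)"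
    using *[of H] hom by simp
  ultimately show ?thesis
    unfolding real_lebesgue_integral_def[OF int(1)] real_lebesgue_integral_def[OF int(2)] c_def[symmetric]
    by (simp add: enn2real_mult right_diff_distrib)
qed

lemma integrable_sph_continuous:
  fixes f :: "'a::euclidean_space \<Rightarrow> 'b::euclidean_space"
  assumes "continuous_on UNIV f"
  shows "integrable sph f"
proof -
  have "compact (f ` sphere 0 1)"
    using assms by (intro compact_continuous_image) (auto intro: continuous_on_subset)
  then obtain B where B: "\<And>x. x \<in> sphere 0 1 \<Longrightarrow> norm (f x) \<le> B"
    using compact_imp_bounded bounded_iff by (metis imageI)
  show ?thesis
  proof (rule sph.integrable_const_bound[where B=B])
    show "AE x in sph. norm (f x) \<le> B"
      using AE_sph_norm by eventually_elim (use B in auto)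
    show "f \<in> borel_measurable sph"
      using borel_measurable_continuous_onI[OF assms] by simp
  qed
qed

lemma integrable_sph_rpf: "rpf f \<Longrightarrow> integrable sph (f :: 'a::euclidean_space \<Rightarrow> real)"
  by (intro integrable_sph_continuous rpf_continuous)

lemma integrable_lborel_supported:
  fixes f :: "'a::euclidean_space \<Rightarrow> real"
  assumes "continuous_on UNIV f" "\<And>x. 1 < norm x \<Longrightarrow> f x = 0"
  shows "integrable lborel f"
proof -
  have "integrable lborel (\<lambda>x. indicator (cball 0 1) x *\<^sub>R f x)"
    using assms by (intro borel_integrable_compact) (auto intro: continuous_on_subset)
  also have "(\<lambda>x. indicator (cball 0 1) x *\<^sub>R f x) = f"
    by (intro ext) (auto simp: indicator_def not_le assms(2))
  finally show ?thesis .
qed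

text \<open>Squaring removes the kink of the positive part. Hence the square of
  \<open>max 0 (1 - (norm x)\<^sup>2)\<close> is a continuously differentiable weight supported in
  the unit ball.\<close>

lemma has_real_derivative_max_0_square:
  "((\<lambda>t::real. (max 0 t)\<^sup>2) has_real_derivative 2 * max 0 t) (at t)"
proof (cases t "0::real" rule: linorder_cases)
  case less
  then have "eventually (\<lambda>s. s < 0) (nhds t)"
    by (intro eventually_nhds_in_open[of "{..<0}", simplified]) auto
  then have "eventually (\<lambda>s. (max 0 s)\<^sup>2 = 0) (nhds t)" by eventually_elim auto
  from DERIV_cong_ev[OF refl this refl, of 0] less show ?thesis by simp
next
  case equal
  have "((\<lambda>h::real. (max 0 h)\<^sup>2 / h) \<longlongrightarrow> 0) (at 0)"
  proof (rule Lim_null_comparison)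
    show "eventually (\<lambda>h::real. norm ((max 0 h)\<^sup>2 / h) \<le> \<bar>h\<bar>) (at 0)"
      by (auto simp: eventually_at_filter max_def power2_eq_square)
    show "((\<lambda>h::real. \<bar>h\<bar>) \<longlongrightarrow> 0) (at 0)" by (auto intro!: tendsto_eq_intros)
  qed
  then show ?thesis using equal by (simp add: DERIV_def)
next
  case greater
  then have "eventually (\<lambda>s. s > 0) (nhds t)"
    by (intro eventually_nhds_in_open[of "{0<..}", simplified]) auto
  then have "eventually (\<lambda>s. (max 0 s)\<^sup>2 = s\<^sup>2) (nhds t)" by eventually_elim auto
  from DERIV_cong_ev[OF refl this refl, of "2 * t"] greater show ?thesis
    by (auto intro!: derivative_eq_intros)
qed

text \<open>The radial constants of that weight and of the factor that appears in its derivative.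
  Four times the second value divided by the first is exactly \<open>m\<close>, which is where the
  constant of \<open>integral_sph_dir_deriv\<close> comes from.\<close>

lemma nn_integral_powers:
  assumes "1 \<le> (m::nat)"
  shows "(\<integral>\<^sup>+r. ennreal (r ^ (m - 1) * (max 0 (1 - r\<^sup>2))\<^sup>2) * indicator {0<..} r \<partial>lborel) = ennreal (8 / (real m * (real m + 2) * (real m + 4)))"
    and "(\<integral>\<^sup>+r. ennreal (r ^ (m + 1) * max 0 (1 - r\<^sup>2)) * indicator {0<..} r \<partial>lborel) = ennreal (2 / ((real m + 2) * (real m + 4)))"
proof -
  have id1: "1 / (t + 1) - 2 * (1 / (t + 3)) + 1 / (t + 5) = 8 / ((t + 1) * (t + 3) * (t + 5))"
    and id2: "1 / (t + 3) - 1 / (t + 5) = 2 / ((t + 3) * (t + 5))" if "0 \<le> t" for t :: real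
    using that by (simp_all add: divide_simps) (simp_all add: algebra_simps)
  obtain k where m: "m = Suc k" using assms by (cases m) auto
  have AE: "(\<integral>\<^sup>+r. ennreal (f r) * indicator {0<..} r \<partial>lborel) = (\<integral>\<^sup>+r. ennreal (g r) * indicator {0..1} r \<partial>lborel)"
    if "\<And>r. 0 < r \<Longrightarrow> r < 1 \<Longrightarrow> f r = g r" "\<And>r. 1 < r \<Longrightarrow> f r = 0" for f g :: "real \<Rightarrow> real"
  proof (rule nn_integral_cong_AE)
    have "AE r in lborel. r \<noteq> (0::real)" "AE r in lborel. r \<noteq> (1::real)" by (rule AE_lborel_singleton)+
    then show "AE r in lborel. ennreal (f r) * indicator {0<..} r = ennreal (g r) * indicator {0..1} r"
      by eventually_elim (use that in \<open>auto simp: indicator_def\<close>)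
  qed
  have le: "(0 \<le> 1 - r\<^sup>2) = (\<bar>r\<bar> \<le> 1)" for r :: real by (simp add: abs_square_le_1)
  have gt: "max 0 (1 - r\<^sup>2) = 0" if "1 < r" for r :: real using le[of r] that by auto
  have ln: "max 0 (1 - r\<^sup>2) = 1 - r\<^sup>2" if "0 < r" "r < 1" for r :: real using le[of r] that by auto
  have "(\<integral>\<^sup>+r. ennreal (r ^ (m - 1) * (max 0 (1 - r\<^sup>2))\<^sup>2) * indicator {0<..} r \<partial>lborel)
    = (\<integral>\<^sup>+r. ennreal (r ^ k * (1 - r\<^sup>2)\<^sup>2) * indicator {0..1} r \<partial>lborel)"
    by (rule AE) (simp_all add: m gt ln)
  also have "\<dots> = ennreal ((\<lambda>r. r ^ Suc k / Suc k - 2 * (r ^ (k + 3) / (k + 3)) + r ^ (k + 5) / (k + 5)) 1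
       - (\<lambda>r. r ^ Suc k / Suc k - 2 * (r ^ (k + 3) / (k + 3)) + r ^ (k + 5) / (k + 5)) 0)"
  proof (rule nn_integral_FTC_Icc)
    have D: "((\<lambda>r. r ^ Suc n / Suc n) has_real_derivative r ^ n) (at r within S)" for n S and r :: real
      by (auto intro!: derivative_eq_intros simp del: power_Suc of_nat_Suc)
    fix r :: real
    have "((\<lambda>r. r ^ Suc k / Suc k - 2 * (r ^ Suc (k + 2) / Suc (k + 2)) + r ^ Suc (k + 4) / Suc (k + 4))
      has_real_derivative r ^ k - 2 * r ^ (k + 2) + r ^ (k + 4)) (at r)"
      by (intro derivative_intros DERIV_cmult D)
    moreover have "r ^ k - 2 * r ^ (k + 2) + r ^ (k + 4) = r ^ k * (1 - r\<^sup>2)\<^sup>2"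
      by (simp add: power_add power2_eq_square algebra_simps power_numeral_reduce)
    ultimately show "((\<lambda>r. r ^ Suc k / Suc k - 2 * (r ^ (k + 3) / (k + 3)) + r ^ (k + 5) / (k + 5))
      has_real_derivative r ^ k * (1 - r\<^sup>2)\<^sup>2) (at r)"
      by (simp add: eval_nat_numeral del: power_Suc)
  qed auto
  also have "\<dots> = ennreal (8 / (real m * (real m + 2) * (real m + 4)))"
  proof (rule arg_cong[of _ _ ennreal])
    show "(\<lambda>r. r ^ Suc k / Suc k - 2 * (r ^ (k + 3) / (k + 3)) + r ^ (k + 5) / (k + 5)) 1
       - (\<lambda>r. r ^ Suc k / Suc k - 2 * (r ^ (k + 3) / (k + 3)) + r ^ (k + 5) / (k + 5)) 0 = 8 / (real m * (real m + 2) * (real m + 4))"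
      using id1[of "real k"] by (simp add: m add_ac zero_power)
  qed
  finally show "(\<integral>\<^sup>+r. ennreal (r ^ (m - 1) * (max 0 (1 - r\<^sup>2))\<^sup>2) * indicator {0<..} r \<partial>lborel) = ennreal (8 / (real m * (real m + 2) * (real m + 4)))" .
  have "(\<integral>\<^sup>+r. ennreal (r ^ (m + 1) * max 0 (1 - r\<^sup>2)) * indicator {0<..} r \<partial>lborel)
    = (\<integral>\<^sup>+r. ennreal (r ^ (k + 2) * (1 - r\<^sup>2)) * indicator {0..1} r \<partial>lborel)"
    by (rule AE) (simp_all add: m gt ln)
  also have "\<dots> = ennreal ((\<lambda>r. r ^ (k + 3) / (k + 3) - r ^ (k + 5) / (k + 5)) 1
       - (\<lambda>r. r ^ (k + 3) / (k + 3) - r ^ (k + 5) / (k + 5)) 0)"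
  proof (rule nn_integral_FTC_Icc)
    have D: "((\<lambda>r. r ^ Suc n / Suc n) has_real_derivative r ^ n) (at r within S)" for n S and r :: real
      by (auto intro!: derivative_eq_intros simp del: power_Suc of_nat_Suc)
    fix r :: real
    have "((\<lambda>r. r ^ Suc (k + 2) / Suc (k + 2) - r ^ Suc (k + 4) / Suc (k + 4))
      has_real_derivative r ^ (k + 2) - r ^ (k + 4)) (at r)"
      by (intro derivative_intros D)
    moreover have "r ^ (k + 2) - r ^ (k + 4) = r ^ (k + 2) * (1 - r\<^sup>2)"
      by (simp add: power_add power2_eq_square algebra_simps power_numeral_reduce)
    ultimately show "((\<lambda>r. r ^ (k + 3) / (k + 3) - r ^ (k + 5) / (k + 5))
      has_real_derivative r ^ (k + 2) * (1 - r\<^sup>2)) (at r)"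
      by (simp add: eval_nat_numeral del: power_Suc)
    show "0 \<le> r ^ (k + 2) * (1 - r\<^sup>2)" if "r \<in> {0..1}"
      using that le[of r] by (intro mult_nonneg_nonneg) auto
  qed auto
  also have "\<dots> = ennreal (2 / ((real m + 2) * (real m + 4)))"
  proof (rule arg_cong[of _ _ ennreal])
    show "(\<lambda>r. r ^ (k + 3) / (k + 3) - r ^ (k + 5) / (k + 5)) 1
       - (\<lambda>r. r ^ (k + 3) / (k + 3) - r ^ (k + 5) / (k + 5)) 0 = 2 / ((real m + 2) * (real m + 4))"
      using id2[of "real k"] by (simp add: m add_ac zero_power)
  qed
  finally show "(\<integral>\<^sup>+r. ennreal (r ^ (m + 1) * max 0 (1 - r\<^sup>2)) * indicator {0<..} r \<partial>lborel) = ennreal (2 / ((real m + 2) * (real m + 4)))" .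
qed

text \<open>The divergence theorem in disguise. With the weight W = max(0, 1 - |x|^2)^2 the
  derivative of F W along \<open>v\<close> integrates to 0 over the whole space, and W itself has
  derivative -4 (x.v) max(0, 1 - |x|^2). Both resulting terms are homogeneous functions times radial
  ones, so each is a radial constant times an integral over the sphere, and the ratio of the
  constants is m = k + D - 1, with D the dimension.\<close>

lemma integral_sph_dir_deriv:
  fixes F :: "'a::euclidean_space \<Rightarrow> real"
  assumes F: "rpf F" and hom: "\<And>c x. 0 < c \<Longrightarrow> F (c *\<^sub>R x) = c ^ k * F x" and D: "2 \<le> DIM('a)"
  shows "(\<integral>x. dir_deriv v F x \<partial>sph) = (real k + DIM('a) - 1) * (\<integral>x. (x \<bullet> v) * F x \<partial>sph)"
proof -
  define m where "m = k + DIM('a) - 1"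
  have m: "1 \<le> m" using D by (simp add: m_def)
  obtain j where j: "DIM('a) = 2 + j" using le_Suc_ex[OF D] by blast
  define W where "W x = (max 0 (1 - (norm x)\<^sup>2))\<^sup>2" for x :: 'a
  define W1 where "W1 x = max 0 (1 - (norm x)\<^sup>2)" for x :: 'a
  have cW: "continuous_on UNIV W" "continuous_on UNIV W1"
    unfolding W_def W1_def by (intro continuous_intros)+
  have cF: "continuous_on UNIV F" "continuous_on UNIV (dir_deriv v F)"
    using F by (auto intro: rpf_continuous rpf_dir_deriv)
  have W0: "W x = 0" "W1 x = 0" if "1 < norm x" for x
    using that by (auto simp: W_def W1_def max_def abs_square_le_1)
  have [measurable]: "F \<in> borel_measurable borel" "dir_deriv v F \<in> borel_measurable borel"
    using F by (auto intro: rpf_borel rpf_dir_deriv)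
  have xF: "rpf (\<lambda>x. (x \<bullet> v) * F x)" using F by (intro real_polynomial_function.intros(4) rpf_inner)
  have int: "integrable lborel (\<lambda>x. dir_deriv v F x * W x)" "integrable lborel (\<lambda>x. ((x \<bullet> v) * F x) * W1 x)" "integrable lborel (\<lambda>x. F x * W x)"
    using W0 by (auto intro!: integrable_lborel_supported continuous_intros cW cF)
  have dW: "((\<lambda>s. W (x + s *\<^sub>R v)) has_real_derivative - 4 * ((x + s *\<^sub>R v) \<bullet> v) * W1 (x + s *\<^sub>R v)) (at s)" for x s
  proof -
    have "((\<lambda>s. 1 - (x + s *\<^sub>R v) \<bullet> (x + s *\<^sub>R v)) has_real_derivative - (2 * ((x + s *\<^sub>R v) \<bullet> v))) (at s)"
      using rpf_line[OF rpf_inner_self, of x v s] by (auto intro!: derivative_eq_intros)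
    from DERIV_chain2[OF has_real_derivative_max_0_square this]
    show ?thesis by (simp add: W_def W1_def power2_norm_eq_inner algebra_simps)
  qed
  have "(\<integral>x. dir_deriv v F x * W x - 4 * (((x \<bullet> v) * F x) * W1 x) \<partial>lborel) = 0"
  proof (rule integral_line_derivative_eq_0)
    show "((\<lambda>s. F (x + s *\<^sub>R v) * W (x + s *\<^sub>R v)) has_real_derivative
       dir_deriv v F (x + s *\<^sub>R v) * W (x + s *\<^sub>R v) - 4 * (((x + s *\<^sub>R v) \<bullet> v * F (x + s *\<^sub>R v)) * W1 (x + s *\<^sub>R v))) (at s)" for x s
      using DERIV_mult[OF rpf_line[OF F, of x v s] dW[of x s]] by (simp add: algebra_simps)
    show "integrable lborel (\<lambda>x. dir_deriv v F x * W x - 4 * (((x \<bullet> v) * F x) * W1 x))"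
      using int by (intro Bochner_Integration.integrable_diff integrable_mult_right)
  qed (auto intro!: continuous_intros cW cF int)
  then have eq: "(\<integral>x. dir_deriv v F x * W x \<partial>lborel) = 4 * (\<integral>x. ((x \<bullet> v) * F x) * W1 x \<partial>lborel)"
    using int by simp
  \<comment> \<open>The derivative has degree \<open>k - 1\<close>; writing its scaling factor as
    \<open>r ^ k * inverse r\<close> includes the case \<open>k = 0\<close>, and dimension at least
    2 ensures that \<open>m - 1\<close> is a true difference.\<close>
  have pw: "r ^ k * inverse r * r ^ (DIM('a) - 1) = r ^ (m - 1)" if "0 < r" for r :: real
  proof -
    have "r ^ (m - 1) * r = r ^ k * r ^ (DIM('a) - 1)"
      by (simp add: m_def j power_add)
    then show ?thesis using that by (simp add: field_simps)
  qed
  have "(\<integral>x. dir_deriv v F x * W x \<partial>lborel) =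
    enn2real (\<integral>\<^sup>+r. ennreal ((r ^ k * inverse r) * (max 0 (1 - r\<^sup>2))\<^sup>2 * r ^ (DIM('a) - 1)) * indicator {0<..} r \<partial>lborel) * (\<integral>x. dir_deriv v F x \<partial>sph)"
    unfolding W_def
  proof (rule integral_homogeneous_polar)
    show "dir_deriv v F (r *\<^sub>R y) = r ^ k * inverse r * dir_deriv v F y" if "0 < r" for r y
      using dir_deriv_homogeneous[OF F hom that, of v y] that by (simp add: field_simps)
    show "integrable sph (dir_deriv v F)" using F by (intro integrable_sph_rpf rpf_dir_deriv)
  qed (use int in \<open>auto simp: W_def\<close>)
  also have "(\<integral>\<^sup>+r. ennreal ((r ^ k * inverse r) * (max 0 (1 - r\<^sup>2))\<^sup>2 * r ^ (DIM('a) - 1)) * indicator {0<..} r \<partial>lborel)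
    = (\<integral>\<^sup>+r. ennreal (r ^ (m - 1) * (max 0 (1 - r\<^sup>2))\<^sup>2) * indicator {0<..} r \<partial>lborel)"
  proof (rule nn_integral_cong)
    fix r :: real
    have "r ^ k * inverse r * (max 0 (1 - r\<^sup>2))\<^sup>2 * r ^ (DIM('a) - 1)
       = (r ^ k * inverse r * r ^ (DIM('a) - 1)) * (max 0 (1 - r\<^sup>2))\<^sup>2" by (simp only: mult_ac)
    then show "ennreal (r ^ k * inverse r * (max 0 (1 - r\<^sup>2))\<^sup>2 * r ^ (DIM('a) - 1)) * indicator {0<..} r
      = ennreal (r ^ (m - 1) * (max 0 (1 - r\<^sup>2))\<^sup>2) * indicator {0<..} r"
      using pw[of r] by (cases "0 < r") (simp_all only: indicator_simps greaterThan_iff mult_zero_right not_False_eq_True)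
  qed
  also have "\<dots> = ennreal (8 / (real m * (real m + 2) * (real m + 4)))" by (rule nn_integral_powers[OF m])
  finally have 1: "(\<integral>x. dir_deriv v F x * W x \<partial>lborel) = 8 / (real m * (real m + 2) * (real m + 4)) * (\<integral>x. dir_deriv v F x \<partial>sph)"
    by simp
  have pw': "r ^ Suc k * r ^ (DIM('a) - 1) = r ^ (m + 1)" for r :: real
    using D by (simp add: m_def power_add[symmetric] del: power_Suc)
  have "(\<integral>x. ((x \<bullet> v) * F x) * W1 x \<partial>lborel) =
    enn2real (\<integral>\<^sup>+r. ennreal (r ^ Suc k * max 0 (1 - r\<^sup>2) * r ^ (DIM('a) - 1)) * indicator {0<..} r \<partial>lborel) * (\<integral>x. (x \<bullet> v) * F x \<partial>sph)"
    unfolding W1_def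
  proof (rule integral_homogeneous_polar)
    show "((r *\<^sub>R y) \<bullet> v) * F (r *\<^sub>R y) = r ^ Suc k * ((y \<bullet> v) * F y)" if "0 < r" for r y
      using hom[OF that] by simp
    show "integrable sph (\<lambda>x. (x \<bullet> v) * F x)" using xF by (rule integrable_sph_rpf)
  qed (use int in \<open>auto simp: W1_def\<close>)
  also have "(\<integral>\<^sup>+r. ennreal (r ^ Suc k * max 0 (1 - r\<^sup>2) * r ^ (DIM('a) - 1)) * indicator {0<..} r \<partial>lborel)
    = (\<integral>\<^sup>+r. ennreal (r ^ (m + 1) * max 0 (1 - r\<^sup>2)) * indicator {0<..} r \<partial>lborel)"
  proof (rule nn_integral_cong)
    fix r :: real
    have "r ^ Suc k * max 0 (1 - r\<^sup>2) * r ^ (DIM('a) - 1)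
       = (r ^ Suc k * r ^ (DIM('a) - 1)) * max 0 (1 - r\<^sup>2)" by (simp only: mult_ac)
    then show "ennreal (r ^ Suc k * max 0 (1 - r\<^sup>2) * r ^ (DIM('a) - 1)) * indicator {0<..} r
      = ennreal (r ^ (m + 1) * max 0 (1 - r\<^sup>2)) * indicator {0<..} r"
      by (simp only: pw')
  qed
  also have "\<dots> = ennreal (2 / ((real m + 2) * (real m + 4)))" by (rule nn_integral_powers[OF m])
  finally have 2: "(\<integral>x. ((x \<bullet> v) * F x) * W1 x \<partial>lborel) = 2 / ((real m + 2) * (real m + 4)) * (\<integral>x. (x \<bullet> v) * F x \<partial>sph)"
    by simp
  have "8 / (real m * (real m + 2) * (real m + 4)) * (\<integral>x. dir_deriv v F x \<partial>sph) = 8 / ((real m + 2) * (real m + 4)) * (\<integral>x. (x \<bullet> v) * F x \<partial>sph)"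
    using eq unfolding 1 2 by simp
  note e = this
  have r: "A = M * B" if "8 / (M * P * Q) * A = 8 / (P * Q) * B" "0 < P" "0 < Q" "0 < M" for A B M P Q :: real
    using that by (simp add: field_simps)
  have "(\<integral>x. dir_deriv v F x \<partial>sph) = m * (\<integral>x. (x \<bullet> v) * F x \<partial>sph)"
    by (rule r[OF e]) (use m in auto)
  then show ?thesis using D by (simp add: m_def of_nat_diff)
qed

section \<open>Powers of an inner product integrated against harmonics\<close>

lemmas rpf_intros = real_polynomial_function.intros(2-4) rpf_inner rpf_inner_self
  real_polynomial_function_power real_polynomial_function_diff

lemma dir_deriv_power_inner: "dir_deriv v (\<lambda>y. (w \<bullet> y) ^ j) = (\<lambda>y. real j * (w \<bullet> y) ^ (j - 1) * (w \<bullet> v))"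
  by (rule ext, rule dir_deriv_eqI) (auto intro!: derivative_eq_intros simp: inner_commute)

lemma solid_harmonic_rpf: "solid_harmonic n h \<Longrightarrow> rpf h"
  and solid_harmonic_hom: "solid_harmonic n h \<Longrightarrow> 0 < c \<Longrightarrow> h (c *\<^sub>R x) = c ^ n * h x"
  and solid_harmonic_real_laplacian: "solid_harmonic n h \<Longrightarrow> real_laplacian h x = 0"
  by (auto simp: solid_harmonic_def)

lemma sum_Basis_dir_deriv_homogeneous:
  assumes "rpf u" "\<And>c x. 0 < c \<Longrightarrow> u (c *\<^sub>R x) = c ^ n * u x"
  shows "(\<Sum>b\<in>Basis. (x \<bullet> b) * dir_deriv b u x) = real n * u x"
  using dir_deriv_Basis[OF assms(1), of x x] euler_homogeneous[OF assms] by simp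

text \<open>The integral of the Laplacian, which is 0, is integrated by parts once in every basis
  direction. Euler's identity turns the sum into a positive multiple of the integral of
  \<open>h\<close>.\<close>

lemma integral_sph_solid_harmonic_eq_0:
  fixes h :: "'a::euclidean_space \<Rightarrow> real"
  assumes h: "solid_harmonic n h" and n: "0 < n" and D: "2 \<le> DIM('a)"
  shows "(\<integral>y. h y \<partial>sph) = 0"
proof -
  obtain k where k: "n = Suc k" using n by (cases n) auto
  have r: "rpf h" using h by (rule solid_harmonic_rpf)
  have "0 = (\<integral>y. real_laplacian h y \<partial>sph)" using h by (simp add: solid_harmonic_real_laplacian)
  also have "\<dots> = (\<Sum>b\<in>Basis. \<integral>y. dir_deriv b (dir_deriv b h) y \<partial>sph)"
    unfolding real_laplacian_def by (intro Bochner_Integration.integral_sum integrable_sph_rpf rpf_dir_deriv r)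
  also have "\<dots> = (\<Sum>b\<in>Basis. (real k + DIM('a) - 1) * (\<integral>y. (y \<bullet> b) * dir_deriv b h y \<partial>sph))"
  proof (intro sum.cong refl integral_sph_dir_deriv rpf_dir_deriv r D)
    show "dir_deriv b h (c *\<^sub>R x) = c ^ k * dir_deriv b h x" if "0 < c" for b c x
      using solid_harmonic_hom[OF solid_harmonic_dir_deriv[OF h[unfolded k]] that] .
  qed
  also have "\<dots> = (real k + DIM('a) - 1) * (\<integral>y. (\<Sum>b\<in>Basis. (y \<bullet> b) * dir_deriv b h y) \<partial>sph)"
    by (subst Bochner_Integration.integral_sum)
       (auto simp: sum_distrib_left intro!: integrable_sph_rpf rpf_intros rpf_dir_deriv r)
  also have "\<dots> = (real k + DIM('a) - 1) * (n * (\<integral>y. h y \<partial>sph))"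
    using h by (simp add: sum_Basis_dir_deriv_homogeneous[OF r solid_harmonic_hom[OF h]])
  finally show ?thesis using n D by auto
qed

text \<open>Integration by parts along \<open>v = x\<close> for the function (x.y)^j h(y) of degree
  \<open>j + n\<close>; the two terms on the right come from the product rule. At
  \<open>j = 0\<close> the truncated exponent \<open>j - 1\<close> is harmless because its term
  carries the factor \<open>j\<close>.\<close>

lemma integral_sph_inner_power_step:
  fixes h :: "'a::euclidean_space \<Rightarrow> real"
  assumes h: "solid_harmonic n h" and D: "2 \<le> DIM('a)"
  shows "(real (j + n) + DIM('a) - 1) * (\<integral>y. (x \<bullet> y) ^ Suc j * h y \<partial>sph)
    = real j * (x \<bullet> x) * (\<integral>y. (x \<bullet> y) ^ (j - 1) * h y \<partial>sph) + (\<integral>y. (x \<bullet> y) ^ j * dir_deriv x h y \<partial>sph)"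
proof -
  have r: "rpf h" using h by (rule solid_harmonic_rpf)
  have rp: "rpf (\<lambda>y. (x \<bullet> y) ^ i)" for i by (intro rpf_intros)
  have "(\<integral>y. dir_deriv x (\<lambda>y. (x \<bullet> y) ^ j * h y) y \<partial>sph)
    = (real (j + n) + DIM('a) - 1) * (\<integral>y. (y \<bullet> x) * ((x \<bullet> y) ^ j * h y) \<partial>sph)"
  proof (intro integral_sph_dir_deriv D)
    show "rpf (\<lambda>y. (x \<bullet> y) ^ j * h y)" by (intro rpf_intros r)
    show "(x \<bullet> c *\<^sub>R z) ^ j * h (c *\<^sub>R z) = c ^ (j + n) * ((x \<bullet> z) ^ j * h z)" if "0 < c" for c z
      using solid_harmonic_hom[OF h that, of z] by (simp add: power_mult_distrib power_add)
  qed
  moreover have "(\<lambda>y. (y \<bullet> x) * ((x \<bullet> y) ^ j * h y)) = (\<lambda>y. (x \<bullet> y) ^ Suc j * h y)"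
    by (simp add: inner_commute mult.assoc)
  moreover have "dir_deriv x (\<lambda>y. (x \<bullet> y) ^ j * h y) =
      (\<lambda>y. real j * (x \<bullet> x) * ((x \<bullet> y) ^ (j - 1) * h y) + (x \<bullet> y) ^ j * dir_deriv x h y)"
    unfolding dir_deriv_mult[OF rp r] dir_deriv_power_inner by (intro ext) (simp add: algebra_simps)
  moreover have "(\<integral>y. real j * (x \<bullet> x) * ((x \<bullet> y) ^ (j - 1) * h y) + (x \<bullet> y) ^ j * dir_deriv x h y \<partial>sph)
    = real j * (x \<bullet> x) * (\<integral>y. (x \<bullet> y) ^ (j - 1) * h y \<partial>sph) + (\<integral>y. (x \<bullet> y) ^ j * dir_deriv x h y \<partial>sph)"
    by (subst Bochner_Integration.integral_add) (auto intro!: integrable_sph_rpf rpf_intros r rpf_dir_deriv)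
  ultimately show ?thesis by simp
qed

text \<open>The recursion expresses the power \<open>Suc j\<close> through the power
  \<open>j - 1\<close> with the same harmonic and the power \<open>j\<close> with a harmonic of
  degree one less. In both cases the power stays below the degree, and at power 0 the mean value
  property applies.\<close>

lemma integral_sph_inner_power_less:
  fixes h :: "'a::euclidean_space \<Rightarrow> real"
  assumes D: "2 \<le> DIM('a)"
  shows "solid_harmonic n h \<Longrightarrow> m < n \<Longrightarrow> (\<integral>y. (x \<bullet> y) ^ m * h y \<partial>sph) = 0"
proof (induction m arbitrary: n h rule: less_induct)
  case (less m)
  show ?case
  proof (cases m)
    case 0
    then show ?thesis using integral_sph_solid_harmonic_eq_0[OF less.prems(1) _ D] less.prems by simp
  next
    case (Suc j)
    obtain k where k: "n = Suc k" "j < k" using less.prems Suc by (cases n) auto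
    have "real j * (x \<bullet> x) * (\<integral>y. (x \<bullet> y) ^ (j - 1) * h y \<partial>sph) = 0"
      using less.IH[of "j - 1" n h] less.prems Suc by (cases j) auto
    moreover have "(\<integral>y. (x \<bullet> y) ^ j * dir_deriv x h y \<partial>sph) = 0"
      using less.IH[of j k "dir_deriv x h"] solid_harmonic_dir_deriv[of k h x] less.prems Suc k by auto
    ultimately have "(real (j + n) + DIM('a) - 1) * (\<integral>y. (x \<bullet> y) ^ m * h y \<partial>sph) = 0"
      using integral_sph_inner_power_step[OF less.prems(1) D, of j x] Suc by simp
    then show ?thesis using k D by auto
  qed
qed

text \<open>The integral of \<open>(w \<bullet> y)\<^sup>n h(y)\<close> over the unit sphere, for \<open>h\<close> harmonic of degree \<open>n\<close>, is
  \<open>inner_power_coeff \<lambda> n\<close> times \<open>h w\<close> and the area of the sphere.\<close>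

primrec inner_power_coeff :: "real \<Rightarrow> nat \<Rightarrow> real" where
  "inner_power_coeff l 0 = 1"
| "inner_power_coeff l (Suc n) = real (Suc n) * inner_power_coeff l n / (2 * (real (Suc n) + l))"

text \<open>For ambient dimension d + 1 this is (d - 1)/2. The same number is the index of the
  Gegenbauer polynomials and the shift in the eigenvalues of the fractional integral.\<close>

definition lam :: "'a::euclidean_space itself \<Rightarrow> real" where
  "lam T = (real DIM('a) - 2) / 2"

lemma two_lam: "real DIM('a::euclidean_space) = 2 * lam TYPE('a) + 2"
  by (simp add: lam_def field_simps)

abbreviation sphere_area :: "'a::euclidean_space itself \<Rightarrow> real" where
  "sphere_area T \<equiv> measure (sph :: 'a measure) UNIV"

text \<open>In the recursion with \<open>j = n\<close> and degree \<open>Suc n\<close> the first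
  term vanishes, because its power is below the degree. The second contains the derivative of
  \<open>h\<close> along \<open>x\<close>, harmonic of degree \<open>n\<close>; by induction it is
  evaluated at the very point \<open>x\<close>, where Euler's identity returns \<open>h x\<close>.
  The factor on the left is 2 (n + 1 + \<lambda>), the denominator in
  \<open>inner_power_coeff\<close>.\<close>

lemma integral_sph_inner_power_eq:
  fixes h :: "'a::euclidean_space \<Rightarrow> real"
  assumes D: "2 \<le> DIM('a)"
  shows "solid_harmonic n h \<Longrightarrow> (\<integral>y. (x \<bullet> y) ^ n * h y \<partial>sph) = inner_power_coeff (lam TYPE('a)) n * sphere_area TYPE('a) * h x"
proof (induction n arbitrary: h)
  case 0
  then have "h = (\<lambda>y. h x)" using solid_harmonic_0_const by blast
  then have "(\<integral>y. h y \<partial>sph) = (\<integral>(y::'a). h x \<partial>sph)" by simp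
  then show ?case by simp
next
  case (Suc n)
  let ?l = "lam TYPE('a)"
  have "real n * (x \<bullet> x) * (\<integral>y. (x \<bullet> y) ^ (n - 1) * h y \<partial>sph) = 0"
    using integral_sph_inner_power_less[OF D Suc.prems, of "n - 1" x] by simp
  moreover have "(\<integral>y. (x \<bullet> y) ^ n * dir_deriv x h y \<partial>sph) = inner_power_coeff ?l n * sphere_area TYPE('a) * dir_deriv x h x"
    using Suc.IH[OF solid_harmonic_dir_deriv[OF Suc.prems]] .
  moreover have "dir_deriv x h x = real (Suc n) * h x"
    by (rule euler_homogeneous[OF solid_harmonic_rpf[OF Suc.prems] solid_harmonic_hom[OF Suc.prems]])
  ultimately have e: "(real (n + Suc n) + DIM('a) - 1) * (\<integral>y. (x \<bullet> y) ^ Suc n * h y \<partial>sph)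
    = inner_power_coeff ?l n * sphere_area TYPE('a) * (real (Suc n) * h x)"
    using integral_sph_inner_power_step[OF Suc.prems D, of n x] by simp
  have P: "real (n + Suc n) + DIM('a) - 1 = 2 * (real (Suc n) + ?l)" by (simp add: lam_def field_simps)
  have "0 < 2 * (real (Suc n) + ?l)" using D by (simp add: lam_def field_simps)
  then have "2 * (real (Suc n) + ?l) \<noteq> 0" by (simp only: less_imp_neq[symmetric] not_False_eq_True)
  moreover have "I = N * K / P * W * H" if "P * I = K * W * (N * H)" "P \<noteq> 0" for P I N K W H :: real
    using that by (simp add: field_simps)
  ultimately show ?case using e unfolding P inner_power_coeff.simps by blast
qed

text \<open>Green's identity: integration by parts on the products
  \<open>u y * dir_deriv b v y\<close> shows that the integral of the inner product of the gradients
  equals (n + m + D - 2) m times the integral of \<open>u * v\<close>. The left side is symmetric in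
  \<open>u\<close> and \<open>v\<close>, so \<open>m\<close> may be replaced by \<open>n\<close> on
  the right, and the integral must vanish when they differ.\<close>

lemma integral_sph_solid_harmonic_orthogonal:
  fixes u v :: "'a::euclidean_space \<Rightarrow> real"
  assumes u: "solid_harmonic n u" and v: "solid_harmonic m v" and nm: "n \<noteq> m" and D: "2 \<le> DIM('a)"
  shows "(\<integral>y. u y * v y \<partial>sph) = 0"
proof -
  have *: "(\<integral>y. (\<Sum>b\<in>Basis. dir_deriv b u y * dir_deriv b v y) \<partial>sph) = (real (n + m) + DIM('a) - 2) * m * (\<integral>y. u y * v y \<partial>sph)"
    if u: "solid_harmonic n u" and v: "solid_harmonic m v" for n m and u v :: "'a \<Rightarrow> real"
  proof (cases m)
    case 0
    then have "v = (\<lambda>y. v 0)" using solid_harmonic_0_const v by blast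
    then have "dir_deriv b v = (\<lambda>y. 0)" for b by (metis dir_deriv_const)
    then show ?thesis using 0 by simp
  next
    case (Suc k)
    have r: "rpf u" "rpf v" using u v solid_harmonic_rpf by auto
    have e: "(\<integral>y. u y * dir_deriv b (dir_deriv b v) y + dir_deriv b u y * dir_deriv b v y \<partial>sph)
      = (real (n + k) + DIM('a) - 1) * (\<integral>y. (y \<bullet> b) * (u y * dir_deriv b v y) \<partial>sph)" for b
    proof -
      have "(\<integral>y. dir_deriv b (\<lambda>y. u y * dir_deriv b v y) y \<partial>sph)
        = (real (n + k) + DIM('a) - 1) * (\<integral>y. (y \<bullet> b) * (u y * dir_deriv b v y) \<partial>sph)"
      proof (intro integral_sph_dir_deriv D)
        show "rpf (\<lambda>y. u y * dir_deriv b v y)" by (intro rpf_intros r rpf_dir_deriv)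
        show "u (c *\<^sub>R x) * dir_deriv b v (c *\<^sub>R x) = c ^ (n + k) * (u x * dir_deriv b v x)" if "0 < c" for c x
          using solid_harmonic_hom[OF u that, of x] solid_harmonic_hom[OF solid_harmonic_dir_deriv[OF v[unfolded Suc]] that, of b x]
          by (simp add: power_add)
      qed
      then show ?thesis by (simp add: dir_deriv_mult[OF r(1) rpf_dir_deriv[OF r(2)]])
    qed
    have "(\<Sum>b\<in>Basis. \<integral>y. u y * dir_deriv b (dir_deriv b v) y + dir_deriv b u y * dir_deriv b v y \<partial>sph)
      = (\<integral>y. (\<Sum>b\<in>Basis. u y * dir_deriv b (dir_deriv b v) y + dir_deriv b u y * dir_deriv b v y) \<partial>sph)"
      by (rule Bochner_Integration.integral_sum[symmetric]) (intro integrable_sph_rpf rpf_intros r rpf_dir_deriv)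
    also have "\<dots> = (\<integral>y. u y * real_laplacian v y + (\<Sum>b\<in>Basis. dir_deriv b u y * dir_deriv b v y) \<partial>sph)"
      by (simp add: sum.distrib real_laplacian_def sum_distrib_left)
    also have "\<dots> = (\<integral>y. (\<Sum>b\<in>Basis. dir_deriv b u y * dir_deriv b v y) \<partial>sph)"
      using v by (simp add: solid_harmonic_real_laplacian)
    finally have 1: "(\<Sum>b\<in>Basis. \<integral>y. u y * dir_deriv b (dir_deriv b v) y + dir_deriv b u y * dir_deriv b v y \<partial>sph) = \<dots>" .
    have "(\<Sum>b\<in>Basis. \<integral>y. (y \<bullet> b) * (u y * dir_deriv b v y) \<partial>sph) = (\<integral>y. (\<Sum>b\<in>Basis. (y \<bullet> b) * (u y * dir_deriv b v y)) \<partial>sph)"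
      by (rule Bochner_Integration.integral_sum[symmetric]) (intro integrable_sph_rpf rpf_intros r rpf_dir_deriv)
    also have "\<dots> = (\<integral>y. u y * (\<Sum>b\<in>Basis. (y \<bullet> b) * dir_deriv b v y) \<partial>sph)"
      by (simp add: sum_distrib_left mult_ac)
    also have "\<dots> = (\<integral>y. m * (u y * v y) \<partial>sph)"
      by (simp add: sum_Basis_dir_deriv_homogeneous[OF r(2) solid_harmonic_hom[OF v]] mult_ac)
    also have "\<dots> = m * (\<integral>y. u y * v y \<partial>sph)" by simp
    finally have 2: "(\<Sum>b\<in>Basis. \<integral>y. (y \<bullet> b) * (u y * dir_deriv b v y) \<partial>sph) = \<dots>" .
    show ?thesis
      unfolding 1[symmetric] e sum_distrib_left[symmetric] 2 using Suc by (simp add: algebra_simps)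
  qed
  have "(real (n + m) + DIM('a) - 2) * m * (\<integral>y. u y * v y \<partial>sph) = (real (n + m) + DIM('a) - 2) * n * (\<integral>y. u y * v y \<partial>sph)"
    using *[OF u v] *[OF v u] by (simp add: mult.commute add.commute)
  moreover have "0 < real (n + m) + DIM('a) - 2" using nm D by (cases "n = 0") auto
  ultimately show ?thesis using nm by auto
qed

subsection \<open>Zonal harmonics\<close>

text \<open>The recurrence \<open>(n + 2) C\<^bsub>n+2\<^esub> = 2 (n + 1 + \<lambda>) t C\<^bsub>n+1\<^esub> - (n + 2 \<lambda>) C\<^sub>n\<close> of the Gegenbauer polynomials
  \<open>C\<^sub>n = C\<^sub>n\<^sup>\<lambda>\<close>.\<close>

fun gegenbauer :: "real \<Rightarrow> nat \<Rightarrow> real poly" where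
  "gegenbauer l 0 = 1"
| "gegenbauer l (Suc 0) = [:0, 2 * l:]"
| "gegenbauer l (Suc (Suc n)) = smult (1 / (real n + 2))
     (smult (2 * (real n + 1 + l)) (pCons 0 (gegenbauer l (Suc n))) - smult (real n + 2 * l) (gegenbauer l n))"

text \<open>The homogeneous extension \<open>\<bar>x\<bar>\<^sup>n C\<^sub>n(w \<bullet> x / \<bar>x\<bar>)\<close>, for a unit vector \<open>w\<close>.\<close>

fun gegenbauer_solid :: "real \<Rightarrow> 'a::euclidean_space \<Rightarrow> nat \<Rightarrow> 'a \<Rightarrow> real" where
  "gegenbauer_solid l w 0 x = 1"
| "gegenbauer_solid l w (Suc 0) x = 2 * l * (w \<bullet> x)"
| "gegenbauer_solid l w (Suc (Suc n)) x = 1 / (real n + 2) *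
     ((2 * (real n + 1 + l)) * ((w \<bullet> x) * gegenbauer_solid l w (Suc n) x) - (real n + 2 * l) * ((x \<bullet> x) * gegenbauer_solid l w n x))"

lemma gegenbauer_solid_0: "gegenbauer_solid l w 0 = (\<lambda>x. 1)" and gegenbauer_solid_1: "gegenbauer_solid l w (Suc 0) = (\<lambda>x. 2 * l * (w \<bullet> x))"
  and gegenbauer_solid_Suc_Suc: "gegenbauer_solid l w (Suc (Suc n)) = (\<lambda>x. 1 / (real n + 2) *
     ((2 * (real n + 1 + l)) * ((w \<bullet> x) * gegenbauer_solid l w (Suc n) x) + (- (real n + 2 * l)) * ((x \<bullet> x) * gegenbauer_solid l w n x)))"
  by (auto simp: fun_eq_iff algebra_simps)

lemma poly_gegenbauer_rec:
  "(real n + 2) * poly (gegenbauer l (Suc (Suc n))) t =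
    2 * (real n + 1 + l) * (t * poly (gegenbauer l (Suc n)) t) - (real n + 2 * l) * poly (gegenbauer l n) t"
  by (simp add: field_simps gegenbauer.simps(3))

lemma gegenbauer_solid_sphere: "norm x = 1 \<Longrightarrow> gegenbauer_solid l w n x = poly (gegenbauer l n) (w \<bullet> x)"
proof (induction l w n x rule: gegenbauer_solid.induct)
  case (3 l w n x)
  then have "x \<bullet> x = 1" by (simp add: dot_square_norm)
  with 3 show ?case by (simp add: gegenbauer.simps(3))
qed simp_all

lemma rpf_gegenbauer_solid: "rpf (gegenbauer_solid l w n)"
proof (induction n rule: less_induct)
  case (less n)
  consider "n = 0" | "n = Suc 0" | k where "n = Suc (Suc k)"
    by (cases n) (auto, metis not0_implies_Suc)
  then show ?case
  proof cases
    case (3 k)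
    then have "rpf (gegenbauer_solid l w (Suc k))" "rpf (gegenbauer_solid l w k)" using less by auto
    then show ?thesis unfolding 3 gegenbauer_solid_Suc_Suc by (intro rpf_intros)
  next
    case 1
    show ?thesis unfolding 1 gegenbauer_solid_0 by (intro rpf_intros)
  next
    case 2
    show ?thesis unfolding 2 gegenbauer_solid_1 by (intro rpf_intros)
  qed
qed

lemma gegenbauer_solid_scaleR: "gegenbauer_solid l w n (c *\<^sub>R x) = c ^ n * gegenbauer_solid l w n x"
  by (induction l w n x rule: gegenbauer_solid.induct) (simp_all add: algebra_simps)

declare gegenbauer_solid.simps [simp del] gegenbauer.simps(3) [simp del]

text \<open>Differentiating the three-term recurrence along the pole \<open>w\<close>, where
  \<open>w \<bullet> w = 1\<close>. After the inductive values are inserted the terms of lower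
  degree form a multiple of the recurrence itself, which collapses them into one polynomial. This
  law is what the Laplacian of the product with \<open>w \<bullet> x\<close> needs.\<close>

lemma dir_deriv_gegenbauer_solid:
  assumes w: "norm w = 1"
  shows "dir_deriv w (gegenbauer_solid l w (Suc n)) x = (real n + 2 * l) * gegenbauer_solid l w n x"
proof (induction n rule: less_induct)
  case (less n)
  have ww: "w \<bullet> w = 1" using w by (simp add: dot_square_norm)
  note r = rpf_gegenbauer_solid[of l w]
  have step: "dir_deriv w (gegenbauer_solid l w (Suc (Suc k))) x = 1 / (real k + 2) *
     ((2 * (real k + 1 + l)) * ((w \<bullet> x) * dir_deriv w (gegenbauer_solid l w (Suc k)) x + gegenbauer_solid l w (Suc k) x)
       - (real k + 2 * l) * ((x \<bullet> x) * dir_deriv w (gegenbauer_solid l w k) x + 2 * (w \<bullet> x) * gegenbauer_solid l w k x))" for k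
  proof -
    have "dir_deriv w (gegenbauer_solid l w (Suc (Suc k))) = (\<lambda>x. 1 / (real k + 2) *
     ((2 * (real k + 1 + l)) * ((w \<bullet> x) * dir_deriv w (gegenbauer_solid l w (Suc k)) x + (w \<bullet> w) * gegenbauer_solid l w (Suc k) x)
       + (- (real k + 2 * l)) * ((x \<bullet> x) * dir_deriv w (gegenbauer_solid l w k) x + 2 * (x \<bullet> w) * gegenbauer_solid l w k x)))"
      unfolding gegenbauer_solid_Suc_Suc
      by (subst dir_deriv_cmult, intro rpf_intros r, subst dir_deriv_add, intro rpf_intros r, intro rpf_intros r,
          subst dir_deriv_cmult, intro rpf_intros r, subst dir_deriv_cmult, intro rpf_intros r,
          subst dir_deriv_mult, intro rpf_intros, rule r, subst dir_deriv_mult, intro rpf_intros, rule r, simp)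
    then show ?thesis by (simp add: ww inner_commute algebra_simps)
  qed
  consider "n = 0" | "n = 1" | k where "n = Suc (Suc k)"
    by (cases n) (auto, metis not0_implies_Suc)
  then show ?case
  proof cases
    case 1
    have "dir_deriv w (gegenbauer_solid l w (Suc 0)) = (\<lambda>x. 2 * l * (w \<bullet> w))"
      unfolding gegenbauer_solid_1 by (subst dir_deriv_cmult) (auto intro: rpf_intros)
    then show ?thesis using 1 ww by (simp add: gegenbauer_solid_0)
  next
    case 2
    have "dir_deriv w (gegenbauer_solid l w 0) x = 0" by (simp add: gegenbauer_solid_0)
    moreover have "dir_deriv w (gegenbauer_solid l w (Suc 0)) x = 2 * l" using less[of 0] 2 by (simp add: gegenbauer_solid_0)
    ultimately show ?thesis
      using 2 step[of 0] by (simp add: gegenbauer_solid_0 gegenbauer_solid_1 field_simps)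
  next
    case (3 k)
    have a: "dir_deriv w (gegenbauer_solid l w (Suc (Suc k))) x = (real k + 1 + 2 * l) * gegenbauer_solid l w (Suc k) x"
      using less[of "Suc k"] 3 by (simp add: add_ac)
    have b: "dir_deriv w (gegenbauer_solid l w (Suc k)) x = (real k + 2 * l) * gegenbauer_solid l w k x"
      using less[of k] 3 by simp
    have c: "(real k + 2) * gegenbauer_solid l w (Suc (Suc k)) x =
      2 * (real k + 1 + l) * ((w \<bullet> x) * gegenbauer_solid l w (Suc k) x) - (real k + 2 * l) * ((x \<bullet> x) * gegenbauer_solid l w k x)"
      by (simp add: gegenbauer_solid_Suc_Suc field_simps)
    have "(real k + 3) * dir_deriv w (gegenbauer_solid l w (Suc (Suc (Suc k)))) x =
      (2 * (real k + 2 + l)) * ((w \<bullet> x) * ((real k + 1 + 2 * l) * gegenbauer_solid l w (Suc k) x) + gegenbauer_solid l w (Suc (Suc k)) x)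
       - (real k + 1 + 2 * l) * ((x \<bullet> x) * ((real k + 2 * l) * gegenbauer_solid l w k x) + 2 * (w \<bullet> x) * gegenbauer_solid l w (Suc k) x)"
      unfolding step[of "Suc k"] a b by (simp add: add_ac)
    \<comment> \<open>The terms are grouped so that the right side of the recurrence
      \<open>c\<close> appears as one block.\<close>
    also have "\<dots> = 2 * (real k + 2 + l) * gegenbauer_solid l w (Suc (Suc k)) x + (real k + 1 + 2 * l) *
      (2 * (real k + 1 + l) * ((w \<bullet> x) * gegenbauer_solid l w (Suc k) x) - (real k + 2 * l) * ((x \<bullet> x) * gegenbauer_solid l w k x))"
      by (simp add: algebra_simps)
    also have "\<dots> = (real k + 3) * ((real k + 2 + 2 * l) * gegenbauer_solid l w (Suc (Suc k)) x)"
      unfolding c[symmetric] by (simp add: algebra_simps)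
    finally have "dir_deriv w (gegenbauer_solid l w (Suc (Suc (Suc k)))) x = (real k + 2 + 2 * l) * gegenbauer_solid l w (Suc (Suc k)) x"
      by simp
    then show ?thesis using 3 by (simp add: add_ac)
  qed
qed

text \<open>Write G_k for the solid polynomials, l for \<open>lam\<close> and D for the dimension.
  Inductively, the Laplacian of (w.x) G_(k+1) is twice its derivative along \<open>w\<close>, that
  is 2 (k + 2l) G_k, and the Laplacian of |x|^2 G_k is (2D + 4k) G_k by Euler's identity. The
  recurrence weighs them with 2 (k + 1 + l) and -(k + 2l), and for D = 2l + 2 the two contributions
  cancel.\<close>

lemma real_laplacian_gegenbauer_solid:
  fixes w :: "'a::euclidean_space"
  assumes w: "norm w = 1"
  shows "real_laplacian (gegenbauer_solid (lam TYPE('a)) w n) x = 0"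
proof (induction n rule: less_induct)
  case (less n)
  let ?l = "lam TYPE('a)"
  note r = rpf_gegenbauer_solid[of ?l w]
  consider "n = 0" | "n = Suc 0" | k where "n = Suc (Suc k)"
    by (cases n) (auto, metis not0_implies_Suc)
  then show ?case
  proof cases
    case 1
    then show ?thesis by (simp add: real_laplacian_def gegenbauer_solid_0)
  next
    case 2
    have "dir_deriv b (gegenbauer_solid ?l w (Suc 0)) = (\<lambda>x. 2 * ?l * (w \<bullet> b))" for b
      unfolding gegenbauer_solid_1 by (subst dir_deriv_cmult) (auto intro: rpf_intros)
    then show ?thesis using 2 by (simp add: real_laplacian_def)
  next
    case (3 k)
    have z: "real_laplacian (gegenbauer_solid ?l w (Suc k)) x = 0" "real_laplacian (gegenbauer_solid ?l w k) x = 0" using less 3 by auto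
    have "real_laplacian (\<lambda>x. (w \<bullet> x) * gegenbauer_solid ?l w (Suc k) x) x = 2 * (\<Sum>b\<in>Basis. (w \<bullet> b) * dir_deriv b (gegenbauer_solid ?l w (Suc k)) x)"
      using z by (subst real_laplacian_mult) (auto intro: rpf_intros r simp: real_laplacian_def)
    also have "\<dots> = 2 * ((real k + 2 * ?l) * gegenbauer_solid ?l w k x)"
      using dir_deriv_gegenbauer_solid[OF w, of ?l k x] dir_deriv_Basis[OF r[of "Suc k"], of w x] by (simp)
    finally have e1: "real_laplacian (\<lambda>x. (w \<bullet> x) * gegenbauer_solid ?l w (Suc k) x) x = \<dots>" .
    have "real_laplacian (\<lambda>x::'a. x \<bullet> x) x = (\<Sum>(b::'a)\<in>Basis. 2 * (b \<bullet> b))"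
      by (simp add: real_laplacian_def dir_deriv_cmult rpf_intros)
    also have "\<dots> = 2 * real DIM('a)" by simp
    finally have "real_laplacian (\<lambda>x::'a. x \<bullet> x) x = 2 * real DIM('a)" .
    then have "real_laplacian (\<lambda>x. (x \<bullet> x) * gegenbauer_solid ?l w k x) x = 2 * DIM('a) * gegenbauer_solid ?l w k x + 2 * (\<Sum>b\<in>Basis. 2 * (x \<bullet> b) * dir_deriv b (gegenbauer_solid ?l w k) x)"
      using z by (subst real_laplacian_mult) (auto intro: rpf_intros r)
    also have "(\<Sum>b\<in>Basis. 2 * (x \<bullet> b) * dir_deriv b (gegenbauer_solid ?l w k) x) = 2 * (real k * gegenbauer_solid ?l w k x)"
      using sum_Basis_dir_deriv_homogeneous[OF r[of k] gegenbauer_solid_scaleR[of ?l w k], of x] by (simp add: mult.assoc sum_distrib_left[symmetric])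
    finally have e2: "real_laplacian (\<lambda>x. (x \<bullet> x) * gegenbauer_solid ?l w k x) x = 2 * DIM('a) * gegenbauer_solid ?l w k x + 2 * (2 * (real k * gegenbauer_solid ?l w k x))" .
    have "real_laplacian (gegenbauer_solid ?l w (Suc (Suc k))) x = 1 / (real k + 2) * ((2 * (real k + 1 + ?l)) * real_laplacian (\<lambda>x. (w \<bullet> x) * gegenbauer_solid ?l w (Suc k) x) x
        + (- (real k + 2 * ?l)) * real_laplacian (\<lambda>x. (x \<bullet> x) * gegenbauer_solid ?l w k x) x)"
      unfolding gegenbauer_solid_Suc_Suc
      by (subst real_laplacian_cmult, intro rpf_intros r, subst real_laplacian_add, intro rpf_intros r, intro rpf_intros r,
          subst real_laplacian_cmult, intro rpf_intros r, subst real_laplacian_cmult, intro rpf_intros r, rule refl)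
    also have "\<dots> = 0" unfolding e1 e2 by (simp add: two_lam field_simps)
    finally show ?thesis using 3 by (simp)
  qed
qed

lemma solid_harmonic_gegenbauer_solid:
  fixes w :: "'a::euclidean_space"
  assumes "norm w = 1" shows "solid_harmonic n (gegenbauer_solid (lam TYPE('a)) w n)"
  using real_laplacian_gegenbauer_solid[OF assms(1)] by (simp add: solid_harmonic_def rpf_gegenbauer_solid gegenbauer_solid_scaleR)

section \<open>Leading coefficients and the reproducing formula\<close>

lemma degree_gegenbauer: "degree (gegenbauer l n) \<le> n"
proof (induction l n rule: gegenbauer.induct)
  case (3 l n)
  have a: "degree (smult (2 * (real n + 1 + l)) (pCons 0 (gegenbauer l (Suc n)))) \<le> Suc (Suc n)"
    by (rule order_trans[OF degree_smult_le], rule order_trans[OF degree_pCons_le]) (use 3 in simp)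
  have b: "degree (smult (real n + 2 * l) (gegenbauer l n)) \<le> Suc (Suc n)"
    by (rule order_trans[OF degree_smult_le]) (use 3 in simp)
  show ?case
    unfolding gegenbauer.simps(3) by (rule order_trans[OF degree_smult_le degree_diff_le[OF a b]])
qed simp_all

lemma coeff_gegenbauer: "(real n + 1) * coeff (gegenbauer l (Suc n)) (Suc n) = 2 * (real n + l) * coeff (gegenbauer l n) n"
proof (cases n)
  case (Suc k)
  have "coeff (gegenbauer l k) (Suc (Suc k)) = 0" using degree_gegenbauer[of l k] by (intro coeff_eq_0) simp
  then show ?thesis using Suc by (simp add: gegenbauer.simps(3) field_simps)
qed simp

text \<open>When \<open>n\<close> increases by one, the successive ratios of the three factors
  multiply to 1, so the product keeps its value at \<open>n = 0\<close>. This is the origin of the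
  normalising factor \<open>(real n + l) / l\<close> of the zonal kernel.\<close>

lemma inner_power_coeff_coeff_gegenbauer:
  assumes "0 < l" shows "(real n + l) / l * coeff (gegenbauer l n) n * inner_power_coeff l n = 1"
proof (induction n)
  case (Suc n)
  have c: "coeff (gegenbauer l (Suc n)) (Suc n) = 2 * (real n + l) * coeff (gegenbauer l n) n / (real n + 1)"
    using coeff_gegenbauer[of n l] by (simp add: field_simps)
  have "(real (Suc n) + l) / l * coeff (gegenbauer l (Suc n)) (Suc n) * inner_power_coeff l (Suc n) = (real n + l) / l * coeff (gegenbauer l n) n * inner_power_coeff l n"
  proof -
    have "P / l * (2 * R * C / Q) * (Q * K / (2 * P)) = R / l * C * K" if "P \<noteq> 0" "Q \<noteq> 0" for P Q R C K :: real
      using that by (simp add: field_simps)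
    from this[of "real (Suc n) + l" "real (Suc n)" "real n + l" "coeff (gegenbauer l n) n" "inner_power_coeff l n"]
    show ?thesis unfolding c using assms by (simp add: add_ac)
  qed
  also note Suc.IH
  finally show ?case .
qed (use assms in simp)

text \<open>Expanded in powers of \<open>x \<bullet> y\<close>, all terms below degree
  \<open>n\<close> integrate to 0 against \<open>h\<close>, so only the leading coefficient
  contributes. Dimension at least 3 makes \<open>l\<close> positive.\<close>

lemma integral_poly_gegenbauer_eq:
  fixes h :: "'a::euclidean_space \<Rightarrow> real"
  assumes D: "3 \<le> DIM('a)" and h: "solid_harmonic n h"
  defines "l \<equiv> lam TYPE('a)"
  shows "(real n + l) / l * (\<integral>y. poly (gegenbauer l n) (x \<bullet> y) * h y \<partial>sph) = sphere_area TYPE('a) * h x"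
proof -
  have r: "rpf h" using h by (rule solid_harmonic_rpf)
  have "poly (gegenbauer l n) t = (\<Sum>i\<le>n. coeff (gegenbauer l n) i * t ^ i)" for t
    unfolding poly_altdef using degree_gegenbauer[of l n]
    by (intro sum.mono_neutral_left) (auto simp: coeff_eq_0)
  then have "(\<integral>y. poly (gegenbauer l n) (x \<bullet> y) * h y \<partial>sph) = (\<integral>y. (\<Sum>i\<le>n. coeff (gegenbauer l n) i * ((x \<bullet> y) ^ i * h y)) \<partial>sph)"
    by (simp only: sum_distrib_right mult.assoc)
  also have "\<dots> = (\<Sum>i\<le>n. coeff (gegenbauer l n) i * (\<integral>y. (x \<bullet> y) ^ i * h y \<partial>sph))"
    by (subst Bochner_Integration.integral_sum) (auto intro!: integrable_sph_rpf rpf_intros r)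
  also have "\<dots> = (\<Sum>i\<le>n. if i = n then coeff (gegenbauer l n) n * (inner_power_coeff l n * sphere_area TYPE('a) * h x) else 0)"
    using integral_sph_inner_power_less[OF _ h] integral_sph_inner_power_eq[OF _ h, of x] D
    by (intro sum.cong refl) (auto simp: l_def)
  also have "\<dots> = coeff (gegenbauer l n) n * (inner_power_coeff l n * sphere_area TYPE('a) * h x)" by simp
  finally have "(real n + l) / l * (\<integral>y. poly (gegenbauer l n) (x \<bullet> y) * h y \<partial>sph)
    = ((real n + l) / l * coeff (gegenbauer l n) n * inner_power_coeff l n) * (sphere_area TYPE('a) * h x)"
    by (simp only: mult_ac)
  also have "0 < l" using D by (simp add: l_def lam_def)
  note inner_power_coeff_coeff_gegenbauer[OF this]
  finally show ?thesis by simp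
qed

section \<open>Kernels polynomial in two variables and the zonal projections\<close>

lemma integrable_sph_mult_continuous:
  fixes q :: "'a::euclidean_space \<Rightarrow> real" and f :: "'a \<Rightarrow> 'b::euclidean_space"
  assumes q: "continuous_on UNIV q" and f: "integrable sph f"
  shows "integrable sph (\<lambda>y. q y *\<^sub>R f y)"
proof -
  have "compact (q ` sphere 0 1)"
    using q by (intro compact_continuous_image) (auto intro: continuous_on_subset)
  then obtain B where B: "\<And>x. x \<in> sphere 0 1 \<Longrightarrow> \<bar>q x\<bar> \<le> B"
    using compact_imp_bounded bounded_iff by (metis imageI real_norm_def)
  have [measurable]: "q \<in> borel_measurable borel" using q by (rule borel_measurable_continuous_onI)
  have [measurable]: "f \<in> borel_measurable borel"
    using borel_measurable_integrable[OF f] by simp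
  show ?thesis
  proof (rule Bochner_Integration.integrable_bound)
    show "integrable sph (\<lambda>y. B *\<^sub>R f y)" using f by simp
    show "AE y in sph. norm (q y *\<^sub>R f y) \<le> norm (B *\<^sub>R f y)"
      using AE_sph_norm
    proof eventually_elim
      case (elim y)
      then have "\<bar>q y\<bar> \<le> B" using B by simp
      then show ?case by (auto intro!: mult_right_mono)
    qed
  qed measurable
qed

text \<open>Finite sums of products p(x) q(y). Integrating such a kernel in \<open>y\<close> against
  an integrable function gives a polynomial in \<open>x\<close>, and derivatives in \<open>x\<close>
  pass under the integral by linearity alone.\<close>

inductive separable_poly :: "('a::euclidean_space \<Rightarrow> 'a \<Rightarrow> real) \<Rightarrow> bool" where
  base: "rpf p \<Longrightarrow> rpf q \<Longrightarrow> separable_poly (\<lambda>x y. p x * q y)"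
| add: "separable_poly V \<Longrightarrow> separable_poly W \<Longrightarrow> separable_poly (\<lambda>x y. V x y + W x y)"

lemma separable_poly_rpf: "separable_poly W \<Longrightarrow> rpf (\<lambda>x. W x y)"
  by (induction rule: separable_poly.induct) (auto intro: rpf_intros)

lemma separable_poly_rpf_right: "separable_poly W \<Longrightarrow> rpf (\<lambda>y. W x y)"
  by (induction rule: separable_poly.induct) (auto intro: rpf_intros)

lemma separable_poly_mult:
  assumes "separable_poly V" "separable_poly W" shows "separable_poly (\<lambda>x y. V x y * W x y)"
  using assms
proof (induction arbitrary: W rule: separable_poly.induct)
  case (base p q)
  from base(3) show ?case
  proof (induction rule: separable_poly.induct)
    case (base p' q')
    have "separable_poly (\<lambda>x y. (p x * p' x) * (q y * q' y))"
      using base \<open>rpf p\<close> \<open>rpf q\<close> by (intro separable_poly.base rpf_intros)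
    then show ?case by (simp add: mult_ac)
  next
    case (add V W)
    then show ?case using separable_poly.add[OF add.IH] by (simp add: distrib_left)
  qed
next
  case (add V1 V2)
  then show ?case using separable_poly.add[OF add.IH] by (simp add: distrib_right)
qed

lemma separable_poly_cmult: "separable_poly W \<Longrightarrow> separable_poly (\<lambda>x y. c * W x y)"
  using separable_poly_mult[OF separable_poly.base[of "\<lambda>x. c" "\<lambda>y. 1"], of W] by (simp add: rpf_intros)

lemma separable_poly_inner: "separable_poly (\<lambda>x y. y \<bullet> x)"
proof -
  have "separable_poly (\<lambda>x y. \<Sum>b\<in>B. (x \<bullet> b) * (y \<bullet> b))" if "finite B" for B :: "'a set"
    using that
  proof (induction rule: finite_induct)
    case empty
    show ?case using separable_poly.base[of "\<lambda>x. 0" "\<lambda>y. 0"] by (simp add: rpf_intros)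
  next
    case (insert b B)
    then show ?case using separable_poly.add[OF separable_poly.base[of "\<lambda>x. x \<bullet> b" "\<lambda>y. y \<bullet> b"]] by (simp add: rpf_intros)
  qed
  from this[of Basis] show ?thesis by (subst inner_commute) (simp add: euclidean_inner[symmetric])
qed

lemma separable_poly_gegenbauer_solid: "separable_poly (\<lambda>x y. gegenbauer_solid l y n x)"
proof (induction n rule: less_induct)
  case (less n)
  consider "n = 0" | "n = Suc 0" | k where "n = Suc (Suc k)"
    by (cases n) (auto, metis not0_implies_Suc)
  then show ?case
  proof cases
    case 1
    show ?thesis using separable_poly.base[of "\<lambda>x. 1" "\<lambda>y. 1"] by (simp add: 1 gegenbauer_solid_0 rpf_intros)
  next
    case 2
    show ?thesis unfolding 2 gegenbauer_solid_1 by (intro separable_poly_cmult separable_poly_inner)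
  next
    case (3 k)
    have x: "separable_poly (\<lambda>x y. x \<bullet> x)" using separable_poly.base[of "\<lambda>x. x \<bullet> x" "\<lambda>y. 1"] by (simp add: rpf_intros)
    show ?thesis unfolding 3 gegenbauer_solid_Suc_Suc
      by (intro separable_poly_cmult separable_poly.add separable_poly_mult separable_poly_inner x) (use less 3 in auto)
  qed
qed

lemma separable_poly_dir_deriv: "separable_poly W \<Longrightarrow> separable_poly (\<lambda>x y. dir_deriv v (\<lambda>x. W x y) x)"
proof (induction rule: separable_poly.induct)
  case (base p q)
  have "dir_deriv v (\<lambda>x. p x * q y) = (\<lambda>x. dir_deriv v p x * q y)" for y
    using base by (subst dir_deriv_mult) (auto intro: rpf_intros)
  then show ?case using base by (auto intro: separable_poly.base rpf_dir_deriv)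
next
  case (add V W)
  then show ?case by (simp add: dir_deriv_add separable_poly_rpf separable_poly.add)
qed

lemma integrable_separable_poly: "separable_poly W \<Longrightarrow> integrable sph f \<Longrightarrow> integrable sph (\<lambda>y. W x y * (f y :: real))"
  unfolding real_scaleR_def[symmetric]
  by (rule integrable_sph_mult_continuous[OF rpf_continuous[OF separable_poly_rpf_right]])

lemma separable_poly_integral:
  fixes f :: "'a::euclidean_space \<Rightarrow> real"
  assumes "separable_poly W" and f: "integrable sph f"
  shows "rpf (\<lambda>x. \<integral>y. W x y * f y \<partial>sph)"
    and "dir_deriv v (\<lambda>x. \<integral>y. W x y * f y \<partial>sph) = (\<lambda>x. \<integral>y. dir_deriv v (\<lambda>x. W x y) x * f y \<partial>sph)"
proof -
  have "rpf (\<lambda>x. \<integral>y. W x y * f y \<partial>sph) \<and>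
    (\<forall>v. dir_deriv v (\<lambda>x. \<integral>y. W x y * f y \<partial>sph) = (\<lambda>x. \<integral>y. dir_deriv v (\<lambda>x. W x y) x * f y \<partial>sph))"
    using assms(1)
  proof (induction rule: separable_poly.induct)
    case (base p q)
    have i: "(\<integral>y. p' x * q y * f y \<partial>sph) = p' x * (\<integral>y. q y * f y \<partial>sph)" for p' :: "'a \<Rightarrow> real" and x
      by (simp add: mult.assoc)
    have d: "dir_deriv v (\<lambda>x. p x * q y) = (\<lambda>x. dir_deriv v p x * q y)" for y v
      using base by (subst dir_deriv_mult) (auto intro: rpf_intros)
    show ?case
      unfolding i d using base
      by (auto intro!: rpf_intros simp: dir_deriv_mult rpf_intros(1))
  next
    case (add V W)
    have i: "(\<integral>y. (V x y + W x y) * f y \<partial>sph) = (\<integral>y. V x y * f y \<partial>sph) + (\<integral>y. W x y * f y \<partial>sph)"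
      if "separable_poly V" "separable_poly W" for V W x
      using integrable_separable_poly[OF that(1) f] integrable_separable_poly[OF that(2) f] by (simp add: distrib_right)
    have d: "dir_deriv v (\<lambda>x. V x y + W x y) = (\<lambda>x. dir_deriv v (\<lambda>x. V x y) x + dir_deriv v (\<lambda>x. W x y) x)" for y v
      using add by (simp add: dir_deriv_add separable_poly_rpf)
    have V: "rpf (\<lambda>x. \<integral>y. V x y * f y \<partial>sph)" and W: "rpf (\<lambda>x. \<integral>y. W x y * f y \<partial>sph)"
      using add.IH by auto
    have i': "(\<integral>y. (dir_deriv v (\<lambda>x. V x y) x + dir_deriv v (\<lambda>x. W x y) x) * f y \<partial>sph)
      = (\<integral>y. dir_deriv v (\<lambda>x. V x y) x * f y \<partial>sph) + (\<integral>y. dir_deriv v (\<lambda>x. W x y) x * f y \<partial>sph)" for v x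
      using i[OF separable_poly_dir_deriv[OF add.hyps(1)] separable_poly_dir_deriv[OF add.hyps(2)]] .
    show ?case
      unfolding i[OF add.hyps] d i'
      using add.IH V W by (auto intro!: rpf_intros simp: dir_deriv_add[OF V W])
  qed
  then show "rpf (\<lambda>x. \<integral>y. W x y * f y \<partial>sph)"
    "dir_deriv v (\<lambda>x. \<integral>y. W x y * f y \<partial>sph) = (\<lambda>x. \<integral>y. dir_deriv v (\<lambda>x. W x y) x * f y \<partial>sph)"
    by auto
qed

lemma real_laplacian_separable_poly_integral:
  fixes f :: "'a::euclidean_space \<Rightarrow> real"
  assumes W: "separable_poly W" and f: "integrable sph f"
  shows "real_laplacian (\<lambda>x. \<integral>y. W x y * f y \<partial>sph) x = (\<integral>y. real_laplacian (\<lambda>x. W x y) x * f y \<partial>sph)"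
proof -
  have "dir_deriv b (dir_deriv b (\<lambda>x. \<integral>y. W x y * f y \<partial>sph)) x = (\<integral>y. dir_deriv b (dir_deriv b (\<lambda>x. W x y)) x * f y \<partial>sph)" for b
    by (simp add: separable_poly_integral(2)[OF W f] separable_poly_integral(2)[OF separable_poly_dir_deriv[OF W] f])
  then show ?thesis
    using integrable_separable_poly[OF separable_poly_dir_deriv[OF separable_poly_dir_deriv[OF W]] f]
    by (simp add: real_laplacian_def sum_distrib_right Bochner_Integration.integral_sum)
qed

text \<open>The reproducing kernel of the spherical harmonics of degree \<open>n\<close>, as a
  function of the inner product of two unit vectors.\<close>

definition zonal :: "'a::euclidean_space itself \<Rightarrow> nat \<Rightarrow> real \<Rightarrow> real" where
  "zonal T n t = (real n + lam T) / (lam T * sphere_area T) * poly (gegenbauer (lam T) n) t"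

text \<open>The kernel enters through its homogeneous extension in \<open>x\<close>, with pole
  \<open>y\<close>, so that the result is a polynomial on the whole space and can be differentiated
  there. On unit vectors it is integration against \<open>zonal\<close>
  (\<open>zonal_proj_sphere\<close>).\<close>

definition zonal_proj :: "nat \<Rightarrow> ('a::euclidean_space \<Rightarrow> real) \<Rightarrow> 'a \<Rightarrow> real" where
  "zonal_proj n f x = (\<integral>y. (real n + lam TYPE('a)) / (lam TYPE('a) * sphere_area TYPE('a)) * gegenbauer_solid (lam TYPE('a)) y n x * f y \<partial>sph)"

lemma separable_poly_zonal_proj: "separable_poly (\<lambda>x y. c * gegenbauer_solid l y n x)"
  by (intro separable_poly_cmult separable_poly_gegenbauer_solid)

lemma zonal_proj_scaleR: "zonal_proj n f (c *\<^sub>R x) = c ^ n * zonal_proj n f x"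
proof -
  have "zonal_proj n f (c *\<^sub>R x) = (\<integral>y. c ^ n * ((real n + lam TYPE('a)) / (lam TYPE('a) * sphere_area TYPE('a)) * gegenbauer_solid (lam TYPE('a)) y n x * f y) \<partial>sph)"
    unfolding zonal_proj_def gegenbauer_solid_scaleR by (simp add: mult_ac)
  then show ?thesis by (simp only: zonal_proj_def integral_mult_right_zero)
qed

text \<open>The Laplacian passes under the integral, and the kernel is harmonic in \<open>x\<close>
  whenever its pole \<open>y\<close> is a unit vector, hence for almost every
  \<open>y\<close>.\<close>

lemma solid_harmonic_zonal_proj:
  fixes f :: "'a::euclidean_space \<Rightarrow> real"
  assumes f: "integrable sph f" shows "solid_harmonic n (zonal_proj n f)"
  unfolding solid_harmonic_def
proof (intro conjI allI impI)
  show "rpf (zonal_proj n f)"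
    unfolding zonal_proj_def[abs_def] by (rule separable_poly_integral(1)[OF separable_poly_zonal_proj f])
  show "zonal_proj n f (c *\<^sub>R x) = c ^ n * zonal_proj n f x" for c x by (rule zonal_proj_scaleR)
  fix x
  have "real_laplacian (zonal_proj n f) x = (\<integral>y. real_laplacian (\<lambda>x. (real n + lam TYPE('a)) / (lam TYPE('a) * sphere_area TYPE('a)) * gegenbauer_solid (lam TYPE('a)) y n x) x * f y \<partial>sph)"
    unfolding zonal_proj_def[abs_def] by (rule real_laplacian_separable_poly_integral[OF separable_poly_zonal_proj f])
  also have "\<dots> = (\<integral>y. 0 \<partial>(sph :: 'a measure))"
  proof (rule integral_cong_AE)
    show "AE y in sph. real_laplacian (\<lambda>x. (real n + lam TYPE('a)) / (lam TYPE('a) * sphere_area TYPE('a)) * gegenbauer_solid (lam TYPE('a)) y n x) x * f y = 0"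
      using AE_sph_norm by eventually_elim (simp only: real_laplacian_cmult[OF rpf_gegenbauer_solid] real_laplacian_gegenbauer_solid mult_zero_right mult_zero_left)
    \<comment> \<open>Off the sphere the Laplacian of the kernel need not vanish; that it is again
      separable supplies the measurability in \<open>y\<close> demanded by the comparison almost
      everywhere.\<close>
    have "separable_poly (\<lambda>(x::'a) y. real_laplacian (\<lambda>x. (real n + lam TYPE('a)) / (lam TYPE('a) * sphere_area TYPE('a)) * gegenbauer_solid (lam TYPE('a)) y n x) x)"
    proof -
      have "separable_poly (\<lambda>x y. \<Sum>b\<in>B. dir_deriv b (dir_deriv b (\<lambda>x. c * gegenbauer_solid l y n x)) x)" if "finite B" for B :: "'a set" and c l
        using that
      proof (induction rule: finite_induct)
        case empty
        show ?case using separable_poly.base[of "\<lambda>x. 0" "\<lambda>y. 0"] by (simp add: rpf_intros)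
      next
        case (insert b B)
        then show ?case using separable_poly.add[OF separable_poly_dir_deriv[OF separable_poly_dir_deriv[OF separable_poly_zonal_proj]] insert.IH] by simp
      qed
      note * = this[OF finite_Basis, of "(real n + lam TYPE('a)) / (lam TYPE('a) * sphere_area TYPE('a))" "lam TYPE('a)"]
      show ?thesis unfolding real_laplacian_def by (rule *)
    qed
    from integrable_separable_poly[OF this f]
    show "(\<lambda>y. real_laplacian (\<lambda>x. (real n + lam TYPE('a)) / (lam TYPE('a) * sphere_area TYPE('a)) * gegenbauer_solid (lam TYPE('a)) y n x) x * f y) \<in> borel_measurable sph"
      by (rule borel_measurable_integrable)
  qed simp
  finally show "real_laplacian (zonal_proj n f) x = 0" by simp
qed

lemma zonal_continuous [continuous_intros]: "continuous_on S f \<Longrightarrow> continuous_on S (\<lambda>x. zonal T n (f x))"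
  unfolding zonal_def by (intro continuous_intros)

lemma zonal_measurable [measurable]: "zonal T n \<in> borel_measurable borel"
  by (intro borel_measurable_continuous_onI continuous_intros)

lemma zonal_proj_sphere:
  fixes f :: "'a::euclidean_space \<Rightarrow> real"
  assumes f: "integrable sph f" and x: "norm x = 1"
  shows "zonal_proj n f x = (\<integral>y. zonal TYPE('a) n (x \<bullet> y) * f y \<partial>sph)"
  unfolding zonal_proj_def zonal_def
  using gegenbauer_solid_sphere[OF x] by (simp add: inner_commute)

lemma sphere_area_pos: "0 < sphere_area TYPE('a::euclidean_space)"
proof -
  have "emeasure (sph :: 'a measure) UNIV = (\<integral>\<^sup>+x. 1 \<partial>(sph :: 'a measure))" by simp
  also have "\<dots> = of_nat DIM('a) * (\<integral>\<^sup>+x. indicator (ball 0 1 - {0}) x \<partial>(lborel :: 'a measure))"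
    by (subst nn_integral_sph_ball) auto
  also have "(\<integral>\<^sup>+x. indicator (ball 0 1 - {0}) x \<partial>(lborel :: 'a measure)) = emeasure lborel (ball (0::'a) 1 - {0})"
    by simp
  also have "\<dots> = emeasure lborel (ball (0::'a) 1)"
    by (rule emeasure_Diff_null_set) auto
  finally have "emeasure (sph :: 'a measure) UNIV \<noteq> 0"
    using content_ball_pos[of 1 "0::'a"] by (auto simp: measure_def enn2real_eq_0_iff)
  then show ?thesis
    using sph.emeasure_eq_measure[of "UNIV :: 'a set"] by (simp add: zero_less_measure_iff)
qed

text \<open>In equal degree this is the reproducing formula. In different degrees
  \<open>y \<mapsto> zonal TYPE('a) n (x \<bullet> y)\<close> agrees on the sphere with a multiple
  of a solid harmonic of degree \<open>n\<close> with pole \<open>x\<close>, which is orthogonal to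
  \<open>h\<close>.\<close>

lemma zonal_proj_solid_harmonic:
  fixes h :: "'a::euclidean_space \<Rightarrow> real"
  assumes D: "3 \<le> DIM('a)" and h: "solid_harmonic m h" and x: "norm x = 1"
  shows "zonal_proj n h x = (if n = m then h x else 0)"
proof -
  have r: "integrable sph h" using h by (intro integrable_sph_rpf solid_harmonic_rpf)
  have l: "0 < lam TYPE('a)" using D by (simp add: lam_def)
  have e: "zonal_proj n h x = (real n + lam TYPE('a)) / (lam TYPE('a) * sphere_area TYPE('a)) * (\<integral>y. poly (gegenbauer (lam TYPE('a)) n) (x \<bullet> y) * h y \<partial>sph)"
    by (simp add: zonal_proj_sphere[OF r x] zonal_def mult.assoc)
  show ?thesis
  proof (cases "n = m")
    case True
    have "zonal_proj n h x = ((real n + lam TYPE('a)) / lam TYPE('a) * (\<integral>y. poly (gegenbauer (lam TYPE('a)) n) (x \<bullet> y) * h y \<partial>sph)) / sphere_area TYPE('a)"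
      by (simp add: e)
    also have "\<dots> = h x"
      unfolding integral_poly_gegenbauer_eq[OF D h[folded True]] using sphere_area_pos[where 'a='a] by simp
    finally show ?thesis using True by simp
  next
    case False
    have "(\<integral>y. poly (gegenbauer (lam TYPE('a)) n) (x \<bullet> y) * h y \<partial>sph) = (\<integral>y. gegenbauer_solid (lam TYPE('a)) x n y * h y \<partial>sph)"
    proof (rule integral_cong_AE)
      show "AE y in sph. poly (gegenbauer (lam TYPE('a)) n) (x \<bullet> y) * h y = gegenbauer_solid (lam TYPE('a)) x n y * h y"
        using AE_sph_norm by eventually_elim (simp add: gegenbauer_solid_sphere)
      show "(\<lambda>y. poly (gegenbauer (lam TYPE('a)) n) (x \<bullet> y) * h y) \<in> borel_measurable sph"
        using rpf_continuous[OF solid_harmonic_rpf[OF h], of UNIV]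
        by (intro borel_measurable_continuous_onI[THEN measurable_cong_sets[OF sets_sph refl, THEN equalityD2, THEN subsetD]] continuous_intros)
      show "(\<lambda>y. gegenbauer_solid (lam TYPE('a)) x n y * h y) \<in> borel_measurable sph"
        using rpf_borel[OF rpf_intros(3)[OF rpf_gegenbauer_solid solid_harmonic_rpf[OF h]]] by simp
    qed
    also have "\<dots> = 0"
      using integral_sph_solid_harmonic_orthogonal[OF solid_harmonic_gegenbauer_solid[OF x] h False] D by simp
    finally show ?thesis using False e by simp
  qed
qed

lemma lam_pos: "3 \<le> DIM('a::euclidean_space) \<Longrightarrow> 0 < lam TYPE('a)"
  by (simp add: lam_def)

text \<open>The reproducing property applied to the zonal harmonic with pole
  \<open>w\<close>.\<close>

lemma zonal_reproducing:
  fixes x w :: "'a::euclidean_space"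
  assumes D: "3 \<le> DIM('a)" and x: "norm x = 1" and w: "norm w = 1"
  shows "(\<integral>y. zonal TYPE('a) n (x \<bullet> y) * zonal TYPE('a) n (w \<bullet> y) \<partial>sph) = zonal TYPE('a) n (w \<bullet> x)"
proof -
  let ?l = "lam TYPE('a)" and ?c = "(real n + lam TYPE('a)) / (lam TYPE('a) * sphere_area TYPE('a))"
  have h: "solid_harmonic n (gegenbauer_solid ?l w n)" using w by (rule solid_harmonic_gegenbauer_solid)
  have i: "integrable sph (gegenbauer_solid ?l w n)" using h by (intro integrable_sph_rpf solid_harmonic_rpf)
  have "(\<integral>y. zonal TYPE('a) n (x \<bullet> y) * gegenbauer_solid ?l w n y \<partial>sph) = gegenbauer_solid ?l w n x"
    using zonal_proj_solid_harmonic[OF D h x, of n] zonal_proj_sphere[OF i x] by simp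
  also have "\<dots> = poly (gegenbauer ?l n) (w \<bullet> x)" by (rule gegenbauer_solid_sphere[OF x])
  also have "(\<integral>y. zonal TYPE('a) n (x \<bullet> y) * gegenbauer_solid ?l w n y \<partial>sph) = (\<integral>y. zonal TYPE('a) n (x \<bullet> y) * poly (gegenbauer ?l n) (w \<bullet> y) \<partial>sph)"
  proof (rule integral_cong_AE)
    have m: "f \<in> borel_measurable sph" if "continuous_on UNIV f" for f :: "'a \<Rightarrow> real"
      using borel_measurable_continuous_onI[OF that] by simp
    show "(\<lambda>y. zonal TYPE('a) n (x \<bullet> y) * gegenbauer_solid ?l w n y) \<in> borel_measurable sph"
      by (intro m continuous_intros rpf_continuous rpf_gegenbauer_solid)
    show "(\<lambda>y. zonal TYPE('a) n (x \<bullet> y) * poly (gegenbauer ?l n) (w \<bullet> y)) \<in> borel_measurable sph"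
      by (intro m continuous_intros)
    show "AE y in sph. zonal TYPE('a) n (x \<bullet> y) * gegenbauer_solid ?l w n y = zonal TYPE('a) n (x \<bullet> y) * poly (gegenbauer ?l n) (w \<bullet> y)"
      using AE_sph_norm by eventually_elim (simp add: gegenbauer_solid_sphere)
  qed
  finally have e: "(\<integral>y. zonal TYPE('a) n (x \<bullet> y) * poly (gegenbauer ?l n) (w \<bullet> y) \<partial>sph) = poly (gegenbauer ?l n) (w \<bullet> x)" .
  have "(\<integral>y. zonal TYPE('a) n (x \<bullet> y) * zonal TYPE('a) n (w \<bullet> y) \<partial>sph)
    = (\<integral>y. ?c * (zonal TYPE('a) n (x \<bullet> y) * poly (gegenbauer ?l n) (w \<bullet> y)) \<partial>sph)"
    by (intro Bochner_Integration.integral_cong refl) (simp add: zonal_def)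
  also have "\<dots> = ?c * poly (gegenbauer ?l n) (w \<bullet> x)" by (simp only: integral_mult_right_zero e)
  finally show ?thesis by (simp add: zonal_def)
qed

text \<open>By \<open>zonal_reproducing\<close> the value is the L2 inner product of the zonal
  functions with poles \<open>x\<close> and \<open>w\<close>, and both have squared norm
  \<open>zonal TYPE('a) n 1\<close>; the bound is then Cauchy-Schwarz, in the form 2|ab| \<le> a^2 +
  b^2.\<close>

lemma abs_zonal_le_norm:
  fixes x w :: "'a::euclidean_space"
  assumes D: "3 \<le> DIM('a)" and x: "norm x = 1" and w: "norm w = 1"
  shows "\<bar>zonal TYPE('a) n (w \<bullet> x)\<bar> \<le> zonal TYPE('a) n 1"
proof -
  let ?z = "zonal TYPE('a) n"
  have c: "continuous_on UNIV ?z" by (intro continuous_intros)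
  have ci: "integrable sph (\<lambda>y. ?z (a \<bullet> y) * ?z (b \<bullet> y))" for a b :: 'a
    by (intro integrable_sph_continuous continuous_intros)
  have "\<bar>?z (w \<bullet> x)\<bar> \<le> (\<integral>y. \<bar>?z (x \<bullet> y) * ?z (w \<bullet> y)\<bar> \<partial>sph)"
    unfolding zonal_reproducing[OF D x w, symmetric] by (rule integral_abs_bound)
  also have "\<dots> \<le> (\<integral>y. (?z (x \<bullet> y) * ?z (x \<bullet> y) + ?z (w \<bullet> y) * ?z (w \<bullet> y)) / 2 \<partial>sph)"
  proof (rule integral_mono)
    show "integrable sph (\<lambda>y. \<bar>?z (x \<bullet> y) * ?z (w \<bullet> y)\<bar>)" using ci by (rule integrable_abs)
    show "integrable sph (\<lambda>y. (?z (x \<bullet> y) * ?z (x \<bullet> y) + ?z (w \<bullet> y) * ?z (w \<bullet> y)) / 2)"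
      using ci by simp
    have "2 * \<bar>a * b\<bar> \<le> a * a + b * b" for a b :: real
      using sum_squares_bound[of "\<bar>a\<bar>" "\<bar>b\<bar>"] by (simp add: abs_mult power2_eq_square)
    then show "\<bar>?z (x \<bullet> y) * ?z (w \<bullet> y)\<bar> \<le> (?z (x \<bullet> y) * ?z (x \<bullet> y) + ?z (w \<bullet> y) * ?z (w \<bullet> y)) / 2" for y
      by (simp add: field_simps)
  qed
  also have "\<dots> = (zonal TYPE('a) n (x \<bullet> x) + zonal TYPE('a) n (w \<bullet> w)) / 2"
    using zonal_reproducing[OF D x x, of n] zonal_reproducing[OF D w w, of n] ci by simp
  also have "\<dots> = zonal TYPE('a) n 1" using x w by (simp add: dot_square_norm)
  finally show ?thesis .
qed

lemma abs_zonal_le: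
  assumes D: "3 \<le> DIM('a::euclidean_space)" and t: "\<bar>t\<bar> \<le> 1"
  shows "\<bar>zonal TYPE('a) n t\<bar> \<le> zonal TYPE('a) n 1"
proof -
  obtain b c :: 'a where bc: "b \<in> Basis" "c \<in> Basis" "b \<noteq> c"
  proof -
    obtain b :: 'a where b: "b \<in> Basis" using nonempty_Basis by blast
    have "Basis \<noteq> {b}"
    proof
      assume "Basis = {b}"
      then have "DIM('a) = card {b}" by (simp only:)
      with D show False by simp
    qed
    then show ?thesis using b that by blast
  qed
  have bci: "b \<bullet> c = 0" "c \<bullet> b = 0" "b \<bullet> b = 1" "c \<bullet> c = 1"
    using bc by (auto simp: inner_Basis)
  \<comment> \<open>A unit vector in the plane of two basis vectors whose inner product with
    \<open>b\<close> is \<open>t\<close>.\<close>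
  define w where "w = t *\<^sub>R b + sqrt (1 - t\<^sup>2) *\<^sub>R c"
  have "0 \<le> 1 - t\<^sup>2" using t by (simp add: abs_square_le_1)
  then have "w \<bullet> w = 1" by (simp add: w_def inner_simps bci power2_eq_square[symmetric])
  then have "norm w = 1" by (simp add: norm_eq_1)
  moreover have "w \<bullet> b = t" by (simp add: w_def inner_simps bci)
  ultimately show ?thesis
    using abs_zonal_le_norm[OF D, of b w n] bc by (simp add: norm_Basis)
qed

subsection \<open>The Poisson kernel\<close>

lemma gegenbauer_1_rec: "(real n + 1) * poly (gegenbauer l (Suc n)) 1 = (real n + 2 * l) * poly (gegenbauer l n) 1"
proof (induction n)
  case (Suc n)
  have "(real n + 2) * poly (gegenbauer l (Suc (Suc n))) 1 = 2 * (real n + 1 + l) * poly (gegenbauer l (Suc n)) 1 - (real n + 1) * poly (gegenbauer l (Suc n)) 1"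
    using poly_gegenbauer_rec[of n l 1] Suc by simp
  also have "\<dots> = (real (Suc n) + 2 * l) * poly (gegenbauer l (Suc n)) 1" by (simp add: algebra_simps)
  finally show ?case by (simp add: add_ac)
qed simp

lemma gegenbauer_1_pos: "0 < l \<Longrightarrow> 0 < poly (gegenbauer l n) 1"
proof (induction n)
  case (Suc n)
  then have "0 < (real n + 1) * poly (gegenbauer l (Suc n)) 1" unfolding gegenbauer_1_rec by simp
  then show ?case by (simp add: zero_less_mult_iff)
qed simp

lemma summable_gegenbauer_1:
  assumes l: "0 < l" and r: "0 \<le> r" "r < 1"
  shows "summable (\<lambda>n. poly (gegenbauer l n) 1 * r ^ n)"
proof -
  \<comment> \<open>The midpoint between \<open>r\<close> and 1 serves as the ratio. Successive
    terms have ratio (n + 2l) r / (n + 1), and \<open>N\<close> below is chosen so that this is at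
    most \<open>c\<close> from there on.\<close>
  define c where "c = (1 + r) / 2"
  have c: "c < 1" "r < c" "0 < c" using r by (auto simp: c_def)
  obtain N where N: "2 * l * r / (c - r) \<le> real N" using real_arch_simple by blast
  show ?thesis
  proof (rule summable_ratio_test[OF c(1), of N])
    fix n assume n: "N \<le> n"
    have "2 * l * r / (c - r) \<le> real n" using N n by linarith
    then have "2 * l * r \<le> real n * (c - r)" using c by (simp add: field_simps)
    then have "(real n + 2 * l) * r \<le> (real n + 1) * c" using c by (simp add: algebra_simps)
    then have i: "(real n + 2 * l) * r * (poly (gegenbauer l n) 1 * r ^ n) \<le> (real n + 1) * c * (poly (gegenbauer l n) 1 * r ^ n)"
      using gegenbauer_1_pos[OF l, of n] r by (intro mult_right_mono) auto
    have e: "(real n + 1) * (poly (gegenbauer l (Suc n)) 1 * r ^ Suc n) = (real n + 2 * l) * r * (poly (gegenbauer l n) 1 * r ^ n)"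
      using gegenbauer_1_rec[of n l] by simp
    have "(real n + 1) * (poly (gegenbauer l (Suc n)) 1 * r ^ Suc n) \<le> (real n + 1) * (c * (poly (gegenbauer l n) 1 * r ^ n))"
      using i unfolding e[symmetric] by (simp only: mult.assoc)
    then have "poly (gegenbauer l (Suc n)) 1 * r ^ Suc n \<le> c * (poly (gegenbauer l n) 1 * r ^ n)"
      by (rule mult_left_le_imp_le) simp
    then show "norm (poly (gegenbauer l (Suc n)) 1 * r ^ Suc n) \<le> c * norm (poly (gegenbauer l n) 1 * r ^ n)"
      using gegenbauer_1_pos[OF l, of n] gegenbauer_1_pos[OF l, of "Suc n"] r by (simp del: power_Suc)
  qed
qed

lemma abs_gegenbauer_le:
  assumes D: "3 \<le> DIM('a::euclidean_space)" and t: "\<bar>t\<bar> \<le> 1"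
  shows "\<bar>poly (gegenbauer (lam TYPE('a)) n) t\<bar> \<le> poly (gegenbauer (lam TYPE('a)) n) 1"
proof -
  have c: "0 < (real n + lam TYPE('a)) / (lam TYPE('a) * sphere_area TYPE('a))"
    using lam_pos[OF D] sphere_area_pos[where 'a='a] by (intro divide_pos_pos) auto
  show ?thesis
    using abs_zonal_le[OF D t, of n] unfolding zonal_def abs_mult abs_of_pos[OF c]
    by (simp only: mult_le_cancel_left_pos[OF c])
qed

lemma quad_pos:
  fixes r t :: real
  assumes "\<bar>r\<bar> < 1" "\<bar>t\<bar> \<le> 1" shows "0 < 1 - 2 * r * t + r\<^sup>2"
proof -
  have "r * t \<le> \<bar>r\<bar>"
    using assms by (metis abs_ge_self abs_ge_zero abs_mult mult_left_le order_trans)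
  then have "1 - 2 * \<bar>r\<bar> + \<bar>r\<bar>\<^sup>2 \<le> 1 - 2 * r * t + r\<^sup>2" by simp
  moreover have "1 - 2 * \<bar>r\<bar> + \<bar>r\<bar>\<^sup>2 = (1 - \<bar>r\<bar>)\<^sup>2" by (simp add: power2_eq_square algebra_simps)
  moreover have "0 < (1 - \<bar>r\<bar>)\<^sup>2" using assms by simp
  ultimately show ?thesis by linarith
qed

text \<open>Let G(x) be the sum of the C_n(t) x^n. Multiplying the recurrence by x^(n+1) and summing
  gives (1 - 2xt + x^2) G' = 2l (t - x) G, so G (1 - 2xt + x^2)^l has derivative 0 and equals its
  value 1 at x = 0. The series in question is G + (r/l) G' at x = r, and the differential equation
  turns it into (1 - r^2) G / (1 - 2rt + r^2). The bound by the values at 1 gives convergence on the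
  whole interval from -1 to 1.\<close>

lemma poisson_sums_aux:
  fixes l t :: real
  assumes l: "0 < l" and t: "\<bar>t\<bar> \<le> 1"
    and b: "\<And>n. \<bar>poly (gegenbauer l n) t\<bar> \<le> poly (gegenbauer l n) 1"
    and r: "\<bar>r\<bar> < 1"
  shows "(\<lambda>n. (real n + l) / l * poly (gegenbauer l n) t * r ^ n) sums
    ((1 - r\<^sup>2) * (1 - 2 * r * t + r\<^sup>2) powr (- l - 1))"
proof -
  define c where "c n = poly (gegenbauer l n) t" for n
  have rec: "(real n + 2) * c (Suc (Suc n)) = 2 * (real n + 1 + l) * (t * c (Suc n)) - (real n + 2 * l) * c n" for n
    unfolding c_def by (rule poly_gegenbauer_rec)
  have c01: "c 0 = 1" "c (Suc 0) = 2 * l * t" by (simp_all add: c_def)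
  define G where "G x = (\<Sum>n. c n * x ^ n)" for x
  define G' where "G' x = (\<Sum>n. diffs c n * x ^ n)" for x
  have S: "summable (\<lambda>n. c n * x ^ n)" if "\<bar>x\<bar> < 1" for x
  proof (rule summable_comparison_test')
    show "summable (\<lambda>n. poly (gegenbauer l n) 1 * \<bar>x\<bar> ^ n)" using that by (intro summable_gegenbauer_1 l) auto
    show "norm (c n * x ^ n) \<le> poly (gegenbauer l n) 1 * \<bar>x\<bar> ^ n" if "0 \<le> n" for n
      using b[of n] by (auto simp: c_def abs_mult power_abs intro!: mult_right_mono)
  qed
  have S': "summable (\<lambda>n. diffs c n * x ^ n)" if "\<bar>x\<bar> < 1" for x
    by (rule termdiff_converges[of _ 1]) (use that S in auto)
  have dG: "(G has_real_derivative G' x) (at x)" if "\<bar>x\<bar> < 1" for x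
    unfolding G_def G'_def by (rule termdiffs_strong'[of 1]) (use that S in auto)
  have Gs: "(\<lambda>n. c n * x ^ n) sums G x" if "\<bar>x\<bar> < 1" for x
    unfolding G_def by (rule summable_sums[OF S[OF that]])
  have Gs': "(\<lambda>n. diffs c n * x ^ n) sums G' x" if "\<bar>x\<bar> < 1" for x
    unfolding G'_def by (rule summable_sums[OF S'[OF that]])
  have nG: "(\<lambda>n. real n * c n * x ^ n) sums (x * G' x)" if "\<bar>x\<bar> < 1" for x
  proof -
    have "(\<lambda>n. real (Suc n) * c (Suc n) * x ^ Suc n) sums (x * G' x)"
      using sums_mult[OF Gs'[OF that], of x] by (simp add: diffs_def mult_ac)
    then show ?thesis by (subst (asm) sums_Suc_iff) simp
  qed
  have ode: "(1 - 2 * x * t + x\<^sup>2) * G' x = 2 * l * (t - x) * G x" if x: "\<bar>x\<bar> < 1" for x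
  proof -
    have 1: "(\<lambda>n. c (Suc n) * x ^ Suc n) sums (G x - 1)"
      using Gs[OF x] c01 by (subst sums_Suc_iff) simp
    have 2: "(\<lambda>n. real (Suc n) * c (Suc n) * x ^ Suc n) sums (x * G' x)"
      using nG[OF x] by (subst sums_Suc_iff) simp
    have 3: "(\<lambda>n. (real n + 2) * c (Suc (Suc n)) * x ^ Suc n) sums (G' x - 2 * l * t)"
    proof -
      have "(\<lambda>n. diffs c (Suc n) * x ^ Suc n) sums (G' x - diffs c 0 * x ^ 0)"
        using Gs'[OF x] by (subst sums_Suc_iff) simp
      then show ?thesis by (simp add: diffs_def c01 add_ac)
    qed
    have "(\<lambda>n. 2 * t * (real (Suc n) * c (Suc n) * x ^ Suc n) + 2 * l * t * (c (Suc n) * x ^ Suc n)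
        - (x * (real n * c n * x ^ n) + 2 * l * x * (c n * x ^ n))) sums
       (2 * t * (x * G' x) + 2 * l * t * (G x - 1) - (x * (x * G' x) + 2 * l * x * G x))"
      by (intro sums_diff sums_add sums_mult 1 2 nG Gs x)
    also have "(\<lambda>n. 2 * t * (real (Suc n) * c (Suc n) * x ^ Suc n) + 2 * l * t * (c (Suc n) * x ^ Suc n)
        - (x * (real n * c n * x ^ n) + 2 * l * x * (c n * x ^ n))) = (\<lambda>n. (real n + 2) * c (Suc (Suc n)) * x ^ Suc n)"
      unfolding rec by (simp add: fun_eq_iff algebra_simps)
    finally have "G' x - 2 * l * t = 2 * t * (x * G' x) + 2 * l * t * (G x - 1) - (x * (x * G' x) + 2 * l * x * G x)"
      using 3 sums_unique2 by blast
    then show ?thesis by (simp add: algebra_simps power2_eq_square)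
  qed
  have "\<exists>C. \<forall>x\<in>{-1<..<1}. G x * (1 - 2 * x * t + x\<^sup>2) powr l = C"
  proof (rule has_field_derivative_zero_constant)
    fix x :: real assume "x \<in> {-1<..<1}"
    then have x: "\<bar>x\<bar> < 1" by auto
    note q = quad_pos[OF x t]
    have "((\<lambda>x. G x * (1 - 2 * x * t + x\<^sup>2) powr l) has_real_derivative
      G' x * (1 - 2 * x * t + x\<^sup>2) powr l + G x * (l * (1 - 2 * x * t + x\<^sup>2) powr (l - 1) * (2 * x - 2 * t))) (at x)"
      using q by (auto intro!: derivative_eq_intros dG[OF x] simp: algebra_simps powr_diff)
    moreover have "G' x * (1 - 2 * x * t + x\<^sup>2) powr l + G x * (l * (1 - 2 * x * t + x\<^sup>2) powr (l - 1) * (2 * x - 2 * t))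
      = ((1 - 2 * x * t + x\<^sup>2) * G' x - 2 * l * (t - x) * G x) * (1 - 2 * x * t + x\<^sup>2) powr (l - 1)"
      using q by (simp add: powr_diff field_simps)
    ultimately show "((\<lambda>x. G x * (1 - 2 * x * t + x\<^sup>2) powr l) has_real_derivative 0) (at x within {-1<..<1})"
      using ode[OF x] by (simp add: has_field_derivative_at_within)
  qed simp
  then obtain C where C0: "\<forall>x\<in>{-1<..<1}. G x * (1 - 2 * x * t + x\<^sup>2) powr l = C" by blast
  have C: "G x * (1 - 2 * x * t + x\<^sup>2) powr l = C" if "\<bar>x\<bar> < 1" for x
    using C0 that by (auto simp: abs_less_iff)
  have "G 0 = 1" using Gs[of 0] sums_unique2[of "\<lambda>n. c n * 0 ^ n" "G 0" 1] powser_sums_zero[of c] c01 by auto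
  then have "C = 1" using C[of 0] by simp
  note q = quad_pos[OF r t]
  have "G r * (1 - 2 * r * t + r\<^sup>2) powr l = 1" using C[OF r] \<open>C = 1\<close> by simp
  then have G: "G r = (1 - 2 * r * t + r\<^sup>2) powr (- l)" using q by (simp add: powr_minus field_simps)
  have "(\<lambda>n. 1 / l * (real n * c n * r ^ n) + c n * r ^ n) sums (1 / l * (r * G' r) + G r)"
    by (intro sums_add sums_mult nG Gs r)
  also have "(\<lambda>n. 1 / l * (real n * c n * r ^ n) + c n * r ^ n) = (\<lambda>n. (real n + l) / l * poly (gegenbauer l n) t * r ^ n)"
    using l by (simp add: fun_eq_iff c_def field_simps)
  also have "1 / l * (r * G' r) + G r = (1 - r\<^sup>2) * G r / (1 - 2 * r * t + r\<^sup>2)"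
  proof -
    have G'r: "G' r = 2 * l * (t - r) * G r / (1 - 2 * r * t + r\<^sup>2)" using ode[OF r] q by (simp add: field_simps)
    have "1 / l * (r * G' r) + G r = (2 * r * (t - r) * G r + G r * (1 - 2 * r * t + r\<^sup>2)) / (1 - 2 * r * t + r\<^sup>2)"
      unfolding G'r using l q by (simp add: add_divide_distrib)
    also have "2 * r * (t - r) * G r + G r * (1 - 2 * r * t + r\<^sup>2) = (1 - r\<^sup>2) * G r"
      by (simp add: algebra_simps power2_eq_square)
    finally show ?thesis .
  qed
  also have "\<dots> = (1 - r\<^sup>2) * (1 - 2 * r * t + r\<^sup>2) powr (- l - 1)"
    unfolding G using q by (simp add: powr_diff)
  finally show ?thesis .
qed

text \<open>With \<open>r = exp (- s)\<close> and \<open>t = x \<bullet> y\<close> for unit vectors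
  this is the classical kernel (1 - r^2) / |x - r y|^D divided by the area of the sphere, since
  \<open>lam T + 1\<close> is half the ambient dimension D.\<close>

definition poisson_kernel :: "'a::euclidean_space itself \<Rightarrow> real \<Rightarrow> real \<Rightarrow> real" where
  "poisson_kernel T s t = (1 - (exp (- s))\<^sup>2) * (1 - 2 * exp (- s) * t + (exp (- s))\<^sup>2) powr (- lam T - 1) / sphere_area T"

lemma poisson_kernel_measurable [measurable]: "(\<lambda>(s, t). poisson_kernel T s t) \<in> borel_measurable (borel \<Otimes>\<^sub>M borel)"
  unfolding poisson_kernel_def by measurable

lemma poisson_kernel_nonneg: "0 < s \<Longrightarrow> 0 \<le> poisson_kernel T s t"
  unfolding poisson_kernel_def by (intro divide_nonneg_nonneg mult_nonneg_nonneg) (auto simp: abs_square_le_1)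

lemma poisson_kernel_sums:
  assumes D: "3 \<le> DIM('a::euclidean_space)" and t: "\<bar>t\<bar> \<le> 1" and s: "0 < s"
  shows "(\<lambda>n. exp (- s) ^ n * zonal TYPE('a) n t) sums poisson_kernel TYPE('a) s t"
proof -
  have "(\<lambda>n. 1 / sphere_area TYPE('a) * ((real n + lam TYPE('a)) / lam TYPE('a) * poly (gegenbauer (lam TYPE('a)) n) t * exp (- s) ^ n)) sums
    (1 / sphere_area TYPE('a) * ((1 - (exp (- s))\<^sup>2) * (1 - 2 * exp (- s) * t + (exp (- s))\<^sup>2) powr (- lam TYPE('a) - 1)))"
    by (rule sums_mult, rule poisson_sums_aux[OF lam_pos[OF D] t abs_gegenbauer_le[OF D t]]) (use s in auto)
  then show ?thesis by (simp add: poisson_kernel_def zonal_def mult_ac)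
qed

lemma summable_zonal_1:
  assumes D: "3 \<le> DIM('a::euclidean_space)" and s: "0 < s"
  shows "summable (\<lambda>n. exp (- s) ^ n * zonal TYPE('a) n 1)"
  using poisson_kernel_sums[OF D _ s, of 1] by (simp add: sums_iff)

text \<open>The decay factor \<open>exp (- (l * s))\<close> is part of the measure, which makes the
  measure finite for positive \<open>\<sigma>\<close> and \<open>l\<close>; Cauchy-Schwarz against
  the constant 1 then costs only its total mass, Gamma(\<sigma>) l^(-\<sigma>).\<close>

definition gamma_measure :: "real \<Rightarrow> real \<Rightarrow> real measure" where
  "gamma_measure \<sigma> l = density lborel (\<lambda>s. ennreal (indicator {0<..} s * s powr (\<sigma> - 1) * exp (- (l * s))))"

lemma sets_gamma_measure [simp, measurable_cong]: "sets (gamma_measure \<sigma> l) = sets borel"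
  and space_gamma_measure [simp]: "space (gamma_measure \<sigma> l) = UNIV"
  by (simp_all add: gamma_measure_def)

lemma AE_gamma_measure_pos: "AE s in gamma_measure \<sigma> l. 0 < s"
  unfolding gamma_measure_def by (subst AE_density) (auto intro!: AE_I2 simp: indicator_def)

text \<open>Euler's integral for \<open>Gamma \<sigma>\<close> under the substitution
  \<open>t = (l + a) * s\<close>.\<close>

lemma nn_integral_gamma_measure_exp:
  assumes \<sigma>: "0 < \<sigma>" and a: "0 < l + a"
  shows "(\<integral>\<^sup>+s. ennreal (exp (- (a * s))) \<partial>gamma_measure \<sigma> l) = ennreal (Gamma \<sigma> * (l + a) powr (- \<sigma>))"
proof -
  define c where "c = l + a"
  have c: "0 < c" using a by (simp add: c_def)
  have "ennreal (Gamma \<sigma>) = (\<integral>\<^sup>+t. ennreal (indicator {0..} t * t powr (\<sigma> - 1) / exp t) \<partial>lborel)"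
    by (rule Gamma_conv_nn_integral_real[OF \<sigma>])
  also have "\<dots> = \<bar>c\<bar> * (\<integral>\<^sup>+s. ennreal (indicator {0..} (0 + c * s) * (0 + c * s) powr (\<sigma> - 1) / exp (0 + c * s)) \<partial>lborel)"
    by (rule nn_integral_real_affine) (use c in auto)
  also have "\<dots> = \<bar>c\<bar> * (\<integral>\<^sup>+s. ennreal (c powr (\<sigma> - 1)) * (ennreal (indicator {0<..} s * s powr (\<sigma> - 1) * exp (- (l * s))) * ennreal (exp (- (a * s)))) \<partial>lborel)"
  proof (intro arg_cong[of _ _ "\<lambda>x. _ * x"] nn_integral_cong)
    fix s :: real
    show "ennreal (indicator {0..} (0 + c * s) * (0 + c * s) powr (\<sigma> - 1) / exp (0 + c * s)) =
      ennreal (c powr (\<sigma> - 1)) * (ennreal (indicator {0<..} s * s powr (\<sigma> - 1) * exp (- (l * s))) * ennreal (exp (- (a * s))))"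
    proof (cases "0 < s")
      case True
      have "exp (c * s) = exp (l * s) * exp (a * s)" by (simp add: c_def exp_add[symmetric] algebra_simps)
      then show ?thesis using True c
        by (simp add: ennreal_mult[symmetric] powr_mult exp_minus field_simps)
    next
      case False
      then have "s = 0 \<or> s < 0" by auto
      then show ?thesis using c by (auto simp: indicator_def zero_le_mult_iff)
    qed
  qed
  also have "\<dots> = ennreal c * (ennreal (c powr (\<sigma> - 1)) * (\<integral>\<^sup>+s. ennreal (exp (- (a * s))) \<partial>gamma_measure \<sigma> l))"
    unfolding gamma_measure_def using c
    by (subst nn_integral_cmult) (simp_all add: nn_integral_density)
  also have "\<dots> = ennreal (c powr \<sigma>) * (\<integral>\<^sup>+s. ennreal (exp (- (a * s))) \<partial>gamma_measure \<sigma> l)"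
    using c by (simp add: mult.assoc[symmetric] ennreal_mult[symmetric] powr_diff)
  finally have e: "ennreal (Gamma \<sigma>) = \<dots>" .
  have "ennreal (c powr (- \<sigma>)) * ennreal (c powr \<sigma>) = 1"
    using c by (simp add: ennreal_mult[symmetric] powr_minus)
  then have "(\<integral>\<^sup>+s. ennreal (exp (- (a * s))) \<partial>gamma_measure \<sigma> l) = ennreal (c powr (- \<sigma>)) * ennreal (Gamma \<sigma>)"
    unfolding e by (metis mult.assoc mult_1)
  also have "\<dots> = ennreal (Gamma \<sigma> * c powr (- \<sigma>))"
    using \<sigma> by (simp add: ennreal_mult[symmetric] mult.commute Gamma_real_pos less_imp_le)
  finally show ?thesis by (simp add: c_def)
qed

lemma finite_measure_gamma_measure: "0 < \<sigma> \<Longrightarrow> 0 < l \<Longrightarrow> finite_measure (gamma_measure \<sigma> l)"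
  using nn_integral_gamma_measure_exp[of \<sigma> l 0] by (intro finite_measureI) simp

lemma has_bochner_integral_gamma_measure_exp:
  assumes "0 < \<sigma>" "0 < l + a"
  shows "integrable (gamma_measure \<sigma> l) (\<lambda>s. exp (- (a * s)))"
    and "(\<integral>s. exp (- (a * s)) \<partial>gamma_measure \<sigma> l) = Gamma \<sigma> * (l + a) powr (- \<sigma>)"
proof -
  have g: "0 \<le> Gamma \<sigma> * (l + a) powr (- \<sigma>)" using assms by (simp add: Gamma_real_pos less_imp_le)
  show "integrable (gamma_measure \<sigma> l) (\<lambda>s. exp (- (a * s)))"
    by (rule integrableI_nn_integral_finite[OF _ _ nn_integral_gamma_measure_exp[OF assms]]) (use g in auto)
  show "(\<integral>s. exp (- (a * s)) \<partial>gamma_measure \<sigma> l) = Gamma \<sigma> * (l + a) powr (- \<sigma>)"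
    by (subst integral_eq_nn_integral) (use g in \<open>auto simp: nn_integral_gamma_measure_exp[OF assms]\<close>)
qed

section \<open>Integration against the Poisson kernel\<close>

lemma abs_inner_le_1: "norm x = 1 \<Longrightarrow> norm y = 1 \<Longrightarrow> \<bar>x \<bullet> y\<bar> \<le> 1"
  using Cauchy_Schwarz_ineq2[of x y] by simp

text \<open>The series is integrated term by term. On the sphere each zonal value is at most the
  value at 1, and these majorants are summable against the powers of \<open>exp (- s)\<close>, so
  the norms of the terms are summable both pointwise and after integration.\<close>

lemma
  fixes f :: "'a::euclidean_space \<Rightarrow> real"
  assumes D: "3 \<le> DIM('a)" and f: "integrable sph f" and x: "norm x = 1" and s: "0 < s"
  shows poisson_kernel_integral_sums: "(\<lambda>n. exp (- s) ^ n * zonal_proj n f x) sums (\<integral>y. poisson_kernel TYPE('a) s (x \<bullet> y) * f y \<partial>sph)"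
    and integrable_poisson_kernel: "integrable sph (\<lambda>y. poisson_kernel TYPE('a) s (x \<bullet> y) * f y)"
proof -
  have [measurable]: "f \<in> borel_measurable borel" using borel_measurable_integrable[OF f] by simp
  let ?F = "\<lambda>n y. exp (- s) ^ n * zonal TYPE('a) n (x \<bullet> y) * f y"
  have bd: "AE y in sph. norm (?F n y) \<le> exp (- s) ^ n * zonal TYPE('a) n 1 * \<bar>f y\<bar>" for n
    using AE_sph_norm
  proof eventually_elim
    case (elim y)
    show ?case
      using abs_zonal_le[OF D abs_inner_le_1[OF x elim], of n]
      by (auto simp: abs_mult intro!: mult_right_mono mult_left_mono)
  qed
  have i: "integrable sph (?F n)" for n
    by (rule Bochner_Integration.integrable_bound[of sph "\<lambda>y. exp (- s) ^ n * zonal TYPE('a) n 1 * \<bar>f y\<bar>"])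
       (use f bd[of n] in \<open>auto elim!: eventually_mono\<close>)
  have sn: "AE y in sph. summable (\<lambda>n. norm (?F n y))"
    using AE_sph_norm
  proof eventually_elim
    case (elim y)
    have sm: "summable (\<lambda>n. exp (- s) ^ n * zonal TYPE('a) n 1 * \<bar>f y\<bar>)"
      by (intro summable_mult2 summable_zonal_1[OF D s])
    show ?case
    proof (rule summable_comparison_test'[OF sm, of 0])
      show "norm (norm (?F n y)) \<le> exp (- s) ^ n * zonal TYPE('a) n 1 * \<bar>f y\<bar>" if "0 \<le> n" for n
        using abs_zonal_le[OF D abs_inner_le_1[OF x elim], of n]
        by (auto simp: abs_mult intro!: mult_right_mono mult_left_mono)
    qed
  qed
  have sI: "summable (\<lambda>n. \<integral>y. norm (?F n y) \<partial>sph)"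
  proof (rule summable_comparison_test')
    show "summable (\<lambda>n. exp (- s) ^ n * zonal TYPE('a) n 1 * (\<integral>y. \<bar>f y\<bar> \<partial>sph))"
      by (intro summable_mult2 summable_zonal_1[OF D s])
    show "norm (\<integral>y. norm (?F n y) \<partial>sph) \<le> exp (- s) ^ n * zonal TYPE('a) n 1 * (\<integral>y. \<bar>f y\<bar> \<partial>sph)" if "0 \<le> n" for n
    proof -
      have "(\<integral>y. norm (?F n y) \<partial>sph) \<le> (\<integral>y. exp (- s) ^ n * zonal TYPE('a) n 1 * \<bar>f y\<bar> \<partial>sph)"
        by (rule integral_mono_AE) (use i bd[of n] f in \<open>auto intro!: integrable_norm\<close>)
      then show ?thesis by (simp add: integral_nonneg_AE)
    qed
  qed
  have ae: "AE y in sph. (\<Sum>n. ?F n y) = poisson_kernel TYPE('a) s (x \<bullet> y) * f y"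
    using AE_sph_norm
  proof eventually_elim
    case (elim y)
    from sums_mult2[OF poisson_kernel_sums[OF D abs_inner_le_1[OF x elim] s], of "f y"]
    show ?case by (simp add: sums_iff)
  qed
  have m: "(\<lambda>y. \<Sum>n. ?F n y) \<in> borel_measurable sph"
    using integrable_suminf[OF i sn sI] by (rule borel_measurable_integrable)
  have "(\<integral>y. (\<Sum>n. ?F n y) \<partial>sph) = (\<integral>y. poisson_kernel TYPE('a) s (x \<bullet> y) * f y \<partial>sph)"
    by (rule integral_cong_AE[OF m _ ae]) measurable
  moreover have "(\<integral>y. ?F n y \<partial>sph) = exp (- s) ^ n * zonal_proj n f x" for n
    by (simp add: zonal_proj_sphere[OF f x] mult.assoc)
  ultimately show "(\<lambda>n. exp (- s) ^ n * zonal_proj n f x) sums (\<integral>y. poisson_kernel TYPE('a) s (x \<bullet> y) * f y \<partial>sph)"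
    using sums_integral[OF i sn sI] by simp
  show "integrable sph (\<lambda>y. poisson_kernel TYPE('a) s (x \<bullet> y) * f y)"
    using integrable_suminf[OF i sn sI] by (rule integrable_cong_AE_imp) (use ae in \<open>auto elim!: eventually_mono\<close>)
qed

text \<open>The constant 1 is harmonic of degree 0, so only the term \<open>n = 0\<close> of its
  Poisson series survives.\<close>

lemma nn_integral_poisson_kernel:
  fixes x :: "'a::euclidean_space"
  assumes D: "3 \<le> DIM('a)" and x: "norm x = 1" and s: "0 < s"
  shows "(\<integral>\<^sup>+y. ennreal (poisson_kernel TYPE('a) s (x \<bullet> y)) \<partial>sph) = 1"
proof -
  have h: "solid_harmonic 0 (\<lambda>x::'a. 1)" by (auto simp: solid_harmonic_def real_laplacian_def intro: rpf_intros)
  have e: "(\<lambda>n. exp (- s) ^ n * zonal_proj n (\<lambda>x. 1) x) = (\<lambda>n. if n = 0 then 1 else 0)"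
    by (rule ext) (simp add: zonal_proj_solid_harmonic[OF D h x])
  have "(\<lambda>n. exp (- s) ^ n * zonal_proj n (\<lambda>x. 1) x) sums 1"
    unfolding e using sums_single[of 0 "\<lambda>_. 1::real"] by (simp only:)
  from sums_unique2[OF poisson_kernel_integral_sums[OF D sph.integrable_const[of 1] x s] this]
  have "(\<integral>y. poisson_kernel TYPE('a) s (x \<bullet> y) * 1 \<partial>sph) = 1" .
  then show ?thesis
    using integrable_poisson_kernel[OF D sph.integrable_const[of 1] x s] poisson_kernel_nonneg[OF s]
    by (subst nn_integral_eq_integral) auto
qed

section \<open>Orthogonality of the projections and Bessel's inequality\<close>

lemma integrable_of_square:
  fixes f :: "'a::euclidean_space \<Rightarrow> real"
  assumes "f \<in> borel_measurable borel" "integrable sph (\<lambda>x. (f x)\<^sup>2)" shows "integrable sph f"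
  by (rule sph.square_integrable_imp_integrable) (use assms in simp_all)

text \<open>The kernel is symmetric in its two points and bounded on the sphere, so Fubini applies
  to its product with f(y) g(x).\<close>

lemma zonal_proj_selfadjoint:
  fixes f g :: "'a::euclidean_space \<Rightarrow> real"
  assumes f: "integrable sph f" and g: "integrable sph g"
  shows "(\<integral>x. zonal_proj n f x * g x \<partial>sph) = (\<integral>y. f y * zonal_proj n g y \<partial>sph)"
    and "integrable sph (\<lambda>x. zonal_proj n f x * g x)"
proof -
  interpret P: pair_sigma_finite "sph :: 'a measure" "sph :: 'a measure" ..
  have [measurable]: "f \<in> borel_measurable borel" "g \<in> borel_measurable borel"
    using borel_measurable_integrable[OF f] borel_measurable_integrable[OF g] by simp_all
  have "compact (zonal TYPE('a) n ` {-1..1})"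
    by (intro compact_continuous_image continuous_intros) auto
  then obtain B where B: "\<And>t. t \<in> {-1..1} \<Longrightarrow> \<bar>zonal TYPE('a) n t\<bar> \<le> B"
    using compact_imp_bounded bounded_iff by (metis imageI real_norm_def)
  let ?F = "\<lambda>x y. zonal TYPE('a) n (x \<bullet> y) * f y * g x"
  have i0: "integrable (sph \<Otimes>\<^sub>M sph) (\<lambda>(x, y). g x * f y)"
  proof (rule P.Fubini_integrable)
    have "(\<lambda>x. \<integral>y. norm (case (x, y) of (x, y) \<Rightarrow> g x * f y) \<partial>sph) = (\<lambda>x. \<bar>g x\<bar> * (\<integral>y. \<bar>f y\<bar> \<partial>sph))"
      by (simp add: abs_mult)
    then show "integrable sph (\<lambda>x. \<integral>y. norm (case (x, y) of (x, y) \<Rightarrow> g x * f y) \<partial>sph)"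
      using g by (simp only:) (intro integrable_mult_left integrable_abs)
    show "AE x in sph. integrable sph (\<lambda>y. case (x, y) of (x, y) \<Rightarrow> g x * f y)"
      using f by simp
  qed measurable
  have sn: "AE p in sph \<Otimes>\<^sub>M sph. norm (fst p :: 'a) = 1 \<and> norm (snd p :: 'a) = 1"
  proof (rule P.AE_pair_measure)
    show "AE x in sph. AE y in sph. norm (fst (x, y) :: 'a) = 1 \<and> norm (snd (x, y) :: 'a) = 1"
      using AE_sph_norm
    proof eventually_elim
      case (elim x)
      from AE_sph_norm show ?case by eventually_elim (simp add: elim)
    qed
  qed measurable
  have i: "integrable (sph \<Otimes>\<^sub>M sph) (\<lambda>(x, y). ?F x y)"
  proof (rule Bochner_Integration.integrable_bound)
    show "integrable (sph \<Otimes>\<^sub>M sph) (\<lambda>p. B *\<^sub>R (\<lambda>(x, y). g x * f y) p)" using i0 by simp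
    show "AE p in sph \<Otimes>\<^sub>M sph. norm ((\<lambda>(x, y). ?F x y) p) \<le> norm (B *\<^sub>R (\<lambda>(x, y). g x * f y) p)"
      using sn
    proof eventually_elim
      case (elim p)
      then have "\<bar>fst p \<bullet> snd p\<bar> \<le> 1" by (auto intro: abs_inner_le_1)
      then have "\<bar>zonal TYPE('a) n (fst p \<bullet> snd p)\<bar> \<le> \<bar>B\<bar>" using B[of "fst p \<bullet> snd p"] by (simp add: abs_le_iff)
      then have "\<bar>zonal TYPE('a) n (fst p \<bullet> snd p)\<bar> * \<bar>f (snd p) * g (fst p)\<bar> \<le> \<bar>B\<bar> * \<bar>f (snd p) * g (fst p)\<bar>"
        by (rule mult_right_mono) simp
      then show ?case by (simp add: split_def abs_mult mult_ac)
    qed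
  qed measurable
  have 1: "AE x in sph. (\<integral>y. ?F x y \<partial>sph) = zonal_proj n f x * g x"
    using AE_sph_norm by eventually_elim (simp add: zonal_proj_sphere[OF f])
  have zm: "zonal_proj n f \<in> borel_measurable borel" "zonal_proj n g \<in> borel_measurable borel"
    using solid_harmonic_rpf[OF solid_harmonic_zonal_proj[OF f]] solid_harmonic_rpf[OF solid_harmonic_zonal_proj[OF g]] by (auto intro: rpf_borel)
  note zm [measurable]
  have 2: "AE y in sph. (\<integral>x. ?F x y \<partial>sph) = f y * zonal_proj n g y"
    using AE_sph_norm
  proof eventually_elim
    case (elim y)
    have "(\<integral>x. ?F x y \<partial>sph) = (\<integral>x. f y * (zonal TYPE('a) n (y \<bullet> x) * g x) \<partial>sph)"
      by (simp add: inner_commute mult_ac)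
    then show ?case using elim by (simp add: zonal_proj_sphere[OF g])
  qed
  have "(\<integral>x. zonal_proj n f x * g x \<partial>sph) = (\<integral>x. (\<integral>y. ?F x y \<partial>sph) \<partial>sph)"
    by (rule integral_cong_AE[symmetric]) (use 1 in \<open>auto\<close>)
  also have "\<dots> = (\<integral>y. (\<integral>x. ?F x y \<partial>sph) \<partial>sph)"
    using P.Fubini_integral[OF i] by simp
  also have "\<dots> = (\<integral>y. f y * zonal_proj n g y \<partial>sph)"
    by (rule integral_cong_AE) (use 2 in \<open>auto\<close>)
  finally show "(\<integral>x. zonal_proj n f x * g x \<partial>sph) = (\<integral>y. f y * zonal_proj n g y \<partial>sph)" .
  show "integrable sph (\<lambda>x. zonal_proj n f x * g x)"
    by (rule integrable_cong_AE_imp[OF P.integrable_fst[OF i]]) (use 1 in \<open>auto elim!: eventually_mono\<close>)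
qed

text \<open>Self-adjointness moves one projection onto the other factor, a solid harmonic of degree
  \<open>m\<close>, where it acts as the identity or as 0.\<close>

lemma zonal_proj_inner_zonal_proj:
  fixes f :: "'a::euclidean_space \<Rightarrow> real"
  assumes D: "3 \<le> DIM('a)" and f: "integrable sph f"
  shows "(\<integral>x. zonal_proj n f x * zonal_proj m f x \<partial>sph) = (if n = m then (\<integral>x. f x * zonal_proj m f x \<partial>sph) else 0)"
proof -
  have h: "solid_harmonic m (zonal_proj m f)" by (rule solid_harmonic_zonal_proj[OF f])
  have i: "integrable sph (zonal_proj m f)" by (intro integrable_sph_rpf solid_harmonic_rpf[OF h])
  have [measurable]: "f \<in> borel_measurable borel" using borel_measurable_integrable[OF f] by simp
  have [measurable]: "zonal_proj k g \<in> borel_measurable borel" if "integrable sph g" for k and g :: "'a \<Rightarrow> real"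
    using solid_harmonic_rpf[OF solid_harmonic_zonal_proj[OF that]] by (rule rpf_borel)
  have "(\<integral>x. zonal_proj n f x * zonal_proj m f x \<partial>sph) = (\<integral>y. f y * zonal_proj n (zonal_proj m f) y \<partial>sph)"
    by (rule zonal_proj_selfadjoint[OF f i])
  also have "\<dots> = (\<integral>y. (if n = m then f y * zonal_proj m f y else 0) \<partial>sph)"
  proof (rule integral_cong_AE)
    show "AE y in sph. f y * zonal_proj n (zonal_proj m f) y = (if n = m then f y * zonal_proj m f y else 0)"
      using AE_sph_norm by eventually_elim (simp add: zonal_proj_solid_harmonic[OF D h])
  qed (use f i in \<open>auto intro!: borel_measurable_times\<close>)
  finally show ?thesis by simp
qed

lemma integral_zonal_proj_sum_square:
  fixes f :: "'a::euclidean_space \<Rightarrow> real"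
  assumes D: "3 \<le> DIM('a)" and f: "integrable sph f" and A: "finite A"
  shows "(\<integral>x. (\<Sum>n\<in>A. c n * zonal_proj n f x)\<^sup>2 \<partial>sph) = (\<Sum>n\<in>A. (c n)\<^sup>2 * (\<integral>x. f x * zonal_proj n f x \<partial>sph))"
proof -
  have r: "rpf (zonal_proj n f)" for n using solid_harmonic_rpf[OF solid_harmonic_zonal_proj[OF f]] .
  have "(\<integral>x. (\<Sum>n\<in>A. c n * zonal_proj n f x)\<^sup>2 \<partial>sph) = (\<integral>x. (\<Sum>n\<in>A. \<Sum>m\<in>A. c n * c m * (zonal_proj n f x * zonal_proj m f x)) \<partial>sph)"
    by (simp add: power2_eq_square sum_product mult_ac)
  also have "\<dots> = (\<Sum>n\<in>A. \<Sum>m\<in>A. c n * c m * (\<integral>x. zonal_proj n f x * zonal_proj m f x \<partial>sph))"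
    by (simp add: Bochner_Integration.integral_sum integrable_sph_rpf r rpf_intros Bochner_Integration.integrable_sum)
  also have "\<dots> = (\<Sum>n\<in>A. (c n)\<^sup>2 * (\<integral>x. f x * zonal_proj n f x \<partial>sph))"
    using A by (simp add: zonal_proj_inner_zonal_proj[OF D f] if_distrib power2_eq_square cong: if_cong)
  finally show ?thesis .
qed

lemma zonal_proj_inner_nonneg:
  fixes f :: "'a::euclidean_space \<Rightarrow> real"
  assumes D: "3 \<le> DIM('a)" and f: "integrable sph f"
  shows "0 \<le> (\<integral>x. f x * zonal_proj n f x \<partial>sph)"
proof -
  have "0 \<le> (\<integral>x. zonal_proj n f x * zonal_proj n f x \<partial>sph)" by (rule integral_nonneg_AE) simp
  then show ?thesis using zonal_proj_inner_zonal_proj[OF D f, of n n] by simp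
qed

lemma bessel:
  fixes f :: "'a::euclidean_space \<Rightarrow> real"
  assumes D: "3 \<le> DIM('a)" and fm: "f \<in> borel_measurable borel" and f2: "integrable sph (\<lambda>x. (f x)\<^sup>2)"
    and A: "finite A"
  shows "(\<Sum>n\<in>A. \<integral>x. f x * zonal_proj n f x \<partial>sph) \<le> (\<integral>x. (f x)\<^sup>2 \<partial>sph)"
proof -
  have f: "integrable sph f" using fm f2 by (rule integrable_of_square)
  have r: "rpf (zonal_proj n f)" for n using solid_harmonic_rpf[OF solid_harmonic_zonal_proj[OF f]] .
  define S where "S x = (\<Sum>n\<in>A. zonal_proj n f x)" for x
  have S: "rpf S" unfolding S_def[abs_def] using A r by (intro real_polynomial_function_sum) auto
  have i1: "integrable sph (\<lambda>x. f x * zonal_proj n f x)" for n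
    using integrable_sph_mult_continuous[OF rpf_continuous[OF r] f] by (simp add: mult.commute)
  have i2: "integrable sph (\<lambda>x. f x * S x)"
    using integrable_sph_mult_continuous[OF rpf_continuous[OF S] f] by (simp add: mult.commute)
  have i3: "integrable sph (\<lambda>x. (S x)\<^sup>2)" using S by (intro integrable_sph_rpf rpf_intros)
  have "0 \<le> (\<integral>x. (f x - S x)\<^sup>2 \<partial>sph)" by (rule integral_nonneg_AE) simp
  also have "\<dots> = (\<integral>x. (f x)\<^sup>2 - 2 * (f x * S x) + (S x)\<^sup>2 \<partial>sph)"
    by (simp add: power2_diff algebra_simps)
  also have "\<dots> = (\<integral>x. (f x)\<^sup>2 \<partial>sph) - 2 * (\<integral>x. f x * S x \<partial>sph) + (\<integral>x. (S x)\<^sup>2 \<partial>sph)"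
    using f2 i2 i3 by simp
  also have "(\<integral>x. f x * S x \<partial>sph) = (\<Sum>n\<in>A. \<integral>x. f x * zonal_proj n f x \<partial>sph)"
    using i1 by (simp add: S_def sum_distrib_left Bochner_Integration.integral_sum)
  also have "(\<integral>x. (S x)\<^sup>2 \<partial>sph) = (\<Sum>n\<in>A. \<integral>x. f x * zonal_proj n f x \<partial>sph)"
    using integral_zonal_proj_sum_square[OF D f A, of "\<lambda>_. 1"] by (simp add: S_def)
  finally show ?thesis by simp
qed

definition poisson_integral :: "('a::euclidean_space \<Rightarrow> real) \<Rightarrow> real \<Rightarrow> 'a \<Rightarrow> real" where
  "poisson_integral f s x = (\<integral>y. poisson_kernel TYPE('a) s (x \<bullet> y) * f y \<partial>sph)"

lemma poisson_integral_measurable [measurable (raw)]: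
  assumes [measurable]: "f \<in> borel_measurable borel" "g \<in> borel_measurable M" "h \<in> M \<rightarrow>\<^sub>M borel"
  shows "(\<lambda>z. poisson_integral f (g z) (h z)) \<in> borel_measurable M"
  unfolding poisson_integral_def by measurable

text \<open>The square norm of a finite block of terms from \<open>N\<close> on is the sum of
  e^(-2ns) <f, P_n f>, with P_n the projection of degree \<open>n\<close>. Each weight is at most
  e^(-2Ns), the inner products are nonnegative, and Bessel's inequality bounds their sum. Fatou's
  lemma passes from finite blocks to the whole tail.\<close>

lemma nn_integral_poisson_kernel_tail:
  fixes f :: "'a::euclidean_space \<Rightarrow> real"
  assumes D: "3 \<le> DIM('a)" and fm: "f \<in> borel_measurable borel" and f2: "integrable sph (\<lambda>x. (f x)\<^sup>2)"
    and s: "0 < s"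
  shows "(\<integral>\<^sup>+x. ennreal ((poisson_integral f s x - (\<Sum>n<N. exp (- s) ^ n * zonal_proj n f x))\<^sup>2) \<partial>sph)
    \<le> ennreal (exp (- (2 * real N * s)) * (\<integral>x. (f x)\<^sup>2 \<partial>sph))"
proof -
  have f: "integrable sph f" using fm f2 by (rule integrable_of_square)
  have r: "rpf (zonal_proj n f)" for n using solid_harmonic_rpf[OF solid_harmonic_zonal_proj[OF f]] .
  note [measurable] = fm rpf_borel[OF r]
  let ?u = "\<lambda>M x. ennreal ((\<Sum>n\<in>{N..<M}. exp (- s) ^ n * zonal_proj n f x)\<^sup>2)"
  have bd: "(\<integral>\<^sup>+x. ?u M x \<partial>sph) \<le> ennreal (exp (- (2 * real N * s)) * (\<integral>x. (f x)\<^sup>2 \<partial>sph))" for M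
  proof -
    have i: "integrable sph (\<lambda>x. (\<Sum>n\<in>{N..<M}. exp (- s) ^ n * zonal_proj n f x)\<^sup>2)"
      by (intro integrable_sph_rpf real_polynomial_function_power real_polynomial_function_sum rpf_intros r) auto
    have "(\<integral>x. (\<Sum>n\<in>{N..<M}. exp (- s) ^ n * zonal_proj n f x)\<^sup>2 \<partial>sph)
      = (\<Sum>n\<in>{N..<M}. (exp (- s) ^ n)\<^sup>2 * (\<integral>x. f x * zonal_proj n f x \<partial>sph))"
      by (rule integral_zonal_proj_sum_square[OF D f]) simp
    also have "\<dots> \<le> (\<Sum>n\<in>{N..<M}. exp (- (2 * real N * s)) * (\<integral>x. f x * zonal_proj n f x \<partial>sph))"
    proof (intro sum_mono mult_right_mono zonal_proj_inner_nonneg[OF D f])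
      fix n assume n: "n \<in> {N..<M}"
      have "(exp (- s) ^ n)\<^sup>2 = exp (- (2 * real n * s))"
        by (simp add: exp_of_nat_mult[symmetric] power2_eq_square exp_add[symmetric])
      also have "\<dots> \<le> exp (- (2 * real N * s))" using n s by (simp add: mult_right_mono)
      finally show "(exp (- s) ^ n)\<^sup>2 \<le> exp (- (2 * real N * s))" .
    qed
    also have "\<dots> \<le> exp (- (2 * real N * s)) * (\<integral>x. (f x)\<^sup>2 \<partial>sph)"
      unfolding sum_distrib_left[symmetric]
      by (intro mult_left_mono bessel[OF D fm f2]) auto
    finally show ?thesis using i by (subst nn_integral_eq_integral) (auto intro: ennreal_leI)
  qed
  have "(\<integral>\<^sup>+x. ennreal ((poisson_integral f s x - (\<Sum>n<N. exp (- s) ^ n * zonal_proj n f x))\<^sup>2) \<partial>sph) = (\<integral>\<^sup>+x. liminf (\<lambda>M. ?u M x) \<partial>sph)"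
  proof (rule nn_integral_cong_AE)
    show "AE x in sph. ennreal ((poisson_integral f s x - (\<Sum>n<N. exp (- s) ^ n * zonal_proj n f x))\<^sup>2) = liminf (\<lambda>M. ?u M x)"
      using AE_sph_norm
    proof eventually_elim
      case (elim x)
      have "(\<lambda>M. \<Sum>n<M. exp (- s) ^ n * zonal_proj n f x) \<longlonglongrightarrow> poisson_integral f s x"
        using poisson_kernel_integral_sums[OF D f elim s] by (simp add: sums_def poisson_integral_def)
      then have "(\<lambda>M. (\<Sum>n<M. exp (- s) ^ n * zonal_proj n f x) - (\<Sum>n<N. exp (- s) ^ n * zonal_proj n f x)) \<longlonglongrightarrow> poisson_integral f s x - (\<Sum>n<N. exp (- s) ^ n * zonal_proj n f x)"
        by (intro tendsto_diff tendsto_const)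
      then have "(\<lambda>M. \<Sum>n\<in>{N..<M}. exp (- s) ^ n * zonal_proj n f x) \<longlonglongrightarrow> poisson_integral f s x - (\<Sum>n<N. exp (- s) ^ n * zonal_proj n f x)"
      proof (rule Lim_transform_eventually)
        show "\<forall>\<^sub>F M in sequentially. (\<Sum>n<M. exp (- s) ^ n * zonal_proj n f x) - (\<Sum>n<N. exp (- s) ^ n * zonal_proj n f x) = (\<Sum>n\<in>{N..<M}. exp (- s) ^ n * zonal_proj n f x)"
          using eventually_ge_at_top[of N]
        proof eventually_elim
          case (elim M)
          then show ?case
            using sum.atLeastLessThan_concat[of 0 N M "\<lambda>n. exp (- s) ^ n * zonal_proj n f x"] by (simp add: lessThan_atLeast0)
        qed
      qed
      then have "(\<lambda>M. ?u M x) \<longlonglongrightarrow> ennreal ((poisson_integral f s x - (\<Sum>n<N. exp (- s) ^ n * zonal_proj n f x))\<^sup>2)"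
        by (intro tendsto_ennrealI tendsto_power)
      from lim_imp_Liminf[OF sequentially_bot this] show ?case by (rule sym)
    qed
  qed
  also have "\<dots> \<le> liminf (\<lambda>M. \<integral>\<^sup>+x. ?u M x \<partial>sph)"
    by (rule nn_integral_liminf) measurable
  also have "\<dots> \<le> ennreal (exp (- (2 * real N * s)) * (\<integral>x. (f x)\<^sup>2 \<partial>sph))"
    using bd by (intro Liminf_le) auto
  finally show ?thesis .
qed

subsection \<open>The kernel of the fractional integral\<close>

text \<open>For 0 < \<sigma> < 1 and positive \<open>lam T\<close> the integral diverges at
  \<open>t = 1\<close>, where the Bochner integral takes the value 0. On the unit sphere this
  concerns the single point \<open>y = x\<close>, a null set when the ambient dimension is at least
  2.\<close>

definition frac_kernel :: "'a::euclidean_space itself \<Rightarrow> real \<Rightarrow> real \<Rightarrow> real" where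
  "frac_kernel T \<sigma> t = (\<integral>s. poisson_kernel T s t \<partial>gamma_measure \<sigma> (lam T)) / Gamma \<sigma>"

definition frac_op :: "real \<Rightarrow> ('a::euclidean_space \<Rightarrow> 'b::euclidean_space) \<Rightarrow> 'a \<Rightarrow> 'b" where
  "frac_op \<sigma> f x = (\<integral>y. frac_kernel TYPE('a) \<sigma> (x \<bullet> y) *\<^sub>R f y \<partial>sph)"

lemma sigma_finite_gamma_measure: "0 < \<sigma> \<Longrightarrow> 0 < l \<Longrightarrow> sigma_finite_measure (gamma_measure \<sigma> l)"
  using finite_measure_gamma_measure finite_measure.axioms(1) by blast

lemma frac_kernel_nonneg: "0 < \<sigma> \<Longrightarrow> 0 \<le> frac_kernel T \<sigma> t"
proof -
  assume \<sigma>: "0 < \<sigma>"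
  have "AE s in gamma_measure \<sigma> (lam T). 0 \<le> poisson_kernel T s t"
    using AE_gamma_measure_pos by eventually_elim (rule poisson_kernel_nonneg)
  then show ?thesis
    unfolding frac_kernel_def using \<sigma> by (intro divide_nonneg_nonneg integral_nonneg_AE) (simp_all add: Gamma_real_pos less_imp_le)
qed

lemma frac_kernel_measurable:
  fixes T :: "'a::euclidean_space itself"
  assumes "0 < \<sigma>" "0 < lam T" shows "frac_kernel T \<sigma> \<in> borel_measurable borel"
proof -
  interpret sigma_finite_measure "gamma_measure \<sigma> (lam T)" using assms by (rule sigma_finite_gamma_measure)
  show ?thesis unfolding frac_kernel_def[abs_def] by measurable
qed

text \<open>By Tonelli the integration in \<open>x\<close> may be done first, and the Poisson kernel
  has integral 1 in either variable; what remains is the total mass of \<open>gamma_measure\<close>.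
  This one computation yields integrability for almost every \<open>x\<close> as well as the L1
  bound.\<close>

lemma nn_integral_poisson_kernel_poisson_kernel:
  fixes f :: "'a::euclidean_space \<Rightarrow> ennreal"
  assumes D: "3 \<le> DIM('a)" and \<sigma>: "0 < \<sigma>" and [measurable]: "f \<in> borel_measurable borel"
  shows "(\<integral>\<^sup>+x. (\<integral>\<^sup>+s. (\<integral>\<^sup>+y. ennreal (poisson_kernel TYPE('a) s (x \<bullet> y)) * f y \<partial>sph) \<partial>gamma_measure \<sigma> (lam TYPE('a))) \<partial>sph)
    = ennreal (Gamma \<sigma> * lam TYPE('a) powr (- \<sigma>)) * (\<integral>\<^sup>+y. f y \<partial>sph)"
proof -
  let ?l = "lam TYPE('a)"
  have l: "0 < ?l" by (rule lam_pos[OF D])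
  interpret G: sigma_finite_measure "gamma_measure \<sigma> ?l" using \<sigma> l by (rule sigma_finite_gamma_measure)
  interpret P: pair_sigma_finite "sph :: 'a measure" "gamma_measure \<sigma> ?l" ..
  interpret Q: pair_sigma_finite "sph :: 'a measure" "sph :: 'a measure" ..
  have "(\<integral>\<^sup>+x. (\<integral>\<^sup>+s. (\<integral>\<^sup>+y. ennreal (poisson_kernel TYPE('a) s (x \<bullet> y)) * f y \<partial>sph) \<partial>gamma_measure \<sigma> ?l) \<partial>sph)
    = (\<integral>\<^sup>+s. (\<integral>\<^sup>+x. (\<integral>\<^sup>+y. ennreal (poisson_kernel TYPE('a) s (x \<bullet> y)) * f y \<partial>sph) \<partial>sph) \<partial>gamma_measure \<sigma> ?l)"
    by (rule P.Fubini'[symmetric]) measurable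
  also have "\<dots> = (\<integral>\<^sup>+s. (\<integral>\<^sup>+y. f y \<partial>sph) \<partial>gamma_measure \<sigma> ?l)"
  proof (rule nn_integral_cong_AE)
    show "AE s in gamma_measure \<sigma> ?l. (\<integral>\<^sup>+x. (\<integral>\<^sup>+y. ennreal (poisson_kernel TYPE('a) s (x \<bullet> y)) * f y \<partial>sph) \<partial>sph) = (\<integral>\<^sup>+y. f y \<partial>sph)"
      using AE_gamma_measure_pos
    proof eventually_elim
      case (elim s)
      have "(\<integral>\<^sup>+x. (\<integral>\<^sup>+y. ennreal (poisson_kernel TYPE('a) s (x \<bullet> y)) * f y \<partial>sph) \<partial>sph)
        = (\<integral>\<^sup>+y. (\<integral>\<^sup>+x. ennreal (poisson_kernel TYPE('a) s (x \<bullet> y)) * f y \<partial>sph) \<partial>sph)"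
        by (rule Q.Fubini'[symmetric]) measurable
      also have "\<dots> = (\<integral>\<^sup>+y. f y \<partial>sph)"
      proof (rule nn_integral_cong_AE)
        show "AE y in sph. (\<integral>\<^sup>+x. ennreal (poisson_kernel TYPE('a) s (x \<bullet> y)) * f y \<partial>sph) = f y"
          using AE_sph_norm
        proof eventually_elim
          case (elim y)
          have "(\<integral>\<^sup>+x. ennreal (poisson_kernel TYPE('a) s (x \<bullet> y)) * f y \<partial>sph) = (\<integral>\<^sup>+x. ennreal (poisson_kernel TYPE('a) s (y \<bullet> x)) \<partial>sph) * f y"
            by (simp add: nn_integral_multc inner_commute)
          also have "(\<integral>\<^sup>+x. ennreal (poisson_kernel TYPE('a) s (y \<bullet> x)) \<partial>sph) = 1"
            using \<open>0 < s\<close> by (rule nn_integral_poisson_kernel[OF D elim])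
          finally show ?case by simp
        qed
      qed
      finally show ?case .
    qed
  qed
  also have "\<dots> = ennreal (Gamma \<sigma> * ?l powr (- \<sigma>)) * (\<integral>\<^sup>+y. f y \<partial>sph)"
    using nn_integral_gamma_measure_exp[of \<sigma> ?l 0] \<sigma> l by (simp add: mult.commute)
  finally show ?thesis .
qed

text \<open>Fubini holds for almost every \<open>x\<close>: the triple integral of the absolute values is finite.\<close>

lemma AE_integrable_poisson_kernel_pair:
  fixes f :: "'a::euclidean_space \<Rightarrow> real"
  assumes D: "3 \<le> DIM('a)" and \<sigma>: "0 < \<sigma>" and f: "integrable sph f"
  shows "AE x in sph. integrable (gamma_measure \<sigma> (lam TYPE('a)) \<Otimes>\<^sub>M sph) (\<lambda>(s, y). poisson_kernel TYPE('a) s (x \<bullet> y) * f y)"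
proof -
  let ?l = "lam TYPE('a)"
  have l: "0 < ?l" by (rule lam_pos[OF D])
  interpret G: sigma_finite_measure "gamma_measure \<sigma> ?l" using \<sigma> l by (rule sigma_finite_gamma_measure)
  have [measurable]: "f \<in> borel_measurable borel" using borel_measurable_integrable[OF f] by simp
  have "(\<integral>\<^sup>+x. (\<integral>\<^sup>+s. (\<integral>\<^sup>+y. ennreal (poisson_kernel TYPE('a) s (x \<bullet> y)) * ennreal \<bar>f y\<bar> \<partial>sph) \<partial>gamma_measure \<sigma> ?l) \<partial>sph) \<noteq> \<infinity>"
    using f unfolding nn_integral_poisson_kernel_poisson_kernel[OF D \<sigma>, of "\<lambda>y. ennreal \<bar>f y\<bar>", simplified]
    by (simp add: ennreal_mult_eq_top_iff integrable_iff_bounded)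
  then have "AE x in sph. (\<integral>\<^sup>+s. (\<integral>\<^sup>+y. ennreal (poisson_kernel TYPE('a) s (x \<bullet> y)) * ennreal \<bar>f y\<bar> \<partial>sph) \<partial>gamma_measure \<sigma> ?l) \<noteq> \<infinity>"
    by (intro nn_integral_PInf_AE) measurable
  then show ?thesis
  proof eventually_elim
    case (elim x)
    have "(\<integral>\<^sup>+p. ennreal (norm (case p of (s, y) \<Rightarrow> poisson_kernel TYPE('a) s (x \<bullet> y) * f y)) \<partial>(gamma_measure \<sigma> ?l \<Otimes>\<^sub>M sph))
      = (\<integral>\<^sup>+s. (\<integral>\<^sup>+y. ennreal (norm (poisson_kernel TYPE('a) s (x \<bullet> y) * f y)) \<partial>sph) \<partial>gamma_measure \<sigma> ?l)"
      by (subst sph.nn_integral_fst[symmetric]) auto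
    also have "\<dots> = (\<integral>\<^sup>+s. (\<integral>\<^sup>+y. ennreal (poisson_kernel TYPE('a) s (x \<bullet> y)) * ennreal \<bar>f y\<bar> \<partial>sph) \<partial>gamma_measure \<sigma> ?l)"
    proof (rule nn_integral_cong_AE)
      show "AE s in gamma_measure \<sigma> ?l. (\<integral>\<^sup>+y. ennreal (norm (poisson_kernel TYPE('a) s (x \<bullet> y) * f y)) \<partial>sph) = (\<integral>\<^sup>+y. ennreal (poisson_kernel TYPE('a) s (x \<bullet> y)) * ennreal \<bar>f y\<bar> \<partial>sph)"
        using AE_gamma_measure_pos by eventually_elim (simp add: abs_mult poisson_kernel_nonneg ennreal_mult)
    qed
    finally show ?case using elim by (intro integrableI_bounded) (auto simp: less_top)
  qed
qed

text \<open>Subordination: interchanging the integrations in \<open>s\<close> and \<open>y\<close>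
  writes the operator as an average of Poisson integrals. Fubini is available only for almost every
  \<open>x\<close>, hence the form of the statement.\<close>

lemma AE_frac_op_eq:
  fixes f :: "'a::euclidean_space \<Rightarrow> real"
  assumes D: "3 \<le> DIM('a)" and \<sigma>: "0 < \<sigma>" and f: "integrable sph f"
  shows "AE x in sph. integrable sph (\<lambda>y. frac_kernel TYPE('a) \<sigma> (x \<bullet> y) * f y) \<and>
    integrable (gamma_measure \<sigma> (lam TYPE('a))) (\<lambda>s. poisson_integral f s x) \<and>
    Gamma \<sigma> * frac_op \<sigma> f x = (\<integral>s. poisson_integral f s x \<partial>gamma_measure \<sigma> (lam TYPE('a)))"
  using AE_integrable_poisson_kernel_pair[OF D \<sigma> f]
proof eventually_elim
  case (elim x)
  let ?l = "lam TYPE('a)"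
  have l: "0 < ?l" by (rule lam_pos[OF D])
  interpret G: sigma_finite_measure "gamma_measure \<sigma> ?l" using \<sigma> l by (rule sigma_finite_gamma_measure)
  interpret P: pair_sigma_finite "gamma_measure \<sigma> ?l" "sph :: 'a measure" ..
  have g: "0 < Gamma \<sigma>" using \<sigma> by (rule Gamma_real_pos)
  have e: "(\<integral>s. poisson_kernel TYPE('a) s (x \<bullet> y) * f y \<partial>gamma_measure \<sigma> ?l) = Gamma \<sigma> * (frac_kernel TYPE('a) \<sigma> (x \<bullet> y) * f y)" for y
    using g by (simp add: frac_kernel_def)
  have "integrable sph (\<lambda>y. Gamma \<sigma> * (frac_kernel TYPE('a) \<sigma> (x \<bullet> y) * f y))"
    using P.integrable_snd[OF elim] by (simp only: e)
  then have 1: "integrable sph (\<lambda>y. frac_kernel TYPE('a) \<sigma> (x \<bullet> y) * f y)" using g by simp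
  have 2: "integrable (gamma_measure \<sigma> ?l) (\<lambda>s. poisson_integral f s x)"
    using P.integrable_fst[OF elim] by (simp add: poisson_integral_def)
  have "(\<integral>s. poisson_integral f s x \<partial>gamma_measure \<sigma> ?l) = (\<integral>y. (\<integral>s. poisson_kernel TYPE('a) s (x \<bullet> y) * f y \<partial>gamma_measure \<sigma> ?l) \<partial>sph)"
    using P.Fubini_integral[OF elim] by (simp add: poisson_integral_def)
  also have "\<dots> = Gamma \<sigma> * frac_op \<sigma> f x" by (simp only: e frac_op_def real_scaleR_def integral_mult_right_zero)
  finally show ?case using 1 2 by simp
qed

lemma frac_op_measurable:
  fixes f :: "'a::euclidean_space \<Rightarrow> 'b::euclidean_space"
  assumes D: "3 \<le> DIM('a)" and \<sigma>: "0 < \<sigma>" and [measurable]: "f \<in> borel_measurable borel"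
  shows "frac_op \<sigma> f \<in> borel_measurable borel"
proof -
  have [measurable]: "frac_kernel TYPE('a) \<sigma> \<in> borel_measurable borel"
    using \<sigma> lam_pos[OF D] by (rule frac_kernel_measurable)
  show ?thesis unfolding frac_op_def[abs_def] by measurable
qed

text \<open>The error, multiplied by \<open>Gamma \<sigma>\<close>, is the average over
  \<open>s\<close> of the tail of the Poisson series. Cauchy-Schwarz in \<open>s\<close> against 1
  costs the mass Gamma(\<sigma>) l^(-\<sigma>); after Tonelli the tail bound e^(-2Ns) integrates to
  Gamma(\<sigma>) (l + 2N)^(-\<sigma>). The two Gamma factors cancel against the square on the left,
  and the decay in \<open>N\<close> gives convergence of the series.\<close>

lemma nn_integral_frac_op_tail:
  fixes f :: "'a::euclidean_space \<Rightarrow> real"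
  assumes D: "3 \<le> DIM('a)" and \<sigma>: "0 < \<sigma>" and fm: "f \<in> borel_measurable borel" and f2: "integrable sph (\<lambda>x. (f x)\<^sup>2)"
  defines "l \<equiv> lam TYPE('a)"
  shows "(\<integral>\<^sup>+x. ennreal ((frac_op \<sigma> f x - (\<Sum>n<N. (l + real n) powr (- \<sigma>) * zonal_proj n f x))\<^sup>2) \<partial>sph)
    \<le> ennreal (l powr (- \<sigma>) * (l + 2 * real N) powr (- \<sigma>) * (\<integral>x. (f x)\<^sup>2 \<partial>sph))"
proof -
  have l: "0 < l" unfolding l_def by (rule lam_pos[OF D])
  have g: "0 < Gamma \<sigma>" using \<sigma> by (rule Gamma_real_pos)
  have f: "integrable sph f" using fm f2 by (rule integrable_of_square)
  have r: "rpf (zonal_proj n f)" for n using solid_harmonic_rpf[OF solid_harmonic_zonal_proj[OF f]] .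
  note [measurable] = fm rpf_borel[OF r] frac_op_measurable[OF D \<sigma> fm]
  interpret G: sigma_finite_measure "gamma_measure \<sigma> l" using \<sigma> l by (rule sigma_finite_gamma_measure)
  interpret P: pair_sigma_finite "gamma_measure \<sigma> l" "sph :: 'a measure" ..
  define T where "T s x = poisson_integral f s x - (\<Sum>n<N. exp (- s) ^ n * zonal_proj n f x)" for s x
  define S where "S x = (\<Sum>n<N. (l + real n) powr (- \<sigma>) * zonal_proj n f x)" for x
  have Tm [measurable]: "(\<lambda>(s, x). T s x) \<in> borel_measurable (borel \<Otimes>\<^sub>M borel)"
    unfolding T_def by measurable
  have Sm [measurable]: "S \<in> borel_measurable borel" unfolding S_def by measurable
  have ex: "exp (- s) ^ n = exp (- (real n * s))" for s :: real and n
    by (simp add: exp_of_nat_mult[symmetric])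
  have "AE x in sph. ennreal ((Gamma \<sigma> * (frac_op \<sigma> f x - S x))\<^sup>2) \<le>
      ennreal (Gamma \<sigma> * l powr (- \<sigma>)) * (\<integral>\<^sup>+s. ennreal ((T s x)\<^sup>2) \<partial>gamma_measure \<sigma> l)"
    using AE_frac_op_eq[OF D \<sigma> f]
  proof eventually_elim
    case (elim x)
    have it: "integrable (gamma_measure \<sigma> l) (\<lambda>s. exp (- s) ^ n * zonal_proj n f x)" for n
      unfolding ex using has_bochner_integral_gamma_measure_exp(1)[of \<sigma> l "real n"] \<sigma> l by simp
    have ie: "(\<integral>s. exp (- s) ^ n * zonal_proj n f x \<partial>gamma_measure \<sigma> l) = Gamma \<sigma> * (l + real n) powr (- \<sigma>) * zonal_proj n f x" for n
      unfolding ex using has_bochner_integral_gamma_measure_exp(2)[of \<sigma> l "real n"] \<sigma> l by simp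
    have "(\<integral>s. (\<Sum>n<N. exp (- s) ^ n * zonal_proj n f x) \<partial>gamma_measure \<sigma> l) = Gamma \<sigma> * S x"
      by (subst Bochner_Integration.integral_sum, rule it) (simp only: ie S_def sum_distrib_left mult.assoc)
    moreover have iS: "integrable (gamma_measure \<sigma> l) (\<lambda>s. \<Sum>n<N. exp (- s) ^ n * zonal_proj n f x)"
      using it by (intro Bochner_Integration.integrable_sum)
    ultimately have eq: "Gamma \<sigma> * (frac_op \<sigma> f x - S x) = (\<integral>s. T s x \<partial>gamma_measure \<sigma> l)"
      using elim by (simp add: T_def l_def right_diff_distrib)
    have iT: "integrable (gamma_measure \<sigma> l) (\<lambda>s. T s x)"
      unfolding T_def using elim iS by (simp add: l_def)
    have "ennreal ((Gamma \<sigma> * (frac_op \<sigma> f x - S x))\<^sup>2) = (ennreal (norm (\<integral>s. T s x \<partial>gamma_measure \<sigma> l)))\<^sup>2"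
      by (simp add: eq ennreal_power)
    also have "\<dots> \<le> (\<integral>\<^sup>+s. ennreal \<bar>T s x\<bar> * 1 \<partial>gamma_measure \<sigma> l)\<^sup>2"
      using integral_norm_bound_ennreal[OF iT] by (intro power_mono) simp_all
    also have "\<dots> \<le> (\<integral>\<^sup>+s. (ennreal \<bar>T s x\<bar>)\<^sup>2 \<partial>gamma_measure \<sigma> l) * (\<integral>\<^sup>+s. 1\<^sup>2 \<partial>gamma_measure \<sigma> l)"
      by (rule Cauchy_Schwarz_nn_integral) (use borel_measurable_integrable[OF iT] in measurable)
    also have "(\<integral>\<^sup>+s. 1\<^sup>2 \<partial>gamma_measure \<sigma> l) = ennreal (Gamma \<sigma> * l powr (- \<sigma>))"
      using nn_integral_gamma_measure_exp[of \<sigma> l 0] \<sigma> l by simp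
    finally show ?case by (simp add: ennreal_power mult.commute)
  qed
  then have "(\<integral>\<^sup>+x. ennreal ((Gamma \<sigma> * (frac_op \<sigma> f x - S x))\<^sup>2) \<partial>sph)
    \<le> (\<integral>\<^sup>+x. ennreal (Gamma \<sigma> * l powr (- \<sigma>)) * (\<integral>\<^sup>+s. ennreal ((T s x)\<^sup>2) \<partial>gamma_measure \<sigma> l) \<partial>sph)"
    by (rule nn_integral_mono_AE)
  also have "\<dots> = ennreal (Gamma \<sigma> * l powr (- \<sigma>)) * (\<integral>\<^sup>+x. (\<integral>\<^sup>+s. ennreal ((T s x)\<^sup>2) \<partial>gamma_measure \<sigma> l) \<partial>sph)"
    by (rule nn_integral_cmult) measurable
  also have "(\<integral>\<^sup>+x. (\<integral>\<^sup>+s. ennreal ((T s x)\<^sup>2) \<partial>gamma_measure \<sigma> l) \<partial>sph) = (\<integral>\<^sup>+s. (\<integral>\<^sup>+x. ennreal ((T s x)\<^sup>2) \<partial>sph) \<partial>gamma_measure \<sigma> l)"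
    by (rule P.Fubini') measurable
  also have "\<dots> \<le> (\<integral>\<^sup>+s. ennreal (\<integral>x. (f x)\<^sup>2 \<partial>sph) * ennreal (exp (- (2 * real N * s))) \<partial>gamma_measure \<sigma> l)"
  proof (rule nn_integral_mono_AE)
    have "0 \<le> (\<integral>x. (f x)\<^sup>2 \<partial>sph)" by (rule integral_nonneg_AE) simp
    show "AE s in gamma_measure \<sigma> l. (\<integral>\<^sup>+x. ennreal ((T s x)\<^sup>2) \<partial>sph) \<le> ennreal (\<integral>x. (f x)\<^sup>2 \<partial>sph) * ennreal (exp (- (2 * real N * s)))"
      using AE_gamma_measure_pos
    proof eventually_elim
      case (elim s)
      then show ?case
        using nn_integral_poisson_kernel_tail[OF D fm f2 elim, of N] \<open>0 \<le> (\<integral>x. (f x)\<^sup>2 \<partial>sph)\<close>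
        by (simp add: T_def ennreal_mult[symmetric] mult.commute)
    qed
  qed
  also have "\<dots> = ennreal (\<integral>x. (f x)\<^sup>2 \<partial>sph) * ennreal (Gamma \<sigma> * (l + 2 * real N) powr (- \<sigma>))"
    using nn_integral_gamma_measure_exp[of \<sigma> l "2 * real N"] \<sigma> l by (subst nn_integral_cmult) simp_all
  finally have fin: "(\<integral>\<^sup>+x. ennreal ((Gamma \<sigma> * (frac_op \<sigma> f x - S x))\<^sup>2) \<partial>sph)
    \<le> ennreal (Gamma \<sigma> * l powr (- \<sigma>)) * (ennreal (\<integral>x. (f x)\<^sup>2 \<partial>sph) * ennreal (Gamma \<sigma> * (l + 2 * real N) powr (- \<sigma>)))"
    by (simp add: mult_left_mono)
  have nf: "0 \<le> (\<integral>x. (f x)\<^sup>2 \<partial>sph)" by (rule integral_nonneg_AE) simp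
  have "(\<integral>\<^sup>+x. ennreal ((frac_op \<sigma> f x - S x)\<^sup>2) \<partial>sph)
    = (\<integral>\<^sup>+x. ennreal (1 / (Gamma \<sigma>)\<^sup>2) * ennreal ((Gamma \<sigma> * (frac_op \<sigma> f x - S x))\<^sup>2) \<partial>sph)"
    using g by (intro nn_integral_cong) (simp add: ennreal_mult[symmetric] power_mult_distrib)
  also have "\<dots> = ennreal (1 / (Gamma \<sigma>)\<^sup>2) * (\<integral>\<^sup>+x. ennreal ((Gamma \<sigma> * (frac_op \<sigma> f x - S x))\<^sup>2) \<partial>sph)"
    by (rule nn_integral_cmult) measurable
  also have "\<dots> \<le> ennreal (1 / (Gamma \<sigma>)\<^sup>2) * (ennreal (Gamma \<sigma> * l powr (- \<sigma>)) * (ennreal (\<integral>x. (f x)\<^sup>2 \<partial>sph) * ennreal (Gamma \<sigma> * (l + 2 * real N) powr (- \<sigma>))))"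
    by (rule mult_left_mono[OF fin]) simp
  also have "\<dots> = ennreal (l powr (- \<sigma>) * (l + 2 * real N) powr (- \<sigma>) * (\<integral>x. (f x)\<^sup>2 \<partial>sph))"
    using g nf by (simp add: ennreal_mult[symmetric] power2_eq_square mult_ac)
  finally show ?thesis by (simp add: S_def)
qed

subsection \<open>Uniqueness of the continuous extension\<close>

lemma L2_functions_diff:
  assumes "f \<in> L2_functions M" "g \<in> L2_functions M"
  shows "(\<lambda>x. f x - g x) \<in> L2_functions M"
proof -
  have [measurable]: "f \<in> borel_measurable M" "g \<in> borel_measurable M" using assms by (auto simp: L2_functions_def)
  have "integrable M (\<lambda>x. (cmod (f x - g x))\<^sup>2)"
  proof (rule Bochner_Integration.integrable_bound)
    show "integrable M (\<lambda>x. 2 * (cmod (f x))\<^sup>2 + 2 * (cmod (g x))\<^sup>2)"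
      using assms by (simp add: L2_functions_def)
    have "(cmod (a - b))\<^sup>2 \<le> 2 * (cmod a)\<^sup>2 + 2 * (cmod b)\<^sup>2" for a b
    proof -
      have "(cmod (a - b))\<^sup>2 \<le> (cmod a + cmod b)\<^sup>2" by (intro power_mono norm_triangle_ineq4) simp
      also have "\<dots> \<le> 2 * (cmod a)\<^sup>2 + 2 * (cmod b)\<^sup>2"
        using sum_squares_bound[of "cmod a" "cmod b"] by (simp add: power2_sum)
      finally show ?thesis .
    qed
    then show "AE x in M. norm ((cmod (f x - g x))\<^sup>2) \<le> norm (2 * (cmod (f x))\<^sup>2 + 2 * (cmod (g x))\<^sup>2)"
      by (auto intro!: AE_I2)
  qed measurable
  then show ?thesis by (simp add: L2_functions_def)
qed

lemma L2_limit_unique: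
  assumes g: "g \<in> L2_functions M" and h: "h \<in> L2_functions M" and s: "\<And>N. s N \<in> L2_functions M"
    and lg: "(\<lambda>N. LINT x|M. (cmod (g x - s N x))\<^sup>2) \<longlonglongrightarrow> 0"
    and lh: "(\<lambda>N::nat. LINT x|M. (cmod (h x - s N x))\<^sup>2) \<longlonglongrightarrow> 0"
  shows "AE x in M. g x = h x"
proof -
  have i: "integrable M (\<lambda>x. (cmod (u x - v x))\<^sup>2)" if "u \<in> L2_functions M" "v \<in> L2_functions M" for u v
    using L2_functions_diff[OF that] by (simp add: L2_functions_def)
  have le: "(LINT x|M. (cmod (g x - h x))\<^sup>2) \<le> 2 * (LINT x|M. (cmod (g x - s N x))\<^sup>2) + 2 * (LINT x|M. (cmod (h x - s N x))\<^sup>2)" for N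
  proof -
    have "(LINT x|M. (cmod (g x - h x))\<^sup>2) \<le> (LINT x|M. 2 * (cmod (g x - s N x))\<^sup>2 + 2 * (cmod (h x - s N x))\<^sup>2)"
    proof (rule integral_mono)
      have "(cmod (a - b))\<^sup>2 \<le> 2 * (cmod (a - c))\<^sup>2 + 2 * (cmod (b - c))\<^sup>2" for a b c
      proof -
        have "cmod (a - b) \<le> cmod (a - c) + cmod (b - c)"
          using norm_triangle_ineq4[of "a - c" "b - c"] by simp
        then have "(cmod (a - b))\<^sup>2 \<le> (cmod (a - c) + cmod (b - c))\<^sup>2" by (rule power_mono) simp
        also have "\<dots> \<le> 2 * (cmod (a - c))\<^sup>2 + 2 * (cmod (b - c))\<^sup>2"
          using sum_squares_bound[of "cmod (a - c)" "cmod (b - c)"] by (simp add: power2_sum)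
        finally show ?thesis .
      qed
      then show "(cmod (g x - h x))\<^sup>2 \<le> 2 * (cmod (g x - s N x))\<^sup>2 + 2 * (cmod (h x - s N x))\<^sup>2" for x .
    qed (use g h s i in auto)
    also have "\<dots> = 2 * (LINT x|M. (cmod (g x - s N x))\<^sup>2) + 2 * (LINT x|M. (cmod (h x - s N x))\<^sup>2)"
      using g h s i by simp
    finally show ?thesis .
  qed
  have "(\<lambda>N. 2 * (LINT x|M. (cmod (g x - s N x))\<^sup>2) + 2 * (LINT x|M. (cmod (h x - s N x))\<^sup>2)) \<longlonglongrightarrow> 2 * 0 + 2 * 0"
    by (intro tendsto_intros lg lh)
  then have "(LINT x|M. (cmod (g x - h x))\<^sup>2) \<le> 0"
    using le by (intro LIMSEQ_le_const[of _ 0]) auto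
  moreover have "0 \<le> (LINT x|M. (cmod (g x - h x))\<^sup>2)" by (rule integral_nonneg_AE) simp
  ultimately have "(LINT x|M. (cmod (g x - h x))\<^sup>2) = 0" by simp
  then have "AE x in M. (cmod (g x - h x))\<^sup>2 = 0"
    using integral_nonneg_eq_0_iff_AE[OF i[OF g h]] by simp
  then show ?thesis by eventually_elim simp
qed

text \<open>Truncations of \<open>f\<close> to the set where it is at most \<open>k\<close> in
  modulus are bounded, hence in L2 of a finite measure, and converge to \<open>f\<close> in L1. Both
  extensions agree with \<open>T\<close> on them, and continuity carries the agreement to
  \<open>f\<close>.\<close>

lemma continuous_L1_extension_unique:
  fixes M :: "'b measure"
  assumes M: "finite_measure M"
    and S: "continuous_L1_extension M T S" and S': "continuous_L1_extension M T S'"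
    and f: "integrable M f"
  shows "AE x in M. S f x = S' f x"
proof -
  interpret finite_measure M by (rule M)
  have [measurable]: "f \<in> borel_measurable M" using f by simp
  define F where "F k x = (if cmod (f x) \<le> real k then f x else 0)" for k x
  have [measurable]: "F k \<in> borel_measurable M" for k unfolding F_def by measurable
  have iF: "integrable M (F k)" for k
    by (rule integrable_const_bound[where B="real k"]) (auto simp: F_def)
  have FL2: "F k \<in> L2_functions M" for k
    unfolding L2_functions_def
    by (auto intro!: integrable_const_bound[where B="(real k)\<^sup>2"] power_mono simp: F_def)
  have lim: "(\<lambda>k. LINT x|M. cmod (F k x - f x)) \<longlonglongrightarrow> (LINT x|M. 0)"
  proof (rule integral_dominated_convergence)
    show "integrable M (\<lambda>x. cmod (f x))" using f by simp
    show "AE x in M. (\<lambda>k. cmod (F k x - f x)) \<longlonglongrightarrow> 0"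
    proof (rule AE_I2)
      fix x
      obtain n where n: "cmod (f x) \<le> real n" using real_arch_simple by blast
      have "\<forall>\<^sub>F k in sequentially. cmod (F k x - f x) = 0"
        using eventually_ge_at_top[of n] by eventually_elim (use n in \<open>auto simp: F_def\<close>)
      then show "(\<lambda>k. cmod (F k x - f x)) \<longlonglongrightarrow> 0" by (rule tendsto_eventually)
    qed
    show "AE x in M. norm (cmod (F k x - f x)) \<le> cmod (f x)" for k by (auto simp: F_def)
  qed (auto)
  have lim': "(\<lambda>k. LINT x|M. cmod (R (F k) x - R f x)) \<longlonglongrightarrow> 0" if "continuous_L1_extension M T R" for R
    using that iF f lim unfolding continuous_L1_extension_def by auto
  have i: "integrable M (R g)" if "continuous_L1_extension M T R" "integrable M g" for R g
    using that unfolding continuous_L1_extension_def by auto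
  have ae: "AE x in M. S (F k) x = S' (F k) x" for k
  proof -
    have "AE x in M. S (F k) x = T (F k) x" "AE x in M. S' (F k) x = T (F k) x"
      using S S' FL2 unfolding continuous_L1_extension_def by auto
    then show ?thesis by eventually_elim simp
  qed
  have le: "(LINT x|M. cmod (S f x - S' f x)) \<le> (LINT x|M. cmod (S (F k) x - S f x)) + (LINT x|M. cmod (S' (F k) x - S' f x))" for k
  proof -
    have i1: "integrable M (\<lambda>x. cmod (S (F k) x - S f x))" "integrable M (\<lambda>x. cmod (S' (F k) x - S' f x))"
      using i[OF S iF] i[OF S f] i[OF S' iF] i[OF S' f] by auto
    have "(LINT x|M. cmod (S f x - S' f x)) \<le> (LINT x|M. cmod (S (F k) x - S f x) + cmod (S' (F k) x - S' f x))"
    proof (rule integral_mono_AE)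
      show "AE x in M. cmod (S f x - S' f x) \<le> cmod (S (F k) x - S f x) + cmod (S' (F k) x - S' f x)"
        using ae[of k]
      proof eventually_elim
        case (elim x)
        have "S f x - S' f x = (S' (F k) x - S' f x) - (S (F k) x - S f x)" using elim by simp
        then show ?case using norm_triangle_ineq4[of "S' (F k) x - S' f x" "S (F k) x - S f x"] by simp
      qed
    qed (use i1 i[OF S f] i[OF S' f] in auto)
    also have "\<dots> = (LINT x|M. cmod (S (F k) x - S f x)) + (LINT x|M. cmod (S' (F k) x - S' f x))"
      using i1 by simp
    finally show ?thesis .
  qed
  have "(\<lambda>k. (LINT x|M. cmod (S (F k) x - S f x)) + (LINT x|M. cmod (S' (F k) x - S' f x))) \<longlonglongrightarrow> 0 + 0"
    by (intro tendsto_add lim' S S')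
  then have "(LINT x|M. cmod (S f x - S' f x)) \<le> 0"
    using le by (intro LIMSEQ_le_const[of _ 0]) auto
  moreover have "0 \<le> (LINT x|M. cmod (S f x - S' f x))" by (rule integral_nonneg_AE) simp
  ultimately have "(LINT x|M. cmod (S f x - S' f x)) = 0" by simp
  then have "AE x in M. cmod (S f x - S' f x) = 0"
    using integral_nonneg_eq_0_iff_AE[of M "\<lambda>x. cmod (S f x - S' f x)"] i[OF S f] i[OF S' f] by simp
  then show ?thesis by eventually_elim simp
qed

text \<open>\<open>SOME\<close> conceals both the L2 sum and its extension. In each case
  \<open>K\<close> is exhibited as a witness, so that the chosen object has the defining property as
  well, and uniqueness up to null sets identifies it with \<open>K\<close>. The measure, the spaces
  and the eigenvalues are kept abstract so that the sphere and the projective space share the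
  argument.\<close>

lemma fractional_integral_AE_eq:
  fixes M :: "'b measure"
  assumes M: "finite_measure M"
    and Kint: "\<And>f. integrable M f \<Longrightarrow> integrable M (K f)"
    and KL1: "\<And>f g. integrable M f \<Longrightarrow> integrable M g \<Longrightarrow>
      (LINT x|M. cmod (K f x - K g x)) \<le> C * (LINT x|M. cmod (f x - g x))"
    and Proj2: "\<And>f n. f \<in> L2_functions M \<Longrightarrow> Proj M (H n) f \<in> L2_functions M"
    and KL2: "\<And>f. f \<in> L2_functions M \<Longrightarrow> K f \<in> L2_functions M"
    and Klim: "\<And>f. f \<in> L2_functions M \<Longrightarrow>
      (\<lambda>N. LINT x|M. (cmod (K f x - (\<Sum>n<N. Proj M (H n) f x /\<^sub>R (\<mu> n powr \<sigma>))))\<^sup>2) \<longlonglongrightarrow> 0"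
    and f: "integrable M f"
  shows "AE x in M. fractional_integral M H \<mu> \<sigma> f x = K f x"
proof -
  let ?s = "\<lambda>f N x. \<Sum>n<N. Proj M (H n) f x /\<^sub>R (\<mu> n powr \<sigma>)"
  have scale: "(\<lambda>x. g x /\<^sub>R c) \<in> L2_functions M" if "g \<in> L2_functions M" for g and c :: real
    using that by (auto simp: L2_functions_def power_mult_distrib)
  have s: "?s f N \<in> L2_functions M" if "f \<in> L2_functions M" for f N
  proof (induction N)
    case 0
    show ?case by (simp add: L2_functions_def)
  next
    case (Suc N)
    have "(\<lambda>x. Proj M (H N) f x /\<^sub>R (- (\<mu> N powr \<sigma>))) \<in> L2_functions M"
      by (rule scale[OF Proj2[OF that]])
    from L2_functions_diff[OF Suc this] show ?case by simp
  qed
  have T: "AE x in M. K f x = fractional_integral_L2 M H \<mu> \<sigma> f x" if f: "f \<in> L2_functions M" for f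
  proof -
    have "fractional_integral_L2 M H \<mu> \<sigma> f \<in> L2_functions M \<and>
      (\<lambda>N. LINT x|M. (cmod (fractional_integral_L2 M H \<mu> \<sigma> f x - ?s f N x))\<^sup>2) \<longlonglongrightarrow> 0"
      unfolding fractional_integral_L2_def
      by (rule someI[of _ "K f"]) (use KL2[OF f] Klim[OF f] in auto)
    then show ?thesis
      using L2_limit_unique[OF KL2[OF f] _ s[OF f] Klim[OF f]] by blast
  qed
  have "continuous_L1_extension M (fractional_integral_L2 M H \<mu> \<sigma>) K"
    unfolding continuous_L1_extension_def
  proof (intro conjI allI impI ballI)
    fix F f assume *: "(\<forall>k. integrable M (F k)) \<and> integrable M f \<and> (\<lambda>k. LINT x|M. cmod (F k x - f x)) \<longlonglongrightarrow> 0"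
    show "(\<lambda>k::nat. LINT x|M. cmod (K (F k) x - K f x)) \<longlonglongrightarrow> 0"
    proof (rule Lim_null_comparison)
      show "\<forall>\<^sub>F k in sequentially. norm (LINT x|M. cmod (K (F k) x - K f x)) \<le> C * (LINT x|M. cmod (F k x - f x))"
        using KL1 * by (auto simp: integral_nonneg_AE)
      show "(\<lambda>k. C * (LINT x|M. cmod (F k x - f x))) \<longlonglongrightarrow> 0"
        using tendsto_mult_right_zero * by blast
    qed
  qed (use Kint T in auto)
  moreover from this have "continuous_L1_extension M (fractional_integral_L2 M H \<mu> \<sigma>) (fractional_integral M H \<mu> \<sigma>)"
    unfolding fractional_integral_def
    by (rule someI[of "continuous_L1_extension M (fractional_integral_L2 M H \<mu> \<sigma>)"])
  ultimately show ?thesis using continuous_L1_extension_unique[OF M _ _ f] by blast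
qed

subsection \<open>The fractional integral on the sphere\<close>

text \<open>A function measurable for \<open>surface_measure\<close> may be arbitrary off the
  sphere; extension by zero makes it Borel measurable on the whole space, as integration against
  \<open>sph\<close> requires.\<close>

definition sphere_part :: "('a::euclidean_space \<Rightarrow> complex) \<Rightarrow> 'a \<Rightarrow> complex" where
  "sphere_part f x = (if x \<in> sphere 0 1 then f x else 0)"

lemma sphere_part_sphere: "norm x = 1 \<Longrightarrow> sphere_part f x = f x"
  by (simp add: sphere_part_def)

lemma measurable_sphere_part:
  assumes "f \<in> borel_measurable surface_measure" shows "sphere_part f \<in> borel_measurable borel"
proof -
  have "f \<in> borel_measurable (restrict_space borel (sphere 0 1))"
    using assms by (simp cong: measurable_cong_sets add: sets_surface_measure)
  then have "(\<lambda>x. indicator (sphere 0 1) x *\<^sub>R f x) \<in> borel_measurable borel"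
    by (subst (asm) borel_measurable_restrict_space_iff) auto
  also have "(\<lambda>x. indicator (sphere 0 1) x *\<^sub>R f x) = sphere_part f"
    by (auto simp: sphere_part_def indicator_def)
  finally show ?thesis .
qed

lemma integral_sph_surface:
  fixes g :: "'a::euclidean_space \<Rightarrow> 'b::euclidean_space"
  assumes g: "g \<in> borel_measurable borel" and fg: "\<And>x. norm x = 1 \<Longrightarrow> f x = g x"
  shows "(\<integral>x. f x \<partial>surface_measure) = (\<integral>x. g x \<partial>sph)"
    and "integrable surface_measure f \<longleftrightarrow> integrable sph g"
proof -
  have "(\<integral>x. f x \<partial>surface_measure) = (\<integral>x. g x \<partial>surface_measure)"
    by (rule Bochner_Integration.integral_cong) (auto simp: fg)
  then show "(\<integral>x. f x \<partial>surface_measure) = (\<integral>x. g x \<partial>sph)"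
    unfolding sph_def by (simp add: integral_distr[OF measurable_ident_surface_measure g])
  have "integrable surface_measure f \<longleftrightarrow> integrable surface_measure g"
    by (rule Bochner_Integration.integrable_cong) (auto simp: fg)
  then show "integrable surface_measure f \<longleftrightarrow> integrable sph g"
    unfolding sph_def by (simp add: integrable_distr_eq[OF measurable_ident_surface_measure g])
qed

lemma AE_surface_measure: "AE x in sph. P x \<Longrightarrow> AE x in surface_measure. P x"
  unfolding sph_def by (rule AE_distrD[OF measurable_ident_surface_measure])

definition complex_zonal_proj :: "nat \<Rightarrow> ('a::euclidean_space \<Rightarrow> complex) \<Rightarrow> 'a \<Rightarrow> complex" where
  "complex_zonal_proj n f x = Complex (zonal_proj n (\<lambda>x. Re (f x)) x) (zonal_proj n (\<lambda>x. Im (f x)) x)"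

section \<open>Complex spherical harmonics and orthogonal projection\<close>

lemma vector_derivative_Complex_line:
  assumes "rpf p" "rpf q"
  shows "vector_derivative (\<lambda>s. Complex (p (x + s *\<^sub>R b)) (q (x + s *\<^sub>R b))) (at t)
    = Complex (dir_deriv b p (x + t *\<^sub>R b)) (dir_deriv b q (x + t *\<^sub>R b))"
  by (rule vector_derivative_at)
     (auto simp: has_vector_derivative_complex_iff intro!: rpf_line assms)

lemma laplacian_Complex:
  assumes "rpf p" "rpf q"
  shows "laplacian (\<lambda>x. Complex (p x) (q x)) x = Complex (real_laplacian p x) (real_laplacian q x)"
proof -
  have "laplacian (\<lambda>x. Complex (p x) (q x)) x = (\<Sum>b\<in>Basis. Complex (dir_deriv b (dir_deriv b p) x) (dir_deriv b (dir_deriv b q) x))"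
    unfolding laplacian_def vector_derivative_Complex_line[OF assms]
    by (simp add: vector_derivative_Complex_line rpf_dir_deriv assms)
  then show ?thesis by (simp add: complex_eq_iff real_laplacian_def)
qed

lemma homogeneous_harmonic_polynomial_ComplexI:
  assumes p: "solid_harmonic n p" "\<And>c x. p (c *\<^sub>R x) = c ^ n * p x" and q: "solid_harmonic n q" "\<And>c x. q (c *\<^sub>R x) = c ^ n * q x"
  shows "homogeneous_harmonic_polynomial n (\<lambda>x. Complex (p x) (q x))"
  unfolding homogeneous_harmonic_polynomial_def
proof (intro conjI allI)
  have r: "rpf p" "rpf q" using solid_harmonic_rpf[OF p(1)] solid_harmonic_rpf[OF q(1)] by auto
  show "polynomial_function (\<lambda>x. Complex (p x) (q x))"
    unfolding polynomial_function_iff_Basis_inner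
    using r by (auto simp: Basis_complex_def inner_complex_def)
  show "Complex (p (c *\<^sub>R x)) (q (c *\<^sub>R x)) = c ^ n *\<^sub>R Complex (p x) (q x)" for c x
    by (simp add: p q complex_eq_iff)
  show "laplacian (\<lambda>x. Complex (p x) (q x)) x = 0" for x
    using solid_harmonic_real_laplacian[OF p(1)] solid_harmonic_real_laplacian[OF q(1)] by (simp add: laplacian_Complex[OF r] complex_eq_iff)
qed

lemma homogeneous_harmonic_polynomialD:
  assumes "homogeneous_harmonic_polynomial n u"
  shows "solid_harmonic n (\<lambda>x. Re (u x))" "solid_harmonic n (\<lambda>x. Im (u x))"
proof -
  have u: "polynomial_function u" "\<And>c x. u (c *\<^sub>R x) = c ^ n *\<^sub>R u x" "\<And>x. laplacian u x = 0"
    using assms by (auto simp: homogeneous_harmonic_polynomial_def)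
  have r: "rpf (\<lambda>x. Re (u x))" "rpf (\<lambda>x. Im (u x))"
    using u(1) unfolding polynomial_function_iff_Basis_inner
    by (auto simp: Basis_complex_def inner_complex_def)
  have "Complex (real_laplacian (\<lambda>x. Re (u x)) x) (real_laplacian (\<lambda>x. Im (u x)) x) = 0" for x
    using laplacian_Complex[OF r, of x] u(3)[of x] by simp
  then show "solid_harmonic n (\<lambda>x. Re (u x))" "solid_harmonic n (\<lambda>x. Im (u x))"
    using r u(2) by (auto simp: solid_harmonic_def complex_eq_iff)
qed

text \<open>Self-adjointness moves the projection from \<open>f\<close> to \<open>g\<close>, which
  it reproduces.\<close>

lemma zonal_proj_project:
  fixes f :: "'a::euclidean_space \<Rightarrow> real"
  assumes D: "3 \<le> DIM('a)" and f: "integrable sph f" and g: "solid_harmonic n g"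
  shows "integrable sph (\<lambda>x. (f x - zonal_proj n f x) * g x)" "(\<integral>x. (f x - zonal_proj n f x) * g x \<partial>sph) = 0"
proof -
  have rg: "rpf g" using g by (rule solid_harmonic_rpf)
  have ig: "integrable sph g" using rg by (rule integrable_sph_rpf)
  have [measurable]: "f \<in> borel_measurable borel" using borel_measurable_integrable[OF f] by simp
  have [measurable]: "g \<in> borel_measurable borel" using rg by (rule rpf_borel)
  have [measurable]: "zonal_proj n g \<in> borel_measurable borel"
    using solid_harmonic_rpf[OF solid_harmonic_zonal_proj[OF ig]] by (rule rpf_borel)
  have i1: "integrable sph (\<lambda>x. f x * g x)"
    using integrable_sph_mult_continuous[OF rpf_continuous[OF rg] f] by (simp add: mult.commute)
  note i2 = zonal_proj_selfadjoint(2)[OF f ig, of n]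
  show "integrable sph (\<lambda>x. (f x - zonal_proj n f x) * g x)"
    using i1 i2 by (simp add: left_diff_distrib)
  have "(\<integral>x. (f x - zonal_proj n f x) * g x \<partial>sph) = (\<integral>x. f x * g x \<partial>sph) - (\<integral>x. zonal_proj n f x * g x \<partial>sph)"
    using i1 i2 by (simp add: left_diff_distrib)
  also have "(\<integral>x. zonal_proj n f x * g x \<partial>sph) = (\<integral>x. f x * zonal_proj n g x \<partial>sph)"
    by (rule zonal_proj_selfadjoint(1)[OF f ig])
  also have "\<dots> = (\<integral>x. f x * g x \<partial>sph)"
    by (rule integral_cong_AE) (use AE_sph_norm in \<open>auto elim!: eventually_mono simp: zonal_proj_solid_harmonic[OF D g]\<close>)
  finally show "(\<integral>x. (f x - zonal_proj n f x) * g x \<partial>sph) = 0" by simp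
qed

text \<open>By symmetry of the kernel the pole may be taken at \<open>x\<close> and the variable at
  \<open>y\<close>. The value at \<open>x\<close> thus becomes an inner product of \<open>f\<close>
  with a harmonic of degree \<open>n\<close>, and is determined by such inner products.\<close>

lemma zonal_proj_eq_gegenbauer_solid:
  fixes f :: "'a::euclidean_space \<Rightarrow> real"
  assumes f: "integrable sph f" and x: "norm x = 1"
  shows "zonal_proj n f x = (real n + lam TYPE('a)) / (lam TYPE('a) * sphere_area TYPE('a)) * (\<integral>y. gegenbauer_solid (lam TYPE('a)) x n y * f y \<partial>sph)"
proof -
  have [measurable]: "f \<in> borel_measurable borel" using borel_measurable_integrable[OF f] by simp
  have [measurable]: "gegenbauer_solid (lam TYPE('a)) x n \<in> borel_measurable borel" using rpf_gegenbauer_solid by (rule rpf_borel)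
  have "zonal_proj n f x = (\<integral>y. (real n + lam TYPE('a)) / (lam TYPE('a) * sphere_area TYPE('a)) * (gegenbauer_solid (lam TYPE('a)) x n y * f y) \<partial>sph)"
    unfolding zonal_proj_sphere[OF f x]
  proof (rule integral_cong_AE)
    show "AE y in sph. zonal TYPE('a) n (x \<bullet> y) * f y = (real n + lam TYPE('a)) / (lam TYPE('a) * sphere_area TYPE('a)) * (gegenbauer_solid (lam TYPE('a)) x n y * f y)"
      using AE_sph_norm by eventually_elim (simp add: gegenbauer_solid_sphere zonal_def)
  qed measurable
  then show ?thesis by (simp only: integral_mult_right_zero)
qed

text \<open>The characterisation behind \<open>THE\<close> in \<open>Proj\<close>. Elements of
  \<open>spherical_harmonics\<close> are \<open>undefined\<close> off the sphere, so agreement on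
  the sphere is agreement as functions. Existence is \<open>zonal_proj_project\<close> applied to
  real and imaginary parts.\<close>

lemma spherical_harmonics_projection_iff:
  fixes f :: "'a::euclidean_space \<Rightarrow> complex"
  assumes D: "3 \<le> DIM('a)" and f: "integrable surface_measure f"
  shows "h \<in> spherical_harmonics n \<and> (\<forall>g\<in>spherical_harmonics n. (LINT x|surface_measure. (f x - h x) * cnj (g x)) = 0)
    \<longleftrightarrow> h = restrict (complex_zonal_proj n (sphere_part f)) (sphere 0 1)"
proof -
  have fm: "sphere_part f \<in> borel_measurable borel" using f by (intro measurable_sphere_part) auto
  have fi: "integrable sph (sphere_part f)" using f integral_sph_surface(2)[OF fm, of f] by (simp add: sphere_part_sphere)
  define fr where "fr x = Re (sphere_part f x)" for x
  define fj where "fj x = Im (sphere_part f x)" for x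
  have i: "integrable sph fr" "integrable sph fj" unfolding fr_def[abs_def] fj_def[abs_def] using fi by auto
  have fm' [measurable]: "fr \<in> borel_measurable borel" "fj \<in> borel_measurable borel"
    using fm by (auto simp: fr_def[abs_def] fj_def[abs_def])
  note h = solid_harmonic_zonal_proj[OF i(1)] solid_harmonic_zonal_proj[OF i(2)]
  have Z: "complex_zonal_proj n (sphere_part f) = (\<lambda>x. Complex (zonal_proj n fr x) (zonal_proj n fj x))"
    by (simp add: complex_zonal_proj_def fr_def[abs_def] fj_def[abs_def] fun_eq_iff)
  have zh: "homogeneous_harmonic_polynomial n (complex_zonal_proj n (sphere_part f))"
    unfolding Z by (intro homogeneous_harmonic_polynomial_ComplexI h zonal_proj_scaleR)
  have 1: "restrict (complex_zonal_proj n (sphere_part f)) (sphere 0 1) \<in> spherical_harmonics n \<and>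
    (\<forall>g\<in>spherical_harmonics n. (LINT x|surface_measure. (f x - restrict (complex_zonal_proj n (sphere_part f)) (sphere 0 1) x) * cnj (g x)) = 0)"
  proof (intro conjI ballI)
    show "restrict (complex_zonal_proj n (sphere_part f)) (sphere 0 1) \<in> spherical_harmonics n"
      using zh by (auto simp: spherical_harmonics_def)
    fix g :: "'a \<Rightarrow> complex" assume "g \<in> spherical_harmonics n"
    then obtain u where u: "homogeneous_harmonic_polynomial n u" "g = restrict u (sphere 0 1)"
      by (auto simp: spherical_harmonics_def)
    note hu = homogeneous_harmonic_polynomialD[OF u(1)]
    have [measurable]: "(\<lambda>x. Re (u x)) \<in> borel_measurable borel" "(\<lambda>x. Im (u x)) \<in> borel_measurable borel"
      "zonal_proj n fr \<in> borel_measurable borel" "zonal_proj n fj \<in> borel_measurable borel"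
      using hu h by (auto intro: rpf_borel solid_harmonic_rpf)
    let ?A = "\<lambda>x. fr x - zonal_proj n fr x" and ?B = "\<lambda>x. fj x - zonal_proj n fj x"
    let ?R = "\<lambda>x. ?A x * Re (u x) + ?B x * Im (u x)" and ?I = "\<lambda>x. ?B x * Re (u x) - ?A x * Im (u x)"
    have "(LINT x|surface_measure. (f x - restrict (complex_zonal_proj n (sphere_part f)) (sphere 0 1) x) * cnj (g x))
      = (LINT x|sph. complex_of_real (?R x) + \<i> * complex_of_real (?I x))"
    proof (rule integral_sph_surface(1))
      show "(f x - restrict (complex_zonal_proj n (sphere_part f)) (sphere 0 1) x) * cnj (g x) = complex_of_real (?R x) + \<i> * complex_of_real (?I x)"
        if "norm x = 1" for x
        using that u(2) by (simp add: complex_eq_iff Z fr_def fj_def sphere_part_sphere algebra_simps)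
    qed measurable
    also have "\<dots> = complex_of_real (LINT x|sph. ?R x) + \<i> * complex_of_real (LINT x|sph. ?I x)"
      using zonal_proj_project(1)[OF D i(1) hu(1)] zonal_proj_project(1)[OF D i(1) hu(2)]
        zonal_proj_project(1)[OF D i(2) hu(1)] zonal_proj_project(1)[OF D i(2) hu(2)]
      by (subst Bochner_Integration.integral_add) (simp_all del: of_real_add of_real_diff of_real_mult)
    also have "\<dots> = 0"
      using zonal_proj_project[OF D i(1) hu(1)] zonal_proj_project[OF D i(1) hu(2)]
        zonal_proj_project[OF D i(2) hu(1)] zonal_proj_project[OF D i(2) hu(2)] by simp
    finally show "(LINT x|surface_measure. (f x - restrict (complex_zonal_proj n (sphere_part f)) (sphere 0 1) x) * cnj (g x)) = 0" .
  qed
  have 2: "h' = restrict (complex_zonal_proj n (sphere_part f)) (sphere 0 1)" if h': "h' \<in> spherical_harmonics n \<and> (\<forall>g\<in>spherical_harmonics n. (LINT x|surface_measure. (f x - h' x) * cnj (g x)) = 0)" for h'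
  proof -
    from h' obtain v where v: "homogeneous_harmonic_polynomial n v" "h' = restrict v (sphere 0 1)"
      by (auto simp: spherical_harmonics_def)
    note hv = homogeneous_harmonic_polynomialD[OF v(1)]
    define vr where "vr x = Re (v x)" for x
    define vj where "vj x = Im (v x)" for x
    have hv': "solid_harmonic n vr" "solid_harmonic n vj" using hv by (simp_all add: vr_def[abs_def] vj_def[abs_def])
    have iv: "integrable sph vr" "integrable sph vj" using hv' by (auto intro: integrable_sph_rpf solid_harmonic_rpf)
    have [measurable]: "vr \<in> borel_measurable borel" "vj \<in> borel_measurable borel"
      using hv' by (auto intro: rpf_borel solid_harmonic_rpf)
    have "complex_zonal_proj n (sphere_part f) x = v x" if x: "norm x = 1" for x
    proof -
      \<comment> \<open>Uniqueness at the point \<open>x\<close>: orthogonality tested against the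
        zonal harmonic with pole \<open>x\<close> says that \<open>f\<close> and the competitor have
        the same zonal projection at \<open>x\<close>, and the competitor is its own
        projection.\<close>
      let ?g = "gegenbauer_solid (lam TYPE('a)) x n"
      have gm [measurable]: "?g \<in> borel_measurable borel" using rpf_gegenbauer_solid by (rule rpf_borel)
      have "homogeneous_harmonic_polynomial n (\<lambda>y. Complex (?g y) 0)"
        by (intro homogeneous_harmonic_polynomial_ComplexI solid_harmonic_gegenbauer_solid x gegenbauer_solid_scaleR)
           (auto simp: solid_harmonic_def real_laplacian_def intro: rpf_intros)
      then have "restrict (\<lambda>y. Complex (?g y) 0) (sphere 0 1) \<in> spherical_harmonics n"
        by (auto simp: spherical_harmonics_def)
      from bspec[OF conjunct2[OF h'] this]
      have "0 = (LINT y|surface_measure. (f y - h' y) * cnj (restrict (\<lambda>y. Complex (?g y) 0) (sphere 0 1) y))"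
        by (rule sym)
      also have "\<dots> = (LINT y|sph. complex_of_real (?g y * fr y - ?g y * vr y) + \<i> * complex_of_real (?g y * fj y - ?g y * vj y))"
      proof (rule integral_sph_surface(1))
        show "(f y - h' y) * cnj (restrict (\<lambda>y. Complex (?g y) 0) (sphere 0 1) y)
          = complex_of_real (?g y * fr y - ?g y * vr y) + \<i> * complex_of_real (?g y * fj y - ?g y * vj y)" if "norm y = 1" for y
          using that v(2) by (simp add: complex_eq_iff fr_def fj_def vr_def vj_def sphere_part_sphere algebra_simps)
      qed measurable
      finally have z: "0 = (LINT y|sph. complex_of_real (?g y * fr y - ?g y * vr y) + \<i> * complex_of_real (?g y * fj y - ?g y * vj y))" .
      have ig: "integrable sph (\<lambda>y. ?g y * F y)" if "integrable sph F" for F :: "'a \<Rightarrow> real"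
        using integrable_sph_mult_continuous[OF rpf_continuous[OF rpf_gegenbauer_solid] that] by simp
      have "(LINT y|sph. complex_of_real (?g y * fr y - ?g y * vr y) + \<i> * complex_of_real (?g y * fj y - ?g y * vj y))
        = complex_of_real (LINT y|sph. ?g y * fr y - ?g y * vr y) + \<i> * complex_of_real (LINT y|sph. ?g y * fj y - ?g y * vj y)"
        using ig[OF i(1)] ig[OF i(2)] ig[OF iv(1)] ig[OF iv(2)]
        by (subst Bochner_Integration.integral_add) (simp_all del: of_real_add of_real_diff of_real_mult)
      with z have "(LINT y|sph. ?g y * fr y - ?g y * vr y) = 0" "(LINT y|sph. ?g y * fj y - ?g y * vj y) = 0"
        by (simp_all add: complex_eq_iff)
      then have "(LINT y|sph. ?g y * fr y) = (LINT y|sph. ?g y * vr y)" "(LINT y|sph. ?g y * fj y) = (LINT y|sph. ?g y * vj y)"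
        using ig[OF i(1)] ig[OF i(2)] ig[OF iv(1)] ig[OF iv(2)] by simp_all
      then have "zonal_proj n fr x = zonal_proj n vr x" "zonal_proj n fj x = zonal_proj n vj x"
        by (simp_all add: zonal_proj_eq_gegenbauer_solid[OF i(1) x] zonal_proj_eq_gegenbauer_solid[OF i(2) x] zonal_proj_eq_gegenbauer_solid[OF iv(1) x] zonal_proj_eq_gegenbauer_solid[OF iv(2) x])
      then show ?thesis
        by (simp add: Z zonal_proj_solid_harmonic[OF D hv'(1) x] zonal_proj_solid_harmonic[OF D hv'(2) x] complex_eq_iff vr_def vj_def)
    qed
    then show ?thesis using v(2) by (auto simp: restrict_def)
  qed
  show ?thesis using 1 2[of h] by blast
qed

lemma Proj_spherical_harmonics:
  fixes f :: "'a::euclidean_space \<Rightarrow> complex"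
  assumes "3 \<le> DIM('a)" "integrable surface_measure f"
  shows "Proj surface_measure (spherical_harmonics n) f = restrict (complex_zonal_proj n (sphere_part f)) (sphere 0 1)"
  unfolding Proj_def spherical_harmonics_projection_iff[OF assms] by (rule the_eq_trivial)

section \<open>Bounds for the kernel operator on complex functions\<close>

lemma
  fixes f :: "'a::euclidean_space \<Rightarrow> complex"
  assumes D: "3 \<le> DIM('a)" and \<sigma>: "0 < \<sigma>" and f: "integrable sph f"
  shows AE_frac_op_Complex: "AE x in sph. frac_op \<sigma> f x = Complex (frac_op \<sigma> (\<lambda>x. Re (f x)) x) (frac_op \<sigma> (\<lambda>x. Im (f x)) x)"
    and AE_frac_op_integrable: "AE x in sph. integrable sph (\<lambda>y. frac_kernel TYPE('a) \<sigma> (x \<bullet> y) *\<^sub>R f y)"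
proof -
  have fR: "integrable sph (\<lambda>x. Re (f x))" "integrable sph (\<lambda>x. Im (f x))" using f by auto
  have *: "AE x in sph. integrable sph (\<lambda>y. frac_kernel TYPE('a) \<sigma> (x \<bullet> y) *\<^sub>R f y) \<and>
    frac_op \<sigma> f x = Complex (frac_op \<sigma> (\<lambda>x. Re (f x)) x) (frac_op \<sigma> (\<lambda>x. Im (f x)) x)"
    using AE_frac_op_eq[OF D \<sigma> fR(1)] AE_frac_op_eq[OF D \<sigma> fR(2)]
  proof eventually_elim
    case (elim x)
    let ?k = "\<lambda>y. frac_kernel TYPE('a) \<sigma> (x \<bullet> y)"
    have e: "(\<lambda>y. ?k y *\<^sub>R f y) = (\<lambda>y. complex_of_real (?k y * Re (f y)) + \<i> * complex_of_real (?k y * Im (f y)))"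
      by (simp add: fun_eq_iff complex_eq_iff)
    have i: "integrable sph (\<lambda>y. complex_of_real (?k y * Re (f y)))" "integrable sph (\<lambda>y. \<i> * complex_of_real (?k y * Im (f y)))"
      using elim by (simp_all del: of_real_mult)
    have "integrable sph (\<lambda>y. ?k y *\<^sub>R f y)" unfolding e using i by (rule Bochner_Integration.integrable_add)
    moreover have "frac_op \<sigma> f x = complex_of_real (frac_op \<sigma> (\<lambda>x. Re (f x)) x) + \<i> * complex_of_real (frac_op \<sigma> (\<lambda>x. Im (f x)) x)"
      unfolding frac_op_def e Bochner_Integration.integral_add[OF i] by (simp del: of_real_mult)
    ultimately show ?case by (simp add: complex_eq_iff)
  qed
  show "AE x in sph. frac_op \<sigma> f x = Complex (frac_op \<sigma> (\<lambda>x. Re (f x)) x) (frac_op \<sigma> (\<lambda>x. Im (f x)) x)"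
    using * by eventually_elim simp
  show "AE x in sph. integrable sph (\<lambda>y. frac_kernel TYPE('a) \<sigma> (x \<bullet> y) *\<^sub>R f y)"
    using * by eventually_elim simp
qed

text \<open>The kernel is nonnegative, so the modulus of the result is at most the operator applied
  to the modulus; subordination and Tonelli then give the factor \<lambda>^(-\<sigma>), the
  eigenvalue on constants.\<close>

lemma nn_integral_frac_op_le:
  fixes f :: "'a::euclidean_space \<Rightarrow> complex"
  assumes D: "3 \<le> DIM('a)" and \<sigma>: "0 < \<sigma>" and f: "integrable sph f"
  shows "(\<integral>\<^sup>+x. ennreal (cmod (frac_op \<sigma> f x)) \<partial>sph) \<le> ennreal (lam TYPE('a) powr (- \<sigma>)) * (\<integral>\<^sup>+x. ennreal (cmod (f x)) \<partial>sph)"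
proof -
  let ?l = "lam TYPE('a)" and ?h = "\<lambda>y. cmod (f y)"
  have g: "0 < Gamma \<sigma>" using \<sigma> by (rule Gamma_real_pos)
  have l: "0 < ?l" by (rule lam_pos[OF D])
  have [measurable]: "f \<in> borel_measurable borel" using borel_measurable_integrable[OF f] by simp
  have ih: "integrable sph ?h" using f by (rule integrable_norm)
  have "AE x in sph. ennreal (cmod (frac_op \<sigma> f x)) \<le> ennreal (1 / Gamma \<sigma>) * (\<integral>\<^sup>+s. (\<integral>\<^sup>+y. ennreal (poisson_kernel TYPE('a) s (x \<bullet> y)) * ennreal (?h y) \<partial>sph) \<partial>gamma_measure \<sigma> ?l)"
    using AE_frac_op_eq[OF D \<sigma> ih] AE_sph_norm
  proof eventually_elim
    case (elim x)
    have k: "0 \<le> frac_kernel TYPE('a) \<sigma> t" for t using \<sigma> by (rule frac_kernel_nonneg)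
    have p: "AE s in gamma_measure \<sigma> ?l. ennreal (poisson_integral ?h s x) = (\<integral>\<^sup>+y. ennreal (poisson_kernel TYPE('a) s (x \<bullet> y)) * ennreal (?h y) \<partial>sph)"
      using AE_gamma_measure_pos
    proof eventually_elim
      case (elim s)
      then show ?case
        unfolding poisson_integral_def
        by (subst nn_integral_eq_integral[symmetric])
           (use integrable_poisson_kernel[OF D ih \<open>norm x = 1\<close> elim] in \<open>auto simp: poisson_kernel_nonneg ennreal_mult\<close>)
    qed
    have pn: "AE s in gamma_measure \<sigma> ?l. 0 \<le> poisson_integral ?h s x"
      using AE_gamma_measure_pos by eventually_elim (auto simp: poisson_integral_def poisson_kernel_nonneg intro!: integral_nonneg_AE)
    have "cmod (frac_op \<sigma> f x) \<le> (\<integral>y. norm (frac_kernel TYPE('a) \<sigma> (x \<bullet> y) *\<^sub>R f y) \<partial>sph)"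
      unfolding frac_op_def by (rule integral_norm_bound)
    also have "\<dots> = frac_op \<sigma> ?h x" unfolding frac_op_def using k by simp
    also have "\<dots> = (1 / Gamma \<sigma>) * (\<integral>s. poisson_integral ?h s x \<partial>gamma_measure \<sigma> ?l)"
      using elim g by (simp add: field_simps)
    finally have "ennreal (cmod (frac_op \<sigma> f x)) \<le> ennreal ((1 / Gamma \<sigma>) * (\<integral>s. poisson_integral ?h s x \<partial>gamma_measure \<sigma> ?l))"
      by (rule ennreal_leI)
    also have "\<dots> = ennreal (1 / Gamma \<sigma>) * (\<integral>\<^sup>+s. ennreal (poisson_integral ?h s x) \<partial>gamma_measure \<sigma> ?l)"
      using g elim pn by (subst nn_integral_eq_integral) (auto simp: less_imp_le simp del: times_divide_eq_left intro!: ennreal_mult')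
    also have "(\<integral>\<^sup>+s. ennreal (poisson_integral ?h s x) \<partial>gamma_measure \<sigma> ?l) = (\<integral>\<^sup>+s. (\<integral>\<^sup>+y. ennreal (poisson_kernel TYPE('a) s (x \<bullet> y)) * ennreal (?h y) \<partial>sph) \<partial>gamma_measure \<sigma> ?l)"
      by (rule nn_integral_cong_AE[OF p])
    finally show ?case .
  qed
  then have "(\<integral>\<^sup>+x. ennreal (cmod (frac_op \<sigma> f x)) \<partial>sph) \<le> (\<integral>\<^sup>+x. ennreal (1 / Gamma \<sigma>) * (\<integral>\<^sup>+s. (\<integral>\<^sup>+y. ennreal (poisson_kernel TYPE('a) s (x \<bullet> y)) * ennreal (?h y) \<partial>sph) \<partial>gamma_measure \<sigma> ?l) \<partial>sph)"
    by (rule nn_integral_mono_AE)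
  also have "\<dots> = ennreal (1 / Gamma \<sigma>) * (ennreal (Gamma \<sigma> * ?l powr (- \<sigma>)) * (\<integral>\<^sup>+x. ennreal (?h x) \<partial>sph))"
  proof -
    interpret G: sigma_finite_measure "gamma_measure \<sigma> ?l" using \<sigma> l by (rule sigma_finite_gamma_measure)
    show ?thesis
      by (subst nn_integral_cmult) (simp_all add: nn_integral_poisson_kernel_poisson_kernel[OF D \<sigma>])
  qed
  also have "\<dots> = ennreal (?l powr (- \<sigma>)) * (\<integral>\<^sup>+x. ennreal (?h x) \<partial>sph)"
    using g by (simp add: mult.assoc[symmetric] ennreal_mult[symmetric])
  finally show ?thesis .
qed

lemma integrable_frac_op:
  fixes f :: "'a::euclidean_space \<Rightarrow> complex"
  assumes D: "3 \<le> DIM('a)" and \<sigma>: "0 < \<sigma>" and f: "integrable sph f"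
  shows "integrable sph (frac_op \<sigma> f)"
proof (rule integrableI_bounded)
  have "f \<in> borel_measurable borel" using borel_measurable_integrable[OF f] by simp
  from frac_op_measurable[OF D \<sigma> this] show "frac_op \<sigma> f \<in> borel_measurable sph" by simp
  have "ennreal (lam TYPE('a) powr (- \<sigma>)) * (\<integral>\<^sup>+x. ennreal (cmod (f x)) \<partial>sph) < \<infinity>"
    using f by (simp add: integrable_iff_bounded ennreal_mult_less_top)
  then show "(\<integral>\<^sup>+x. ennreal (norm (frac_op \<sigma> f x)) \<partial>sph) < \<infinity>"
    using nn_integral_frac_op_le[OF D \<sigma> f] by (rule order.strict_trans1[rotated])
qed

lemma integral_frac_op_diff_le:
  fixes f g :: "'a::euclidean_space \<Rightarrow> complex"
  assumes D: "3 \<le> DIM('a)" and \<sigma>: "0 < \<sigma>" and f: "integrable sph f" and g: "integrable sph g"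
  shows "(LINT x|sph. cmod (frac_op \<sigma> f x - frac_op \<sigma> g x)) \<le> lam TYPE('a) powr (- \<sigma>) * (LINT x|sph. cmod (f x - g x))"
proof -
  have fg: "integrable sph (\<lambda>x. f x - g x)" using f g by simp
  have "AE x in sph. frac_op \<sigma> f x - frac_op \<sigma> g x = frac_op \<sigma> (\<lambda>x. f x - g x) x"
    using AE_frac_op_integrable[OF D \<sigma> f] AE_frac_op_integrable[OF D \<sigma> g]
    by eventually_elim (simp add: frac_op_def scaleR_diff_right)
  then have "ennreal (LINT x|sph. cmod (frac_op \<sigma> f x - frac_op \<sigma> g x)) = (\<integral>\<^sup>+x. ennreal (cmod (frac_op \<sigma> (\<lambda>x. f x - g x) x)) \<partial>sph)"
    using integrable_frac_op[OF D \<sigma> f] integrable_frac_op[OF D \<sigma> g]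
    by (subst nn_integral_eq_integral[symmetric]) (auto intro!: nn_integral_cong_AE elim!: eventually_mono)
  also have "\<dots> \<le> ennreal (lam TYPE('a) powr (- \<sigma>)) * (\<integral>\<^sup>+x. ennreal (cmod (f x - g x)) \<partial>sph)"
    by (rule nn_integral_frac_op_le[OF D \<sigma> fg])
  also have "\<dots> = ennreal (lam TYPE('a) powr (- \<sigma>) * (LINT x|sph. cmod (f x - g x)))"
    using fg by (subst nn_integral_eq_integral) (auto simp: ennreal_mult')
  finally show ?thesis by (subst (asm) ennreal_le_iff) (auto intro!: mult_nonneg_nonneg integral_nonneg_AE)
qed

lemma nn_integral_frac_op_tail_complex:
  fixes f :: "'a::euclidean_space \<Rightarrow> complex"
  assumes D: "3 \<le> DIM('a)" and \<sigma>: "0 < \<sigma>" and fm: "f \<in> borel_measurable borel" and f2: "integrable sph (\<lambda>x. (cmod (f x))\<^sup>2)"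
  defines "l \<equiv> lam TYPE('a)"
  shows "(\<integral>\<^sup>+x. ennreal ((cmod (frac_op \<sigma> f x - (\<Sum>n<N. complex_zonal_proj n f x /\<^sub>R ((real n + l) powr \<sigma>))))\<^sup>2) \<partial>sph)
    \<le> ennreal (l powr (- \<sigma>) * (l + 2 * real N) powr (- \<sigma>) * (LINT x|sph. (cmod (f x))\<^sup>2))"
proof -
  let ?c = "l powr (- \<sigma>) * (l + 2 * real N) powr (- \<sigma>)"
  let ?R = "\<lambda>x. Re (f x)" and ?I = "\<lambda>x. Im (f x)"
  let ?E = "\<lambda>F x. frac_op \<sigma> F x - (\<Sum>n<N. (l + real n) powr (- \<sigma>) * zonal_proj n F x)"
  note [measurable] = fm
  have f2': "integrable sph (\<lambda>x. (?R x)\<^sup>2)" "integrable sph (\<lambda>x. (?I x)\<^sup>2)"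
    by (rule Bochner_Integration.integrable_bound[OF f2]; auto simp: cmod_power2)+
  have m: "?R \<in> borel_measurable borel" "?I \<in> borel_measurable borel" by measurable
  have fi: "integrable sph ?R" "integrable sph ?I"
    using integrable_of_square[OF m(1) f2'(1)] integrable_of_square[OF m(2) f2'(2)] .
  have f: "integrable sph f"
  proof -
    have "integrable sph (\<lambda>x. complex_of_real (?R x) + \<i> * complex_of_real (?I x))" using fi by simp
    then show ?thesis by (simp add: complex_eq[symmetric])
  qed
  have "rpf (zonal_proj n ?R)" "rpf (zonal_proj n ?I)" for n
    using solid_harmonic_rpf[OF solid_harmonic_zonal_proj[OF fi(1)]] solid_harmonic_rpf[OF solid_harmonic_zonal_proj[OF fi(2)]] .
  note [measurable] = rpf_borel[OF this(1)] rpf_borel[OF this(2)] frac_op_measurable[OF D \<sigma> m(1)] frac_op_measurable[OF D \<sigma> m(2)]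
  have nn: "0 \<le> (LINT x|sph. (?R x)\<^sup>2)" "0 \<le> (LINT x|sph. (?I x)\<^sup>2)" by (rule integral_nonneg_AE; simp)+
  have "(\<integral>\<^sup>+x. ennreal ((cmod (frac_op \<sigma> f x - (\<Sum>n<N. complex_zonal_proj n f x /\<^sub>R ((real n + l) powr \<sigma>))))\<^sup>2) \<partial>sph)
    = (\<integral>\<^sup>+x. ennreal ((?E ?R x)\<^sup>2) + ennreal ((?E ?I x)\<^sup>2) \<partial>sph)"
  proof (rule nn_integral_cong_AE)
    show "AE x in sph. ennreal ((cmod (frac_op \<sigma> f x - (\<Sum>n<N. complex_zonal_proj n f x /\<^sub>R ((real n + l) powr \<sigma>))))\<^sup>2)
      = ennreal ((?E ?R x)\<^sup>2) + ennreal ((?E ?I x)\<^sup>2)"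
      using AE_frac_op_Complex[OF D \<sigma> f]
    proof eventually_elim
      case (elim x)
      have "frac_op \<sigma> f x - (\<Sum>n<N. complex_zonal_proj n f x /\<^sub>R ((real n + l) powr \<sigma>)) = Complex (?E ?R x) (?E ?I x)"
        by (simp add: elim complex_zonal_proj_def complex_eq_iff powr_minus add.commute)
      then show ?case by (simp add: cmod_power2 ennreal_plus)
    qed
  qed
  also have "\<dots> = (\<integral>\<^sup>+x. ennreal ((?E ?R x)\<^sup>2) \<partial>sph) + (\<integral>\<^sup>+x. ennreal ((?E ?I x)\<^sup>2) \<partial>sph)"
    by (rule nn_integral_add) measurable
  also have "\<dots> \<le> ennreal (?c * (LINT x|sph. (?R x)\<^sup>2)) + ennreal (?c * (LINT x|sph. (?I x)\<^sup>2))"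
    unfolding l_def by (intro add_mono nn_integral_frac_op_tail D \<sigma> m f2')
  also have "\<dots> = ennreal (?c * (LINT x|sph. (cmod (f x))\<^sup>2))"
    using f2' nn by (simp add: ennreal_plus[symmetric] cmod_power2 distrib_left del: ennreal_plus)
  finally show ?thesis .
qed

lemma L2_sphere_part:
  fixes f :: "'a::euclidean_space \<Rightarrow> complex"
  assumes "f \<in> L2_functions surface_measure"
  shows "sphere_part f \<in> borel_measurable borel" "integrable sph (\<lambda>x. (cmod (sphere_part f x))\<^sup>2)" "integrable surface_measure f"
proof -
  have f: "f \<in> borel_measurable surface_measure" "integrable surface_measure (\<lambda>x. (cmod (f x))\<^sup>2)"
    using assms by (auto simp: L2_functions_def)
  show m [measurable]: "sphere_part f \<in> borel_measurable borel" using f(1) by (rule measurable_sphere_part)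
  have "(\<lambda>x. (cmod (sphere_part f x))\<^sup>2) \<in> borel_measurable borel" by measurable
  from integral_sph_surface(2)[OF this, of "\<lambda>x. (cmod (f x))\<^sup>2"] f(2)
  show "integrable sph (\<lambda>x. (cmod (sphere_part f x))\<^sup>2)" by (simp add: sphere_part_sphere)
  have "integrable surface_measure (\<lambda>x. cmod (f x))"
    by (rule surface.square_integrable_imp_integrable) (use f in simp_all)
  then show "integrable surface_measure f" using f(1) by (simp add: integrable_norm_iff)
qed

lemma tendsto_frac_op_tail_bound:
  assumes "0 < \<sigma>"
  shows "(\<lambda>N. l powr (- \<sigma>) * (l + 2 * real N) powr (- \<sigma>) * c) \<longlonglongrightarrow> 0"
proof -
  have "filterlim (\<lambda>N. l + 2 * real N) at_top sequentially"
    by (intro filterlim_tendsto_add_at_top[OF tendsto_const] filterlim_tendsto_pos_mult_at_top[OF tendsto_const] filterlim_real_sequentially) simp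
  then have "(\<lambda>N. (l + 2 * real N) powr (- \<sigma>)) \<longlonglongrightarrow> 0"
    using assms by (intro tendsto_neg_powr) auto
  from tendsto_mult[OF tendsto_mult[OF tendsto_const this] tendsto_const, of "l powr (- \<sigma>)" c]
  show ?thesis by simp
qed

lemma complex_zonal_proj_measurable:
  fixes f :: "'a::euclidean_space \<Rightarrow> complex"
  assumes f: "integrable sph f" shows "continuous_on UNIV (complex_zonal_proj n f)"
proof -
  have "rpf (zonal_proj n (\<lambda>x. Re (f x)))" "rpf (zonal_proj n (\<lambda>x. Im (f x)))"
    by (rule solid_harmonic_rpf[OF solid_harmonic_zonal_proj], use f in simp)+
  then have "continuous_on UNIV (zonal_proj n (\<lambda>x. Re (f x)))" "continuous_on UNIV (zonal_proj n (\<lambda>x. Im (f x)))"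
    by (auto intro: rpf_continuous)
  then show ?thesis unfolding complex_zonal_proj_def[abs_def] Complex_eq by (intro continuous_intros)
qed

lemma fractional_integral_frac_op_limit:
  fixes f :: "'a::euclidean_space \<Rightarrow> complex"
  assumes D: "3 \<le> DIM('a)" and \<sigma>: "0 < \<sigma>" and f: "f \<in> L2_functions surface_measure"
  shows "(\<lambda>N. LINT x|surface_measure. (cmod (frac_op \<sigma> (sphere_part f) x - (\<Sum>n<N. complex_zonal_proj n (sphere_part f) x /\<^sub>R ((real n + lam TYPE('a)) powr \<sigma>))))\<^sup>2) \<longlonglongrightarrow> 0"
    and "frac_op \<sigma> (sphere_part f) \<in> L2_functions surface_measure"
    and "complex_zonal_proj n (sphere_part f) \<in> L2_functions surface_measure"
proof -
  let ?l = "lam TYPE('a)"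
  note h = L2_sphere_part[OF f]
  have hi: "integrable sph (sphere_part f)"
    using h(3) integral_sph_surface(2)[OF h(1), of f] by (simp add: sphere_part_sphere)
  have [measurable]: "complex_zonal_proj n (sphere_part f) \<in> borel_measurable borel" for n
    by (rule borel_measurable_continuous_onI[OF complex_zonal_proj_measurable[OF hi]])
  note km [measurable] = frac_op_measurable[OF D \<sigma> h(1)]
  let ?E = "\<lambda>N x. (cmod (frac_op \<sigma> (sphere_part f) x - (\<Sum>n<N. complex_zonal_proj n (sphere_part f) x /\<^sub>R ((real n + ?l) powr \<sigma>))))\<^sup>2"
  let ?b = "\<lambda>N. ?l powr (- \<sigma>) * (?l + 2 * real N) powr (- \<sigma>) * (LINT x|sph. (cmod (sphere_part f x))\<^sup>2)"
  have nn: "0 \<le> (LINT x|sph. (cmod (sphere_part f x))\<^sup>2)" by (rule integral_nonneg_AE) simp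
  have bd: "(\<integral>\<^sup>+x. ennreal (?E N x) \<partial>sph) \<le> ennreal (?b N)" for N
    by (rule nn_integral_frac_op_tail_complex[OF D \<sigma> h(1,2)])
  have fin: "ennreal (?b N) < \<infinity>" for N by simp
  have iE: "integrable sph (?E N)" for N
    by (rule integrableI_bounded) (use order.strict_trans1[OF bd fin, of N] in auto)
  have "(LINT x|sph. ?E N x) \<le> ?b N" for N
  proof -
    have "ennreal (LINT x|sph. ?E N x) = (\<integral>\<^sup>+x. ennreal (?E N x) \<partial>sph)"
      using iE[of N] by (subst nn_integral_eq_integral) auto
    then have "ennreal (LINT x|sph. ?E N x) \<le> ennreal (?b N)" using bd[of N] by simp
    then show ?thesis by (subst (asm) ennreal_le_iff) (use nn in auto)
  qed
  then have "(\<lambda>N. LINT x|sph. ?E N x) \<longlonglongrightarrow> 0"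
    by (intro Lim_null_comparison[OF _ tendsto_frac_op_tail_bound[OF \<sigma>]] always_eventually allI)
       (auto simp: integral_nonneg_AE)
  moreover have "(LINT x|surface_measure. ?E N x) = (LINT x|sph. ?E N x)" for N
    by (rule integral_sph_surface(1)) measurable
  ultimately show "(\<lambda>N. LINT x|surface_measure. ?E N x) \<longlonglongrightarrow> 0" by simp
  have "integrable surface_measure (\<lambda>x. (cmod (frac_op \<sigma> (sphere_part f) x))\<^sup>2) \<longleftrightarrow> integrable sph (\<lambda>x. (cmod (frac_op \<sigma> (sphere_part f) x))\<^sup>2)"
    by (rule integral_sph_surface(2)) measurable
  then show "frac_op \<sigma> (sphere_part f) \<in> L2_functions surface_measure"
    using iE[of 0] measurable_surface_measure_borel[OF km] by (simp add: L2_functions_def)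
  have "integrable surface_measure (\<lambda>x. (cmod (complex_zonal_proj n (sphere_part f) x))\<^sup>2) \<longleftrightarrow> integrable sph (\<lambda>x. (cmod (complex_zonal_proj n (sphere_part f) x))\<^sup>2)"
    by (rule integral_sph_surface(2)) measurable
  moreover have "integrable sph (\<lambda>x. (cmod (complex_zonal_proj n (sphere_part f) x))\<^sup>2)"
    by (intro integrable_sph_continuous continuous_intros complex_zonal_proj_measurable[OF hi])
  moreover have "complex_zonal_proj n (sphere_part f) \<in> borel_measurable surface_measure"
    by (rule measurable_surface_measure_borel) measurable
  ultimately show "complex_zonal_proj n (sphere_part f) \<in> L2_functions surface_measure"
    unfolding L2_functions_def by blast
qed

lemma integrable_sphere_part:
  fixes f :: "'a::euclidean_space \<Rightarrow> complex"
  assumes "integrable surface_measure f" shows "integrable sph (sphere_part f)"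
proof -
  have "sphere_part f \<in> borel_measurable borel" using assms by (intro measurable_sphere_part) auto
  from integral_sph_surface(2)[OF this, of f] assms show ?thesis by (simp add: sphere_part_sphere)
qed

text \<open>The abstract criterion with the Lipschitz constant \<lambda>^(-\<sigma>), the largest of
  the eigenvalues.\<close>

lemma fractional_integral_sphere_eq_frac_op:
  fixes f :: "'a::euclidean_space \<Rightarrow> complex"
  assumes D: "3 \<le> DIM('a)" and \<sigma>: "0 < \<sigma>" and f: "integrable surface_measure f"
  shows "AE x in surface_measure.
    fractional_integral surface_measure spherical_harmonics (\<lambda>n. real n + lam TYPE('a)) \<sigma> f x = frac_op \<sigma> (sphere_part f) x"
proof (rule fractional_integral_AE_eq[where C="lam TYPE('a) powr (- \<sigma>)", OF finite_measure_surface_measure _ _ _ _ _ f])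
  \<comment> \<open>\<open>Proj\<close> returns a function that is \<open>undefined\<close> off the
    sphere; membership in \<open>L2_functions\<close> depends only on values on the sphere.\<close>
  have res: "restrict g (sphere 0 1) \<in> L2_functions surface_measure" if "g \<in> L2_functions surface_measure" for g :: "'a \<Rightarrow> complex"
  proof -
    have g: "g \<in> borel_measurable surface_measure" "integrable surface_measure (\<lambda>x. (cmod (g x))\<^sup>2)"
      using that by (auto simp: L2_functions_def)
    have "restrict g (sphere 0 1) \<in> borel_measurable surface_measure"
      by (rule measurable_cong[THEN iffD1, OF _ g(1)]) auto
    moreover have "integrable surface_measure (\<lambda>x. (cmod (restrict g (sphere 0 1) x))\<^sup>2)"
      by (rule Bochner_Integration.integrable_cong[THEN iffD1, OF refl _ g(2)]) auto
    ultimately show ?thesis by (simp add: L2_functions_def)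
  qed
  fix g :: "'a \<Rightarrow> complex"
  {
    assume g: "integrable surface_measure g"
    have "frac_op \<sigma> (sphere_part g) \<in> borel_measurable borel"
      using g by (intro frac_op_measurable[OF D \<sigma>] measurable_sphere_part) auto
    from integral_sph_surface(2)[OF this, of "frac_op \<sigma> (sphere_part g)"]
    show "integrable surface_measure (frac_op \<sigma> (sphere_part g))"
      using integrable_frac_op[OF D \<sigma> integrable_sphere_part[OF g]] by simp
    fix f :: "'a \<Rightarrow> complex" assume f: "integrable surface_measure f"
    have [measurable]: "sphere_part f \<in> borel_measurable borel" "sphere_part g \<in> borel_measurable borel"
      using f g by (auto intro!: measurable_sphere_part)
    have [measurable]: "frac_op \<sigma> (sphere_part f) \<in> borel_measurable borel" "frac_op \<sigma> (sphere_part g) \<in> borel_measurable borel"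
      by (auto intro!: frac_op_measurable[OF D \<sigma>])
    have "(LINT x|surface_measure. cmod (frac_op \<sigma> (sphere_part f) x - frac_op \<sigma> (sphere_part g) x)) = (LINT x|sph. cmod (frac_op \<sigma> (sphere_part f) x - frac_op \<sigma> (sphere_part g) x))"
      by (rule integral_sph_surface(1)) measurable
    also have "\<dots> \<le> lam TYPE('a) powr (- \<sigma>) * (LINT x|sph. cmod (sphere_part f x - sphere_part g x))"
      by (rule integral_frac_op_diff_le[OF D \<sigma> integrable_sphere_part[OF f] integrable_sphere_part[OF g]])
    also have "(LINT x|sph. cmod (sphere_part f x - sphere_part g x)) = (LINT x|surface_measure. cmod (f x - g x))"
      by (rule integral_sph_surface(1)[symmetric]) (auto simp: sphere_part_sphere)
    finally show "(LINT x|surface_measure. cmod (frac_op \<sigma> (sphere_part f) x - frac_op \<sigma> (sphere_part g) x)) \<le> lam TYPE('a) powr (- \<sigma>) * (LINT x|surface_measure. cmod (f x - g x))" .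
  }
  assume g: "g \<in> L2_functions surface_measure"
  note P = Proj_spherical_harmonics[OF D L2_sphere_part(3)[OF g]]
  show "Proj surface_measure (spherical_harmonics n) g \<in> L2_functions surface_measure" for n
    unfolding P by (rule res[OF fractional_integral_frac_op_limit(3)[OF D \<sigma> g]])
  show "frac_op \<sigma> (sphere_part g) \<in> L2_functions surface_measure" by (rule fractional_integral_frac_op_limit(2)[OF D \<sigma> g])
  have "(LINT x|surface_measure. (cmod (frac_op \<sigma> (sphere_part g) x - (\<Sum>n<N. Proj surface_measure (spherical_harmonics n) g x /\<^sub>R (real n + lam TYPE('a)) powr \<sigma>)))\<^sup>2)
    = (LINT x|surface_measure. (cmod (frac_op \<sigma> (sphere_part g) x - (\<Sum>n<N. complex_zonal_proj n (sphere_part g) x /\<^sub>R (real n + lam TYPE('a)) powr \<sigma>)))\<^sup>2)" for N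
    by (rule Bochner_Integration.integral_cong) (auto simp: P)
  then show "(\<lambda>N. LINT x|surface_measure. (cmod (frac_op \<sigma> (sphere_part g) x - (\<Sum>n<N. Proj surface_measure (spherical_harmonics n) g x /\<^sub>R (real n + lam TYPE('a)) powr \<sigma>)))\<^sup>2) \<longlonglongrightarrow> 0"
    using fractional_integral_frac_op_limit(1)[OF D \<sigma> g] by simp
qed

subsection \<open>The fractional integral on the projective space\<close>

lemma nn_integral_sph_uminus:
  fixes g :: "'a::euclidean_space \<Rightarrow> ennreal"
  assumes [measurable]: "g \<in> borel_measurable borel"
  shows "(\<integral>\<^sup>+x. g (- x) \<partial>sph) = (\<integral>\<^sup>+x. g x \<partial>sph)"
proof -
  have [measurable]: "(ball 0 1 - {0} :: 'a set) \<in> sets borel" by auto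
  have m: "(\<lambda>x. g (sgn x) * indicator (ball 0 1 - {0}) x) \<in> borel_measurable borel"
    by measurable
  have "(\<integral>\<^sup>+x. g (sgn x) * indicator (ball 0 1 - {0}) x \<partial>lborel)
    = ennreal (\<bar>-1\<bar> ^ DIM('a)) * (\<integral>\<^sup>+x. g (sgn ((-1) *\<^sub>R x)) * indicator (ball 0 1 - {0}) ((-1) *\<^sub>R x) \<partial>lborel)"
    by (rule nn_integral_lborel_scaleR[OF m]) simp
  also have "\<dots> = (\<integral>\<^sup>+x. g (- sgn x) * indicator (ball 0 1 - {0}) x \<partial>lborel)"
    by (simp add: sgn_minus indicator_def)
  finally show ?thesis
    by (simp add: nn_integral_sph_ball)
qed

lemma distr_sph_uminus: "distr sph borel uminus = (sph :: 'a::euclidean_space measure)"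
proof (rule measure_eqI)
  fix A assume A: "A \<in> sets (distr sph borel (uminus :: 'a \<Rightarrow> 'a))"
  then have [measurable]: "A \<in> sets borel" by simp
  have "emeasure (distr sph borel uminus) A = (\<integral>\<^sup>+x. indicator A x \<partial>distr sph borel uminus)"
    by simp
  also have "\<dots> = (\<integral>\<^sup>+x. indicator A (- x) \<partial>sph)" by (subst nn_integral_distr) auto
  also have "\<dots> = (\<integral>\<^sup>+x. indicator A x \<partial>sph)" by (rule nn_integral_sph_uminus) measurable
  finally show "emeasure (distr sph borel uminus) A = emeasure sph A" by simp
qed simp

lemma integral_sph_uminus:
  fixes g :: "'a::euclidean_space \<Rightarrow> 'b::euclidean_space"
  assumes "g \<in> borel_measurable borel"
  shows "(\<integral>x. g (- x) \<partial>sph) = (\<integral>x. g x \<partial>sph)"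
  using integral_distr[of uminus sph borel g] assms by (simp add: distr_sph_uminus)

lemma frac_op_uminus:
  fixes g :: "'a::euclidean_space \<Rightarrow> complex"
  assumes D: "3 \<le> DIM('a)" and \<sigma>: "0 < \<sigma>" and [measurable]: "g \<in> borel_measurable borel"
    and even: "\<And>x. g (- x) = g x"
  shows "frac_op \<sigma> g (- x) = frac_op \<sigma> g x"
proof -
  have [measurable]: "frac_kernel TYPE('a) \<sigma> \<in> borel_measurable borel"
    using \<sigma> lam_pos[OF D] by (rule frac_kernel_measurable)
  have m: "(\<lambda>y. frac_kernel TYPE('a) \<sigma> (x \<bullet> y) *\<^sub>R g y) \<in> borel_measurable borel" by measurable
  show ?thesis using integral_sph_uminus[OF m] by (simp add: frac_op_def even)
qed

lemma zonal_proj_uminus: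
  fixes f :: "'a::euclidean_space \<Rightarrow> real"
  assumes f: "integrable sph f" and even: "\<And>x. f (- x) = f x" and x: "norm x = 1"
  shows "zonal_proj n f (- x) = zonal_proj n f x"
proof -
  have [measurable]: "f \<in> borel_measurable borel" using borel_measurable_integrable[OF f] by simp
  have m: "(\<lambda>y. zonal TYPE('a) n (x \<bullet> y) * f y) \<in> borel_measurable borel" by measurable
  show ?thesis using integral_sph_uminus[OF m] x by (simp add: zonal_proj_sphere[OF f] even)
qed

text \<open>The projection of an even function is even on the sphere, while homogeneity with factor
  -1 makes it odd when the degree is odd.\<close>

lemma zonal_proj_odd_eq_0:
  fixes f :: "'a::euclidean_space \<Rightarrow> real"
  assumes f: "integrable sph f" and even: "\<And>x. f (- x) = f x" and x: "norm x = 1" and n: "odd n"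
  shows "zonal_proj n f x = 0"
  using zonal_proj_uminus[OF assms(1-3), of n] zonal_proj_scaleR[of n f "-1" x] n by simp

lemma
  fixes f :: "'a::euclidean_space \<Rightarrow> complex"
  assumes f: "integrable sph f" and even: "\<And>x. f (- x) = f x" and x: "norm x = 1"
  shows complex_zonal_proj_uminus: "complex_zonal_proj n f (- x) = complex_zonal_proj n f x" and complex_zonal_proj_odd_eq_0: "odd n \<Longrightarrow> complex_zonal_proj n f x = 0"
proof -
  have i: "integrable sph (\<lambda>x. Re (f x))" "integrable sph (\<lambda>x. Im (f x))" using f by auto
  show "complex_zonal_proj n f (- x) = complex_zonal_proj n f x"
    using zonal_proj_uminus[OF i(1) _ x, of n] zonal_proj_uminus[OF i(2) _ x, of n] even by (simp add: complex_zonal_proj_def)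
  show "odd n \<Longrightarrow> complex_zonal_proj n f x = 0"
    using zonal_proj_odd_eq_0[OF i(1) _ x, of n] zonal_proj_odd_eq_0[OF i(2) _ x, of n] even by (simp add: complex_zonal_proj_def complex_eq_iff)
qed

section \<open>Measure and functions on the projective space\<close>

abbreviation "projective_sets \<equiv> {B. B \<subseteq> projective_space \<and> antipodal_class -` B \<inter> sphere 0 1 \<in> sets surface_measure}"

lemma projective_sets_subset: "projective_sets \<subseteq> Pow projective_space" by auto

lemma antipodal_class_in: "norm x = 1 \<Longrightarrow> antipodal_class x \<in> projective_space"
  by (auto simp: projective_space_def)

lemma antipodal_class_eq_iff: "antipodal_class x = antipodal_class y \<longleftrightarrow> x = y \<or> x = - y"
  by (auto simp: antipodal_class_def doubleton_eq_iff)

lemma measurable_antipodal_class': "antipodal_class \<in> surface_measure \<rightarrow>\<^sub>M sigma projective_space projective_sets"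
  by (rule measurable_measure_of[OF projective_sets_subset]) (auto simp: antipodal_class_in)

lemma space_projective_measure [simp]: "space projective_measure = projective_space"
  unfolding projective_measure_def by (simp add: space_measure_of[OF projective_sets_subset])

lemma measurable_antipodal_class: "antipodal_class \<in> surface_measure \<rightarrow>\<^sub>M projective_measure"
  using measurable_antipodal_class' unfolding projective_measure_def by simp

lemma measurable_projective_measure_iff:
  fixes F :: "'a::euclidean_space set \<Rightarrow> complex"
  shows "F \<in> borel_measurable projective_measure \<longleftrightarrow> F \<circ> antipodal_class \<in> borel_measurable surface_measure"
proof
  assume "F \<in> borel_measurable projective_measure"
  then show "F \<circ> antipodal_class \<in> borel_measurable surface_measure"
    by (rule measurable_comp[OF measurable_antipodal_class])
next
  assume F: "F \<circ> antipodal_class \<in> borel_measurable surface_measure"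
  show "F \<in> borel_measurable projective_measure"
  proof (rule measurableI)
    fix A :: "complex set" assume A: "A \<in> sets borel"
    have "antipodal_class -` (F -` A \<inter> projective_space) \<inter> sphere 0 1 = (F \<circ> antipodal_class) -` A \<inter> space surface_measure"
      by (auto simp: antipodal_class_in)
    then have "F -` A \<inter> projective_space \<in> projective_sets"
      using measurable_sets[OF F A] by auto
    then have "F -` A \<inter> projective_space \<in> sets (sigma projective_space projective_sets)"
      unfolding sets_measure_of[OF projective_sets_subset] by (rule sigma_sets.Basic)
    moreover have "sets (projective_measure :: 'a set measure) = sets (sigma projective_space projective_sets)"
      by (simp add: projective_measure_def)
    ultimately show "F -` A \<inter> space projective_measure \<in> sets projective_measure"
      by (simp only: space_projective_measure)
  qed simp
qed

lemma finite_measure_projective: "finite_measure projective_measure"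
  unfolding projective_measure_def by (rule surface.finite_measure_distr[OF measurable_antipodal_class'])

lemma integral_projective_measure:
  fixes F :: "'a::euclidean_space set \<Rightarrow> 'b::euclidean_space"
  assumes "F \<in> borel_measurable projective_measure"
  shows "(\<integral>c. F c \<partial>projective_measure) = (\<integral>x. F (antipodal_class x) \<partial>surface_measure)"
    and "integrable projective_measure F \<longleftrightarrow> integrable surface_measure (\<lambda>x. F (antipodal_class x))"
proof -
  have "F \<in> borel_measurable (sigma projective_space projective_sets)"
    using assms unfolding projective_measure_def by simp
  then show "(\<integral>c. F c \<partial>projective_measure) = (\<integral>x. F (antipodal_class x) \<partial>surface_measure)"
    and "integrable projective_measure F \<longleftrightarrow> integrable surface_measure (\<lambda>x. F (antipodal_class x))"
    unfolding projective_measure_def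
    by (simp_all add: integral_distr[OF measurable_antipodal_class'] integrable_distr_eq[OF measurable_antipodal_class'])
qed

lemma AE_projective_measure: "AE c in projective_measure. P c \<Longrightarrow> AE x in surface_measure. P (antipodal_class x)"
  unfolding projective_measure_def by (rule AE_distrD[OF measurable_antipodal_class'])

text \<open>A choice of representatives made without regard to measurability. For an even
  \<open>v\<close> the lift of \<open>v\<close> composed with \<open>antipodal_rep\<close> is
  \<open>v\<close> again on the sphere, and measurability downstairs is tested on the lift.\<close>

definition antipodal_rep :: "'a::euclidean_space set \<Rightarrow> 'a" where
  "antipodal_rep c = (SOME x. norm x = 1 \<and> antipodal_class x = c)"

lemma antipodal_rep_antipodal_class: "norm x = 1 \<Longrightarrow> antipodal_rep (antipodal_class x) = x \<or> antipodal_rep (antipodal_class x) = - x"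
proof -
  assume "norm x = 1"
  then have "norm (antipodal_rep (antipodal_class x)) = 1 \<and> antipodal_class (antipodal_rep (antipodal_class x)) = antipodal_class x"
    unfolding antipodal_rep_def by (intro someI[of "\<lambda>y. norm y = 1 \<and> antipodal_class y = antipodal_class x" x]) simp
  then show ?thesis by (simp add: antipodal_class_eq_iff)
qed

lemma antipodal_rep_even: "norm x = 1 \<Longrightarrow> v (- x) = v x \<Longrightarrow> v (antipodal_rep (antipodal_class x)) = v x"
  using antipodal_rep_antipodal_class[of x] by auto

lemma sphere_part_lift_even: "sphere_part (F \<circ> antipodal_class) (- x) = sphere_part (F \<circ> antipodal_class) x"
  by (simp add: sphere_part_def antipodal_class_def insert_commute)

text \<open>For even \<open>n\<close> lifting is a bijection between the projective and the
  spherical harmonics of degree \<open>n\<close>: homogeneity of even degree makes the polynomials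
  even, hence functions of the class, and extensionality makes the lift injective. Lifting also
  preserves the inner products, so the characterisation of the projection is transported from the
  sphere.\<close>

lemma Proj_projective_harmonics:
  fixes F :: "'a::euclidean_space set \<Rightarrow> complex"
  assumes D: "3 \<le> DIM('a)" and F: "integrable projective_measure F" and n: "even n"
  shows "Proj projective_measure (projective_harmonics n) F
    = restrict (\<lambda>c. complex_zonal_proj n (sphere_part (F \<circ> antipodal_class)) (antipodal_rep c)) projective_space"
proof -
  let ?f = "F \<circ> antipodal_class"
  let ?p = "restrict (complex_zonal_proj n (sphere_part ?f)) (sphere 0 1)"
  let ?P = "restrict (\<lambda>c. complex_zonal_proj n (sphere_part ?f) (antipodal_rep c)) projective_space"
  let ?lift = "\<lambda>h. restrict (h \<circ> antipodal_class) (sphere 0 1)"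
  have Fm: "F \<in> borel_measurable projective_measure" using F by auto
  then have fm: "?f \<in> borel_measurable surface_measure" by (simp add: measurable_projective_measure_iff)
  have f: "integrable surface_measure ?f"
    using F integral_projective_measure(2)[OF Fm] by (simp add: o_def)
  note ev = complex_zonal_proj_uminus[OF integrable_sphere_part[OF f] sphere_part_lift_even]
  have lP: "?lift ?P = ?p"
    by (rule ext) (auto simp: restrict_def antipodal_class_in antipodal_rep_even ev)
  have inj: "h = ?P" if "h \<in> extensional projective_space" "?lift h = ?p" for h
  proof (rule extensionalityI[OF that(1)])
    show "?P \<in> extensional projective_space" by simp
    fix c :: "'a set" assume "c \<in> projective_space"
    then obtain x where x: "norm x = 1" "c = antipodal_class x" by (auto simp: projective_space_def)
    have "?lift h x = ?lift ?P x" using that(2) lP by simp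
    then show "h c = ?P c" using x by simp
  qed
  have shm: "g \<in> borel_measurable surface_measure" if "g \<in> spherical_harmonics n" for g :: "'a \<Rightarrow> complex"
  proof -
    obtain u where u: "homogeneous_harmonic_polynomial n u" "g = restrict u (sphere 0 1)"
      using \<open>g \<in> spherical_harmonics n\<close> by (auto simp: spherical_harmonics_def)
    have "polynomial_function u" using u by (simp add: homogeneous_harmonic_polynomial_def)
    then have "u \<in> borel_measurable borel"
      by (intro borel_measurable_continuous_onI continuous_on_polymonial_function)
    then have "u \<in> borel_measurable surface_measure" by (rule measurable_surface_measure_borel)
    then show ?thesis by (rule measurable_cong[THEN iffD1, rotated]) (auto simp: u)
  qed
  have phm: "h \<in> borel_measurable projective_measure" if "h \<in> projective_harmonics n" for h :: "'a set \<Rightarrow> complex"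
  proof -
    have "?lift h \<in> borel_measurable surface_measure"
      using that shm by (auto simp: projective_harmonics_def)
    then have "h \<circ> antipodal_class \<in> borel_measurable surface_measure"
      by (rule measurable_cong[THEN iffD1, rotated]) auto
    then show ?thesis by (simp add: measurable_projective_measure_iff)
  qed
  have int: "(LINT c|projective_measure. (F c - h c) * cnj (g c)) = (LINT x|surface_measure. (?f x - ?lift h x) * cnj (?lift g x))"
    if "h \<in> projective_harmonics n" "g \<in> projective_harmonics n" for h g
  proof -
    note [measurable] = phm[OF that(1)] phm[OF that(2)] Fm
    have [measurable]: "(\<lambda>c. cnj (g c)) \<in> borel_measurable projective_measure"
      by (rule measurable_compose[OF phm[OF that(2)]]) (intro borel_measurable_continuous_onI continuous_intros)
    have "(LINT c|projective_measure. (F c - h c) * cnj (g c)) = (LINT x|surface_measure. (F (antipodal_class x) - h (antipodal_class x)) * cnj (g (antipodal_class x)))"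
      by (rule integral_projective_measure(1)) measurable
    also have "\<dots> = (LINT x|surface_measure. (?f x - ?lift h x) * cnj (?lift g x))"
      by (rule Bochner_Integration.integral_cong) auto
    finally show ?thesis .
  qed
  have lift_ph: "?lift g \<in> spherical_harmonics n" if "g \<in> projective_harmonics n" for g
    using that by (simp add: projective_harmonics_def)
  have sur: "\<exists>g'\<in>projective_harmonics n. g = ?lift g'" if g: "g \<in> spherical_harmonics n" for g :: "'a \<Rightarrow> complex"
  proof -
    obtain u where u: "homogeneous_harmonic_polynomial n u" "g = restrict u (sphere 0 1)"
      using g by (auto simp: spherical_harmonics_def)
    have "u ((-1) *\<^sub>R x) = (-1) ^ n *\<^sub>R u x" for x
      using u(1) unfolding homogeneous_harmonic_polynomial_def by blast
    then have ue: "u (- x) = u x" for x using n by simp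
    let ?g = "restrict (\<lambda>c. u (antipodal_rep c)) projective_space"
    have "?lift ?g = g"
      by (rule ext) (auto simp: u(2) restrict_def antipodal_class_in antipodal_rep_even ue)
    then show ?thesis using g by (intro bexI[of _ ?g]) (auto simp: projective_harmonics_def)
  qed
  have iff: "h \<in> projective_harmonics n \<and> (\<forall>g\<in>projective_harmonics n. (LINT c|projective_measure. (F c - h c) * cnj (g c)) = 0)
    \<longleftrightarrow> h = ?P" for h
  proof
    assume h: "h \<in> projective_harmonics n \<and> (\<forall>g\<in>projective_harmonics n. (LINT c|projective_measure. (F c - h c) * cnj (g c)) = 0)"
    have "\<forall>g\<in>spherical_harmonics n. (LINT x|surface_measure. (?f x - ?lift h x) * cnj (g x)) = 0"
    proof
      fix g :: "'a \<Rightarrow> complex" assume "g \<in> spherical_harmonics n"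
      then obtain g' where g': "g' \<in> projective_harmonics n" "g = ?lift g'" using sur by blast
      have "(LINT c|projective_measure. (F c - h c) * cnj (g' c)) = 0" using h g' by blast
      then show "(LINT x|surface_measure. (?f x - ?lift h x) * cnj (g x)) = 0"
        unfolding g'(2) int[OF conjunct1[OF h] g'(1)] .
    qed
    with lift_ph[OF conjunct1[OF h]] have "?lift h = ?p"
      using spherical_harmonics_projection_iff[OF D f, of "?lift h" n] by blast
    then show "h = ?P" using h by (intro inj) (auto simp: projective_harmonics_def)
  next
    assume h: "h = ?P"
    have p: "?p \<in> spherical_harmonics n \<and> (\<forall>g\<in>spherical_harmonics n. (LINT x|surface_measure. (?f x - ?p x) * cnj (g x)) = 0)"
      using spherical_harmonics_projection_iff[OF D f, of ?p n] by blast
    have hp: "h \<in> projective_harmonics n" using p lP unfolding h by (simp add: projective_harmonics_def)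
    show "h \<in> projective_harmonics n \<and> (\<forall>g\<in>projective_harmonics n. (LINT c|projective_measure. (F c - h c) * cnj (g c)) = 0)"
    proof (intro conjI ballI hp)
      fix g :: "'a set \<Rightarrow> complex" assume g: "g \<in> projective_harmonics n"
      show "(LINT c|projective_measure. (F c - h c) * cnj (g c)) = 0"
        unfolding int[OF hp g] unfolding h lP using p lift_ph[OF g] by blast
    qed
  qed
  show ?thesis unfolding Proj_def iff by (rule the_eq_trivial)
qed

lemma sum_even_terms:
  fixes a :: "nat \<Rightarrow> 'b::comm_monoid_add"
  assumes "\<And>n. odd n \<Longrightarrow> a n = 0"
  shows "(\<Sum>n<N. a (2 * n)) = (\<Sum>m<2 * N. a m)"
  by (induction N) (simp_all add: assms)

text \<open>For an even lift the odd terms of the spherical series vanish, so \<open>N\<close> terms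
  of the projective series lift to \<open>2 * N\<close> terms of the spherical one; L2 convergence
  holds along this subsequence. The other hypotheses of the abstract criterion are transported by
  lifting.\<close>

lemma fractional_integral_projective_eq_frac_op:
  fixes F :: "'a::euclidean_space set \<Rightarrow> complex"
  assumes D: "3 \<le> DIM('a)" and \<sigma>: "0 < \<sigma>" and F: "integrable projective_measure F"
  shows "AE c in projective_measure.
    fractional_integral projective_measure (\<lambda>n. projective_harmonics (2 * n)) (\<lambda>n. 2 * real n + lam TYPE('a)) \<sigma> F c
      = frac_op \<sigma> (sphere_part (F \<circ> antipodal_class)) (antipodal_rep c)"
proof (rule fractional_integral_AE_eq[where C="lam TYPE('a) powr (- \<sigma>)", OF finite_measure_projective _ _ _ _ _ F])
  let ?h = "\<lambda>G :: 'a set \<Rightarrow> complex. sphere_part (G \<circ> antipodal_class)" and ?pi = "antipodal_class :: 'a \<Rightarrow> 'a set"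
  have lift: "G \<circ> ?pi \<in> borel_measurable surface_measure" if "G \<in> borel_measurable projective_measure" for G :: "'a set \<Rightarrow> complex"
    using that by (simp add: measurable_projective_measure_iff)
  have hm: "?h G \<in> borel_measurable borel" if "G \<in> borel_measurable projective_measure" for G
    by (rule measurable_sphere_part[OF lift[OF that]])
  have km: "frac_op \<sigma> (?h G) \<in> borel_measurable borel" if "G \<in> borel_measurable projective_measure" for G
    by (rule frac_op_measurable[OF D \<sigma> hm[OF that]])
  have kr: "frac_op \<sigma> (?h G) (antipodal_rep (?pi x)) = frac_op \<sigma> (?h G) x" if "G \<in> borel_measurable projective_measure" "norm x = 1" for G x
    by (rule antipodal_rep_even[OF that(2)]) (rule frac_op_uminus[OF D \<sigma> hm[OF that(1)] sphere_part_lift_even])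
  have pm: "(\<lambda>c. v (antipodal_rep c)) \<in> borel_measurable projective_measure"
    if "v \<in> borel_measurable borel" "\<And>x. norm x = 1 \<Longrightarrow> v (- x) = v x" for v :: "'a \<Rightarrow> complex"
    unfolding measurable_projective_measure_iff
    by (rule measurable_cong[THEN iffD1, OF _ measurable_surface_measure_borel[OF that(1)]]) (simp add: antipodal_rep_even that(2))
  have kpm: "(\<lambda>c. frac_op \<sigma> (?h G) (antipodal_rep c)) \<in> borel_measurable projective_measure" if "G \<in> borel_measurable projective_measure" for G
    by (rule pm[OF km[OF that]]) (rule frac_op_uminus[OF D \<sigma> hm[OF that] sphere_part_lift_even])
  have li: "integrable surface_measure (G \<circ> ?pi)" if "integrable projective_measure G" for G :: "'a set \<Rightarrow> complex"
    using that integral_projective_measure(2)[of G] by (simp add: o_def)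
  have L2i: "integrable projective_measure G" if "G \<in> L2_functions projective_measure" for G :: "'a set \<Rightarrow> complex"
  proof -
    interpret finite_measure "projective_measure :: 'a set measure" by (rule finite_measure_projective)
    have [measurable]: "G \<in> borel_measurable projective_measure" using that by (simp add: L2_functions_def)
    have "(\<lambda>c. cmod (G c)) \<in> borel_measurable projective_measure" by measurable
    then have "integrable projective_measure (\<lambda>c. cmod (G c))"
      by (rule square_integrable_imp_integrable) (use that in \<open>simp add: L2_functions_def\<close>)
    then show ?thesis using that by (simp add: L2_functions_def integrable_norm_iff)
  qed
  have L2l: "G \<circ> ?pi \<in> L2_functions surface_measure" if "G \<in> L2_functions projective_measure" for G
  proof -
    have [measurable]: "G \<in> borel_measurable projective_measure" using that by (simp add: L2_functions_def)
    have "(\<lambda>c. (cmod (G c))\<^sup>2) \<in> borel_measurable projective_measure" by measurable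
    from integral_projective_measure(2)[OF this] show ?thesis
      using that lift[of G] by (simp add: L2_functions_def)
  qed
  have L2d: "H \<in> L2_functions projective_measure"
    if "H \<in> borel_measurable projective_measure" "v \<in> L2_functions surface_measure" "\<And>x. norm x = 1 \<Longrightarrow> H (?pi x) = v x" for H v
  proof -
    note [measurable] = that(1)
    have "(\<lambda>c. (cmod (H c))\<^sup>2) \<in> borel_measurable projective_measure" by measurable
    note i = integral_projective_measure(2)[OF this]
    have "integrable surface_measure (\<lambda>x. (cmod (v x))\<^sup>2)" using that(2) by (simp add: L2_functions_def)
    then have "integrable surface_measure (\<lambda>x. (cmod (H (?pi x)))\<^sup>2)"
      by (rule Bochner_Integration.integrable_cong[THEN iffD1, OF refl, rotated]) (simp add: that(3))
    then show ?thesis using i that(1) by (simp add: L2_functions_def)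
  qed
  fix G :: "'a set \<Rightarrow> complex"
  {
    assume G: "integrable projective_measure G"
    have Gm: "G \<in> borel_measurable projective_measure" using G by auto
    note iG = integrable_frac_op[OF D \<sigma> integrable_sphere_part[OF li[OF G]]]
    show "integrable projective_measure (\<lambda>c. frac_op \<sigma> (?h G) (antipodal_rep c))"
      using integral_projective_measure(2)[OF kpm[OF Gm]] integral_sph_surface(2)[OF km[OF Gm] kr[OF Gm]] iG by simp
    fix F :: "'a set \<Rightarrow> complex" assume F: "integrable projective_measure F"
    have Fm: "F \<in> borel_measurable projective_measure" using F by auto
    have "(LINT c|projective_measure. cmod (frac_op \<sigma> (?h F) (antipodal_rep c) - frac_op \<sigma> (?h G) (antipodal_rep c)))
      = (LINT x|surface_measure. cmod (frac_op \<sigma> (?h F) (antipodal_rep (?pi x)) - frac_op \<sigma> (?h G) (antipodal_rep (?pi x))))"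
      using kpm[OF Gm] kpm[OF Fm] by (intro integral_projective_measure(1)) measurable
    also have "\<dots> = (LINT x|sph. cmod (frac_op \<sigma> (?h F) x - frac_op \<sigma> (?h G) x))"
      using km[OF Gm] km[OF Fm] by (intro integral_sph_surface(1)) (auto simp: kr Gm Fm)
    also have "\<dots> \<le> lam TYPE('a) powr (- \<sigma>) * (LINT x|sph. cmod (?h F x - ?h G x))"
      by (rule integral_frac_op_diff_le[OF D \<sigma> integrable_sphere_part[OF li[OF F]] integrable_sphere_part[OF li[OF G]]])
    also have "(LINT x|sph. cmod (?h F x - ?h G x)) = (LINT x|surface_measure. cmod (F (?pi x) - G (?pi x)))"
      using hm[OF Gm] hm[OF Fm] by (intro integral_sph_surface(1)[symmetric]) (auto simp: sphere_part_sphere)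
    also have "\<dots> = (LINT c|projective_measure. cmod (F c - G c))"
      using Gm Fm by (intro integral_projective_measure(1)[symmetric]) measurable
    finally show "(LINT c|projective_measure. cmod (frac_op \<sigma> (?h F) (antipodal_rep c) - frac_op \<sigma> (?h G) (antipodal_rep c)))
      \<le> lam TYPE('a) powr (- \<sigma>) * (LINT c|projective_measure. cmod (F c - G c))" .
  }
  assume G: "G \<in> L2_functions projective_measure"
  have Gm: "G \<in> borel_measurable projective_measure" using G by (simp add: L2_functions_def)
  note Gi = L2i[OF G] and Gl = L2l[OF G]
  note hi = integrable_sphere_part[OF li[OF Gi]]
  have zm: "complex_zonal_proj n (?h G) \<in> borel_measurable borel" for n
    by (rule borel_measurable_continuous_onI[OF complex_zonal_proj_measurable[OF hi]])
  note ze = complex_zonal_proj_uminus[OF hi sphere_part_lift_even]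
  have zpm: "(\<lambda>c. complex_zonal_proj n (?h G) (antipodal_rep c)) \<in> borel_measurable projective_measure" for n
    by (rule pm[OF zm ze])
  note [measurable] = kpm[OF Gm] zpm
  have P: "Proj projective_measure (projective_harmonics (2 * n)) G = restrict (\<lambda>c. complex_zonal_proj (2 * n) (?h G) (antipodal_rep c)) projective_space" for n
    by (rule Proj_projective_harmonics[OF D Gi]) simp
  show "Proj projective_measure (projective_harmonics (2 * n)) G \<in> L2_functions projective_measure" for n
    unfolding P
  proof (rule L2d[OF _ fractional_integral_frac_op_limit(3)[OF D \<sigma> Gl, of "2 * n"]])
    show "restrict (\<lambda>c. complex_zonal_proj (2 * n) (?h G) (antipodal_rep c)) projective_space \<in> borel_measurable projective_measure"
      by (rule measurable_cong[THEN iffD1, OF _ zpm]) simp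
  qed (simp add: antipodal_class_in antipodal_rep_even ze)
  show "(\<lambda>c. frac_op \<sigma> (?h G) (antipodal_rep c)) \<in> L2_functions projective_measure"
    by (rule L2d[OF kpm[OF Gm] fractional_integral_frac_op_limit(2)[OF D \<sigma> Gl] kr[OF Gm]])
  let ?L = "\<lambda>N. LINT x|surface_measure. (cmod (frac_op \<sigma> (?h G) x - (\<Sum>n<N. complex_zonal_proj n (?h G) x /\<^sub>R ((real n + lam TYPE('a)) powr \<sigma>))))\<^sup>2"
  have "(LINT c|projective_measure. (cmod (frac_op \<sigma> (?h G) (antipodal_rep c) - (\<Sum>n<N. Proj projective_measure (projective_harmonics (2 * n)) G c /\<^sub>R (2 * real n + lam TYPE('a)) powr \<sigma>)))\<^sup>2)
    = ?L (2 * N)" for N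
  proof -
    have "(LINT c|projective_measure. (cmod (frac_op \<sigma> (?h G) (antipodal_rep c) - (\<Sum>n<N. Proj projective_measure (projective_harmonics (2 * n)) G c /\<^sub>R (2 * real n + lam TYPE('a)) powr \<sigma>)))\<^sup>2)
      = (LINT c|projective_measure. (cmod (frac_op \<sigma> (?h G) (antipodal_rep c) - (\<Sum>n<N. complex_zonal_proj (2 * n) (?h G) (antipodal_rep c) /\<^sub>R (2 * real n + lam TYPE('a)) powr \<sigma>)))\<^sup>2)"
      by (rule Bochner_Integration.integral_cong) (simp_all add: P)
    also have "\<dots> = (LINT x|surface_measure. (cmod (frac_op \<sigma> (?h G) (antipodal_rep (?pi x)) - (\<Sum>n<N. complex_zonal_proj (2 * n) (?h G) (antipodal_rep (?pi x)) /\<^sub>R (2 * real n + lam TYPE('a)) powr \<sigma>)))\<^sup>2)"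
      by (intro integral_projective_measure(1)) measurable
    also have "\<dots> = ?L (2 * N)"
    proof (rule Bochner_Integration.integral_cong[OF refl])
      fix x :: 'a assume "x \<in> space surface_measure"
      then have x: "norm x = 1" by simp
      have "(\<Sum>n<N. complex_zonal_proj (2 * n) (?h G) (antipodal_rep (?pi x)) /\<^sub>R (2 * real n + lam TYPE('a)) powr \<sigma>)
        = (\<Sum>m<2 * N. complex_zonal_proj m (?h G) x /\<^sub>R (real m + lam TYPE('a)) powr \<sigma>)"
        using sum_even_terms[of "\<lambda>m. complex_zonal_proj m (?h G) x /\<^sub>R (real m + lam TYPE('a)) powr \<sigma>" N]
        by (simp add: complex_zonal_proj_odd_eq_0[OF hi sphere_part_lift_even x] antipodal_rep_even x ze)
      then show "(cmod (frac_op \<sigma> (?h G) (antipodal_rep (?pi x)) - (\<Sum>n<N. complex_zonal_proj (2 * n) (?h G) (antipodal_rep (?pi x)) /\<^sub>R (2 * real n + lam TYPE('a)) powr \<sigma>)))\<^sup>2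
        = (cmod (frac_op \<sigma> (?h G) x - (\<Sum>n<2 * N. complex_zonal_proj n (?h G) x /\<^sub>R ((real n + lam TYPE('a)) powr \<sigma>))))\<^sup>2"
        by (simp add: kr[OF Gm x])
    qed
    finally show ?thesis .
  qed
  moreover have "(\<lambda>N. ?L (2 * N)) \<longlonglongrightarrow> 0"
    using LIMSEQ_subseq_LIMSEQ[OF fractional_integral_frac_op_limit(1)[OF D \<sigma> Gl], of "\<lambda>N. 2 * N"]
    by (simp add: o_def strict_mono_def)
  ultimately show "(\<lambda>N. LINT c|projective_measure. (cmod (frac_op \<sigma> (?h G) (antipodal_rep c) - (\<Sum>n<N. Proj projective_measure (projective_harmonics (2 * n)) G c /\<^sub>R (2 * real n + lam TYPE('a)) powr \<sigma>)))\<^sup>2) \<longlonglongrightarrow> 0"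
    by simp
qed

subsection \<open>Inequalities for Lebesgue integrals\<close>

lemma epowr_ennreal: "0 \<le> x \<Longrightarrow> epowr (ennreal x) a = ennreal (x powr a)"
  by (simp add: epowr_def)

lemma epowr_top [simp]: "epowr \<infinity> a = \<infinity>" "epowr top a = \<infinity>"
  by (simp_all add: epowr_def)

lemma epowr_0 [simp]: "epowr 0 a = 0"
  by (simp_all add: epowr_def)

lemma epowr_one [simp]: "epowr t 1 = t"
  by (cases t) (auto simp: epowr_ennreal)

lemma epowr_two: "epowr t 2 = t\<^sup>2"
  by (cases t) (auto simp: epowr_ennreal ennreal_power)

lemma epowr_measurable [measurable (raw)]:
  assumes [measurable]: "f \<in> borel_measurable M"
  shows "(\<lambda>x. epowr (f x) a) \<in> borel_measurable M"
  unfolding epowr_def by measurable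

lemma epowr_mono: "0 \<le> a \<Longrightarrow> s \<le> t \<Longrightarrow> epowr s a \<le> epowr t a"
  by (cases s; cases t) (auto simp: epowr_ennreal intro!: ennreal_leI powr_mono2 simp: top_unique)

lemma epowr_eq_0_iff [simp]: "epowr t a = 0 \<longleftrightarrow> t = 0"
  by (cases t) (auto simp: epowr_ennreal)

lemma epowr_eq_top_iff [simp]: "epowr t a = \<infinity> \<longleftrightarrow> t = \<infinity>" "epowr t a = top \<longleftrightarrow> t = top"
  by (auto simp: epowr_def)

text \<open>\<open>epowr\<close> fixes 0 and \<infinity> for every exponent, and
  \<open>0 * \<infinity> = 0\<close> in \<open>ennreal\<close>, so the law has no exceptional
  cases.\<close>

lemma epowr_mult: "epowr (s * t) a = epowr s a * epowr t a"
proof (cases "s = 0 \<or> t = 0 \<or> s = \<infinity> \<or> t = \<infinity>")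
  case True
  then show ?thesis by (auto simp: ennreal_mult_top ennreal_top_mult)
next
  case False
  then show ?thesis
    by (cases s; cases t) (auto simp: epowr_ennreal ennreal_mult[symmetric] powr_mult)
qed

lemma epowr_epowr: "epowr (epowr t a) b = epowr t (a * b)"
  by (cases t) (auto simp: epowr_ennreal powr_powr)

lemma epowr_add: "epowr t (a + b) = epowr t a * epowr t b"
  by (cases t) (auto simp: epowr_ennreal powr_add ennreal_mult[symmetric] ennreal_mult_top)

lemma epowr_half_power2 [simp]: "(epowr t (1 / 2))\<^sup>2 = t"
  using epowr_epowr[of t "1 / 2" 2] by (simp add: epowr_two)

text \<open>Unless one of the integrals F and G is 0 or infinite, where the bound is trivial, the
  weighted arithmetic-geometric inequality is applied pointwise to f/F and g/G; integrating gives a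
  + b = 1. The powers are placed outside the functions so that no conjugate exponents have to be
  inverted.\<close>

lemma Holder_nn_integral:
  assumes [measurable]: "f \<in> borel_measurable M" "g \<in> borel_measurable M"
    and ab: "0 < a" "0 < b" "a + b = 1"
  shows "(\<integral>\<^sup>+x. epowr (f x) a * epowr (g x) b \<partial>M) \<le> epowr (\<integral>\<^sup>+x. f x \<partial>M) a * epowr (\<integral>\<^sup>+x. g x \<partial>M) b"
proof -
  define F where "F = (\<integral>\<^sup>+x. f x \<partial>M)"
  define G where "G = (\<integral>\<^sup>+x. g x \<partial>M)"
  consider "F = 0 \<or> G = 0" | "F \<noteq> 0" "G \<noteq> 0" "F = \<infinity> \<or> G = \<infinity>" | "F \<noteq> 0" "G \<noteq> 0" "F \<noteq> \<infinity>" "G \<noteq> \<infinity>" by blast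
  then show ?thesis
  proof cases
    case 1
    then have "(AE x in M. f x = 0) \<or> (AE x in M. g x = 0)"
      by (auto simp: F_def G_def nn_integral_0_iff_AE)
    then have "AE x in M. epowr (f x) a * epowr (g x) b = 0"
      by (auto elim!: eventually_mono)
    then have "(\<integral>\<^sup>+x. epowr (f x) a * epowr (g x) b \<partial>M) = 0"
      by (subst nn_integral_0_iff_AE) auto
    then show ?thesis by simp
  next
    case 2
    then have "epowr F a * epowr G b = \<infinity>" by (auto simp: ennreal_mult_eq_top_iff)
    then show ?thesis by (simp add: F_def G_def)
  next
    case 3
    then obtain F' G' where F': "F = ennreal F'" "0 < F'" and G': "G = ennreal G'" "0 < G'"
      by (cases F; cases G) (auto simp: less_le)
    have pw: "epowr s a * epowr t b \<le> ennreal (F' powr a * G' powr b) * (ennreal (a / F') * s + ennreal (b / G') * t)" for s t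
    proof -
      consider "s = 0 \<or> t = 0" | "s \<noteq> 0" "t \<noteq> 0" "s = \<infinity> \<or> t = \<infinity>" | x y where "s = ennreal x" "t = ennreal y" "0 < x" "0 < y"
        by (cases s; cases t) (auto simp: less_le)
      then show ?thesis
      proof cases
        case 1
        then show ?thesis by auto
      next
        case 2
        then show ?thesis using ab F' G' by (auto simp: ennreal_mult_eq_top_iff ennreal_mult_top)
      next
        case (3 x y)
        have "(x / F') powr a * (y / G') powr b \<le> a * (x / F') + b * (y / G')"
          by (rule Youngs_inequality_0) (use ab 3 F' G' in auto)
        then have "F' powr a * G' powr b * ((x / F') powr a * (y / G') powr b) \<le> F' powr a * G' powr b * (a * (x / F') + b * (y / G'))"
          by (rule mult_left_mono) simp
        moreover have "F' powr a * G' powr b * ((x / F') powr a * (y / G') powr b) = x powr a * y powr b"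
          using 3 F' G' by (simp add: powr_divide)
        ultimately have le: "x powr a * y powr b \<le> F' powr a * G' powr b * (a / F' * x + b / G' * y)" by simp
        have "epowr s a * epowr t b = ennreal (x powr a * y powr b)"
          using 3 by (simp add: epowr_ennreal ennreal_mult)
        also have "\<dots> \<le> ennreal (F' powr a * G' powr b * (a / F' * x + b / G' * y))"
          by (rule ennreal_leI[OF le])
        also have "\<dots> = ennreal (F' powr a * G' powr b) * ennreal (a / F' * x + b / G' * y)"
          by (rule ennreal_mult') simp
        also have "ennreal (a / F' * x + b / G' * y) = ennreal (a / F') * s + ennreal (b / G') * t"
          using 3 ab F' G' by (simp add: ennreal_plus ennreal_mult'[symmetric] less_imp_le)
        finally show ?thesis .
      qed
    qed
    have "(\<integral>\<^sup>+x. epowr (f x) a * epowr (g x) b \<partial>M) \<le> (\<integral>\<^sup>+x. ennreal (F' powr a * G' powr b) * (ennreal (a / F') * f x + ennreal (b / G') * g x) \<partial>M)"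
      by (intro nn_integral_mono pw)
    also have "\<dots> = ennreal (F' powr a * G' powr b) * (ennreal (a / F') * F + ennreal (b / G') * G)"
      by (simp add: nn_integral_cmult nn_integral_add F_def G_def)
    also have "ennreal (a / F') * F + ennreal (b / G') * G = 1"
      using F' G' ab by (simp add: ennreal_mult'[symmetric] ennreal_plus[symmetric] del: ennreal_plus)
    also have "ennreal (F' powr a * G' powr b) * 1 = epowr F a * epowr G b"
      using F' G' by (simp add: epowr_ennreal ennreal_mult)
    finally show ?thesis by (simp add: F_def G_def)
  qed
qed

lemma Cauchy_Schwarz_nn_integral_half:
  assumes [measurable]: "f \<in> borel_measurable M" "g \<in> borel_measurable M"
  shows "(\<integral>\<^sup>+x. f x * g x \<partial>M) \<le> epowr (\<integral>\<^sup>+x. (f x)\<^sup>2 \<partial>M) (1 / 2) * epowr (\<integral>\<^sup>+x. (g x)\<^sup>2 \<partial>M) (1 / 2)"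
proof -
  have "epowr (x\<^sup>2) (1 / 2) = x" for x :: ennreal
    using epowr_epowr[of x 2 "1 / 2"] by (simp add: epowr_two)
  then show ?thesis using Holder_nn_integral[of "\<lambda>x. (f x)\<^sup>2" M "\<lambda>x. (g x)\<^sup>2" "1 / 2" "1 / 2"] by simp
qed

text \<open>Writing \<open>k G = k\<^bsup>r/p'\<^esup> (k\<^bsup>r/q\<^esup> G)\<close> and \<open>k\<^bsup>r p/q\<^esup> G\<^sup>p = (k\<^sup>r G\<^sup>p)\<^bsup>p/q\<^esup> (G\<^sup>p)\<^bsup>1-p/q\<^esup>\<close>, two
  applications of Hoelder's inequality give Young's inequality for kernels.\<close>

lemma Young_nn_integral:
  fixes k :: "'a \<Rightarrow> 'a \<Rightarrow> ennreal"
  assumes M: "sigma_finite_measure M"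
    and km: "(\<lambda>(u, v). k u v) \<in> borel_measurable (M \<Otimes>\<^sub>M M)" and [measurable]: "G \<in> borel_measurable M"
    and pq: "1 < p" "p \<le> q" and r: "0 < r" "1 / r = 1 + 1 / q - 1 / p"
    and A1: "\<And>u. u \<in> space M \<Longrightarrow> (\<integral>\<^sup>+v. epowr (k u v) r \<partial>M) \<le> A"
    and A2: "\<And>v. v \<in> space M \<Longrightarrow> (\<integral>\<^sup>+u. epowr (k u v) r \<partial>M) \<le> A"
  shows "(\<integral>\<^sup>+u. epowr (\<integral>\<^sup>+v. k u v * G v \<partial>M) q \<partial>M) \<le> epowr A (q / r) * epowr (\<integral>\<^sup>+v. epowr (G v) p \<partial>M) (q / p)"
proof -
  interpret sigma_finite_measure M by (rule M)
  interpret P: pair_sigma_finite M M ..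
  note [measurable] = km
  have kr [measurable]: "k u \<in> borel_measurable M" if "u \<in> space M" for u
    using measurable_compose[OF measurable_Pair1' km] that by simp
  define a where "a = 1 - 1 / p"
  have a: "0 < a" "a + 1 / p = 1" using pq by (auto simp: a_def)
  have q: "0 < q" using pq by simp
  have ra: "r * a + r / q = 1" using r(2) r(1) pq q by (simp add: a_def field_simps)
  define N where "N = (\<integral>\<^sup>+v. epowr (G v) p \<partial>M)"
  \<comment> \<open>The factor contributed by the second application of Hoelder's inequality. At
    \<open>p = q\<close> its exponent is 0, where \<open>epowr\<close> would still give 0 at 0 and
    \<infinity> at \<infinity>, so the value 1 is put in explicitly.\<close>
  define W where "W = (if p < q then epowr N (q / p - 1) else 1)"
  have pw: "epowr (\<integral>\<^sup>+v. k u v * G v \<partial>M) q \<le> epowr A (q * a) * W * (\<integral>\<^sup>+v. epowr (k u v) r * epowr (G v) p \<partial>M)"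
    if u: "u \<in> space M" for u
  proof -
    note [measurable] = kr[OF u]
    have s1: "k u v * G v = epowr (epowr (k u v) r) a * epowr (epowr (k u v) (r * p / q) * epowr (G v) p) (1 / p)" for v
      using pq q ra by (simp add: epowr_mult epowr_epowr mult.assoc[symmetric] epowr_add[symmetric])
    have "(\<integral>\<^sup>+v. k u v * G v \<partial>M) \<le> epowr (\<integral>\<^sup>+v. epowr (k u v) r \<partial>M) a * epowr (\<integral>\<^sup>+v. epowr (k u v) (r * p / q) * epowr (G v) p \<partial>M) (1 / p)"
      unfolding s1 by (rule Holder_nn_integral) (use a pq in auto)
    also have "\<dots> \<le> epowr A a * epowr (\<integral>\<^sup>+v. epowr (k u v) (r * p / q) * epowr (G v) p \<partial>M) (1 / p)"
      by (intro mult_right_mono epowr_mono A1 u) (use a in auto)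
    also have "\<dots> \<le> epowr A a * epowr (epowr (\<integral>\<^sup>+v. epowr (k u v) r * epowr (G v) p \<partial>M) (p / q) * epowr W (p / q)) (1 / p)"
    proof (intro mult_left_mono epowr_mono)
      show "(\<integral>\<^sup>+v. epowr (k u v) (r * p / q) * epowr (G v) p \<partial>M) \<le> epowr (\<integral>\<^sup>+v. epowr (k u v) r * epowr (G v) p \<partial>M) (p / q) * epowr W (p / q)"
      proof (cases "p < q")
        case True
        have s2: "epowr (k u v) (r * p / q) * epowr (G v) p = epowr (epowr (k u v) r * epowr (G v) p) (p / q) * epowr (epowr (G v) p) (1 - p / q)" for v
        proof -
          have "p * (p / q) + p * (1 - p / q) = p" by (simp add: algebra_simps)
          then show ?thesis by (simp add: epowr_mult epowr_epowr mult.assoc epowr_add[symmetric])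
        qed
        have "(\<integral>\<^sup>+v. epowr (k u v) (r * p / q) * epowr (G v) p \<partial>M) \<le> epowr (\<integral>\<^sup>+v. epowr (k u v) r * epowr (G v) p \<partial>M) (p / q) * epowr N (1 - p / q)"
          unfolding s2 N_def by (rule Holder_nn_integral) (use pq True in auto)
        also have "epowr N (1 - p / q) = epowr W (p / q)"
        proof -
          have "(q / p - 1) * (p / q) = 1 - p / q" using pq by (simp add: field_simps)
          then show ?thesis using True by (simp add: W_def epowr_epowr)
        qed
        finally show ?thesis .
      next
        case False
        then have "p = q" using pq by simp
        then show ?thesis using q by (simp add: W_def)
      qed
    qed (use pq in auto)
    also have "\<dots> = epowr A a * (epowr (\<integral>\<^sup>+v. epowr (k u v) r * epowr (G v) p \<partial>M) (1 / q) * epowr W (1 / q))"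
      using pq by (simp add: epowr_mult epowr_epowr)
    finally have "epowr (\<integral>\<^sup>+v. k u v * G v \<partial>M) q \<le> epowr (epowr A a * (epowr (\<integral>\<^sup>+v. epowr (k u v) r * epowr (G v) p \<partial>M) (1 / q) * epowr W (1 / q))) q"
      using q by (intro epowr_mono) auto
    also have "\<dots> = epowr A (q * a) * W * (\<integral>\<^sup>+v. epowr (k u v) r * epowr (G v) p \<partial>M)"
      using q by (simp add: epowr_mult epowr_epowr mult_ac)
    finally show ?thesis .
  qed
  have "(\<integral>\<^sup>+u. epowr (\<integral>\<^sup>+v. k u v * G v \<partial>M) q \<partial>M) \<le> (\<integral>\<^sup>+u. epowr A (q * a) * W * (\<integral>\<^sup>+v. epowr (k u v) r * epowr (G v) p \<partial>M) \<partial>M)"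
    by (intro nn_integral_mono pw)
  also have "\<dots> = epowr A (q * a) * W * (\<integral>\<^sup>+u. (\<integral>\<^sup>+v. epowr (k u v) r * epowr (G v) p \<partial>M) \<partial>M)"
    by (rule nn_integral_cmult) measurable
  also have "(\<integral>\<^sup>+u. (\<integral>\<^sup>+v. epowr (k u v) r * epowr (G v) p \<partial>M) \<partial>M) = (\<integral>\<^sup>+v. (\<integral>\<^sup>+u. epowr (k u v) r * epowr (G v) p \<partial>M) \<partial>M)"
    by (rule P.Fubini'[symmetric]) measurable
  also have "\<dots> \<le> (\<integral>\<^sup>+v. A * epowr (G v) p \<partial>M)"
  proof (rule nn_integral_mono)
    fix v assume v: "v \<in> space M"
    then have [measurable]: "(\<lambda>u. k u v) \<in> borel_measurable M"
      using measurable_compose[OF measurable_Pair2' km] by simp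
    show "(\<integral>\<^sup>+u. epowr (k u v) r * epowr (G v) p \<partial>M) \<le> A * epowr (G v) p"
      by (simp add: nn_integral_multc mult_right_mono A2 v)
  qed
  also have "\<dots> = A * N" unfolding N_def by (rule nn_integral_cmult) measurable
  finally have "(\<integral>\<^sup>+u. epowr (\<integral>\<^sup>+v. k u v * G v \<partial>M) q \<partial>M) \<le> epowr A (q * a) * W * (A * N)"
    by (simp add: mult_left_mono)
  also have "\<dots> = (epowr A (q * a) * epowr A 1) * (W * N)" by (simp add: mult_ac)
  also have "epowr A (q * a) * epowr A 1 = epowr A (q / r)"
  proof -
    have "q * a + 1 = q / r" using r(2) q by (simp add: a_def field_simps)
    then show ?thesis unfolding epowr_add[symmetric] by simp
  qed
  also have "W * N = epowr N (q / p)"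
  proof (cases "p < q")
    case True
    then show ?thesis using epowr_add[of N "q / p - 1" 1] by (simp add: W_def)
  next
    case False
    then have "q / p = 1" using pq by simp
    then show ?thesis using False by (simp add: W_def)
  qed
  finally show ?thesis by (simp add: N_def)
qed

text \<open>The square of the inner integral is a double integral over \<open>v\<close> and
  \<open>w\<close>. Tonelli brings the integration in \<open>x\<close> inside, and Cauchy-Schwarz
  there separates the two variables into a square again.\<close>

lemma Minkowski_L2_nn_integral:
  assumes M: "sigma_finite_measure M" and X: "sigma_finite_measure X"
    and hm: "(\<lambda>(v, x). h v x) \<in> borel_measurable (M \<Otimes>\<^sub>M X)"
  shows "epowr (\<integral>\<^sup>+x. (\<integral>\<^sup>+v. h v x \<partial>M)\<^sup>2 \<partial>X) (1 / 2) \<le> (\<integral>\<^sup>+v. epowr (\<integral>\<^sup>+x. (h v x)\<^sup>2 \<partial>X) (1 / 2) \<partial>M)"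
proof -
  interpret M: sigma_finite_measure M by (rule M)
  interpret X: sigma_finite_measure X by (rule X)
  interpret P: pair_sigma_finite M X ..
  note [measurable] = hm
  let ?N = "\<lambda>v. epowr (\<integral>\<^sup>+x. (h v x)\<^sup>2 \<partial>X) (1 / 2)"
  have hx [measurable]: "(\<lambda>v. h v x) \<in> borel_measurable M" if "x \<in> space X" for x
    using measurable_compose[OF measurable_Pair2' hm] that by simp
  have hv [measurable]: "h v \<in> borel_measurable X" if "v \<in> space M" for v
    using measurable_compose[OF measurable_Pair1' hm] that by simp
  have "(\<integral>\<^sup>+x. (\<integral>\<^sup>+v. h v x \<partial>M)\<^sup>2 \<partial>X) = (\<integral>\<^sup>+x. (\<integral>\<^sup>+v. h v x * (\<integral>\<^sup>+w. h w x \<partial>M) \<partial>M) \<partial>X)"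
    by (intro nn_integral_cong) (simp add: nn_integral_multc power2_eq_square)
  also have "\<dots> = (\<integral>\<^sup>+v. (\<integral>\<^sup>+x. h v x * (\<integral>\<^sup>+w. h w x \<partial>M) \<partial>X) \<partial>M)"
    by (rule P.Fubini') measurable
  also have "\<dots> = (\<integral>\<^sup>+v. (\<integral>\<^sup>+x. (\<integral>\<^sup>+w. h v x * h w x \<partial>M) \<partial>X) \<partial>M)"
    by (intro nn_integral_cong) (simp add: nn_integral_cmult)
  also have "\<dots> = (\<integral>\<^sup>+v. (\<integral>\<^sup>+w. (\<integral>\<^sup>+x. h v x * h w x \<partial>X) \<partial>M) \<partial>M)"
  proof (rule nn_integral_cong)
    fix v assume v: "v \<in> space M"
    note [measurable] = hv[OF v]
    show "(\<integral>\<^sup>+x. (\<integral>\<^sup>+w. h v x * h w x \<partial>M) \<partial>X) = (\<integral>\<^sup>+w. (\<integral>\<^sup>+x. h v x * h w x \<partial>X) \<partial>M)"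
      by (rule P.Fubini') measurable
  qed
  also have "\<dots> \<le> (\<integral>\<^sup>+v. (\<integral>\<^sup>+w. ?N v * ?N w \<partial>M) \<partial>M)"
    by (intro nn_integral_mono Cauchy_Schwarz_nn_integral_half hv)
  also have "\<dots> = (\<integral>\<^sup>+v. ?N v * (\<integral>\<^sup>+w. ?N w \<partial>M) \<partial>M)"
    by (intro nn_integral_cong nn_integral_cmult) measurable
  also have "\<dots> = (\<integral>\<^sup>+v. ?N v \<partial>M)\<^sup>2"
    by (subst nn_integral_multc) (simp_all add: power2_eq_square)
  finally have "epowr (\<integral>\<^sup>+x. (\<integral>\<^sup>+v. h v x \<partial>M)\<^sup>2 \<partial>X) (1 / 2) \<le> epowr ((\<integral>\<^sup>+v. ?N v \<partial>M)\<^sup>2) (1 / 2)"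
    by (intro epowr_mono) auto
  also have "\<dots> = (\<integral>\<^sup>+v. ?N v \<partial>M)"
    using epowr_epowr[of "(\<integral>\<^sup>+v. ?N v \<partial>M)" 2 "1 / 2"] by (simp add: epowr_two)
  finally show ?thesis .
qed

text \<open>One half power of the kernel is kept with \<open>f\<close> and one is split off;
  Cauchy-Schwarz uses the bound on the integrals in \<open>y\<close>, and after Tonelli the bound on
  the integrals in \<open>x\<close> finishes. Bounds almost everywhere suffice, which suits
  integrals over \<open>sph\<close>.\<close>

lemma Schur_L2_nn_integral:
  assumes X: "sigma_finite_measure X"
    and km: "(\<lambda>(x, y). k x y) \<in> borel_measurable (X \<Otimes>\<^sub>M X)" and [measurable]: "f \<in> borel_measurable X"
    and A1: "AE x in X. (\<integral>\<^sup>+y. k x y \<partial>X) \<le> A" and A2: "AE y in X. (\<integral>\<^sup>+x. k x y \<partial>X) \<le> A"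
  shows "epowr (\<integral>\<^sup>+x. (\<integral>\<^sup>+y. k x y * f y \<partial>X)\<^sup>2 \<partial>X) (1 / 2) \<le> A * epowr (\<integral>\<^sup>+y. (f y)\<^sup>2 \<partial>X) (1 / 2)"
proof -
  interpret X: sigma_finite_measure X by (rule X)
  interpret P: pair_sigma_finite X X ..
  note [measurable] = km
  have kx [measurable]: "k x \<in> borel_measurable X" if "x \<in> space X" for x
    using measurable_compose[OF measurable_Pair1' km] that by simp
  have ky [measurable]: "(\<lambda>x. k x y) \<in> borel_measurable X" if "y \<in> space X" for y
    using measurable_compose[OF measurable_Pair2' km] that by simp
  have "(\<integral>\<^sup>+x. (\<integral>\<^sup>+y. k x y * f y \<partial>X)\<^sup>2 \<partial>X) \<le> (\<integral>\<^sup>+x. A * (\<integral>\<^sup>+y. k x y * (f y)\<^sup>2 \<partial>X) \<partial>X)"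
  proof (rule nn_integral_mono_AE, use A1 AE_space in eventually_elim)
    case (elim x)
    note [measurable] = kx[OF elim(2)]
    have "(\<integral>\<^sup>+y. k x y * f y \<partial>X) = (\<integral>\<^sup>+y. epowr (k x y) (1 / 2) * (epowr (k x y) (1 / 2) * f y) \<partial>X)"
      by (simp add: mult.assoc[symmetric] epowr_add[symmetric])
    then have "(\<integral>\<^sup>+y. k x y * f y \<partial>X)\<^sup>2 \<le> (\<integral>\<^sup>+y. (epowr (k x y) (1 / 2))\<^sup>2 \<partial>X) * (\<integral>\<^sup>+y. (epowr (k x y) (1 / 2) * f y)\<^sup>2 \<partial>X)"
      by (simp only:) (rule Cauchy_Schwarz_nn_integral; measurable)
    also have "\<dots> = (\<integral>\<^sup>+y. k x y \<partial>X) * (\<integral>\<^sup>+y. k x y * (f y)\<^sup>2 \<partial>X)"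
      by (simp add: power_mult_distrib)
    also have "\<dots> \<le> A * (\<integral>\<^sup>+y. k x y * (f y)\<^sup>2 \<partial>X)" by (rule mult_right_mono[OF elim(1)]) simp
    finally show ?case .
  qed
  also have "\<dots> = A * (\<integral>\<^sup>+x. (\<integral>\<^sup>+y. k x y * (f y)\<^sup>2 \<partial>X) \<partial>X)"
    by (rule nn_integral_cmult) measurable
  also have "(\<integral>\<^sup>+x. (\<integral>\<^sup>+y. k x y * (f y)\<^sup>2 \<partial>X) \<partial>X) = (\<integral>\<^sup>+y. (\<integral>\<^sup>+x. k x y * (f y)\<^sup>2 \<partial>X) \<partial>X)"
    by (rule P.Fubini'[symmetric]) measurable
  also have "\<dots> \<le> (\<integral>\<^sup>+y. A * (f y)\<^sup>2 \<partial>X)"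
  proof (rule nn_integral_mono_AE, use A2 AE_space in eventually_elim)
    case (elim y)
    note [measurable] = ky[OF elim(2)]
    show ?case by (simp add: nn_integral_multc mult_right_mono elim)
  qed
  also have "\<dots> = A * (\<integral>\<^sup>+y. (f y)\<^sup>2 \<partial>X)" by (rule nn_integral_cmult) measurable
  finally have "(\<integral>\<^sup>+x. (\<integral>\<^sup>+y. k x y * f y \<partial>X)\<^sup>2 \<partial>X) \<le> A\<^sup>2 * (\<integral>\<^sup>+y. (f y)\<^sup>2 \<partial>X)"
    by (simp add: mult_left_mono power2_eq_square mult.assoc)
  then have "epowr (\<integral>\<^sup>+x. (\<integral>\<^sup>+y. k x y * f y \<partial>X)\<^sup>2 \<partial>X) (1 / 2) \<le> epowr (A\<^sup>2 * (\<integral>\<^sup>+y. (f y)\<^sup>2 \<partial>X)) (1 / 2)"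
    by (intro epowr_mono) auto
  also have "\<dots> = A * epowr (\<integral>\<^sup>+y. (f y)\<^sup>2 \<partial>X) (1 / 2)"
    using epowr_epowr[of A 2 "1 / 2"] by (simp add: epowr_mult epowr_two)
  finally show ?thesis .
qed

subsection \<open>Kernel estimates\<close>

lemma sinh_ge_self: "0 \<le> t \<Longrightarrow> (t::real) \<le> sinh t"
proof -
  assume t: "0 \<le> t"
  have "\<exists>y. ((\<lambda>t. sinh t - t) has_real_derivative y) (at x) \<and> 0 \<le> y" for x :: real
    by (rule exI[of _ "cosh x - 1"]) (auto intro!: derivative_eq_intros cosh_real_ge_1)
  then have "sinh 0 - 0 \<le> sinh t - t"
    by (intro DERIV_nonneg_imp_nondecreasing[OF t])
  then show ?thesis by simp
qed

lemma cosh_ge_quadratic: "1 + w\<^sup>2 / 2 \<le> cosh (w::real)"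
proof -
  have "0 \<le> \<bar>w\<bar> / 2" by simp
  from sinh_ge_self[OF this] have "(\<bar>w\<bar> / 2)\<^sup>2 \<le> (sinh (\<bar>w\<bar> / 2))\<^sup>2" by (intro power_mono) auto
  moreover have "cosh \<bar>w\<bar> = 1 + 2 * (sinh (\<bar>w\<bar> / 2))\<^sup>2"
    using cosh_double_cosh[of "\<bar>w\<bar> / 2"] by (simp add: cosh_square_eq)
  moreover have "cosh \<bar>w\<bar> = cosh w" by (cases "0 \<le> w") auto
  ultimately show ?thesis by (simp add: power_divide)
qed

lemma cosh_minus_one: "cosh (s::real) - 1 = 2 * (sinh (s / 2))\<^sup>2"
  using cosh_double_cosh[of "s / 2"] by (simp add: cosh_square_eq)

lemma sinh_le_cosh_2: "0 \<le> s \<Longrightarrow> s \<le> 2 \<Longrightarrow> sinh s \<le> s * cosh (2::real)"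
proof -
  assume s: "0 \<le> s" "s \<le> 2"
  have "\<exists>y. ((\<lambda>t. t * cosh 2 - sinh t) has_real_derivative y) (at x) \<and> 0 \<le> y" if "0 \<le> x" "x \<le> s" for x :: real
  proof (rule exI[of _ "cosh 2 - cosh x"], rule conjI)
    show "((\<lambda>t. t * cosh 2 - sinh t) has_real_derivative cosh 2 - cosh x) (at x)"
      by (auto intro!: derivative_eq_intros)
    show "0 \<le> cosh 2 - cosh x" using that s by (simp add: cosh_real_nonneg_le_iff)
  qed
  then have "0 * cosh 2 - sinh 0 \<le> s * cosh 2 - sinh s"
    by (rule DERIV_nonneg_imp_nondecreasing[OF s(1)])
  then show ?thesis by simp
qed

text \<open>From \<open>cosh h \<le> 1 + sinh h\<close>, \<open>h \<le> sinh h\<close> and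
  \<open>h\<^sup>2 \<le> 2 * sinh h\<close>. It trades the growth of \<open>cosh h\<close> for two
  powers of \<open>sinh h / h\<close>.\<close>

lemma square_cosh_le: "0 \<le> h \<Longrightarrow> h\<^sup>2 * cosh h \<le> 3 * (sinh (h::real))\<^sup>2"
proof -
  assume h: "0 \<le> h"
  have s: "h \<le> sinh h" by (rule sinh_ge_self[OF h])
  have c: "cosh h \<le> 1 + sinh h" using cosh_minus_sinh[of h] h by (simp add: algebra_simps)
  have q: "h\<^sup>2 \<le> 2 * sinh h" using cosh_ge_quadratic[of h] c by simp
  have "h\<^sup>2 * cosh h \<le> h\<^sup>2 * (1 + sinh h)" by (rule mult_left_mono[OF c]) simp
  also have "\<dots> = h\<^sup>2 + h\<^sup>2 * sinh h" by (simp add: algebra_simps)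
  also have "\<dots> \<le> (sinh h)\<^sup>2 + (2 * sinh h) * sinh h"
    using s h q by (intro add_mono power_mono mult_right_mono) auto
  also have "\<dots> = 3 * (sinh h)\<^sup>2" by (simp add: power2_eq_square)
  finally show ?thesis .
qed

text \<open>With \<open>r = exp (- s)\<close> one has 1 - r^2 = 2 r sinh s and 1 - 2rt + r^2 = 2 r
  (cosh s - t). The powers of \<open>r\<close>, with exponents \<lambda>, 1 and -\<lambda> - 1,
  cancel, so the decay factor of \<open>gamma_measure\<close> is absorbed completely.\<close>

lemma poisson_kernel_eq_sinh:
  fixes T :: "'a::euclidean_space itself"
  assumes "t \<le> 1" "0 < s"
  shows "exp (- (lam T * s)) * poisson_kernel T s t = 2 * sinh s * (2 * (cosh s - t)) powr (- lam T - 1) / sphere_area T"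
proof -
  define r where "r = exp (- s)"
  have r: "0 < r" by (simp add: r_def)
  have rs: "r * exp s = 1" by (simp add: r_def exp_minus)
  have cs: "2 * cosh s = exp s + r" "2 * sinh s = exp s - r" by (simp_all add: cosh_def sinh_def r_def)
  have rc: "r * (2 * cosh s) = 1 + r\<^sup>2" and rsi: "r * (2 * sinh s) = 1 - r\<^sup>2"
    unfolding cs using rs by (simp_all add: algebra_simps power2_eq_square)
  have c: "1 - 2 * r * t + r\<^sup>2 = r * (2 * (cosh s - t))" and si: "1 - r\<^sup>2 = r * (2 * sinh s)"
    using rc rsi by (simp_all add: algebra_simps)
  have "1 < cosh s" using assms(2) cosh_real_strict_mono[of 0 s] by simp
  then have p: "0 < 2 * (cosh s - t)" using assms by simp
  have "exp (- (lam T * s)) = r powr lam T" by (simp add: r_def powr_def)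
  then have "exp (- (lam T * s)) * poisson_kernel T s t = r powr lam T * (r * (2 * sinh s) * (r * (2 * (cosh s - t))) powr (- lam T - 1)) / sphere_area T"
    unfolding poisson_kernel_def r_def[symmetric] c si by simp
  also have "\<dots> = (r powr lam T * r * r powr (- lam T - 1)) * (2 * sinh s * (2 * (cosh s - t)) powr (- lam T - 1)) / sphere_area T"
    using r p by (simp add: powr_mult)
  also have "r powr lam T * r * r powr (- lam T - 1) = 1"
    using r by (simp add: powr_minus powr_diff field_simps)
  finally show ?thesis by simp
qed

text \<open>For h = s/2 the left side is 2 cosh h (2 sinh h)^(-d). Here d - 2 of the factors are
  bounded through \<open>s \<le> 2 * sinh h\<close>, and the other two absorb \<open>cosh h\<close>
  by \<open>square_cosh_le\<close>; this is where \<open>2 \<le> d\<close> enters.\<close>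

lemma sinh_cosh_powr_le:
  fixes s d :: real
  assumes s: "0 < s" and d: "2 \<le> d"
  shows "2 * sinh s * (2 * (cosh s - 1)) powr (- (d + 1) / 2) \<le> 12 * s powr (- d)"
proof -
  define h where "h = s / 2"
  have h: "0 < h" using s by (simp add: h_def)
  have sh: "0 < sinh h" using h by simp
  have c: "2 * (cosh s - 1) = (2 * sinh h)\<^sup>2" by (simp add: cosh_minus_one h_def power2_eq_square)
  have "2 * sinh s = 2 * (2 * sinh h) * cosh h" using sinh_double[of h] by (simp add: h_def)
  moreover have "(2 * (cosh s - 1)) powr (- (d + 1) / 2) = (2 * sinh h) powr (- (d + 1))"
  proof -
    have sq: "(2 * sinh h)\<^sup>2 = (2 * sinh h) powr 2" using sh by (simp add: powr_numeral)
    have "2 * (- (d + 1) / 2) = - (d + 1)" by simp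
    then show ?thesis unfolding c by (simp only: sq powr_powr)
  qed
  ultimately have "2 * sinh s * (2 * (cosh s - 1)) powr (- (d + 1) / 2) = 2 * cosh h * ((2 * sinh h) * (2 * sinh h) powr (- (d + 1)))"
    by simp
  also have "(2 * sinh h) * (2 * sinh h) powr (- (d + 1)) = (2 * sinh h) powr (- d)"
    using sh by (simp add: powr_mult_base)
  also have "\<dots> = (2 * sinh h) powr (- 2) * (2 * sinh h) powr (- (d - 2))"
    by (simp add: powr_add[symmetric])
  also have "2 * cosh h * \<dots> \<le> 2 * cosh h * ((2 * sinh h) powr (- 2) * s powr (- (d - 2)))"
  proof (intro mult_left_mono)
    have "s \<le> 2 * sinh h" using sinh_ge_self[of h] h by (simp add: h_def)
    then show "(2 * sinh h) powr (- (d - 2)) \<le> s powr (- (d - 2))" using s d by (intro powr_mono2') auto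
  qed (auto simp: less_imp_le)
  also have "\<dots> \<le> 12 * s powr (- d)"
  proof -
    have e: "(2 * sinh h) powr (- 2) = 1 / (4 * (sinh h)\<^sup>2)" using sh by (simp add: powr_minus powr_numeral field_simps)
    have "4 * (h\<^sup>2 * cosh h) \<le> 24 * (sinh h)\<^sup>2" using square_cosh_le[of h] h zero_le_power2[of "sinh h"] by linarith
    moreover have "s\<^sup>2 = 4 * h\<^sup>2" by (simp add: h_def power_divide)
    ultimately have "s\<^sup>2 * cosh h \<le> 24 * (sinh h)\<^sup>2" by (simp only: mult.assoc)
    then have "2 * cosh h * (2 * sinh h) powr (- 2) \<le> 12 * s powr (- 2)"
      unfolding e using s sh by (simp add: powr_minus powr_numeral divide_simps) (simp add: algebra_simps)
    then have "2 * cosh h * (2 * sinh h) powr (- 2) * s powr (- (d - 2)) \<le> 12 * s powr (- 2) * s powr (- (d - 2))"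
      by (rule mult_right_mono) simp
    also have "\<dots> = 12 * s powr (- d)" by (simp add: powr_add[symmetric])
    finally show ?thesis by (simp add: mult.assoc)
  qed
  finally show ?thesis .
qed

text \<open>Put d = D - 1 with D the dimension, a = 1 - t and b = sqrt a. For s < b the kernel is at
  most a constant times s a^(-(d+1)/2), because cosh s - t \<ge> a; for s \<ge> b it is at most a
  constant times s^(-d), its bound at t = 1. Against s^(\<sigma>-1) both ranges contribute a
  constant times a^(-(d-\<sigma>)/2).\<close>

lemma frac_kernel_le:
  fixes T :: "'a::euclidean_space itself"
  assumes D: "3 \<le> DIM('a)" and \<sigma>: "0 < \<sigma>" "\<sigma> < 1"
  shows "\<exists>C\<ge>0. \<forall>t. -1 \<le> t \<longrightarrow> t < 1 \<longrightarrow> frac_kernel T \<sigma> t \<le> C * (1 - t) powr (- (real DIM('a) - 1 - \<sigma>) / 2)"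
proof -
  define d where "d = real DIM('a) - 1"
  have d: "2 \<le> d" using D by (simp add: d_def)
  have lam: "- lam T - 1 = - (d + 1) / 2" by (simp add: d_def lam_def field_simps)
  have sphere_area: "0 < sphere_area T" by (rule sphere_area_pos)
  have g: "0 < Gamma \<sigma>" using \<sigma> by (simp add: Gamma_real_pos)
  define C1 where "C1 = 2 * cosh 2 * 2 powr (- (d + 1) / 2) / sphere_area T"
  define C2 where "C2 = 12 / sphere_area T"
  have C: "0 \<le> C1" "0 \<le> C2" using sphere_area by (simp_all add: C1_def C2_def)
  define C3 where "C3 = (C1 + C2 / (d - \<sigma>)) / Gamma \<sigma>"
  have C3: "0 \<le> C3" using C d \<sigma> g by (simp add: C3_def)
  have "frac_kernel T \<sigma> t \<le> C3 * (1 - t) powr (- (d - \<sigma>) / 2)" if t: "-1 \<le> t" "t < 1" for t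
  proof -
    define a where "a = 1 - t"
    have a: "0 < a" "a \<le> 2" using t by (auto simp: a_def)
    \<comment> \<open>The scale at which \<open>cosh s - 1\<close>, of size s^2/2 for small s,
      becomes comparable with 1 - t. Below it \<open>s\<close> stays under 2, so
      \<open>sinh s\<close> is at most a multiple of \<open>s\<close>.\<close>
    define b where "b = sqrt a"
    have "b \<le> sqrt 4" using a unfolding b_def by (intro real_sqrt_le_mono) simp
    then have b: "0 < b" "b \<le> 2" "a = b\<^sup>2" using a by (auto simp: b_def)
    have pw: "indicator {0<..} s * s powr (\<sigma> - 1) * exp (- (lam T * s)) * poisson_kernel T s t \<le>
      C1 * a powr (- (d + 1) / 2) * b powr \<sigma> * indicator {0..b} s + C2 * (indicator {b..} s * s powr (\<sigma> - 1 - d))" for s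
    proof (cases "0 < s")
      case s: True
      have e: "exp (- (lam T * s)) * poisson_kernel T s t = 2 * sinh s * (2 * (cosh s - t)) powr (- (d + 1) / 2) / sphere_area T"
        using poisson_kernel_eq_sinh[of t s T] t s by (simp add: lam)
      have c1: "1 < cosh s" using s cosh_real_strict_mono[of 0 s] by simp
      show ?thesis
      proof (cases "s < b")
        case True
        have "2 * a \<le> 2 * (cosh s - t)" using c1 by (simp add: a_def)
        then have "(2 * (cosh s - t)) powr (- (d + 1) / 2) \<le> (2 * a) powr (- (d + 1) / 2)"
          using a d by (intro powr_mono2') auto
        also have "\<dots> = 2 powr (- (d + 1) / 2) * a powr (- (d + 1) / 2)" using a by (simp add: powr_mult)
        finally have "2 * sinh s * (2 * (cosh s - t)) powr (- (d + 1) / 2) \<le> 2 * (s * cosh 2) * (2 powr (- (d + 1) / 2) * a powr (- (d + 1) / 2))"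
          using sinh_le_cosh_2[of s] s True b by (intro mult_mono) auto
        then have "2 * sinh s * (2 * (cosh s - t)) powr (- (d + 1) / 2) / sphere_area T \<le> 2 * (s * cosh 2) * (2 powr (- (d + 1) / 2) * a powr (- (d + 1) / 2)) / sphere_area T"
          using sphere_area by (intro divide_right_mono) auto
        then have "s powr (\<sigma> - 1) * (exp (- (lam T * s)) * poisson_kernel T s t) \<le> s powr (\<sigma> - 1) * (2 * (s * cosh 2) * (2 powr (- (d + 1) / 2) * a powr (- (d + 1) / 2)) / sphere_area T)"
          unfolding e by (intro mult_left_mono) auto
        also have "\<dots> = C1 * a powr (- (d + 1) / 2) * s powr \<sigma>"
          using s by (simp add: C1_def powr_diff field_simps)
        also have "\<dots> \<le> C1 * a powr (- (d + 1) / 2) * b powr \<sigma>"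
          using s True \<sigma> C by (intro mult_left_mono powr_mono2) auto
        finally show ?thesis using s True by (simp add: mult.assoc)
      next
        case False
        have "(2 * (cosh s - t)) powr (- (d + 1) / 2) \<le> (2 * (cosh s - 1)) powr (- (d + 1) / 2)"
          using c1 t d by (intro powr_mono2') auto
        then have "2 * sinh s * (2 * (cosh s - t)) powr (- (d + 1) / 2) \<le> 2 * sinh s * (2 * (cosh s - 1)) powr (- (d + 1) / 2)"
          using s by (intro mult_left_mono) auto
        also have "\<dots> \<le> 12 * s powr (- d)" by (rule sinh_cosh_powr_le[OF s d])
        finally have "2 * sinh s * (2 * (cosh s - t)) powr (- (d + 1) / 2) / sphere_area T \<le> 12 * s powr (- d) / sphere_area T"
          using sphere_area by (intro divide_right_mono) auto
        then have "s powr (\<sigma> - 1) * (exp (- (lam T * s)) * poisson_kernel T s t) \<le> s powr (\<sigma> - 1) * (12 * s powr (- d) / sphere_area T)"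
          unfolding e by (intro mult_left_mono) auto
        also have "\<dots> = C2 * s powr (\<sigma> - 1 - d)"
          by (simp add: C2_def powr_add[symmetric])
        finally have "s powr (\<sigma> - 1) * (exp (- (lam T * s)) * poisson_kernel T s t) \<le> C2 * s powr (\<sigma> - 1 - d)" .
        moreover have "0 \<le> C1 * a powr (- (d + 1) / 2) * b powr \<sigma> * indicator {0..b} s" using C by simp
        ultimately show ?thesis using s False by (simp add: mult.assoc)
      qed
    next
      case False
      then show ?thesis using C b by (auto simp: indicator_def)
    qed
    have "(\<integral>\<^sup>+s. ennreal (poisson_kernel T s t) \<partial>gamma_measure \<sigma> (lam T))
      = (\<integral>\<^sup>+s. ennreal (indicator {0<..} s * s powr (\<sigma> - 1) * exp (- (lam T * s))) * ennreal (poisson_kernel T s t) \<partial>lborel)"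
      unfolding gamma_measure_def by (rule nn_integral_density) measurable
    also have "\<dots> = (\<integral>\<^sup>+s. ennreal (indicator {0<..} s * s powr (\<sigma> - 1) * exp (- (lam T * s)) * poisson_kernel T s t) \<partial>lborel)"
      by (intro nn_integral_cong ennreal_mult'[symmetric]) auto
    also have "\<dots> \<le> (\<integral>\<^sup>+s. ennreal (C1 * a powr (- (d + 1) / 2) * b powr \<sigma>) * indicator {0..b} s + ennreal C2 * ennreal (indicator {b..} s * s powr (\<sigma> - 1 - d)) \<partial>lborel)"
    proof (rule nn_integral_mono)
      fix s
      have "ennreal (indicator {0<..} s * s powr (\<sigma> - 1) * exp (- (lam T * s)) * poisson_kernel T s t)
        \<le> ennreal (C1 * a powr (- (d + 1) / 2) * b powr \<sigma> * indicator {0..b} s + C2 * (indicator {b..} s * s powr (\<sigma> - 1 - d)))"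
        by (rule ennreal_leI[OF pw])
      also have "\<dots> = ennreal (C1 * a powr (- (d + 1) / 2) * b powr \<sigma> * indicator {0..b} s) + ennreal (C2 * (indicator {b..} s * s powr (\<sigma> - 1 - d)))"
        using C by (intro ennreal_plus) auto
      finally show "ennreal (indicator {0<..} s * s powr (\<sigma> - 1) * exp (- (lam T * s)) * poisson_kernel T s t)
        \<le> ennreal (C1 * a powr (- (d + 1) / 2) * b powr \<sigma>) * indicator {0..b} s + ennreal C2 * ennreal (indicator {b..} s * s powr (\<sigma> - 1 - d))"
        using C by (simp add: ennreal_mult' ennreal_indicator)
    qed
    also have "\<dots> = ennreal (C1 * a powr (- (d + 1) / 2) * b powr \<sigma>) * ennreal b + ennreal C2 * (\<integral>\<^sup>+s. ennreal (indicator {b..} s * s powr (\<sigma> - 1 - d)) \<partial>lborel)"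
      using b by (simp add: nn_integral_add nn_integral_cmult nn_integral_cmult_indicator)
    also have "(\<integral>\<^sup>+s. ennreal (indicator {b..} s * s powr (\<sigma> - 1 - d)) \<partial>lborel) = ennreal (- (b powr (\<sigma> - 1 - d + 1)) / (\<sigma> - 1 - d + 1))"
      by (rule nn_integral_has_integral_lebesgue[OF _ has_integral_powr_to_inf]) (use b d \<sigma> in auto)
    also have "- (b powr (\<sigma> - 1 - d + 1)) / (\<sigma> - 1 - d + 1) = b powr (\<sigma> - d) / (d - \<sigma>)"
      using d \<sigma> by (simp add: divide_simps) (simp add: algebra_simps)
    also have "ennreal (C1 * a powr (- (d + 1) / 2) * b powr \<sigma>) * ennreal b + ennreal C2 * ennreal (b powr (\<sigma> - d) / (d - \<sigma>))
      = ennreal (C1 * a powr (- (d + 1) / 2) * b powr \<sigma> * b + C2 * (b powr (\<sigma> - d) / (d - \<sigma>)))"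
      using C b d \<sigma> by (simp add: ennreal_mult'[symmetric] ennreal_plus[symmetric] del: ennreal_plus)
    also have "C1 * a powr (- (d + 1) / 2) * b powr \<sigma> * b + C2 * (b powr (\<sigma> - d) / (d - \<sigma>)) = Gamma \<sigma> * (C3 * a powr (- (d - \<sigma>) / 2))"
    proof -
      have ba: "b = a powr (1 / 2)" using a by (simp add: b_def powr_half_sqrt)
      have "a powr (- (d + 1) / 2) * b powr \<sigma> * b = a powr (- (d + 1) / 2 + \<sigma> / 2 + 1 / 2)"
        unfolding ba by (simp add: powr_powr powr_add)
      also have "- (d + 1) / 2 + \<sigma> / 2 + 1 / 2 = - (d - \<sigma>) / 2" by (simp add: field_simps)
      finally have e1: "a powr (- (d + 1) / 2) * b powr \<sigma> * b = a powr (- (d - \<sigma>) / 2)" .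
      have e2: "b powr (\<sigma> - d) = a powr (- (d - \<sigma>) / 2)"
        unfolding ba by (simp add: powr_powr)
      have "C1 * a powr (- (d + 1) / 2) * b powr \<sigma> * b = C1 * a powr (- (d - \<sigma>) / 2)"
        unfolding e1[symmetric] by (simp only: mult.assoc)
      then show ?thesis using g by (simp add: e2 C3_def distrib_right)
    qed
    finally have le: "(\<integral>\<^sup>+s. ennreal (poisson_kernel T s t) \<partial>gamma_measure \<sigma> (lam T)) \<le> ennreal (Gamma \<sigma> * (C3 * a powr (- (d - \<sigma>) / 2)))" .
    have "AE s in gamma_measure \<sigma> (lam T). 0 \<le> poisson_kernel T s t"
      using AE_gamma_measure_pos by eventually_elim (rule poisson_kernel_nonneg)
    then have "(\<integral>s. poisson_kernel T s t \<partial>gamma_measure \<sigma> (lam T)) = enn2real (\<integral>\<^sup>+s. ennreal (poisson_kernel T s t) \<partial>gamma_measure \<sigma> (lam T))"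
      by (intro integral_eq_nn_integral) auto
    also have "\<dots> \<le> Gamma \<sigma> * (C3 * a powr (- (d - \<sigma>) / 2))"
      using le C3 g by (intro enn2real_leI) auto
    finally show ?thesis using g by (simp add: frac_kernel_def a_def divide_le_eq mult.commute)
  qed
  then show ?thesis using C3 by (auto simp: d_def)
qed

text \<open>The cone over a point lies in a line, which is negligible in dimension at least
  2.\<close>

lemma emeasure_sph_singleton:
  fixes x :: "'a::euclidean_space"
  assumes D: "2 \<le> DIM('a)" shows "emeasure sph {x} = 0"
proof -
  have "dim (span {x}) < DIM('a)" using dim_le_card'[of "{x}"] D by simp
  then have "negligible (span {x})" by (rule negligible_lowdim)
  moreover have [measurable]: "span {x} \<in> sets borel" by (intro borel_closed closed_subspace subspace_span)
  ultimately have n: "emeasure lborel (span {x}) = 0"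
    by (simp add: negligible_iff_null_sets null_sets_completion_iff null_setsD1)
  have "emeasure sph {x} = (\<integral>\<^sup>+y. indicator {x} y \<partial>sph)" by simp
  also have "\<dots> = of_nat DIM('a) * (\<integral>\<^sup>+z. indicator {x} (sgn z) * indicator (ball 0 1 - {0}) z \<partial>lborel)"
    by (rule nn_integral_sph_ball) simp
  finally have e: "emeasure sph {x} = \<dots>" .
  have "(\<integral>\<^sup>+z. indicator {x} (sgn z) * indicator (ball 0 1 - {0}) z \<partial>lborel) \<le> (\<integral>\<^sup>+z. indicator (span {x}) z \<partial>lborel)"
  proof (rule nn_integral_mono)
    fix z :: 'a
    have "z \<in> span {x}" if "sgn z = x"
    proof -
      have "z = norm z *\<^sub>R sgn z" by (cases "z = 0") (auto simp: sgn_div_norm)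
      then show ?thesis using that by (metis span_base span_mul singletonI)
    qed
    then show "indicator {x} (sgn z) * indicator (ball 0 1 - {0}) z \<le> (indicator (span {x}) z :: ennreal)"
      by (auto simp: indicator_def)
  qed
  also have "\<dots> = 0" using n by simp
  finally show ?thesis unfolding e by simp
qed

lemma AE_sph_neq:
  fixes x :: "'a::euclidean_space"
  assumes "2 \<le> DIM('a)" shows "AE y in sph. y \<noteq> x"
  by (rule AE_I[of _ _ "{x}"]) (use emeasure_sph_singleton[OF assms, of x] in auto)

text \<open>The surface potential of order \<open>\<beta>\<close> is dominated by the volume potential of order \<open>\<beta> + 1\<close>:
  on the segment \<open>{r y | 1 - \<bar>x - y\<bar> / 4 \<le> r \<le> 1}\<close> one has \<open>\<bar>x - r y\<bar> \<le> 2 \<bar>x - y\<bar>\<close>.\<close>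

lemma nn_integral_sph_potential:
  fixes T :: "'a::euclidean_space itself"
  assumes D: "2 \<le> DIM('a)" and \<beta>: "0 \<le> \<beta>" "\<beta> < real DIM('a) - 1"
  shows "\<exists>B\<ge>0. \<forall>x::'a. norm x = 1 \<longrightarrow> (\<integral>\<^sup>+y. ennreal (norm (x - y) powr (- \<beta>)) \<partial>sph) \<le> ennreal B"
proof -
  let ?d = "DIM('a)"
  \<comment> \<open>The factors are a quarter from the length of the segment, 2^(-(\<beta>+1)) from
    the bound 2 |x - y| on the distance along it, and a power of 1/2 from r \<ge> 1/2, valid because
    |x - y| \<le> 2.\<close>
  define c where "c = 1 / 4 * 2 powr (- (\<beta> + 1)) * (1 / 2) ^ (?d - 1)"
  have c: "0 < c" by (simp add: c_def)
  have pw: "ennreal (c * norm (x - y) powr (- \<beta>)) \<le> (\<integral>\<^sup>+r. ennreal (norm (x - r *\<^sub>R y) powr (- (\<beta> + 1))) * indicator (cball 0 1) (r *\<^sub>R y) * ennreal (r ^ (?d - 1)) * indicator {0<..} r \<partial>lborel)"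
    if x: "norm x = 1" and y: "norm y = 1" and xy: "y \<noteq> x" for x y :: 'a
  proof -
    define \<delta> where "\<delta> = norm (x - y)"
    have \<delta>: "0 < \<delta>" using xy by (simp add: \<delta>_def)
    have \<delta>2: "\<delta> \<le> 2" using norm_triangle_ineq4[of x y] x y by (simp add: \<delta>_def)
    have e: "c * \<delta> powr (- \<beta>) = (2 * \<delta>) powr (- (\<beta> + 1)) * (1 / 2) ^ (?d - 1) * (\<delta> / 4)"
    proof -
      have "\<delta> powr (- \<beta>) = \<delta> powr (- (\<beta> + 1)) * \<delta>" using \<delta> by (simp add: powr_mult_base mult.commute)
      then show ?thesis using \<delta> by (simp add: c_def powr_mult mult_ac)
    qed
    have "ennreal (c * \<delta> powr (- \<beta>)) = (\<integral>\<^sup>+r. ennreal ((2 * \<delta>) powr (- (\<beta> + 1)) * (1 / 2) ^ (?d - 1)) * indicator {1 - \<delta> / 4..<1} r \<partial>lborel)"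
      unfolding e using \<delta> by (simp add: nn_integral_cmult_indicator ennreal_mult'[symmetric])
    also have "\<dots> \<le> (\<integral>\<^sup>+r. ennreal (norm (x - r *\<^sub>R y) powr (- (\<beta> + 1))) * indicator (cball 0 1) (r *\<^sub>R y) * ennreal (r ^ (?d - 1)) * indicator {0<..} r \<partial>lborel)"
    proof (rule nn_integral_mono)
      fix r :: real
      show "ennreal ((2 * \<delta>) powr (- (\<beta> + 1)) * (1 / 2) ^ (?d - 1)) * indicator {1 - \<delta> / 4..<1} r
        \<le> ennreal (norm (x - r *\<^sub>R y) powr (- (\<beta> + 1))) * indicator (cball 0 1) (r *\<^sub>R y) * ennreal (r ^ (?d - 1)) * indicator {0<..} r"
      proof (cases "r \<in> {1 - \<delta> / 4..<1}")
        case True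
        then have r: "1 / 2 \<le> r" "r < 1" "1 - r \<le> \<delta>" using \<delta> \<delta>2 by auto
        have eq: "x - r *\<^sub>R y = (x - y) + (1 - r) *\<^sub>R y" by (simp add: algebra_simps)
        have "norm (x - r *\<^sub>R y) \<le> norm (x - y) + norm ((1 - r) *\<^sub>R y)"
          unfolding eq by (rule norm_triangle_ineq)
        then have "norm (x - r *\<^sub>R y) \<le> \<delta> + (1 - r)" using y r by (simp add: \<delta>_def)
        then have n2: "norm (x - r *\<^sub>R y) \<le> 2 * \<delta>" using r by simp
        have "norm (r *\<^sub>R y) \<noteq> norm x" using x y r by simp
        then have n1: "0 < norm (x - r *\<^sub>R y)" by auto
        have "(2 * \<delta>) powr (- (\<beta> + 1)) * (1 / 2) ^ (?d - 1) \<le> norm (x - r *\<^sub>R y) powr (- (\<beta> + 1)) * r ^ (?d - 1)"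
          using n1 n2 \<beta> r by (intro mult_mono powr_mono2' power_mono) auto
        then have "ennreal ((2 * \<delta>) powr (- (\<beta> + 1)) * (1 / 2) ^ (?d - 1)) \<le> ennreal (norm (x - r *\<^sub>R y) powr (- (\<beta> + 1))) * ennreal (r ^ (?d - 1))"
          using r by (simp add: ennreal_mult[symmetric] ennreal_leI)
        then show ?thesis using True r y by simp
      qed simp
    qed
    finally show ?thesis by (simp add: \<delta>_def)
  qed
  \<comment> \<open>The unit ball lies in the ball of radius 2 about \<open>x\<close>, where the
    volume potential is computed in polar coordinates; the radial exponent
    \<open>real ?d - 2 - \<beta>\<close> exceeds -1 by the assumption on
    \<open>\<beta>\<close>.\<close>
  define B where "B = sphere_area T * (2 powr (real ?d - 2 - \<beta> + 1) / (real ?d - 2 - \<beta> + 1)) / c"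
  have B: "0 \<le> B" using c \<beta> by (simp add: B_def)
  have "(\<integral>\<^sup>+y. ennreal (norm (x - y) powr (- \<beta>)) \<partial>sph) \<le> ennreal B" if x: "norm x = 1" for x :: 'a
  proof -
    have [measurable]: "cball 0 1 \<in> sets (borel :: 'a measure)" "cball 0 2 \<in> sets (borel :: 'a measure)" by auto
    have "ennreal c * (\<integral>\<^sup>+y. ennreal (norm (x - y) powr (- \<beta>)) \<partial>sph) = (\<integral>\<^sup>+y. ennreal (c * norm (x - y) powr (- \<beta>)) \<partial>sph)"
      using c by (simp add: nn_integral_cmult ennreal_mult)
    also have "\<dots> \<le> (\<integral>\<^sup>+y. (\<integral>\<^sup>+r. ennreal (norm (x - r *\<^sub>R y) powr (- (\<beta> + 1))) * indicator (cball 0 1) (r *\<^sub>R y) * ennreal (r ^ (?d - 1)) * indicator {0<..} r \<partial>lborel) \<partial>sph)"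
      by (rule nn_integral_mono_AE, use AE_sph_norm AE_sph_neq[OF D, of x] in eventually_elim) (rule pw[OF x])
    also have "\<dots> = (\<integral>\<^sup>+r. (\<integral>\<^sup>+y. ennreal (norm (x - r *\<^sub>R y) powr (- (\<beta> + 1))) * indicator (cball 0 1) (r *\<^sub>R y) * ennreal (r ^ (?d - 1)) * indicator {0<..} r \<partial>sph) \<partial>lborel)"
    proof -
      interpret P: pair_sigma_finite "lborel :: real measure" "sph :: 'a measure" ..
      show ?thesis by (rule P.Fubini') measurable
    qed
    also have "\<dots> = (\<integral>\<^sup>+r. (\<integral>\<^sup>+y. ennreal (norm (x - r *\<^sub>R y) powr (- (\<beta> + 1))) * indicator (cball 0 1) (r *\<^sub>R y) \<partial>sph) * ennreal (r ^ (?d - 1)) * indicator {0<..} r \<partial>lborel)"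
      by (simp add: nn_integral_multc)
    also have "\<dots> = (\<integral>\<^sup>+z. ennreal (norm (x - z) powr (- (\<beta> + 1))) * indicator (cball 0 1) z \<partial>lborel)"
      by (rule nn_integral_polar_sph[symmetric]) measurable
    also have "\<dots> \<le> (\<integral>\<^sup>+z. ennreal (norm (x - z) powr (- (\<beta> + 1))) * indicator (cball 0 2) (z - x) \<partial>lborel)"
    proof (rule nn_integral_mono)
      fix z :: 'a
      have "norm (z - x) \<le> 2" if "norm z \<le> 1" using norm_triangle_ineq4[of z x] x that by simp
      then show "ennreal (norm (x - z) powr (- (\<beta> + 1))) * indicator (cball 0 1) z \<le> ennreal (norm (x - z) powr (- (\<beta> + 1))) * indicator (cball 0 2) (z - x)"
        by (auto simp: indicator_def)
    qed
    also have "\<dots> = (\<integral>\<^sup>+(w::'a). ennreal (norm w powr (- (\<beta> + 1))) * indicator (cball 0 2) w \<partial>lborel)"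
    proof -
      have "(\<integral>\<^sup>+z. ennreal (norm (x - z) powr (- (\<beta> + 1))) * indicator (cball 0 2) (z - x) \<partial>distr lborel borel ((+) x))
        = (\<integral>\<^sup>+(w::'a). ennreal (norm w powr (- (\<beta> + 1))) * indicator (cball 0 2) w \<partial>lborel)"
        by (subst nn_integral_distr) auto
      then show ?thesis by (simp only: lborel_distr_plus)
    qed
    also have "\<dots> = (\<integral>\<^sup>+r. (\<integral>\<^sup>+(y::'a). ennreal (norm (r *\<^sub>R y) powr (- (\<beta> + 1))) * indicator (cball 0 2) (r *\<^sub>R y) \<partial>sph) * ennreal (r ^ (?d - 1)) * indicator {0<..} r \<partial>lborel)"
      by (rule nn_integral_polar_sph) measurable
    also have "\<dots> = (\<integral>\<^sup>+r. ennreal (sphere_area T) * ennreal (indicator {0..2} r * r powr (real ?d - 2 - \<beta>)) \<partial>lborel)"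
    proof (rule nn_integral_cong)
      fix r :: real
      show "(\<integral>\<^sup>+(y::'a). ennreal (norm (r *\<^sub>R y) powr (- (\<beta> + 1))) * indicator (cball 0 2) (r *\<^sub>R y) \<partial>sph) * ennreal (r ^ (?d - 1)) * indicator {0<..} r
        = ennreal (sphere_area T) * ennreal (indicator {0..2} r * r powr (real ?d - 2 - \<beta>))"
      proof (cases "0 < r")
        case True
        have "(\<integral>\<^sup>+(y::'a). ennreal (norm (r *\<^sub>R y) powr (- (\<beta> + 1))) * indicator (cball 0 2) (r *\<^sub>R y) \<partial>sph) = (\<integral>\<^sup>+(y::'a). ennreal (r powr (- (\<beta> + 1)) * indicator {0..2} r) \<partial>sph)"
          by (rule nn_integral_cong_AE, use AE_sph_norm in eventually_elim) (use True in \<open>auto simp: indicator_def\<close>)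
        also have "\<dots> = ennreal (r powr (- (\<beta> + 1)) * indicator {0..2} r) * ennreal (sphere_area T)"
          using sph.emeasure_eq_measure[of "UNIV :: 'a set"] by simp
        finally have e: "(\<integral>\<^sup>+(y::'a). ennreal (norm (r *\<^sub>R y) powr (- (\<beta> + 1))) * indicator (cball 0 2) (r *\<^sub>R y) \<partial>sph) = \<dots>" .
        have "r powr (- (\<beta> + 1)) * r ^ (?d - 1) = r powr (- (\<beta> + 1)) * r powr (real (?d - 1))"
          using True by (simp only: powr_realpow)
        also have "\<dots> = r powr (real ?d - 2 - \<beta>)" using D by (simp add: powr_add[symmetric] of_nat_diff algebra_simps)
        finally have "r powr (- (\<beta> + 1)) * r ^ (?d - 1) = r powr (real ?d - 2 - \<beta>)" .
        then have e2: "r powr (- (\<beta> + 1)) * indicator {0..2} r * sphere_area T * r ^ (?d - 1) = sphere_area T * (indicator {0..2} r * r powr (real ?d - 2 - \<beta>))"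
          by (metis mult.assoc mult.commute)
        show ?thesis unfolding e using True e2 by (simp add: ennreal_mult[symmetric])
      qed (auto simp: indicator_def)
    qed
    also have "\<dots> = ennreal (sphere_area T) * ennreal (2 powr (real ?d - 2 - \<beta> + 1) / (real ?d - 2 - \<beta> + 1))"
    proof -
      have "(\<integral>\<^sup>+r. ennreal (indicator {0..2} r * r powr (real ?d - 2 - \<beta>)) \<partial>lborel) = ennreal (2 powr (real ?d - 2 - \<beta> + 1) / (real ?d - 2 - \<beta> + 1))"
        by (rule nn_integral_has_integral_lebesgue[OF _ has_integral_powr_from_0]) (use \<beta> in auto)
      then show ?thesis by (simp add: nn_integral_cmult)
    qed
    also have "\<dots> = ennreal c * ennreal B"
      using c \<beta> by (simp add: ennreal_mult[symmetric] B_def)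
    finally have "ennreal c * (\<integral>\<^sup>+y. ennreal (norm (x - y) powr (- \<beta>)) \<partial>sph) \<le> ennreal c * ennreal B" .
    then have "ennreal (1 / c) * (ennreal c * (\<integral>\<^sup>+y. ennreal (norm (x - y) powr (- \<beta>)) \<partial>sph)) \<le> ennreal (1 / c) * (ennreal c * ennreal B)"
      by (rule mult_left_mono) simp
    then show ?thesis using c by (simp add: mult.assoc[symmetric] ennreal_mult[symmetric])
  qed
  then show ?thesis using B by blast
qed

section \<open>Hyperbolic weights and the one-dimensional kernel\<close>

lemma cosh_le_exp_cosh: "cosh (v::real) \<le> exp \<bar>u - v\<bar> * cosh u"
proof -
  have "cosh v = cosh u * cosh (v - u) + sinh u * sinh (v - u)"
    using cosh_add[of u "v - u"] by simp
  also have "sinh u * sinh (v - u) \<le> \<bar>sinh u\<bar> * \<bar>sinh (v - u)\<bar>" by (simp add: abs_mult[symmetric])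
  also have "\<dots> \<le> cosh u * \<bar>sinh (v - u)\<bar>"
  proof (rule mult_right_mono)
    have "\<bar>sinh u\<bar>\<^sup>2 \<le> (cosh u)\<^sup>2" by (simp add: cosh_square_eq)
    then show "\<bar>sinh u\<bar> \<le> cosh u" by (rule power2_le_imp_le) simp
  qed simp
  finally have "cosh v \<le> cosh u * (cosh (v - u) + \<bar>sinh (v - u)\<bar>)" by (simp add: distrib_left)
  moreover have "cosh w + \<bar>sinh w\<bar> = exp \<bar>w\<bar>" for w :: real
    using cosh_plus_sinh[of w] cosh_minus_sinh[of w] by (cases "0 \<le> w") (auto simp: abs_if)
  ultimately show ?thesis by (simp add: mult.commute abs_minus_commute)
qed

lemma sech_le_exp: "sech u \<le> exp \<bar>u - v\<bar> * sech v"
proof -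
  have "0 < cosh u" "0 < cosh v" by simp_all
  then show ?thesis using cosh_le_exp_cosh[of v u] by (simp add: sech_def field_simps)
qed

text \<open>With both exponents nonnegative the product is at most 1. If \<open>a\<close> is
  negative, \<open>sech v powr b\<close> is split into exponents a + b \<ge> 0, which costs nothing,
  and -a > 0, where \<open>sech v \<le> exp \<bar>u - v\<bar> * sech u\<close> cancels the power of
  \<open>sech u\<close>. The other sign pattern is symmetric.\<close>

lemma sech_powr_le:
  assumes ab: "0 \<le> a + b" and m: "0 \<le> m" "- a \<le> m" "- b \<le> m"
  shows "sech u powr a * sech v powr b \<le> exp (m * \<bar>u - v\<bar>)"
proof -
  have key: "sech u powr a * sech v powr b \<le> exp (m * \<bar>u - v\<bar>)" if "a < 0" "0 \<le> a + b" "- a \<le> m" for a b m u v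
  proof -
    have "sech v powr b = sech v powr (a + b) * sech v powr (- a)" by (simp add: powr_add[symmetric])
    also have "\<dots> \<le> 1 * (exp \<bar>v - u\<bar> * sech u) powr (- a)"
      using that sech_le_1[of v] sech_le_exp[of v u] by (intro mult_mono powr_le1 powr_mono2) (auto simp: less_imp_le)
    also have "\<dots> = exp \<bar>v - u\<bar> powr (- a) * sech u powr (- a)" by (simp add: powr_mult less_imp_le)
    finally have "sech u powr a * sech v powr b \<le> sech u powr a * (exp \<bar>v - u\<bar> powr (- a) * sech u powr (- a))"
      by (rule mult_left_mono) simp
    also have "\<dots> = exp (- a * \<bar>u - v\<bar>)"
    proof -
      have "sech u powr a * (exp \<bar>v - u\<bar> powr (- a) * sech u powr (- a)) = exp \<bar>v - u\<bar> powr (- a) * sech u powr (a + - a)"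
        by (simp only: powr_add mult_ac)
      also have "\<dots> = exp (- a * \<bar>u - v\<bar>)"
        using less_imp_neq[OF sech_pos, of u, symmetric] by (simp add: exp_powr_real abs_minus_commute mult.commute)
      finally show ?thesis .
    qed
    also have "\<dots> \<le> exp (m * \<bar>u - v\<bar>)" using mult_right_mono[of "- a" m "\<bar>u - v\<bar>"] that by simp
    finally show ?thesis .
  qed
  consider "a < 0" | "b < 0" | "0 \<le> a" "0 \<le> b" by linarith
  then show ?thesis
  proof cases
    case 1
    then show ?thesis using key[of a b m u v] ab m by simp
  next
    case 2
    then show ?thesis using key[of b a m v u] ab m by (simp add: mult.commute abs_minus_commute add.commute)
  next
    case 3
    then have "sech u powr a * sech v powr b \<le> 1 * 1"
      using sech_le_1[of u] sech_le_1[of v] by (intro mult_mono powr_le1) (auto simp: less_imp_le)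
    also have "\<dots> \<le> exp (m * \<bar>u - v\<bar>)" using m by simp
    finally show ?thesis by simp
  qed
qed

lemma one_minus_inner_cyl:
  assumes x: "norm x = 1" and y: "norm y = 1"
  shows "1 - cyl u x \<bullet> cyl v y = sech u * sech v * (cosh (u - v) - x \<bullet> y)"
proof -
  have "0 < cosh u" "0 < cosh v" by simp_all
  then show ?thesis by (simp add: cyl_def tanh_def sech_def cosh_diff field_simps)
qed

definition cutoff_bound :: "real \<Rightarrow> real \<Rightarrow> real \<Rightarrow> real \<Rightarrow> real \<Rightarrow> real" where
  "cutoff_bound C1 C2 e c w = (if \<bar>w\<bar> \<le> 1 then C1 * \<bar>w\<bar> powr (- e) else C2 * exp (- (c * \<bar>w\<bar>)))"

lemma cutoff_bound_measurable [measurable]: "cutoff_bound C1 C2 e c \<in> borel_measurable borel"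
  unfolding cutoff_bound_def by measurable

lemma nn_integral_even:
  fixes f :: "real \<Rightarrow> ennreal"
  assumes [measurable]: "f \<in> borel_measurable borel" and "\<And>x. f (- x) = f x"
  shows "(\<integral>\<^sup>+x. f x \<partial>lborel) = 2 * (\<integral>\<^sup>+x. f x * indicator {0..} x \<partial>lborel)"
proof -
  have "(\<integral>\<^sup>+x. f x \<partial>lborel) = (\<integral>\<^sup>+x. f x * indicator {0..} x + f x * indicator {..0} x \<partial>lborel)"
  proof (rule nn_integral_cong_AE)
    have "AE x in lborel. x \<noteq> (0::real)" by (rule AE_lborel_singleton)
    then show "AE x in lborel. f x = f x * indicator {0..} x + f x * indicator {..0} x"
      by eventually_elim (auto simp: indicator_def)
  qed
  also have "\<dots> = (\<integral>\<^sup>+x. f x * indicator {0..} x \<partial>lborel) + (\<integral>\<^sup>+x. f x * indicator {..0} x \<partial>lborel)"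
    by (rule nn_integral_add) measurable
  also have "(\<integral>\<^sup>+x. f x * indicator {..0} x \<partial>lborel) = ennreal \<bar>-1\<bar> * (\<integral>\<^sup>+x. f (0 + (-1) * x) * indicator {..0} (0 + (-1) * x) \<partial>lborel)"
    by (rule nn_integral_real_affine) simp_all
  also have "\<dots> = (\<integral>\<^sup>+x. f x * indicator {0..} x \<partial>lborel)"
    by (auto simp: assms(2) indicator_def intro!: nn_integral_cong)
  finally show ?thesis by (simp add: mult_2)
qed

text \<open>By evenness the half line suffices: \<open>e * r < 1\<close> makes the singularity at 0
  integrable, and positive \<open>c * r\<close> takes care of the tail.\<close>

lemma cutoff_bound_Lr:
  assumes C: "0 \<le> C1" "0 \<le> C2" and r: "0 < r" and e: "e * r < 1" and c: "0 < c"
  shows "\<exists>A\<ge>0. (\<integral>\<^sup>+w. epowr (ennreal (cutoff_bound C1 C2 e c w)) r \<partial>lborel) \<le> ennreal A"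
proof -
  let ?F = "\<lambda>w. epowr (ennreal (cutoff_bound C1 C2 e c w)) r"
  have ev: "?F (- w) = ?F w" for w by (simp add: cutoff_bound_def)
  have "(\<integral>\<^sup>+w. ?F w * indicator {0..} w \<partial>lborel) \<le> (\<integral>\<^sup>+w. ennreal (C1 powr r) * ennreal (indicator {0..1} w * w powr (- (e * r))) + ennreal (C2 powr r) * (ennreal (exp (- (c * r * w))) * indicator {0..} w) \<partial>lborel)"
  proof (rule nn_integral_mono)
    fix w :: real
    show "?F w * indicator {0..} w \<le> ennreal (C1 powr r) * ennreal (indicator {0..1} w * w powr (- (e * r))) + ennreal (C2 powr r) * (ennreal (exp (- (c * r * w))) * indicator {0..} w)"
    proof -
      consider "w < 0" | "0 \<le> w" "w \<le> 1" | "1 < w" by linarith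
      then show ?thesis
      proof cases
        case 1
        then show ?thesis by simp
      next
        case 2
        then have "?F w = ennreal (C1 powr r) * ennreal (w powr (- (e * r)))"
          using C by (simp add: cutoff_bound_def epowr_ennreal epowr_mult powr_powr ennreal_mult)
        then show ?thesis using 2 by (simp add: add_increasing2)
      next
        case 3
        then have "?F w = ennreal (C2 powr r) * ennreal (exp (- (c * r * w)))"
          using C by (simp add: cutoff_bound_def epowr_ennreal epowr_mult exp_powr_real ennreal_mult mult_ac)
        then show ?thesis using 3 by simp
      qed
    qed
  qed
  also have "\<dots> = ennreal (C1 powr r) * (\<integral>\<^sup>+w. ennreal (indicator {0..1} w * w powr (- (e * r))) \<partial>lborel)
      + ennreal (C2 powr r) * (\<integral>\<^sup>+w. ennreal (exp (- (c * r * w))) * indicator {0..} w \<partial>lborel)"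
    by (simp add: nn_integral_add nn_integral_cmult)
  also have "(\<integral>\<^sup>+w. ennreal (indicator {0..1} w * w powr (- (e * r))) \<partial>lborel) = ennreal (1 powr (- (e * r) + 1) / (- (e * r) + 1))"
    by (rule nn_integral_has_integral_lebesgue[OF _ has_integral_powr_from_0]) (use e in auto)
  also have "(\<integral>\<^sup>+w. ennreal (exp (- (c * r * w))) * indicator {0..} w \<partial>lborel) = ennreal (0 - (- exp (- (c * r * 0)) / (c * r)))"
  proof (rule nn_integral_FTC_atLeast)
    show "((\<lambda>w. - exp (- (c * r * w)) / (c * r)) has_real_derivative exp (- (c * r * x))) (at x)" for x
      using c r by (auto intro!: derivative_eq_intros)
    have "filterlim (\<lambda>w. c * r * w) at_top at_top"
      using c r by (intro filterlim_tendsto_pos_mult_at_top[where f = "\<lambda>_. c * r" and c = "c * r"] tendsto_const filterlim_ident) simp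
    then have "filterlim (\<lambda>w. - (c * r * w)) at_bot at_top" by (simp add: filterlim_uminus_at_bot)
    then have "((\<lambda>w. exp (- (c * r * w))) \<longlongrightarrow> 0) at_top"
      by (rule filterlim_compose[OF exp_at_bot])
    then have "((\<lambda>w. - exp (- (c * r * w)) / (c * r)) \<longlongrightarrow> - 0 / (c * r)) at_top"
      using c r by (intro tendsto_divide tendsto_minus tendsto_const) auto
    then show "((\<lambda>w. - exp (- (c * r * w)) / (c * r)) \<longlongrightarrow> 0) at_top" by simp
  qed auto
  finally have le: "(\<integral>\<^sup>+w. ?F w * indicator {0..} w \<partial>lborel) \<le> ennreal (C1 powr r * (1 / (1 - e * r)) + C2 powr r * (1 / (c * r)))"
    using c r e by (simp add: ennreal_mult'[symmetric] ennreal_plus[symmetric] del: ennreal_plus)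
  define A where "A = 2 * (C1 powr r * (1 / (1 - e * r)) + C2 powr r * (1 / (c * r)))"
  have A: "0 \<le> A" using c r e by (simp add: A_def)
  have "(\<integral>\<^sup>+w. ?F w \<partial>lborel) = 2 * (\<integral>\<^sup>+w. ?F w * indicator {0..} w \<partial>lborel)"
    by (rule nn_integral_even) (measurable, rule ev)
  also have "\<dots> \<le> 2 * ennreal (C1 powr r * (1 / (1 - e * r)) + C2 powr r * (1 / (c * r)))"
    by (rule mult_left_mono[OF le]) simp
  also have "\<dots> = ennreal A"
    unfolding A_def by (subst ennreal_mult') simp_all
  finally show ?thesis using A by blast
qed

text \<open>The constant 10 comes from e^|w| \<ge> 5/2, which is equivalent to e^|w|/2 - 1 \<ge>
  e^|w|/10.\<close>

lemma cosh_minus_one_ge_exp: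
  assumes "1 \<le> \<bar>w\<bar>" shows "exp \<bar>w\<bar> / 10 \<le> cosh (w::real) - 1"
proof -
  have "1 + 1 + 1\<^sup>2 / 2 \<le> exp (1::real)" by (rule exp_lower_Taylor_quadratic) simp
  also have "\<dots> \<le> exp \<bar>w\<bar>" using assms by simp
  finally have e: "5 / 2 \<le> exp \<bar>w\<bar>" by (simp add: power2_eq_square)
  have "exp \<bar>w\<bar> \<le> 2 * cosh w" by (cases "0 \<le> w") (auto simp: cosh_def)
  with e show ?thesis by linarith
qed

text \<open>For |w| \<le> 1 the base is at least w^2/2 and at least |x - y|^2/2. Spending
  \<open>a1\<close> of the exponent on the first bound gives the singularity |w|^(-2 a1), and
  spending \<open>a2\<close> on the second leaves a potential over the slice, uniformly bounded
  because 2 a2 is below the dimension of the slice. For larger |w| the base is at least e^|w|/10 and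
  the whole exponent becomes exponential decay, of which \<open>m\<close> is given up.\<close>

lemma nn_integral_sph_cosh_le:
  fixes T :: "'a::euclidean_space itself"
  assumes D: "2 \<le> DIM('a)" and a1: "0 \<le> a1" and a2: "0 \<le> a2" "2 * a2 < real DIM('a) - 1"
    and al: "\<alpha> = a1 + a2" and m: "0 \<le> m" "m < \<alpha>"
  shows "\<exists>C1 C2. 0 \<le> C1 \<and> 0 \<le> C2 \<and> (\<forall>w. w \<noteq> 0 \<longrightarrow> (\<forall>x::'a. norm x = 1 \<longrightarrow>
    (\<integral>\<^sup>+y. ennreal (exp (m * \<bar>w\<bar>) * (cosh w - x \<bullet> y) powr (- \<alpha>)) \<partial>sph) \<le> ennreal (cutoff_bound C1 C2 (2 * a1) (\<alpha> - m) w)))"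
proof -
  obtain B where B: "0 \<le> B" "\<And>x::'a. norm x = 1 \<Longrightarrow> (\<integral>\<^sup>+y. ennreal (norm (x - y) powr (- (2 * a2))) \<partial>sph) \<le> ennreal B"
    using nn_integral_sph_potential[OF D, of "2 * a2"] a2 by auto
  define C1 where "C1 = exp m * (2 powr a1 * (2 powr a2 * B))"
  define C2 where "C2 = sphere_area T * 10 powr \<alpha>"
  have C: "0 \<le> C1" "0 \<le> C2" using B by (simp_all add: C1_def C2_def)
  have "(\<integral>\<^sup>+y. ennreal (exp (m * \<bar>w\<bar>) * (cosh w - x \<bullet> y) powr (- \<alpha>)) \<partial>sph) \<le> ennreal (cutoff_bound C1 C2 (2 * a1) (\<alpha> - m) w)"
    if w: "w \<noteq> 0" and x: "norm x = 1" for w and x :: 'a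
  proof (cases "\<bar>w\<bar> \<le> 1")
    case True
    have "AE y in sph. ennreal (exp (m * \<bar>w\<bar>) * (cosh w - x \<bullet> y) powr (- \<alpha>))
      \<le> ennreal (exp m * (2 powr a1 * \<bar>w\<bar> powr (- (2 * a1)) * 2 powr a2)) * ennreal (norm (x - y) powr (- (2 * a2)))"
      using AE_sph_norm AE_sph_neq[OF D, of x]
    proof eventually_elim
      case (elim y)
      define \<delta> where "\<delta> = norm (x - y)"
      have \<delta>: "0 < \<delta>" using elim by (simp add: \<delta>_def)
      have "\<delta>\<^sup>2 = 2 * (1 - x \<bullet> y)"
        using dot_norm_neg[of x y] x elim by (simp add: \<delta>_def)
      then have xy: "1 - x \<bullet> y = \<delta>\<^sup>2 / 2" by simp
      have g1: "w\<^sup>2 / 2 \<le> cosh w - x \<bullet> y" using cosh_ge_quadratic[of w] xy zero_le_power2[of \<delta>] by linarith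
      have g2: "\<delta>\<^sup>2 / 2 \<le> cosh w - x \<bullet> y" using cosh_real_ge_1[of w] xy by linarith
      have p: "0 < w\<^sup>2 / 2" "0 < \<delta>\<^sup>2 / 2" using w \<delta> by auto
      have "(cosh w - x \<bullet> y) powr (- \<alpha>) = (cosh w - x \<bullet> y) powr (- a1) * (cosh w - x \<bullet> y) powr (- a2)"
        by (simp add: al powr_add[symmetric])
      also have "\<dots> \<le> (w\<^sup>2 / 2) powr (- a1) * (\<delta>\<^sup>2 / 2) powr (- a2)"
        using g1 g2 p a1 a2 by (intro mult_mono powr_mono2') auto
      also have "(w\<^sup>2 / 2) powr (- a1) = 2 powr a1 * \<bar>w\<bar> powr (- (2 * a1))"
      proof -
        have "(w\<^sup>2) powr a1 = \<bar>w\<bar> powr (2 * a1)" using w powr_powr[of "\<bar>w\<bar>" 2 a1] by simp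
        then show ?thesis using w by (simp add: powr_divide powr_minus field_simps)
      qed
      also have "(\<delta>\<^sup>2 / 2) powr (- a2) = 2 powr a2 * \<delta> powr (- (2 * a2))"
      proof -
        have "(\<delta>\<^sup>2) powr a2 = \<delta> powr (2 * a2)" using \<delta> powr_powr[of \<delta> 2 a2] by simp
        then show ?thesis using \<delta> by (simp add: powr_divide powr_minus field_simps)
      qed
      finally have le: "(cosh w - x \<bullet> y) powr (- \<alpha>) \<le> 2 powr a1 * \<bar>w\<bar> powr (- (2 * a1)) * (2 powr a2 * \<delta> powr (- (2 * a2)))" .
      have "exp (m * \<bar>w\<bar>) \<le> exp m" using True m by (simp add: mult_left_le)
      with le have "exp (m * \<bar>w\<bar>) * (cosh w - x \<bullet> y) powr (- \<alpha>) \<le> exp m * (2 powr a1 * \<bar>w\<bar> powr (- (2 * a1)) * (2 powr a2 * \<delta> powr (- (2 * a2))))"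
        by (intro mult_mono) auto
      also have "\<dots> = exp m * (2 powr a1 * \<bar>w\<bar> powr (- (2 * a1)) * 2 powr a2) * \<delta> powr (- (2 * a2))" by (simp add: mult.assoc)
      finally show ?case by (simp add: \<delta>_def ennreal_mult[symmetric] ennreal_leI)
    qed
    then have "(\<integral>\<^sup>+y. ennreal (exp (m * \<bar>w\<bar>) * (cosh w - x \<bullet> y) powr (- \<alpha>)) \<partial>sph)
      \<le> (\<integral>\<^sup>+y. ennreal (exp m * (2 powr a1 * \<bar>w\<bar> powr (- (2 * a1)) * 2 powr a2)) * ennreal (norm (x - y) powr (- (2 * a2))) \<partial>sph)"
      by (rule nn_integral_mono_AE)
    also have "\<dots> = ennreal (exp m * (2 powr a1 * \<bar>w\<bar> powr (- (2 * a1)) * 2 powr a2)) * (\<integral>\<^sup>+y. ennreal (norm (x - y) powr (- (2 * a2))) \<partial>sph)"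
      by (rule nn_integral_cmult) measurable
    also have "\<dots> \<le> ennreal (exp m * (2 powr a1 * \<bar>w\<bar> powr (- (2 * a1)) * 2 powr a2)) * ennreal B"
      by (intro mult_left_mono B x) simp
    also have "\<dots> = ennreal (cutoff_bound C1 C2 (2 * a1) (\<alpha> - m) w)"
      using True B by (simp add: cutoff_bound_def C1_def ennreal_mult[symmetric] mult_ac)
    finally show ?thesis .
  next
    case False
    have "AE y in sph. ennreal (exp (m * \<bar>w\<bar>) * (cosh w - x \<bullet> y) powr (- \<alpha>)) \<le> ennreal (10 powr \<alpha> * exp (- ((\<alpha> - m) * \<bar>w\<bar>)))"
      using AE_sph_norm
    proof eventually_elim
      case (elim y)
      have "x \<bullet> y \<le> 1" using abs_inner_le_1[OF x elim] by simp
      then have "exp \<bar>w\<bar> / 10 \<le> cosh w - x \<bullet> y" using cosh_minus_one_ge_exp[of w] False by simp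
      then have "(cosh w - x \<bullet> y) powr (- \<alpha>) \<le> (exp \<bar>w\<bar> / 10) powr (- \<alpha>)" using m by (intro powr_mono2') auto
      also have "\<dots> = 10 powr \<alpha> * exp (- (\<alpha> * \<bar>w\<bar>))"
        by (simp add: powr_divide exp_powr_real powr_minus field_simps exp_minus_inverse)
      finally have "exp (m * \<bar>w\<bar>) * (cosh w - x \<bullet> y) powr (- \<alpha>) \<le> exp (m * \<bar>w\<bar>) * (10 powr \<alpha> * exp (- (\<alpha> * \<bar>w\<bar>)))"
        by (rule mult_left_mono) simp
      also have "\<dots> = 10 powr \<alpha> * exp (- ((\<alpha> - m) * \<bar>w\<bar>))"
        by (simp add: exp_add[symmetric] algebra_simps)
      finally show ?case by (rule ennreal_leI)
    qed
    then have "(\<integral>\<^sup>+y. ennreal (exp (m * \<bar>w\<bar>) * (cosh w - x \<bullet> y) powr (- \<alpha>)) \<partial>sph) \<le> (\<integral>\<^sup>+(y::'a). ennreal (10 powr \<alpha> * exp (- ((\<alpha> - m) * \<bar>w\<bar>))) \<partial>sph)"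
      by (rule nn_integral_mono_AE)
    also have "\<dots> = ennreal (cutoff_bound C1 C2 (2 * a1) (\<alpha> - m) w)"
      using False sph.emeasure_eq_measure[of "UNIV :: 'a set"] by (simp add: cutoff_bound_def C2_def ennreal_mult[symmetric] mult_ac)
    finally show ?thesis .
  qed
  then show ?thesis using C by blast
qed

subsection \<open>The mixed-norm inequality\<close>

definition slice_norm :: "(real \<times> 'b::euclidean_space \<Rightarrow> complex) \<Rightarrow> real \<Rightarrow> ennreal" where
  "slice_norm f u = epowr (\<integral>\<^sup>+y. (ennreal (cmod (f (cyl u y))))\<^sup>2 \<partial>sph) (1 / 2)"

lemma slice_norm_measurable [measurable]:
  assumes [measurable]: "f \<in> borel_measurable borel"
  shows "slice_norm f \<in> borel_measurable borel"
  unfolding slice_norm_def[abs_def] by measurable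

text \<open>The kernel bound holds away from the diagonal, where 1 - X.Y factors in cylindrical
  coordinates. The factors \<open>sech u\<close> and \<open>sech v\<close> leave the slice integral,
  and that of \<open>v\<close> merges with the density of the surface measure.\<close>

lemma pointwise_frac_op_le:
  fixes f :: "real \<times> 'b::euclidean_space \<Rightarrow> complex"
  assumes b: "2 \<le> DIM('b)" and \<sigma>: "0 < \<sigma>" and fm [measurable]: "f \<in> borel_measurable borel"
    and C: "0 \<le> C" "\<And>t. -1 \<le> t \<Longrightarrow> t < 1 \<Longrightarrow> frac_kernel TYPE(real \<times> 'b) \<sigma> t \<le> C * (1 - t) powr (- \<alpha>)"
    and x: "norm x = 1"
  shows "ennreal (cmod (frac_op \<sigma> f (cyl u x))) \<le>
    (\<integral>\<^sup>+v. ennreal (C * sech u powr (- \<alpha>)) * (\<integral>\<^sup>+y. ennreal ((cosh (u - v) - x \<bullet> y) powr (- \<alpha>)) * ennreal (cmod (f (cyl v y))) \<partial>sph)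
       * ennreal (sech v powr (real DIM('b) - \<alpha>)) \<partial>lborel)"
proof -
  let ?X = "cyl u x"
  have D: "3 \<le> DIM(real \<times> 'b)" "2 \<le> DIM(real \<times> 'b)" using b by simp_all
  have X: "norm ?X = 1" using x by (rule norm_cyl)
  have [measurable]: "frac_kernel TYPE(real \<times> 'b) \<sigma> \<in> borel_measurable borel"
    using \<sigma> lam_pos[OF D(1)] by (rule frac_kernel_measurable)
  have "ennreal (cmod (frac_op \<sigma> f ?X)) \<le> (\<integral>\<^sup>+Y. ennreal (norm (frac_kernel TYPE(real \<times> 'b) \<sigma> (?X \<bullet> Y) *\<^sub>R f Y)) \<partial>sph)"
  proof (cases "integrable sph (\<lambda>Y. frac_kernel TYPE(real \<times> 'b) \<sigma> (?X \<bullet> Y) *\<^sub>R f Y)")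
    case True
    then show ?thesis unfolding frac_op_def by (rule integral_norm_bound_ennreal)
  next
    \<comment> \<open>The Bochner integral of a function that is not integrable is 0, so the
      estimate is trivial here.\<close>
    case False
    then show ?thesis by (simp add: frac_op_def not_integrable_integral_eq)
  qed
  also have "\<dots> \<le> (\<integral>\<^sup>+Y. ennreal (C * (1 - ?X \<bullet> Y) powr (- \<alpha>)) * ennreal (cmod (f Y)) \<partial>sph)"
  proof (rule nn_integral_mono_AE, use AE_sph_norm AE_sph_neq[OF D(2), of ?X] in eventually_elim)
    case (elim Y)
    have "\<bar>?X \<bullet> Y\<bar> \<le> 1" by (rule abs_inner_le_1[OF X elim(1)])
    moreover have "?X \<bullet> Y \<noteq> 1"
    proof
      assume "?X \<bullet> Y = 1"
      then have "(norm (?X - Y))\<^sup>2 = 0" using dot_norm_neg[of ?X Y] X elim by simp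
      then show False using elim by simp
    qed
    ultimately have "frac_kernel TYPE(real \<times> 'b) \<sigma> (?X \<bullet> Y) \<le> C * (1 - ?X \<bullet> Y) powr (- \<alpha>)" by (intro C(2)) auto
    then have "norm (frac_kernel TYPE(real \<times> 'b) \<sigma> (?X \<bullet> Y) *\<^sub>R f Y) \<le> C * (1 - ?X \<bullet> Y) powr (- \<alpha>) * cmod (f Y)"
      using frac_kernel_nonneg[OF \<sigma>, of "TYPE(real \<times> 'b)" "?X \<bullet> Y"] by (simp add: mult_right_mono)
    then show ?case using C(1) by (simp add: ennreal_mult[symmetric] ennreal_leI)
  qed
  also have "\<dots> = (\<integral>\<^sup>+v. (\<integral>\<^sup>+y. ennreal (C * (1 - ?X \<bullet> cyl v y) powr (- \<alpha>)) * ennreal (cmod (f (cyl v y))) \<partial>sph) * ennreal (sech v ^ DIM('b)) \<partial>lborel)"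
    by (rule nn_integral_sph_cyl) measurable
  also have "\<dots> = (\<integral>\<^sup>+v. ennreal (C * sech u powr (- \<alpha>)) * (\<integral>\<^sup>+y. ennreal ((cosh (u - v) - x \<bullet> y) powr (- \<alpha>)) * ennreal (cmod (f (cyl v y))) \<partial>sph)
       * ennreal (sech v powr (real DIM('b) - \<alpha>)) \<partial>lborel)"
  proof (rule nn_integral_cong)
    fix v :: real
    have "(\<integral>\<^sup>+y. ennreal (C * (1 - ?X \<bullet> cyl v y) powr (- \<alpha>)) * ennreal (cmod (f (cyl v y))) \<partial>sph)
      = (\<integral>\<^sup>+y. ennreal (C * sech u powr (- \<alpha>) * sech v powr (- \<alpha>)) * (ennreal ((cosh (u - v) - x \<bullet> y) powr (- \<alpha>)) * ennreal (cmod (f (cyl v y)))) \<partial>sph)"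
    proof (rule nn_integral_cong_AE, use AE_sph_norm in eventually_elim)
      case (elim y)
      have "0 \<le> cosh (u - v) - x \<bullet> y"
        using abs_inner_le_1[OF x elim] cosh_real_ge_1[of "u - v"] by linarith
      then have "C * (1 - ?X \<bullet> cyl v y) powr (- \<alpha>) = C * sech u powr (- \<alpha>) * sech v powr (- \<alpha>) * (cosh (u - v) - x \<bullet> y) powr (- \<alpha>)"
        unfolding one_minus_inner_cyl[OF x elim] by (simp add: powr_mult less_imp_le)
      then show ?case using C(1) by (simp only: ennreal_mult[symmetric] mult.assoc mult_nonneg_nonneg powr_ge_zero norm_ge_zero)
    qed
    also have "\<dots> = ennreal (C * sech u powr (- \<alpha>) * sech v powr (- \<alpha>)) * (\<integral>\<^sup>+y. ennreal ((cosh (u - v) - x \<bullet> y) powr (- \<alpha>)) * ennreal (cmod (f (cyl v y))) \<partial>sph)"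
      by (rule nn_integral_cmult) measurable
    finally have e: "(\<integral>\<^sup>+y. ennreal (C * (1 - ?X \<bullet> cyl v y) powr (- \<alpha>)) * ennreal (cmod (f (cyl v y))) \<partial>sph) = \<dots>" .
    have "sech v ^ DIM('b) = sech v powr real DIM('b)" by (simp add: powr_realpow)
    then have "C * sech u powr (- \<alpha>) * sech v powr (- \<alpha>) * sech v ^ DIM('b) = C * sech u powr (- \<alpha>) * sech v powr (real DIM('b) - \<alpha>)"
      by (simp add: powr_add[symmetric] mult.assoc)
    then have s: "ennreal (C * sech u powr (- \<alpha>) * sech v powr (- \<alpha>)) * ennreal (sech v ^ DIM('b)) = ennreal (C * sech u powr (- \<alpha>)) * ennreal (sech v powr (real DIM('b) - \<alpha>))"
      using C(1) by (simp add: ennreal_mult[symmetric] less_imp_le)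
    show "(\<integral>\<^sup>+y. ennreal (C * (1 - ?X \<bullet> cyl v y) powr (- \<alpha>)) * ennreal (cmod (f (cyl v y))) \<partial>sph) * ennreal (sech v ^ DIM('b))
      = ennreal (C * sech u powr (- \<alpha>)) * (\<integral>\<^sup>+y. ennreal ((cosh (u - v) - x \<bullet> y) powr (- \<alpha>)) * ennreal (cmod (f (cyl v y))) \<partial>sph)
       * ennreal (sech v powr (real DIM('b) - \<alpha>))"
    proof -
      have "A * J * S = B * J * S'" if "A * S = B * S'" for A B J S S' :: ennreal
        by (metis that mult.assoc mult.commute)
      from this[OF s] show ?thesis unfolding e .
    qed
  qed
  finally show ?thesis .
qed

text \<open>The slice kernel is symmetric in \<open>x\<close> and \<open>y\<close>, so both of
  Schur's integrals are controlled by the same number \<open>\<kappa> (u - v)\<close>. The slice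
  \<open>v = u\<close>, where no bound is available, is a single point of the line.\<close>

lemma slice_norm_frac_op_le:
  fixes f :: "real \<times> 'b::euclidean_space \<Rightarrow> complex"
  assumes b: "2 \<le> DIM('b)" and \<sigma>: "0 < \<sigma>" and fm [measurable]: "f \<in> borel_measurable borel"
    and C: "0 \<le> C" "\<And>t. -1 \<le> t \<Longrightarrow> t < 1 \<Longrightarrow> frac_kernel TYPE(real \<times> 'b) \<sigma> t \<le> C * (1 - t) powr (- \<alpha>)"
    and \<kappa>: "\<And>w x. w \<noteq> 0 \<Longrightarrow> norm (x::'b) = 1 \<Longrightarrow> (\<integral>\<^sup>+y. ennreal ((cosh w - x \<bullet> y) powr (- \<alpha>)) \<partial>sph) \<le> ennreal (\<kappa> w)"
    and \<kappa>0: "\<And>w. 0 \<le> \<kappa> w" "\<And>w. \<kappa> (- w) = \<kappa> w"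
  shows "slice_norm (frac_op \<sigma> f) u \<le> (\<integral>\<^sup>+v. ennreal (C * sech u powr (- \<alpha>) * sech v powr (real DIM('b) - \<alpha>) * \<kappa> (u - v)) * slice_norm f v \<partial>lborel)"
proof -
  let ?k = "\<lambda>v (x :: 'b) y. ennreal ((cosh (u - v) - x \<bullet> y) powr (- \<alpha>))"
  define h where "h v x = ennreal (C * sech u powr (- \<alpha>)) * (\<integral>\<^sup>+y. ?k v x y * ennreal (cmod (f (cyl v y))) \<partial>sph)
       * ennreal (sech v powr (real DIM('b) - \<alpha>))" for v and x :: 'b
  have hm [measurable]: "(\<lambda>(v, x). h v x) \<in> borel_measurable (lborel \<Otimes>\<^sub>M sph)" unfolding h_def by measurable
  have "slice_norm (frac_op \<sigma> f) u \<le> epowr (\<integral>\<^sup>+x. (\<integral>\<^sup>+v. h v x \<partial>lborel)\<^sup>2 \<partial>sph) (1 / 2)"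
    unfolding slice_norm_def
  proof (intro epowr_mono)
    show "(\<integral>\<^sup>+y. (ennreal (cmod (frac_op \<sigma> f (cyl u y))))\<^sup>2 \<partial>sph) \<le> (\<integral>\<^sup>+x. (\<integral>\<^sup>+v. h v x \<partial>lborel)\<^sup>2 \<partial>sph)"
    proof (rule nn_integral_mono_AE, use AE_sph_norm in eventually_elim)
      case (elim x)
      show ?case unfolding h_def by (intro power_mono pointwise_frac_op_le[OF b \<sigma> fm C elim]) auto
    qed
  qed simp
  also have "\<dots> \<le> (\<integral>\<^sup>+v. epowr (\<integral>\<^sup>+x. (h v x)\<^sup>2 \<partial>sph) (1 / 2) \<partial>lborel)"
    by (rule Minkowski_L2_nn_integral[OF sigma_finite_lborel sph.sigma_finite_measure_axioms hm])
  also have "\<dots> \<le> (\<integral>\<^sup>+v. ennreal (C * sech u powr (- \<alpha>) * sech v powr (real DIM('b) - \<alpha>) * \<kappa> (u - v)) * slice_norm f v \<partial>lborel)"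
  proof (rule nn_integral_mono_AE)
    have "AE v in lborel. v \<noteq> u" by (rule AE_lborel_singleton)
    then show "AE v in lborel. epowr (\<integral>\<^sup>+x. (h v x)\<^sup>2 \<partial>sph) (1 / 2) \<le> ennreal (C * sech u powr (- \<alpha>) * sech v powr (real DIM('b) - \<alpha>) * \<kappa> (u - v)) * slice_norm f v"
    proof eventually_elim
      case (elim v)
      then have w: "u - v \<noteq> 0" by simp
      let ?c = "ennreal (C * sech u powr (- \<alpha>)) * ennreal (sech v powr (real DIM('b) - \<alpha>))"
      have s: "epowr (\<integral>\<^sup>+x. (\<integral>\<^sup>+y. ?k v x y * ennreal (cmod (f (cyl v y))) \<partial>sph)\<^sup>2 \<partial>(sph :: 'b measure)) (1 / 2)
        \<le> ennreal (\<kappa> (u - v)) * epowr (\<integral>\<^sup>+y. (ennreal (cmod (f (cyl v y))))\<^sup>2 \<partial>sph) (1 / 2)"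
      proof (rule Schur_L2_nn_integral[OF sph.sigma_finite_measure_axioms])
        show "AE x in sph. (\<integral>\<^sup>+y. ?k v x y \<partial>sph) \<le> ennreal (\<kappa> (u - v))"
          using AE_sph_norm by eventually_elim (rule \<kappa>[OF w])
        show "AE y in sph. (\<integral>\<^sup>+x. ?k v x y \<partial>sph) \<le> ennreal (\<kappa> (u - v))"
          using AE_sph_norm
        proof eventually_elim
          case (elim y)
          have "(\<integral>\<^sup>+x. ?k v x y \<partial>sph) = (\<integral>\<^sup>+x. ?k v y x \<partial>sph)" by (simp add: inner_commute)
          then show ?case using \<kappa>[OF w elim] by simp
        qed
      qed measurable
      have "(\<integral>\<^sup>+x. (h v x)\<^sup>2 \<partial>sph) = (\<integral>\<^sup>+x. ?c\<^sup>2 * (\<integral>\<^sup>+y. ?k v x y * ennreal (cmod (f (cyl v y))) \<partial>sph)\<^sup>2 \<partial>sph)"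
        by (intro nn_integral_cong) (simp only: h_def power_mult_distrib mult_ac)
      also have "\<dots> = ?c\<^sup>2 * (\<integral>\<^sup>+x. (\<integral>\<^sup>+y. ?k v x y * ennreal (cmod (f (cyl v y))) \<partial>sph)\<^sup>2 \<partial>sph)"
        by (rule nn_integral_cmult) measurable
      finally have "epowr (\<integral>\<^sup>+x. (h v x)\<^sup>2 \<partial>sph) (1 / 2) = ?c * epowr (\<integral>\<^sup>+x. (\<integral>\<^sup>+y. ?k v x y * ennreal (cmod (f (cyl v y))) \<partial>sph)\<^sup>2 \<partial>sph) (1 / 2)"
        using epowr_epowr[of ?c 2 "1 / 2"] by (simp add: epowr_mult epowr_two)
      also have "\<dots> \<le> ?c * (ennreal (\<kappa> (u - v)) * slice_norm f v)"
        unfolding slice_norm_def by (rule mult_left_mono[OF s]) simp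
      also have "\<dots> = ennreal (C * sech u powr (- \<alpha>) * sech v powr (real DIM('b) - \<alpha>) * \<kappa> (u - v)) * slice_norm f v"
        using C(1) \<kappa>0 by (simp add: ennreal_mult mult.assoc)
      finally show ?case .
    qed
  qed
  finally show ?thesis .
qed

lemma frac_op_slice_norm_bound:
  fixes T :: "'b::euclidean_space itself"
  assumes b: "2 \<le> DIM('b)" and \<sigma>: "0 < \<sigma>" "\<sigma> < 1" and pq: "1 < p" "p \<le> q"
    and gap: "1 / q \<ge> 1 / p - \<sigma> / real DIM('b)"
  shows "\<exists>C\<ge>0. \<forall>f :: real \<times> 'b \<Rightarrow> complex. f \<in> borel_measurable borel \<longrightarrow>
    epowr (\<integral>\<^sup>+u. epowr (slice_norm (frac_op \<sigma> f) u) q * ennreal (sech u ^ DIM('b)) \<partial>lborel) (1 / q)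
    \<le> ennreal C * epowr (\<integral>\<^sup>+u. epowr (slice_norm f u) p * ennreal (sech u ^ DIM('b)) \<partial>lborel) (1 / p)"
proof -
  define d where "d = real DIM('b)"
  have d: "2 \<le> d" using b by (simp add: d_def)
  have D: "3 \<le> DIM(real \<times> 'b)" using b by simp
  have q: "0 < q" using pq by simp
  define \<alpha> where "\<alpha> = (d - \<sigma>) / 2"
  \<comment> \<open>\<open>a\<close> and \<open>e\<close> are the exponents left on
    \<open>sech u\<close> and \<open>sech v\<close> once the weight
    \<open>sech u powr (d / q)\<close> has been added on the output side and
    \<open>sech v powr (d / p)\<close> has been set aside for the input.\<close>
  define a where "a = d / q - \<alpha>"
  define e where "e = d - \<alpha> - d / p"
  define m where "m = max 0 (max (- a) (- e))"
  define r where "r = 1 / (1 + 1 / q - 1 / p)"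
  \<comment> \<open>2 a1 is the midpoint of 1 - \<sigma> and 1 - \<sigma>/d. Being above the first
    gives 2 a2 < d - 1, the condition on the slice; being below the second, hence below 1/r, gives 2
    a1 r < 1, the condition on the line.\<close>
  define a1 where "a1 = (1 - \<sigma> / 2 - \<sigma> / (2 * d)) / 2"
  define a2 where "a2 = \<alpha> - a1"
  define s where "s = \<sigma> / d"
  have sd: "s \<le> \<sigma> / 2" using d \<sigma> by (simp add: s_def field_simps)
  have sd0: "0 < s" using d \<sigma> by (simp add: s_def)
  have a1_s: "a1 = (1 - \<sigma> / 2 - s / 2) / 2" by (simp add: a1_def s_def)
  have a1: "0 \<le> a1" unfolding a1_s using sd \<sigma> by (simp add: field_simps)
  have a2: "0 \<le> a2" "2 * a2 < d - 1" unfolding a2_def a1_s \<alpha>_def using sd sd0 d \<sigma> by (simp_all add: field_simps)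
  have qp: "1 / q \<le> 1 / p" using pq by (simp add: frac_le)
  have ip: "1 / p < 1" "0 < 1 / q" using pq by simp_all
  have den: "1 - s \<le> 1 + 1 / q - 1 / p" using gap by (simp add: d_def s_def)
  have den0: "0 < 1 + 1 / q - 1 / p" using ip by linarith
  have r: "0 < r" "1 / r = 1 + 1 / q - 1 / p" using den0 by (simp_all add: r_def)
  have e2: "2 * a1 * r < 1"
  proof -
    have "2 * a1 < 1 + 1 / q - 1 / p" using den sd sd0 unfolding a1_s by (simp add: diff_divide_distrib)
    then show ?thesis using den0 by (simp add: r_def)
  qed
  \<comment> \<open>The sum a + e equals \<sigma> - d (1/p - 1/q), so this is the gap
    condition.\<close>
  have ae: "0 \<le> a + e"
  proof -
    have "d * (1 / p - 1 / q) \<le> d * (\<sigma> / d)" using gap d by (intro mult_left_mono) (simp_all add: d_def)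
    then show ?thesis using d by (simp add: a_def e_def \<alpha>_def algebra_simps)
  qed
  have m: "0 \<le> m" "- a \<le> m" "- e \<le> m" by (auto simp: m_def)
  \<comment> \<open>Here -a < \<alpha> amounts to 1/q > 0 and -e < \<alpha> to 1/p < 1; exponential
    decay therefore survives the loss \<open>m\<close>.\<close>
  have ma: "m < \<alpha>"
  proof -
    have "0 < \<alpha>" using d \<sigma> by (simp add: \<alpha>_def)
    moreover have "- a < \<alpha>" using d q by (simp add: a_def)
    moreover have "- e < \<alpha>" using mult_strict_left_mono[OF ip(1), of d] d by (simp add: e_def)
    ultimately show ?thesis by (simp add: m_def)
  qed
  obtain C where C: "0 \<le> C" "\<And>t. -1 \<le> t \<Longrightarrow> t < 1 \<Longrightarrow> frac_kernel TYPE(real \<times> 'b) \<sigma> t \<le> C * (1 - t) powr (- \<alpha>)"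
  proof -
    have "- (real DIM(real \<times> 'b) - 1 - \<sigma>) / 2 = - \<alpha>" by (simp add: \<alpha>_def d_def minus_divide_left)
    then show ?thesis using frac_kernel_le[OF D \<sigma>, of "TYPE(real \<times> 'b)"] that by auto
  qed
  have "\<exists>C1 C2. 0 \<le> C1 \<and> 0 \<le> C2 \<and> (\<forall>w. w \<noteq> 0 \<longrightarrow> (\<forall>x::'b. norm x = 1 \<longrightarrow>
    (\<integral>\<^sup>+y. ennreal (exp (m * \<bar>w\<bar>) * (cosh w - x \<bullet> y) powr (- \<alpha>)) \<partial>sph) \<le> ennreal (cutoff_bound C1 C2 (2 * a1) (\<alpha> - m) w)))"
    by (rule nn_integral_sph_cosh_le[OF b a1 a2(1) _ _ m(1) ma]) (use a2 in \<open>auto simp: a2_def d_def\<close>)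
  then obtain C1 C2 where K: "0 \<le> C1" "0 \<le> C2" "\<And>w x. w \<noteq> 0 \<Longrightarrow> norm (x::'b) = 1 \<Longrightarrow>
    (\<integral>\<^sup>+y. ennreal (exp (m * \<bar>w\<bar>) * (cosh w - x \<bullet> y) powr (- \<alpha>)) \<partial>sph) \<le> ennreal (cutoff_bound C1 C2 (2 * a1) (\<alpha> - m) w)"
    by blast
  let ?K = "cutoff_bound C1 C2 (2 * a1) (\<alpha> - m)"
  have K0: "0 \<le> ?K w" "?K (- w) = ?K w" for w using K by (auto simp: cutoff_bound_def)
  obtain A where A: "0 \<le> A" "(\<integral>\<^sup>+w. epowr (ennreal (?K w)) r \<partial>lborel) \<le> ennreal A"
    using cutoff_bound_Lr[OF K(1,2) r(1) e2, of "\<alpha> - m"] ma by auto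
  \<comment> \<open>The factor \<open>exp (- (m * \<bar>w\<bar>))\<close> anticipates the growth
    that \<open>sech_powr_le\<close> allows for the weights; the two cancel and leave the
    convolution kernel \<open>?K\<close>.\<close>
  define \<kappa> where "\<kappa> w = exp (- (m * \<bar>w\<bar>)) * ?K w" for w
  have \<kappa>: "(\<integral>\<^sup>+y. ennreal ((cosh w - x \<bullet> y) powr (- \<alpha>)) \<partial>sph) \<le> ennreal (\<kappa> w)" if "w \<noteq> 0" "norm x = 1" for w and x :: 'b
  proof -
    have "(\<integral>\<^sup>+y. ennreal ((cosh w - x \<bullet> y) powr (- \<alpha>)) \<partial>sph) = (\<integral>\<^sup>+y. ennreal (exp (- (m * \<bar>w\<bar>))) * ennreal (exp (m * \<bar>w\<bar>) * (cosh w - x \<bullet> y) powr (- \<alpha>)) \<partial>sph)"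
      by (intro nn_integral_cong) (simp add: ennreal_mult[symmetric] mult.assoc[symmetric] exp_add[symmetric])
    also have "\<dots> = ennreal (exp (- (m * \<bar>w\<bar>))) * (\<integral>\<^sup>+y. ennreal (exp (m * \<bar>w\<bar>) * (cosh w - x \<bullet> y) powr (- \<alpha>)) \<partial>sph)"
      by (rule nn_integral_cmult) measurable
    also have "\<dots> \<le> ennreal (exp (- (m * \<bar>w\<bar>))) * ennreal (?K w)"
      by (rule mult_left_mono[OF K(3)[OF that]]) simp
    finally show ?thesis using K0 by (simp add: \<kappa>_def ennreal_mult)
  qed
  have \<kappa>0: "0 \<le> \<kappa> w" "\<kappa> (- w) = \<kappa> w" for w using K0 by (auto simp: \<kappa>_def)
  let ?B = "epowr (ennreal A) (1 / r)"
  have Bfin: "ennreal C * ?B = ennreal (C * A powr (1 / r))" using A C by (simp add: epowr_ennreal ennreal_mult)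
  show ?thesis
  proof (intro exI[of _ "C * A powr (1 / r)"] conjI allI impI)
    show "0 \<le> C * A powr (1 / r)" using C by simp
    fix f :: "real \<times> 'b \<Rightarrow> complex" assume fm [measurable]: "f \<in> borel_measurable borel"
    \<comment> \<open>With the weight included, the unweighted norm of \<open>G\<close> on the line
      is the weighted norm of the slices, as Young's inequality requires.\<close>
    define G where "G v = slice_norm f v * ennreal (sech v powr (d / p))" for v
    have Gm [measurable]: "G \<in> borel_measurable borel" unfolding G_def by measurable
    have sp: "sech u ^ DIM('b) = sech u powr d" for u unfolding d_def by (simp add: powr_realpow)
    have pt: "slice_norm (frac_op \<sigma> f) u * ennreal (sech u powr (d / q)) \<le> ennreal C * (\<integral>\<^sup>+v. ennreal (?K (u - v)) * G v \<partial>lborel)" for u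
    proof -
      have "slice_norm (frac_op \<sigma> f) u * ennreal (sech u powr (d / q)) \<le>
        (\<integral>\<^sup>+v. ennreal (C * sech u powr (- \<alpha>) * sech v powr (d - \<alpha>) * \<kappa> (u - v)) * slice_norm f v \<partial>lborel) * ennreal (sech u powr (d / q))"
        unfolding d_def by (rule mult_right_mono[OF slice_norm_frac_op_le[OF b \<sigma>(1) fm C \<kappa> \<kappa>0]]) auto
      also have "\<dots> = (\<integral>\<^sup>+v. ennreal (C * sech u powr (- \<alpha>) * sech v powr (d - \<alpha>) * \<kappa> (u - v)) * slice_norm f v * ennreal (sech u powr (d / q)) \<partial>lborel)"
        by (rule nn_integral_multc[symmetric]) (unfold \<kappa>_def, measurable)
      also have "\<dots> \<le> (\<integral>\<^sup>+v. ennreal C * (ennreal (?K (u - v)) * G v) \<partial>lborel)"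
      proof (rule nn_integral_mono)
        fix v
        have "C * sech u powr (- \<alpha>) * sech v powr (d - \<alpha>) * \<kappa> (u - v) * sech u powr (d / q)
          = C * (\<kappa> (u - v) * (sech u powr a * sech v powr e)) * sech v powr (d / p)"
        proof -
          have "sech u powr (- \<alpha>) * sech u powr (d / q) = sech u powr a" by (simp add: a_def powr_add[symmetric])
          moreover have "sech v powr (d - \<alpha>) = sech v powr e * sech v powr (d / p)" by (simp add: e_def powr_add[symmetric])
          moreover have "C * A * (E * F) * K * Q = C * (K * ((A * Q) * E)) * F" for A E F K Q :: real by (simp add: mult_ac)
          ultimately show ?thesis by metis
        qed
        also have "\<dots> \<le> C * (\<kappa> (u - v) * exp (m * \<bar>u - v\<bar>)) * sech v powr (d / p)"
          using C(1) \<kappa>0 sech_powr_le[OF ae m, of u v] by (intro mult_right_mono mult_left_mono) auto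
        also have "\<kappa> (u - v) * exp (m * \<bar>u - v\<bar>) = ?K (u - v)"
          by (simp add: \<kappa>_def exp_minus)
        finally have le: "C * sech u powr (- \<alpha>) * sech v powr (d - \<alpha>) * \<kappa> (u - v) * sech u powr (d / q) \<le> C * ?K (u - v) * sech v powr (d / p)" .
        have "ennreal (C * sech u powr (- \<alpha>) * sech v powr (d - \<alpha>) * \<kappa> (u - v)) * slice_norm f v * ennreal (sech u powr (d / q))
          = ennreal (C * sech u powr (- \<alpha>) * sech v powr (d - \<alpha>) * \<kappa> (u - v)) * ennreal (sech u powr (d / q)) * slice_norm f v"
          by (simp only: mult_ac)
        also have "\<dots> = ennreal (C * sech u powr (- \<alpha>) * sech v powr (d - \<alpha>) * \<kappa> (u - v) * sech u powr (d / q)) * slice_norm f v"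
          using C(1) \<kappa>0 by (subst ennreal_mult[symmetric]) auto
        also have "\<dots> \<le> ennreal (C * ?K (u - v) * sech v powr (d / p)) * slice_norm f v"
          by (rule mult_right_mono[OF ennreal_leI[OF le]]) simp
        also have "\<dots> = ennreal C * (ennreal (?K (u - v)) * G v)"
          using C(1) K0 by (simp add: G_def ennreal_mult mult_ac)
        finally show "ennreal (C * sech u powr (- \<alpha>) * sech v powr (d - \<alpha>) * \<kappa> (u - v)) * slice_norm f v * ennreal (sech u powr (d / q))
          \<le> ennreal C * (ennreal (?K (u - v)) * G v)" .
      qed
      also have "\<dots> = ennreal C * (\<integral>\<^sup>+v. ennreal (?K (u - v)) * G v \<partial>lborel)"
        by (rule nn_integral_cmult) measurable
      finally show ?thesis .
    qed
    have pw: "epowr (slice_norm g u) s * ennreal (sech u ^ DIM('b)) = epowr (slice_norm g u * ennreal (sech u powr (d / s))) s"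
      if "0 < s" for g :: "real \<times> 'b \<Rightarrow> complex" and s u
      using that by (simp add: epowr_mult epowr_ennreal powr_powr sp)
    have Kint: "(\<integral>\<^sup>+v. epowr (ennreal (?K (u - v))) r \<partial>lborel) \<le> ennreal A" for u
    proof -
      have "(\<integral>\<^sup>+w. epowr (ennreal (?K w)) r \<partial>lborel) = ennreal \<bar>-1\<bar> * (\<integral>\<^sup>+v. epowr (ennreal (?K (u + (-1) * v))) r \<partial>lborel)"
        by (rule nn_integral_real_affine) simp_all
      then show ?thesis using A by simp
    qed
    have Kint': "(\<integral>\<^sup>+u. epowr (ennreal (?K (u - v))) r \<partial>lborel) \<le> ennreal A" for v
      using Kint[of v] K0(2)[of "_ - _"] by (simp add: minus_diff_eq[symmetric, of _ v] del: minus_diff_eq)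
    have "(\<integral>\<^sup>+u. epowr (slice_norm (frac_op \<sigma> f) u) q * ennreal (sech u ^ DIM('b)) \<partial>lborel)
      \<le> (\<integral>\<^sup>+u. epowr (ennreal C) q * epowr (\<integral>\<^sup>+v. ennreal (?K (u - v)) * G v \<partial>lborel) q \<partial>lborel)"
      unfolding pw[OF q] epowr_mult[symmetric] using q by (intro nn_integral_mono epowr_mono pt) simp
    also have "\<dots> = epowr (ennreal C) q * (\<integral>\<^sup>+u. epowr (\<integral>\<^sup>+v. ennreal (?K (u - v)) * G v \<partial>lborel) q \<partial>lborel)"
      by (rule nn_integral_cmult) measurable
    also have "\<dots> \<le> epowr (ennreal C) q * (epowr (ennreal A) (q / r) * epowr (\<integral>\<^sup>+v. epowr (G v) p \<partial>lborel) (q / p))"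
      by (intro mult_left_mono Young_nn_integral[OF sigma_finite_lborel _ _ pq r Kint Kint']) auto
    finally have "epowr (\<integral>\<^sup>+u. epowr (slice_norm (frac_op \<sigma> f) u) q * ennreal (sech u ^ DIM('b)) \<partial>lborel) (1 / q)
      \<le> epowr (epowr (ennreal C) q * (epowr (ennreal A) (q / r) * epowr (\<integral>\<^sup>+v. epowr (G v) p \<partial>lborel) (q / p))) (1 / q)"
      using q by (intro epowr_mono) auto
    also have "\<dots> = ennreal C * ?B * epowr (\<integral>\<^sup>+v. epowr (G v) p \<partial>lborel) (1 / p)"
      using q by (simp add: epowr_mult epowr_epowr mult.assoc)
    also have "(\<integral>\<^sup>+v. epowr (G v) p \<partial>lborel) = (\<integral>\<^sup>+u. epowr (slice_norm f u) p * ennreal (sech u ^ DIM('b)) \<partial>lborel)"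
      using pw[of p f] pq by (simp add: G_def)
    finally show "epowr (\<integral>\<^sup>+u. epowr (slice_norm (frac_op \<sigma> f) u) q * ennreal (sech u ^ DIM('b)) \<partial>lborel) (1 / q)
      \<le> ennreal (C * A powr (1 / r)) * epowr (\<integral>\<^sup>+u. epowr (slice_norm f u) p * ennreal (sech u ^ DIM('b)) \<partial>lborel) (1 / p)"
      unfolding Bfin .
  qed
qed

section \<open>The mixed norm in cylindrical coordinates\<close>

lemma polar_arctan_exp: "polar (2 * arctan (exp u)) y = cyl u y"
  and sin_2_arctan_exp: "sin (2 * arctan (exp u)) = sech u"
proof -
  define t where "t = exp u"
  have t: "0 < t" "exp (- u) = inverse t" by (simp_all add: t_def exp_minus)
  have p: "0 < 1 + t\<^sup>2" by (simp add: add_pos_nonneg)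
  have c: "cosh u = (1 + t\<^sup>2) / (2 * t)" "sinh u = (t\<^sup>2 - 1) / (2 * t)"
    unfolding cosh_def sinh_def t(2) t_def[symmetric] using t(1) by (simp_all add: field_simps power2_eq_square)
  have ch: "sech u = 2 * t / (1 + t\<^sup>2)" and th: "tanh u = (t\<^sup>2 - 1) / (1 + t\<^sup>2)"
    unfolding sech_def tanh_def c using t(1) by simp_all
  show s: "sin (2 * arctan (exp u)) = sech u"
    unfolding ch t_def[symmetric] using p by (simp add: sin_double sin_arctan cos_arctan)
  have "cos (2 * arctan (exp u)) = - tanh u"
    unfolding th t_def[symmetric] cos_double cos_arctan sin_arctan power_divide
    using p by (simp add: diff_divide_distrib)
  with s show "polar (2 * arctan (exp u)) y = cyl u y" by (simp add: polar_def cyl_def)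
qed

text \<open>The angle 2 arctan(exp u) has both derivative and sine equal to \<open>sech u\<close>,
  whence the exponent \<open>Suc n\<close>. The image of the line is the open interval, which misses
  only the two endpoints.\<close>

lemma nn_integral_polar_angle:
  fixes \<Phi> :: "real \<Rightarrow> ennreal"
  assumes \<Phi> [measurable]: "\<Phi> \<in> borel_measurable borel"
  shows "(\<integral>\<^sup>+\<theta>\<in>{0..pi}. \<Phi> \<theta> * ennreal (sin \<theta> ^ n) \<partial>lborel)
    = (\<integral>\<^sup>+u. \<Phi> (2 * arctan (exp u)) * ennreal (sech u ^ Suc n) \<partial>lborel)"
proof -
  let ?g = "\<lambda>u. 2 * arctan (exp u) :: real"
  let ?S = "\<Union>n. {?g (- real (Suc n))..?g (real (Suc n))}"
  have S: "?S = {0<..<pi}"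
  proof (intro equalityI subsetI)
    fix x assume "x \<in> ?S"
    then obtain n where "?g (- real (Suc n)) \<le> x" "x \<le> ?g (real (Suc n))" by auto
    moreover have "0 < ?g (- real (Suc n))" by (simp add: zero_less_arctan_iff)
    moreover have "?g (real (Suc n)) < pi" using arctan_ubound[of "exp (real (Suc n))"] by linarith
    ultimately show "x \<in> {0<..<pi}" unfolding greaterThanLessThan_iff by (blast intro: less_le_trans le_less_trans)
  next
    fix x assume x: "x \<in> {0<..<pi}"
    then have t: "0 < tan (x / 2)" by (intro tan_gt_zero) auto
    define u where "u = ln (tan (x / 2))"
    have gu: "?g u = x" using x t by (simp add: u_def arctan_tan)
    obtain n where n: "\<bar>u\<bar> \<le> real n" using real_arch_simple by blast
    have "?g (- real (Suc n)) \<le> ?g u" "?g u \<le> ?g (real (Suc n))"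
      using n by (intro mult_left_mono arctan_monotone'; simp)+
    then show "x \<in> ?S" unfolding gu by (intro UN_I[of n]) simp_all
  qed
  have der: "(?g has_real_derivative sech u) (at u)" for u
  proof -
    have "sech u = 2 * (inverse (1 + (exp u)\<^sup>2) * exp u)"
      unfolding sech_def cosh_def exp_minus
      by (simp add: field_simps power2_eq_square add_pos_pos less_imp_neq[symmetric])
    then show ?thesis by (auto intro!: derivative_eq_intros)
  qed
  have "(\<integral>\<^sup>+\<theta>\<in>{0..pi}. \<Phi> \<theta> * ennreal (sin \<theta> ^ n) \<partial>lborel)
    = (\<integral>\<^sup>+\<theta>. \<Phi> \<theta> * ennreal (sin \<theta> ^ n) * indicator ?S \<theta> \<partial>lborel)"
  proof (rule nn_integral_cong_AE)
    show "AE \<theta> in lborel. \<Phi> \<theta> * ennreal (sin \<theta> ^ n) * indicator {0..pi} \<theta> = \<Phi> \<theta> * ennreal (sin \<theta> ^ n) * indicator ?S \<theta>"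
      unfolding S
      using AE_lborel_singleton[of 0] AE_lborel_singleton[of pi]
      by eventually_elim (auto simp: indicator_def)
  qed
  also have "\<dots> = (\<integral>\<^sup>+u. \<Phi> (?g u) * ennreal (sin (?g u) ^ n) * ennreal (sech u) \<partial>lborel)"
  proof (rule nn_integral_substitution_UNIV)
    have "cosh u \<noteq> 0" for u :: real using cosh_real_pos[of u] by simp
    then show "continuous_on UNIV sech" unfolding sech_def[abs_def] by (intro continuous_intros) auto
  qed (use der in \<open>auto intro: less_imp_le\<close>)
  also have "\<dots> = (\<integral>\<^sup>+u. \<Phi> (?g u) * ennreal (sech u ^ Suc n) \<partial>lborel)"
    by (simp add: sin_2_arctan_exp mult.assoc ennreal_mult[symmetric] less_imp_le mult.commute[of "sech _"])
  finally show ?thesis .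
qed

lemma norm_polar: "norm y = 1 \<Longrightarrow> norm (polar \<theta> y) = 1"
  by (simp add: polar_def norm_Pair)

lemma measurable_polar [measurable]:
  assumes [measurable]: "f \<in> borel_measurable M" "g \<in> M \<rightarrow>\<^sub>M borel"
  shows "(\<lambda>x. polar (f x) (g x)) \<in> M \<rightarrow>\<^sub>M borel"
  unfolding polar_def borel_prod[symmetric] by measurable

text \<open>The inner power \<open>p / 2\<close> of the squared integral is the power
  \<open>p\<close> of \<open>slice_norm\<close>, and the Jacobian raises the exponent of the weight
  from d - 1 to d.\<close>

lemma sphere_mixed_norm_eq_slice_norm:
  fixes f :: "'n::finite ambient \<Rightarrow> complex"
  assumes f: "f \<in> borel_measurable surface_measure"
  shows "sphere_mixed_norm p f =
    epowr (\<integral>\<^sup>+u. epowr (slice_norm (sphere_part f) u) p * ennreal (sech u ^ CARD('n)) \<partial>lborel) (1 / p)"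
proof -
  have [measurable]: "sphere_part f \<in> borel_measurable borel" by (rule measurable_sphere_part[OF f])
  define \<Phi> where "\<Phi> \<theta> = epowr (\<integral>\<^sup>+y. (ennreal (cmod (sphere_part f (polar \<theta> y))))\<^sup>2 \<partial>sph) (p / 2)" for \<theta>
  have [measurable]: "\<Phi> \<in> borel_measurable borel" unfolding \<Phi>_def[abs_def] by measurable
  have "(\<integral>\<^sup>+y. ennreal ((cmod (f (polar \<theta> y)))\<^sup>2) \<partial>surface_measure) = (\<integral>\<^sup>+y. (ennreal (cmod (sphere_part f (polar \<theta> y))))\<^sup>2 \<partial>sph)" for \<theta>
    by (subst nn_integral_sph, measurable, rule nn_integral_cong) (auto simp: sphere_part_sphere norm_polar ennreal_power)
  then have "sphere_mixed_norm p f = epowr (\<integral>\<^sup>+\<theta>\<in>{0..pi}. \<Phi> \<theta> * ennreal (sin \<theta> ^ (CARD('n) - 1)) \<partial>lborel) (1 / p)"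
    unfolding sphere_mixed_norm_def \<Phi>_def by simp
  also have "(\<integral>\<^sup>+\<theta>\<in>{0..pi}. \<Phi> \<theta> * ennreal (sin \<theta> ^ (CARD('n) - 1)) \<partial>lborel)
    = (\<integral>\<^sup>+u. \<Phi> (2 * arctan (exp u)) * ennreal (sech u ^ Suc (CARD('n) - 1)) \<partial>lborel)"
    by (rule nn_integral_polar_angle) measurable
  also have "\<dots> = (\<integral>\<^sup>+u. epowr (slice_norm (sphere_part f) u) p * ennreal (sech u ^ CARD('n)) \<partial>lborel)"
    by (simp add: \<Phi>_def slice_norm_def polar_arctan_exp epowr_epowr del: power_Suc)
  finally show ?thesis .
qed

text \<open>By the cylindrical formula a null set of the sphere meets almost every slice in a null
  set: the weight is positive for angles strictly between 0 and pi and can be divided out. The inner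
  integrals then agree slice by slice.\<close>

lemma sphere_mixed_norm_cong_AE:
  fixes h k :: "'n::finite ambient \<Rightarrow> complex"
  assumes "AE x in surface_measure. h x = k x"
  shows "sphere_mixed_norm p h = sphere_mixed_norm p k"
proof -
  obtain N where N: "N \<in> null_sets surface_measure" and sub: "{x \<in> space surface_measure. h x \<noteq> k x} \<subseteq> N"
    using assms by (auto simp: eventually_ae_filter)
  have "N \<in> sets (restrict_space borel (sphere 0 1))" using N sets_surface_measure by auto
  then have [measurable]: "N \<in> sets borel" by (auto simp: sets_restrict_space_iff)
  define \<Phi> where "\<Phi> \<theta> = (\<integral>\<^sup>+y. indicator N (polar \<theta> y) \<partial>(sph :: (real ^ 'n) measure))" for \<theta>
  have [measurable]: "\<Phi> \<in> borel_measurable borel" unfolding \<Phi>_def[abs_def] by measurable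
  have "(\<integral>\<^sup>+\<theta>\<in>{0..pi}. \<Phi> \<theta> * ennreal (sin \<theta> ^ (CARD('n) - 1)) \<partial>lborel)
    = (\<integral>\<^sup>+u. \<Phi> (2 * arctan (exp u)) * ennreal (sech u ^ Suc (CARD('n) - 1)) \<partial>lborel)"
    by (rule nn_integral_polar_angle) measurable
  also have "\<dots> = (\<integral>\<^sup>+x. indicator N x \<partial>(sph :: 'n ambient measure))"
    by (subst nn_integral_sph_cyl) (simp_all add: \<Phi>_def polar_arctan_exp del: power_Suc)
  also have "\<dots> = 0"
    by (subst nn_integral_sph, measurable) (simp only: nn_integral_indicator[OF null_setsD2[OF N]] null_setsD1[OF N])
  finally have null: "AE \<theta> in lborel. \<Phi> \<theta> * ennreal (sin \<theta> ^ (CARD('n) - 1)) * indicator {0..pi} \<theta> = 0"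
    by (subst (asm) nn_integral_0_iff_AE) measurable
  have "(\<integral>\<^sup>+\<theta>\<in>{0..pi}. epowr (\<integral>\<^sup>+y. ennreal ((cmod (h (polar \<theta> y)))\<^sup>2) \<partial>surface_measure) (p / 2) * ennreal (sin \<theta> ^ (CARD('n) - 1)) \<partial>lborel)
    = (\<integral>\<^sup>+\<theta>\<in>{0..pi}. epowr (\<integral>\<^sup>+y. ennreal ((cmod (k (polar \<theta> y)))\<^sup>2) \<partial>surface_measure) (p / 2) * ennreal (sin \<theta> ^ (CARD('n) - 1)) \<partial>lborel)"
  proof (intro nn_integral_cong_AE, use null AE_lborel_singleton[of 0] AE_lborel_singleton[of pi] in eventually_elim)
    case (elim \<theta>)
    show ?case
    proof (cases "\<theta> \<in> {0..pi}")
      case True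
      then have "0 < sin \<theta>" using elim by (intro sin_gt_zero) auto
      then have "\<Phi> \<theta> = 0" using elim True by simp
      then have "AE y in (sph :: (real ^ 'n) measure). polar \<theta> y \<notin> N"
        unfolding \<Phi>_def by (subst (asm) nn_integral_0_iff_AE) (auto simp: indicator_def split: if_splits)
      then have out: "AE y in surface_measure. polar \<theta> y \<notin> N" by (rule AE_surface_measure)
      have "(\<integral>\<^sup>+y. ennreal ((cmod (h (polar \<theta> y)))\<^sup>2) \<partial>surface_measure) = (\<integral>\<^sup>+y. ennreal ((cmod (k (polar \<theta> y)))\<^sup>2) \<partial>surface_measure)"
      proof (intro nn_integral_cong_AE, use out AE_space in eventually_elim)
        case (elim y)
        then have "h (polar \<theta> y) = k (polar \<theta> y)" using sub norm_polar[of y \<theta>] by auto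
        then show ?case by simp
      qed
      then show ?thesis by simp
    qed simp
  qed
  then show ?thesis by (simp add: sphere_mixed_norm_def)
qed

text \<open>Cauchy-Schwarz on each slice, whose area is finite, followed by Hoelder's inequality in
  \<open>u\<close> with exponents 1/p and 1 - 1/p for the finite weight given by the power of
  \<open>sech u\<close>. It places mixed-norm functions in the domain of the L1 extension.\<close>

lemma sphere_mixed_space_integrable:
  fixes f :: "'n::finite ambient \<Rightarrow> complex"
  assumes f: "f \<in> sphere_mixed_space p" and p: "1 < p"
  shows "integrable surface_measure f"
proof (rule integrableI_bounded)
  show fm: "f \<in> borel_measurable surface_measure" using f by (simp add: sphere_mixed_space_def)
  have [measurable]: "sphere_part f \<in> borel_measurable borel" by (rule measurable_sphere_part[OF fm])
  let ?d = "CARD('n)"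
  let ?U = "\<integral>\<^sup>+u. ennreal (sech u ^ ?d) \<partial>lborel"
  let ?P = "\<integral>\<^sup>+u. epowr (slice_norm (sphere_part f) u) p * ennreal (sech u ^ ?d) \<partial>lborel"
  have U: "?U < \<infinity>"
  proof -
    have "?U = (\<integral>\<^sup>+\<theta>\<in>{0..pi}. ennreal (sin \<theta> ^ (?d - 1)) \<partial>lborel)"
      using nn_integral_polar_angle[of "\<lambda>_. 1" "?d - 1"] by (simp del: power_Suc)
    also have "\<dots> \<le> (\<integral>\<^sup>+\<theta>. indicator {0..pi} \<theta> \<partial>lborel)"
    proof (intro nn_integral_mono)
      fix \<theta> :: real
      have "ennreal (sin \<theta> ^ (?d - 1)) \<le> 1" if "\<theta> \<in> {0..pi}"
        using that sin_ge_zero[of \<theta>] by (simp add: power_le_one)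
      then show "ennreal (sin \<theta> ^ (?d - 1)) * indicator {0..pi} \<theta> \<le> indicator {0..pi} \<theta>"
        by (auto simp: indicator_def)
    qed
    also have "\<dots> = ennreal pi" by simp
    finally show ?thesis by (rule le_less_trans) simp
  qed
  let ?c = "epowr (emeasure sph (UNIV :: (real ^ 'n) set)) (1 / 2)"
  have c: "?c < \<infinity>"
    using sph.emeasure_finite[of "UNIV :: (real ^ 'n) set"] by (auto simp: epowr_def)
  have P: "epowr ?P (1 / p) < \<infinity>"
    using f sphere_mixed_norm_eq_slice_norm[OF fm, of p] by (simp add: sphere_mixed_space_def)
  have "(\<integral>\<^sup>+x. ennreal (norm (f x)) \<partial>surface_measure) = (\<integral>\<^sup>+x. ennreal (cmod (sphere_part f x)) \<partial>sph)"
    by (subst nn_integral_sph, measurable, rule nn_integral_cong) (simp add: sphere_part_sphere)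
  also have "\<dots> = (\<integral>\<^sup>+u. (\<integral>\<^sup>+y. ennreal (cmod (sphere_part f (cyl u y))) \<partial>sph) * ennreal (sech u ^ ?d) \<partial>lborel)"
    by (subst nn_integral_sph_cyl) simp_all
  also have "\<dots> \<le> (\<integral>\<^sup>+u. ?c * (epowr (epowr (slice_norm (sphere_part f) u) p * ennreal (sech u ^ ?d)) (1 / p) * epowr (ennreal (sech u ^ ?d)) (1 - 1 / p)) \<partial>lborel)"
  proof (rule nn_integral_mono)
    fix u :: real
    let ?s = "ennreal (sech u ^ ?d)"
    have "(\<integral>\<^sup>+y. ennreal (cmod (sphere_part f (cyl u y))) \<partial>sph) \<le> slice_norm (sphere_part f) u * ?c"
      using Cauchy_Schwarz_nn_integral_half[of "\<lambda>y. ennreal (cmod (sphere_part f (cyl u y)))" sph "\<lambda>_. 1"]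
      by (simp add: slice_norm_def space_sph)
    then have le: "(\<integral>\<^sup>+y. ennreal (cmod (sphere_part f (cyl u y))) \<partial>sph) * ?s \<le> slice_norm (sphere_part f) u * ?c * ?s"
      by (rule mult_right_mono) simp
    have s: "epowr ?s (1 / p) * epowr ?s (1 - 1 / p) = ?s"
      unfolding epowr_add[symmetric] by (simp add: epowr_ennreal less_imp_le)
    have "slice_norm (sphere_part f) u * ?c * ?s = slice_norm (sphere_part f) u * ?c * (epowr ?s (1 / p) * epowr ?s (1 - 1 / p))"
      unfolding s ..
    also have "\<dots> = ?c * (epowr (epowr (slice_norm (sphere_part f) u) p * ?s) (1 / p) * epowr ?s (1 - 1 / p))"
      using p by (simp add: epowr_mult epowr_epowr mult_ac)
    finally show "(\<integral>\<^sup>+y. ennreal (cmod (sphere_part f (cyl u y))) \<partial>sph) * ?s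
      \<le> ?c * (epowr (epowr (slice_norm (sphere_part f) u) p * ?s) (1 / p) * epowr ?s (1 - 1 / p))" using le by simp
  qed
  also have "\<dots> = ?c * (\<integral>\<^sup>+u. epowr (epowr (slice_norm (sphere_part f) u) p * ennreal (sech u ^ ?d)) (1 / p) * epowr (ennreal (sech u ^ ?d)) (1 - 1 / p) \<partial>lborel)"
    by (rule nn_integral_cmult) measurable
  also have "\<dots> \<le> ?c * (epowr ?P (1 / p) * epowr ?U (1 - 1 / p))"
    using p by (intro mult_left_mono Holder_nn_integral) auto
  also have "\<dots> < \<infinity>"
    using c P U by (auto simp: ennreal_mult_less_top epowr_def)
  finally show "(\<integral>\<^sup>+x. ennreal (norm (f x)) \<partial>surface_measure) < \<infinity>" .
qed

lemma slice_norm_sphere_part: "slice_norm (sphere_part f) u = slice_norm f u"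
  unfolding slice_norm_def
  by (intro arg_cong[where f = "\<lambda>t. epowr t _"] nn_integral_cong_AE, use AE_sph_norm in eventually_elim)
    (simp add: sphere_part_sphere norm_cyl)

theorem theorem1p1:
  fixes \<sigma> p q :: real
  assumes "CARD('n::finite) \<ge> 2"
    and "0 < \<sigma>" and "\<sigma> < 1"
    and "2 * real CARD('n) / (real CARD('n) + 1) < p"
    and "p \<le> q"
    and "q < 2 * real CARD('n) / (real CARD('n) - 1)"
    and "1 / q \<ge> 1 / p - \<sigma> / real CARD('n)"
  shows "(\<exists>C::real. \<forall>f :: 'n ambient \<Rightarrow> complex. f \<in> sphere_mixed_space p \<longrightarrow>
            sphere_mixed_norm q (sphere_fractional_integral \<sigma> f)
              \<le> ennreal C * sphere_mixed_norm p f) \<and>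
         (\<exists>C::real. \<forall>F :: 'n ambient set \<Rightarrow> complex. F \<in> projective_mixed_space p \<longrightarrow>
            projective_mixed_norm q (projective_fractional_integral \<sigma> F)
              \<le> ennreal C * projective_mixed_norm p F)"
proof -
  have d: "2 \<le> real CARD('n)" using assms(1) by simp
  \<comment> \<open>The lower endpoint for \<open>p\<close> is at least 1, so \<open>p > 1\<close>,
    as Young's inequality and the embedding into L1 require.\<close>
  have "1 \<le> 2 * real CARD('n) / (real CARD('n) + 1)" using d by (simp add: le_divide_eq)
  with assms(4) have p: "1 < p" by linarith
  have D: "3 \<le> DIM('n ambient)" using assms(1) by simp
  have lam: "(real CARD('n) - 1) / 2 = lam TYPE('n ambient)" by (simp add: lam_def)
  obtain C where C: "0 \<le> C" "\<And>f :: 'n ambient \<Rightarrow> complex. f \<in> borel_measurable borel \<Longrightarrow>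
    epowr (\<integral>\<^sup>+u. epowr (slice_norm (frac_op \<sigma> f) u) q * ennreal (sech u ^ CARD('n)) \<partial>lborel) (1 / q)
    \<le> ennreal C * epowr (\<integral>\<^sup>+u. epowr (slice_norm f u) p * ennreal (sech u ^ CARD('n)) \<partial>lborel) (1 / p)"
    using frac_op_slice_norm_bound[where 'b = "real ^ 'n", OF _ assms(2,3) p assms(5)] assms(1,7) by auto
  \<comment> \<open>Stated for any function that agrees almost everywhere with the kernel operator,
    so that it serves the sphere directly and the projective space through lifts, with one
    constant.\<close>
  have bound: "sphere_mixed_norm q h \<le> ennreal C * sphere_mixed_norm p f"
    if f: "f \<in> borel_measurable surface_measure" and h: "AE x in surface_measure. h x = frac_op \<sigma> (sphere_part f) x"
    for f h :: "'n ambient \<Rightarrow> complex"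
  proof -
    have m: "sphere_part f \<in> borel_measurable borel" by (rule measurable_sphere_part[OF f])
    then have "frac_op \<sigma> (sphere_part f) \<in> borel_measurable borel" by (rule frac_op_measurable[OF D assms(2)])
    then have "frac_op \<sigma> (sphere_part f) \<in> borel_measurable surface_measure" by (rule measurable_surface_measure_borel)
    from sphere_mixed_norm_eq_slice_norm[OF this, of q] C(2)[OF m] show ?thesis
      unfolding sphere_mixed_norm_cong_AE[OF h] sphere_mixed_norm_eq_slice_norm[OF f] by (simp add: slice_norm_sphere_part)
  qed
  show ?thesis
  proof (intro conjI exI[of _ C] allI impI)
    fix f :: "'n ambient \<Rightarrow> complex" assume f: "f \<in> sphere_mixed_space p"
    have "AE x in surface_measure. sphere_fractional_integral \<sigma> f x = frac_op \<sigma> (sphere_part f) x"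
      unfolding sphere_fractional_integral_def lam
      by (rule fractional_integral_sphere_eq_frac_op[OF D assms(2) sphere_mixed_space_integrable[OF f p]])
    with f show "sphere_mixed_norm q (sphere_fractional_integral \<sigma> f) \<le> ennreal C * sphere_mixed_norm p f"
      by (intro bound) (simp_all add: sphere_mixed_space_def)
  next
    fix F :: "'n ambient set \<Rightarrow> complex" assume F: "F \<in> projective_mixed_space p"
    let ?G = "F \<circ> antipodal_class"
    have G: "?G \<in> sphere_mixed_space p" using F by (simp add: projective_mixed_space_def)
    then have Gm: "?G \<in> borel_measurable surface_measure" by (simp add: sphere_mixed_space_def)
    then have Fm: "F \<in> borel_measurable projective_measure" by (simp add: measurable_projective_measure_iff)
    have "integrable projective_measure F"
      using sphere_mixed_space_integrable[OF G p] integral_projective_measure(2)[OF Fm] by (simp add: comp_def)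
    then have "AE c in projective_measure. projective_fractional_integral \<sigma> F c = frac_op \<sigma> (sphere_part ?G) (antipodal_rep c)"
      unfolding projective_fractional_integral_def lam
      by (rule fractional_integral_projective_eq_frac_op[OF D assms(2)])
    then have "AE x in surface_measure. projective_fractional_integral \<sigma> F (antipodal_class x) = frac_op \<sigma> (sphere_part ?G) (antipodal_rep (antipodal_class x))"
      by (rule AE_projective_measure)
    then have "AE x in surface_measure. (projective_fractional_integral \<sigma> F \<circ> antipodal_class) x = frac_op \<sigma> (sphere_part ?G) x"
    proof (rule AE_mp, intro AE_I2 impI)
      fix x :: "'n ambient"
      assume x: "x \<in> space surface_measure"
        and e: "projective_fractional_integral \<sigma> F (antipodal_class x) = frac_op \<sigma> (sphere_part ?G) (antipodal_rep (antipodal_class x))"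
      \<comment> \<open>The kernel operator preserves evenness, so its value does not depend on
        which representative \<open>antipodal_rep\<close> has chosen.\<close>
      have "frac_op \<sigma> (sphere_part ?G) (- x) = frac_op \<sigma> (sphere_part ?G) x"
        by (rule frac_op_uminus[OF D assms(2) measurable_sphere_part[OF Gm] sphere_part_lift_even])
      with x e show "(projective_fractional_integral \<sigma> F \<circ> antipodal_class) x = frac_op \<sigma> (sphere_part ?G) x"
        by (simp add: antipodal_rep_even)
    qed
    with Gm show "projective_mixed_norm q (projective_fractional_integral \<sigma> F) \<le> ennreal C * projective_mixed_norm p F"
      unfolding projective_mixed_norm_def by (intro bound)
  qed
qed

end
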